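(* Let $G$ be a virtually cyclic group and let $A\in M(r,s;\mathbb Q G)$ with $\alpha^{(2)}(A)<\infty^+$. Choose an infinite cyclic normal subgroup $Z\trianglelefteq G$ of finite index and let $p_k(z)$ be the maximal invariant factor of $\operatorname{res}^Z_G(A)$. Denote the zeros of $p_k(z)$ on the unit circle $S^1$ by $a_1,\dots,a_u$ and let $D$ be the maximal occurring Baker constant $D=D(a_t,-1)$ for $a_t\neq1$. Then \[\liminf_{i\in\mathcal F}\alpha(A_i)\ge\frac{\alpha^{(2)}(A)}{1+D},\] where $\mathcal F$ is the directed set indexing all finite index normal subgroups $G_i$ of $G$.
   Context: Spectral distribution function and Novikov--Shubin numbers. For a countable discrete group $G$ and $A\in M(r,s;\mathbb C G)$, let $A^*$ be obtained from $A$ by transposing and applying the involution $(\sum\lambda_g g)^*=\sum\overline{\lambda_g}g^{-1}$ to the entries. Let $r^{(2)}_{AA^*}\colon(\ell^2G)^r\to(\ell^2G)^r$, $x\mapsto xAA^*$, let $E^{AA^*}_\lambda=\chi_{[0,\lambda]}(r^{(2)}_{AA^*})$ be its spectral projections, and set $F_A(\lambda)=\operatorname{tr}_{\mathcal N(G)}E^{AA^*}_{\lambda^2}$ for $\lambda\ge0$, where $\operatorname{tr}_{\mathcal N(G)}$ is the canonical trace of the group von Neumann algebra, extended diagonally to equivariant operators of $(\ell^2G)^r$. If $F_A(\lambda)=F_A(0)$ for some $\lambda>0$, one sets $\alpha^{(2)}(A)=\infty^+$ (a formal symbol). Otherwise the upper Novikov--Shubin number is \[\overline\alpha^{(2)}(A)=\limsup_{\lambda\to0^+}\frac{\log(F_A(\lambda)-F_A(0))}{\log\lambda}\in[0,\infty]\]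 and the lower one $\underline\alpha^{(2)}(A)$ is defined with $\liminf$ instead. When both agree, the common value is denoted $\alpha^{(2)}(A)$; this is always the case if $G$ is virtually cyclic. By convention $c<\infty<\infty^+$ for all $c\in[0,\infty)$. Alpha numbers. For a finite index normal subgroup $G_i\trianglelefteq G$, let $A_i\in M(r,s;\mathbb C(G/G_i))$ be the image of $A$ under $\mathbb C G\to\mathbb C(G/G_i)$ applied entrywise. Via the regular representation of $G/G_i$, view $A_i$ as a complex matrix of size $r[G:G_i]\times s[G:G_i]$. If $A_i\neq0$, let $\sigma^+(A_i)$ be its smallest positive singular value and $m^+(A_i)=\dim_{\mathbb C}\ker(A_iA_i^*-\sigma^+(A_i)^2)$ its multiplicity. The alpha number is \[\alpha(A_i)=\frac{\log\left(m^+(A_i)/[G:G_i]\right)}{\log\sigma^+(A_i)}.\] Nets. $\mathcal F$ is directed by $i\le j$ iff $G_j\subseteq G_i$. For a net $(x_i)$ of real numbers, $\liminf_i x_i=\sup_i\inf_{j\ge i}x_j$. Restriction. Let $n=[G:Z]$ and $Z\backslash G=\{Zg_1,\dots,Zg_n\}$. Then $\operatorname{res}^Z_G(A)\in M(rn,sn;\mathbb C Z)$ is the matrix of right multiplication by $A$ viewed as a homomorphism $(\mathbb C Z)^{rn}\to(\mathbb C Z)^{sn}$ of left $\mathbb C Z$-modules with respect to the basis $g_1,\dots,g_n$ of $\mathbb C G$ over $\mathbb C Z$: each entry $\sum_{g\in G}\lambda_g g$ of $A$ is replaced by the $n\times n$ matrix with $(u,v)$-entry $\sum_{h\in Z}\lambda_{g_u^{-1}hg_v}h$.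 Invariant factors. The group ring $\mathbb C Z$ is identified with the ring of Laurent polynomials $\mathbb C[z,z^{-1}]$. As this is a principal ideal domain, $\operatorname{res}^Z_G(A)$ has a Smith normal form $\left(\begin{smallmatrix}P&0\\0&0\end{smallmatrix}\right)$ with $P=\operatorname{diag}(p_1(z),\dots,p_k(z))$ and $p_l\mid p_{l+1}$. The $p_l$ are the invariant factors; the maximal one is the last one, $p_k$. Baker constants. Let $\alpha_1,\alpha_2$ be algebraic numbers different from $0$ and $1$, with (some fixed values of) $\log\alpha_1$ and $\log\alpha_2$. A Baker constant of the pair $(\alpha_1,\alpha_2)$ is any $D=D(\alpha_1,\alpha_2)\ge1$ such that for all rational integers $b_1,b_2$ with $\Lambda=b_1\log\alpha_1+b_2\log\alpha_2\ne0$ one has $|\Lambda|>B^{-D}$, where $B=\max\{|b_1|,|b_2|\}$. *)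

theory Defs
  imports
    "HOL-Analysis.Analysis"
    "HOL-Algebra.Algebra"
    "HOL-Library.Poly_Mapping"
    "Jordan_Normal_Form.Matrix_Kernel"
    "Jordan_Normal_Form.Schur_Decomposition"
begin

section \<open>Group rings and matrices over them\<close>

text \<open>
  An element \<open>\<Sum>\<lambda>\<^sub>g g\<close> of the complex group ring is its coefficient function \<open>g \<mapsto> \<lambda>\<^sub>g\<close>.
  A matrix over the group ring is a doubly indexed family of such functions, of which only the
  entries \<open>(i, j)\<close> with \<open>i < r\<close> and \<open>j < s\<close> are relevant.
\<close>

definition group_ring :: "('g, 'm) monoid_scheme \<Rightarrow> ('g \<Rightarrow> complex) set" where
  "group_ring G = {f. finite {g. f g \<noteq> 0} \<and> {g. f g \<noteq> 0} \<subseteq> carrier G}"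

definition rat_group_ring :: "('g, 'm) monoid_scheme \<Rightarrow> ('g \<Rightarrow> complex) set" where
  "rat_group_ring G = {f \<in> group_ring G. range f \<subseteq> \<rat>}"

type_synonym 'g gr_mat = "nat \<Rightarrow> nat \<Rightarrow> 'g \<Rightarrow> complex"

definition gr_adjoint :: "('g, 'm) monoid_scheme \<Rightarrow> 'g gr_mat \<Rightarrow> 'g gr_mat" where
  "gr_adjoint G A = (\<lambda>j i g. if g \<in> carrier G then cnj (A i j (inv\<^bsub>G\<^esub> g)) else 0)"

text \<open>Product of a matrix with \<open>s\<close> columns and a matrix with \<open>s\<close> rows; the entries are convolved.\<close>

definition gr_mult :: "('g, 'm) monoid_scheme \<Rightarrow> nat \<Rightarrow> 'g gr_mat \<Rightarrow> 'g gr_mat \<Rightarrow> 'g gr_mat" where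
  "gr_mult G s A B = (\<lambda>i k g. if g \<in> carrier G
     then \<Sum>j<s. \<Sum>h | A i j h \<noteq> 0. A i j h * B j k (inv\<^bsub>G\<^esub> h \<otimes>\<^bsub>G\<^esub> g) else 0)"

text \<open>
  Image of a group ring element under the projection to the group ring of \<open>G Mod N\<close>, whose
  elements are the cosets of \<open>N\<close>.
\<close>

definition gr_proj :: "('g, 'm) monoid_scheme \<Rightarrow> 'g set \<Rightarrow> ('g \<Rightarrow> complex) \<Rightarrow> 'g set \<Rightarrow> complex" where
  "gr_proj G N f = (\<lambda>c. if c \<in> carrier (G Mod N) then \<Sum>g | g \<in> c \<and> f g \<noteq> 0. f g else 0)"

definition gr_mat_proj :: "('g, 'm) monoid_scheme \<Rightarrow> 'g set \<Rightarrow> 'g gr_mat \<Rightarrow> 'g set gr_mat" where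
  "gr_mat_proj G N A = (\<lambda>i j. gr_proj G N (A i j))"


section \<open>Square summable functions, spectral families\<close>

definition ell2 :: "'i set \<Rightarrow> ('i \<Rightarrow> complex) set" where
  "ell2 I = {x. (\<forall>i. i \<notin> I \<longrightarrow> x i = 0) \<and> (\<lambda>i. (cmod (x i))\<^sup>2) summable_on I}"

definition ell2_inner :: "'i set \<Rightarrow> ('i \<Rightarrow> complex) \<Rightarrow> ('i \<Rightarrow> complex) \<Rightarrow> complex" where
  "ell2_inner I x y = (\<Sum>\<^sub>\<infinity>i\<in>I. x i * cnj (y i))"

definition ell2_norm :: "'i set \<Rightarrow> ('i \<Rightarrow> complex) \<Rightarrow> real" where
  "ell2_norm I x = sqrt (\<Sum>\<^sub>\<infinity>i\<in>I. (cmod (x i))\<^sup>2)"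

text \<open>
  Boundedness is automatic.  The value outside the Hilbert space is fixed only to make the
  function representing a projection unique.
\<close>

definition orth_projection :: "'i set \<Rightarrow> (('i \<Rightarrow> complex) \<Rightarrow> 'i \<Rightarrow> complex) \<Rightarrow> bool" where
  "orth_projection I P \<longleftrightarrow>
     (\<forall>x\<in>ell2 I. P x \<in> ell2 I) \<and>
     (\<forall>x\<in>ell2 I. \<forall>y\<in>ell2 I. P (\<lambda>i. x i + y i) = (\<lambda>i. P x i + P y i)) \<and>
     (\<forall>c. \<forall>x\<in>ell2 I. P (\<lambda>i. c * x i) = (\<lambda>i. c * P x i)) \<and>
     (\<forall>x\<in>ell2 I. P (P x) = P x) \<and>
     (\<forall>x\<in>ell2 I. \<forall>y\<in>ell2 I. ell2_inner I (P x) y = ell2_inner I x (P y)) \<and>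
     (\<forall>x. x \<notin> ell2 I \<longrightarrow> P x = (\<lambda>i. 0))"

text \<open>
  Spectral family (resolution of the identity) of a bounded positive operator \<open>T\<close>: an increasing,
  strongly right-continuous family of projections with \<open>E \<lambda> = 0\<close> for \<open>\<lambda> < 0\<close>, \<open>E \<lambda> = 1\<close> for large
  \<open>\<lambda>\<close>, and \<open>T = \<integral> \<lambda> dE\<^sub>\<lambda>\<close>, the integral being taken in the weak sense with respect to the
  Lebesgue-Stieltjes measures of \<open>\<lambda> \<mapsto> \<langle>E\<^sub>\<lambda> x, x\<rangle>\<close>.  As the spectrum of \<open>T\<close> is contained in
  \<open>[0, \<infinity>)\<close>, the projection \<open>E \<lambda>\<close> is the value at \<open>T\<close> of the indicator function of \<open>[0, \<lambda>]\<close>.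
\<close>

definition spectral_family ::
  "'i set \<Rightarrow> (('i \<Rightarrow> complex) \<Rightarrow> 'i \<Rightarrow> complex) \<Rightarrow> (real \<Rightarrow> ('i \<Rightarrow> complex) \<Rightarrow> 'i \<Rightarrow> complex) \<Rightarrow> bool"
where
  "spectral_family I T E \<longleftrightarrow>
     (\<forall>l. orth_projection I (E l)) \<and>
     (\<forall>l m. l \<le> m \<longrightarrow> (\<forall>x\<in>ell2 I. E m (E l x) = E l x)) \<and>
     (\<forall>l. \<forall>x\<in>ell2 I. ((\<lambda>m. ell2_norm I (\<lambda>i. E m x i - E l x i)) \<longlongrightarrow> 0) (at_right l)) \<and>
     (\<forall>l<0. \<forall>x\<in>ell2 I. E l x = (\<lambda>i. 0)) \<and>
     (\<exists>K. \<forall>l\<ge>K. \<forall>x\<in>ell2 I. E l x = x) \<and>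
     (\<forall>x\<in>ell2 I. ell2_inner I (T x) x =
        of_real (LINT t|interval_measure (\<lambda>l. Re (ell2_inner I (E l x) x)). t))"

definition spectral_projection ::
  "'i set \<Rightarrow> (('i \<Rightarrow> complex) \<Rightarrow> 'i \<Rightarrow> complex) \<Rightarrow> real \<Rightarrow> ('i \<Rightarrow> complex) \<Rightarrow> 'i \<Rightarrow> complex" where
  "spectral_projection I T l = (THE P. \<exists>E. spectral_family I T E \<and> P = E l)"


section \<open>Spectral distribution functions and Novikov-Shubin numbers\<close>

text \<open>The \<open>r\<close>-fold sum of \<open>\<ell>\<^sup>2 G\<close> is realized as \<open>ell2 (gr_index G r)\<close>.\<close>

definition gr_index :: "('g, 'm) monoid_scheme \<Rightarrow> nat \<Rightarrow> (nat \<times> 'g) set" where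
  "gr_index G r = {..<r} \<times> carrier G"

text \<open>Right multiplication \<open>x \<mapsto> x A\<close> of row vectors of length \<open>r\<close> by an \<open>r \<times> s\<close> matrix.\<close>

definition gr_rmult ::
  "('g, 'm) monoid_scheme \<Rightarrow> nat \<Rightarrow> nat \<Rightarrow> 'g gr_mat \<Rightarrow> (nat \<times> 'g \<Rightarrow> complex) \<Rightarrow> nat \<times> 'g \<Rightarrow> complex"
where
  "gr_rmult G r s A x = (\<lambda>(j, h). if (j, h) \<in> gr_index G s
     then \<Sum>i<r. \<Sum>k | A i j k \<noteq> 0. x (i, h \<otimes>\<^bsub>G\<^esub> inv\<^bsub>G\<^esub> k) * A i j k else 0)"

text \<open>The diagonal extension of the trace \<open>T \<mapsto> \<langle>T e, e\<rangle>\<close> of the group von Neumann algebra.\<close>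

definition vn_trace ::
  "('g, 'm) monoid_scheme \<Rightarrow> nat \<Rightarrow> ((nat \<times> 'g \<Rightarrow> complex) \<Rightarrow> nat \<times> 'g \<Rightarrow> complex) \<Rightarrow> complex" where
  "vn_trace G r T = (\<Sum>i<r. ell2_inner (gr_index G r)
     (T (indicator {(i, \<one>\<^bsub>G\<^esub>)})) (indicator {(i, \<one>\<^bsub>G\<^esub>)}))"

definition spectral_distribution ::
  "('g, 'm) monoid_scheme \<Rightarrow> nat \<Rightarrow> nat \<Rightarrow> 'g gr_mat \<Rightarrow> real \<Rightarrow> real" where
  "spectral_distribution G r s A l = Re (vn_trace G r
     (spectral_projection (gr_index G r)
        (gr_rmult G r r (gr_mult G s A (gr_adjoint G A))) (l\<^sup>2)))"

text \<open>
  Values of Novikov-Shubin numbers: extended reals together with the formal symbol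
  \<open>\<infinity>\<^sup>+\<close>, written \<open>NS_Infty_Plus\<close>, which exceeds all of them.
\<close>

datatype ns_value = NS (ns_ereal: ereal) | NS_Infty_Plus

instantiation ns_value :: linorder
begin

fun less_eq_ns_value :: "ns_value \<Rightarrow> ns_value \<Rightarrow> bool" where
  "NS a \<le> NS b \<longleftrightarrow> a \<le> b"
| "NS_Infty_Plus \<le> NS b \<longleftrightarrow> False"
| "x \<le> NS_Infty_Plus \<longleftrightarrow> True"

definition less_ns_value :: "ns_value \<Rightarrow> ns_value \<Rightarrow> bool" where
  "less_ns_value x y \<longleftrightarrow> x \<le> y \<and> \<not> y \<le> x"

instance
proof
  fix x y z :: ns_value
  show "x < y \<longleftrightarrow> x \<le> y \<and> \<not> y \<le> x" by (rule less_ns_value_def)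
  show "x \<le> x" by (cases x) auto
  show "x \<le> y \<Longrightarrow> y \<le> z \<Longrightarrow> x \<le> z" by (cases x; cases y; cases z) auto
  show "x \<le> y \<Longrightarrow> y \<le> x \<Longrightarrow> x = y" by (cases x; cases y) auto
  show "x \<le> y \<or> y \<le> x" by (cases x; cases y) auto
qed

end

definition upper_novikov_shubin ::
  "('g, 'm) monoid_scheme \<Rightarrow> nat \<Rightarrow> nat \<Rightarrow> 'g gr_mat \<Rightarrow> ns_value" where
  "upper_novikov_shubin G r s A = (let F = spectral_distribution G r s A in
     if \<exists>l>0. F l = F 0 then NS_Infty_Plus
     else NS (Limsup (at_right 0) (\<lambda>l. ereal (ln (F l - F 0) / ln l))))"

definition lower_novikov_shubin ::
  "('g, 'm) monoid_scheme \<Rightarrow> nat \<Rightarrow> nat \<Rightarrow> 'g gr_mat \<Rightarrow> ns_value" where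
  "lower_novikov_shubin G r s A = (let F = spectral_distribution G r s A in
     if \<exists>l>0. F l = F 0 then NS_Infty_Plus
     else NS (Liminf (at_right 0) (\<lambda>l. ereal (ln (F l - F 0) / ln l))))"

text \<open>Unspecified if the upper and lower numbers differ.\<close>

definition novikov_shubin ::
  "('g, 'm) monoid_scheme \<Rightarrow> nat \<Rightarrow> nat \<Rightarrow> 'g gr_mat \<Rightarrow> ns_value" where
  "novikov_shubin G r s A =
     (THE a. upper_novikov_shubin G r s A = a \<and> lower_novikov_shubin G r s A = a)"


section \<open>Alpha numbers\<close>

definition block_mat :: "nat \<Rightarrow> nat \<Rightarrow> nat \<Rightarrow> (nat \<Rightarrow> nat \<Rightarrow> nat \<Rightarrow> nat \<Rightarrow> 'a) \<Rightarrow> 'a mat" where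
  "block_mat r s n f =
     mat (r * n) (s * n) (\<lambda>(a, b). f (a div n) (b div n) (a mod n) (b mod n))"

text \<open>
  For a finite group with elements \<open>q\<^sub>0, \<dots>, q\<^bsub>n-1\<^esub>\<close> the entry \<open>\<Sum>\<lambda>\<^sub>q q\<close> is replaced by the matrix
  of its right multiplication in the basis \<open>q\<^sub>0, \<dots>, q\<^bsub>n-1\<^esub>\<close>, with \<open>(u, v)\<close>-entry the
  coefficient at \<open>q\<^sub>u\<^sup>-\<^sup>1 q\<^sub>v\<close>.  Different enumerations give matrices that are
  conjugate by permutation matrices.
\<close>

definition regular_mat :: "('q, 'm) monoid_scheme \<Rightarrow> nat \<Rightarrow> nat \<Rightarrow> 'q gr_mat \<Rightarrow> complex mat" where
  "regular_mat Q r s A =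
     (let qs = (SOME qs. distinct qs \<and> set qs = carrier Q)
      in block_mat r s (length qs) (\<lambda>i j u v. A i j (inv\<^bsub>Q\<^esub> (qs ! u) \<otimes>\<^bsub>Q\<^esub> qs ! v)))"

definition singular_values :: "complex mat \<Rightarrow> real set" where
  "singular_values M = {\<sigma>. \<sigma> \<ge> 0 \<and> eigenvalue (M * mat_adjoint M) (of_real (\<sigma>\<^sup>2))}"

definition sigma_plus :: "complex mat \<Rightarrow> real" where
  "sigma_plus M = Min {\<sigma> \<in> singular_values M. \<sigma> > 0}"

definition mult_plus :: "complex mat \<Rightarrow> nat" where
  "mult_plus M = kernel_dim (M * mat_adjoint M - of_real ((sigma_plus M)\<^sup>2) \<cdot>\<^sub>m 1\<^sub>m (dim_row M))"

definition alpha_number ::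
  "('g, 'm) monoid_scheme \<Rightarrow> nat \<Rightarrow> nat \<Rightarrow> 'g gr_mat \<Rightarrow> 'g set \<Rightarrow> real" where
  "alpha_number G r s A N =
     (let M = regular_mat (G Mod N) r s (gr_mat_proj G N A)
      in ln (real (mult_plus M) / real (card (rcosets\<^bsub>G\<^esub> N))) / ln (sigma_plus M))"

definition finite_index_normal :: "('g, 'm) monoid_scheme \<Rightarrow> 'g set set" where
  "finite_index_normal G = {N. N \<lhd> G \<and> finite (rcosets\<^bsub>G\<^esub> N)}"

text \<open>Limit inferior of a net indexed by a family of sets directed by reverse inclusion.\<close>

definition net_liminf :: "'a set set \<Rightarrow> ('a set \<Rightarrow> ereal) \<Rightarrow> ereal" where
  "net_liminf \<F> x = (SUP N\<in>\<F>. INF M\<in>{M \<in> \<F>. M \<subseteq> N}. x M)"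


section \<open>Virtually cyclic groups, restriction, and invariant factors\<close>

definition virtually_cyclic :: "('g, 'm) monoid_scheme \<Rightarrow> bool" where
  "virtually_cyclic G \<longleftrightarrow> (\<exists>c\<in>carrier G. finite (rcosets\<^bsub>G\<^esub> (generate G {c})))"

definition coset_transversal :: "('g, 'm) monoid_scheme \<Rightarrow> 'g set \<Rightarrow> 'g list \<Rightarrow> bool" where
  "coset_transversal G H gs \<longleftrightarrow> set gs \<subseteq> carrier G \<and>
     distinct (map (\<lambda>g. H #>\<^bsub>G\<^esub> g) gs) \<and> set (map (\<lambda>g. H #>\<^bsub>G\<^esub> g) gs) = rcosets\<^bsub>G\<^esub> H"

text \<open>
  The ring of Laurent polynomials is the monoid algebra \<open>int \<Rightarrow>\<^sub>0 complex\<close> with the convolution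
  product.
\<close>

type_synonym laurent_poly = "int \<Rightarrow>\<^sub>0 complex"

definition laurent_eval :: "laurent_poly \<Rightarrow> complex \<Rightarrow> complex" where
  "laurent_eval p a = (\<Sum>e\<in>Poly_Mapping.keys p. Poly_Mapping.lookup p e * a powi e)"

definition circle_zeros :: "laurent_poly \<Rightarrow> complex set" where
  "circle_zeros p = {a. cmod a = 1 \<and> laurent_eval p a = 0}"

text \<open>
  Restriction to the infinite cyclic subgroup generated by \<open>z\<close>, with respect to the coset
  representatives \<open>gs\<close>.  The support condition required by \<open>Abs_poly_mapping\<close> holds because
  \<open>z\<close> has infinite order.
\<close>

definition res_mat ::
  "('g, 'm) monoid_scheme \<Rightarrow> 'g \<Rightarrow> 'g list \<Rightarrow> nat \<Rightarrow> nat \<Rightarrow> 'g gr_mat \<Rightarrow> laurent_poly mat" where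
  "res_mat G z gs r s A = block_mat r s (length gs) (\<lambda>i j u v.
     Abs_poly_mapping (\<lambda>e::int.
       A i j (inv\<^bsub>G\<^esub> (gs ! u) \<otimes>\<^bsub>G\<^esub> (z [^]\<^bsub>G\<^esub> e) \<otimes>\<^bsub>G\<^esub> gs ! v)))"

definition invariant_factors :: "'a::comm_ring_1 mat \<Rightarrow> 'a list \<Rightarrow> bool" where
  "invariant_factors B ps \<longleftrightarrow>
     length ps \<le> min (dim_row B) (dim_col B) \<and> 0 \<notin> set ps \<and>
     (\<forall>l. Suc l < length ps \<longrightarrow> ps ! l dvd ps ! Suc l) \<and>
     (\<exists>U V. U \<in> carrier_mat (dim_row B) (dim_row B) \<and> invertible_mat U \<and>
            V \<in> carrier_mat (dim_col B) (dim_col B) \<and> invertible_mat V \<and>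
            U * B * V = mat (dim_row B) (dim_col B)
              (\<lambda>(i, j). if i = j \<and> i < length ps then ps ! i else 0))"


section \<open>Baker constants\<close>

text \<open>
  The values of the logarithms are arbitrary but fixed.  (A particular choice such as the principal
  values may admit no constant: the inequality with \<open>B = 1\<close> demands \<open>\<bar>\<Lambda>\<bar> > 1\<close>.)
  Algebraicity of \<open>a\<^sub>1\<close> and \<open>a\<^sub>2\<close> matters only for the existence of Baker constants.
\<close>

definition baker_constant :: "complex \<Rightarrow> complex \<Rightarrow> real \<Rightarrow> bool" where
  "baker_constant a1 a2 D \<longleftrightarrow> D \<ge> 1 \<and>
     (\<exists>l1 l2. exp l1 = a1 \<and> exp l2 = a2 \<and>
        (\<forall>b1 b2 :: int. of_int b1 * l1 + of_int b2 * l2 \<noteq> 0 \<longrightarrow>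
           cmod (of_int b1 * l1 + of_int b2 * l2) > of_int (max \<bar>b1\<bar> \<bar>b2\<bar>) powr (- D)))"

end

theory Submission
  imports Defs "Jordan_Normal_Form.Jordan_Normal_Form_Uniqueness"
begin

text \<open>
  A positive operator \<open>T\<close> has as its spectral projection for \<open>[0, l]\<close> the orthogonal projection onto
  the space of all \<open>x\<close> with \<open>norm (T ^ k x) \<le> l ^ k * norm x\<close> for every \<open>k\<close>.  Hence the spectral
  distribution function of \<open>A\<close> belongs to a measure whose \<open>k\<close>-th moment is the trace of \<open>(A A*) ^ k\<close>.
  For the subgroups \<open>Z m\<close> generated by \<open>z ^ m\<close> the normalized trace of \<open>(A\<^sub>m A\<^sub>m*) ^ k\<close> has the same
  value as soon as \<open>m\<close> is large, so the eigenvalue counts of \<open>A\<^sub>m A\<^sub>m*\<close> approximate the distribution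
  function.

  The discrete Fourier transform splits \<open>A\<^sub>m\<close> into the values of \<open>res A\<close> at the \<open>m\<close>-th roots of unity.
  By the Smith normal form and the counting form of Courant-Fischer, the number of eigenvalues
  \<open>\<le> t\<close> is, up to a factor of \<open>t\<close> that does not depend on \<open>m\<close>, the number of pairs \<open>(l, \<xi>)\<close>
  with \<open>\<xi> ^ m = 1\<close> and \<open>\<bar>p\<^sub>l(\<xi>)\<bar>\<^sup>2 \<le> t\<close>.  Let \<open>\<mu>\<close> be the largest multiplicity of a zero of \<open>p\<^sub>k\<close> on the
  unit circle.  Counting roots of unity near the zeros shows that \<open>F \<lambda> - F 0\<close> is of the order of
  \<open>\<lambda> powr (1 / \<mu>)\<close>, so the Novikov-Shubin number is \<open>1 / \<mu>\<close>, and that the smallest positive singular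
  value of \<open>A\<^sub>m\<close> is at most of the order of \<open>m powr - \<mu>\<close>, with bounded multiplicity.  A Baker constant
  keeps the \<open>m\<close>-th roots of unity at distance at least \<open>c * m powr - (1 + D)\<close> from the zeros they do
  not hit, which bounds that singular value from below by a multiple of \<open>m powr - ((1 + D) * \<mu>)\<close>.
  Finally, every normal subgroup of finite index that lies in \<open>Z m\<close> is of the form \<open>Z (m * j)\<close>.
\<close>

text \<open>\<open>spectral_projection\<close> is a definite description, so existence and
  uniqueness of spectral families come before any statement about F. Both rest on growth rates of
  \<open>T ^ k x\<close>; the only function of an operator that is constructed is a square root. The
  Hilbert space is treated as a real one, with the real part of the inner product; complex linearity
  returns because growth spaces are stable under complex scalars. The constants lost in comparing a
  matrix with its Smith form do not depend on m, and constant factors disappear in a quotient of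
  logarithms. For n = [G:Z], the alpha number at \<open>Z m\<close> is ln (mult / (n m)) / ln
  \<sigma>. Its numerator is -ln m up to a bounded error, and -ln \<sigma> lies between \<mu> ln m
  and (1 + D) \<mu> ln m up to bounded errors, so asymptotically the quotient is at least 1 / ((1 +
  D) \<mu>). The loss of 1 + D instead of D comes from dividing Baker's linear form by m to get an
  angle. The zero 1 has no Baker constant, but other m-th roots of unity keep distance 1 / m from
  it, which D \<ge> 1 covers.\<close>

hide_const (open) VectorSpace.subspace Module.submodule
no_notation Matrix.scalar_prod (infix "\<bullet>" 70)

section \<open>Operators on real Hilbert spaces\<close>

text \<open>The closest point of V: by the parallelogram law a minimizing sequence for the distance
  is Cauchy, and minimality of its limit along every line y + t v forces orthogonality.\<close>

lemma ex_orthogonal_projection: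
  fixes V :: "'a::{real_inner,banach} set"
  assumes V: "subspace V" "closed V"
  shows "\<exists>y\<in>V. \<forall>v\<in>V. (x - y) \<bullet> v = 0"
proof -
  define Q where "Q = (\<lambda>y. (norm (x - y))\<^sup>2) ` V"
  define d where "d = Inf Q"
  have ne: "Q \<noteq> {}" using subspace_0[OF V(1)] by (auto simp: Q_def)
  have bdd: "bdd_below Q" by (auto simp: Q_def intro!: bdd_belowI[of _ 0])
  have d_le: "d \<le> (norm (x - y))\<^sup>2" if "y \<in> V" for y
    unfolding d_def by (rule cInf_lower[OF _ bdd]) (use that in \<open>auto simp: Q_def\<close>)
  have "\<exists>y\<in>V. (norm (x - y))\<^sup>2 < d + 1 / real (Suc n)" for n
  proof -
    have "Inf Q < d + 1 / real (Suc n)" by (simp add: d_def)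
    then show ?thesis using cInf_lessD[OF ne] by (auto simp: Q_def)
  qed
  then obtain Y where Y: "\<And>n. Y n \<in> V" "\<And>n. (norm (x - Y n))\<^sup>2 < d + 1 / real (Suc n)"
    by metis
  \<comment> \<open>The parallelogram law for x - Y m and x - Y n; the midpoint lies in V, so its
    squared distance is at least d, and 4 d cancels.\<close>
  have par: "(norm (Y m - Y n))\<^sup>2 \<le> 2 / real (Suc m) + 2 / real (Suc n)" for m n
  proof -
    have mid: "(1/2) *\<^sub>R (Y m + Y n) \<in> V"
      using Y V by (intro subspace_mul subspace_add) auto
    have "(norm (Y m - Y n))\<^sup>2 = 2 * (norm (x - Y m))\<^sup>2 + 2 * (norm (x - Y n))\<^sup>2
        - 4 * (norm (x - (1/2) *\<^sub>R (Y m + Y n)))\<^sup>2"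
      unfolding power2_norm_eq_inner
      by (simp add: inner_diff inner_add inner_commute algebra_simps)
    with d_le[OF mid] Y(2)[of m] Y(2)[of n] show ?thesis by simp
  qed
  have "Cauchy Y"
  proof (rule metric_CauchyI)
    fix e :: real assume e: "0 < e"
    obtain M where M: "4 / e\<^sup>2 < real M" using reals_Archimedean2 by blast
    show "\<exists>M. \<forall>m\<ge>M. \<forall>n\<ge>M. dist (Y m) (Y n) < e"
    proof (intro exI allI impI)
      fix m n assume "M \<le> m" "M \<le> n"
      have "M > 0" using M e by (cases M) (auto simp: field_simps)
      have a: "2 / real (Suc k) < e\<^sup>2 / 2" if "M \<le> k" for k
      proof -
        have "4 / e\<^sup>2 < real (Suc k)" using M that by linarith
        then show ?thesis using e by (simp add: field_simps)
      qed
      have "(norm (Y m - Y n))\<^sup>2 < e\<^sup>2" using par[of m n] a[OF \<open>M \<le> m\<close>] a[OF \<open>M \<le> n\<close>] by simp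
      then show "dist (Y m) (Y n) < e" using e by (simp add: dist_norm power2_less_imp_less)
    qed
  qed
  then obtain y where y: "Y \<longlonglongrightarrow> y" using convergent_eq_Cauchy by blast
  have yV: "y \<in> V" using closed_sequentially[OF V(2)] Y(1) y by blast
  have "(\<lambda>n. (norm (x - Y n))\<^sup>2) \<longlonglongrightarrow> (norm (x - y))\<^sup>2"
    by (intro tendsto_intros y)
  moreover have "(\<lambda>n. d + 1 / real (Suc n)) \<longlonglongrightarrow> d + 0"
    by (intro tendsto_intros LIMSEQ_Suc lim_1_over_n)
  ultimately have "(norm (x - y))\<^sup>2 \<le> d + 0"
    by (rule LIMSEQ_le) (intro exI[of _ 0] allI impI less_imp_le[OF Y(2)])
  then have min: "(norm (x - y))\<^sup>2 \<le> d" by simp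
  have "(x - y) \<bullet> v = 0" if v: "v \<in> V" for v
  proof (rule ccontr)
    assume c: "(x - y) \<bullet> v \<noteq> 0"
    define c where "c = (x - y) \<bullet> v"
    define t where "t = c / (v \<bullet> v)"
    have vv: "v \<bullet> v > 0" using c by auto
    have "y + t *\<^sub>R v \<in> V" using yV v V by (intro subspace_mul subspace_add) auto
    then have "(norm (x - y))\<^sup>2 \<le> (norm (x - (y + t *\<^sub>R v)))\<^sup>2" using d_le[of "y + t *\<^sub>R v"] min by linarith
    also have "\<dots> = (norm (x - y))\<^sup>2 - 2 * t * c + t\<^sup>2 * (v \<bullet> v)"
      unfolding power2_norm_eq_inner c_def
      by (simp add: inner_diff inner_add inner_commute algebra_simps power2_eq_square)
    also have "\<dots> = (norm (x - y))\<^sup>2 - c\<^sup>2 / (v \<bullet> v)"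
      using vv by (simp add: t_def field_simps power2_eq_square)
    finally show False using vv c by (simp add: c_def field_simps)
  qed
  with yV show ?thesis by blast
qed

definition oproj :: "'a::{real_inner,banach} set \<Rightarrow> 'a \<Rightarrow> 'a" where
  "oproj V x = (SOME y. y \<in> V \<and> (\<forall>v\<in>V. (x - y) \<bullet> v = 0))"

context
  fixes V :: "'a::{real_inner,banach} set"
  assumes V: "subspace V" "closed V"
begin

lemma oproj: "oproj V x \<in> V" and oproj_orth: "v \<in> V \<Longrightarrow> (x - oproj V x) \<bullet> v = 0"
proof -
  have "oproj V x \<in> V \<and> (\<forall>v\<in>V. (x - oproj V x) \<bullet> v = 0)"
    unfolding oproj_def by (rule someI_ex) (use ex_orthogonal_projection[OF V, of x] in blast)
  then show "oproj V x \<in> V" "v \<in> V \<Longrightarrow> (x - oproj V x) \<bullet> v = 0" by auto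
qed

lemma oproj_unique:
  assumes "y \<in> V" "\<And>v. v \<in> V \<Longrightarrow> (x - y) \<bullet> v = 0"
  shows "oproj V x = y"
proof -
  have *: "y - oproj V x \<in> V" using assms(1) oproj V by (simp add: subspace_diff)
  have "(y - oproj V x) \<bullet> (y - oproj V x)
      = (x - oproj V x) \<bullet> (y - oproj V x) - (x - y) \<bullet> (y - oproj V x)"
    by (simp add: inner_diff_left)
  also have "\<dots> = 0" using oproj_orth[OF *] assms(2)[OF *] by simp
  finally show ?thesis by simp
qed

lemma oproj_fixed: "x \<in> V \<Longrightarrow> oproj V x = x"
  by (rule oproj_unique) auto

lemma oproj_eq_0_iff: "oproj V x = 0 \<longleftrightarrow> (\<forall>v\<in>V. x \<bullet> v = 0)"
  using oproj_orth[of _ x] oproj_unique[of 0 x] subspace_0[OF V(1)] by fastforce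

lemma oproj_add: "oproj V (x + y) = oproj V x + oproj V y"
  using oproj_orth[of _ x] oproj_orth[of _ y]
  by (intro oproj_unique subspace_add V oproj) (simp add: inner_diff_left inner_add_left)

lemma oproj_scaleR: "oproj V (c *\<^sub>R x) = c *\<^sub>R oproj V x"
  using oproj_orth[of _ x]
  by (intro oproj_unique subspace_mul V oproj) (simp add: inner_diff_left)

lemma oproj_sym: "oproj V x \<bullet> y = x \<bullet> oproj V y"
  using oproj_orth[OF oproj, of x y] oproj_orth[OF oproj, of y x]
  by (simp add: inner_diff inner_commute)

text \<open>Commuting with a projection amounts to preserving its range and its kernel; the third
  assumption says that L maps the orthogonal complement of V into itself.\<close>

lemma oproj_commute:
  assumes "linear L" "\<And>x. x \<in> V \<Longrightarrow> L x \<in> V"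
    and "\<And>x v. (\<And>v. v \<in> V \<Longrightarrow> x \<bullet> v = 0) \<Longrightarrow> v \<in> V \<Longrightarrow> L x \<bullet> v = 0"
  shows "oproj V (L x) = L (oproj V x)"
proof (rule oproj_unique)
  fix v assume "v \<in> V"
  then show "(L x - L (oproj V x)) \<bullet> v = 0"
    using assms(3)[of "x - oproj V x" v] oproj_orth[of _ x] assms(1)
    by (simp add: linear_diff)
qed (use assms oproj in auto)

end

text \<open>Coefficients of \<open>(1 - t)\<^bsup>1/2\<^esup>\<close>.\<close>

definition sqrt_coeff :: "nat \<Rightarrow> real" where
  "sqrt_coeff k = (1/2 gchoose k) * (-1) ^ k"

lemma sqrt_coeff_0 [simp]: "sqrt_coeff 0 = 1"
  by (simp add: sqrt_coeff_def)

lemma sqrt_coeff_Suc: "sqrt_coeff (Suc k) = sqrt_coeff k * ((real k - 1/2) / (real k + 1))"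
proof -
  have "(1/2 gchoose Suc k) = (1/2 gchoose k) * ((1/2 - real k) / (real k + 1))"
    using gbinomial_mult_1[of "1/2::real" k] by (simp add: field_simps)
  moreover have "(real k - 1/2) / (real k + 1) = - ((1/2 - real k) / (real k + 1))"
    by (simp add: field_simps)
  ultimately show ?thesis by (simp add: sqrt_coeff_def)
qed

text \<open>The coefficient at 1 is -1/2, and the ratio (k - 1/2) / (k + 1) of consecutive
  coefficients is nonnegative from k = 1 on.\<close>

lemma sqrt_coeff_nonpos: "k \<noteq> 0 \<Longrightarrow> sqrt_coeff k \<le> 0"
proof (induction k)
  case (Suc k)
  show ?case
  proof (cases "k = 0")
    case False
    then have "sqrt_coeff k \<le> 0" "(real k - 1/2) / (real k + 1) \<ge> 0" using Suc by auto
    then show ?thesis unfolding sqrt_coeff_Suc by (rule mult_nonpos_nonneg)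
  qed (simp add: sqrt_coeff_Suc)
qed simp

text \<open>The partial sums of the binomial series at t = 1 have a closed form, (-1)^n times the
  binomial coefficient of -1/2 and n, which is a product of positive numbers. Together with the
  signs of the coefficients this gives absolute convergence at t = 1, which covers operators of norm
  exactly 1.\<close>

lemma sum_sqrt_coeff_nonneg: "(\<Sum>k\<le>n. sqrt_coeff k) \<ge> 0"
proof -
  have "(-1) ^ n * ((1/2 - 1) gchoose n :: real) \<ge> 0"
  proof (induction n)
    case (Suc n)
    have "((1/2 - 1 :: real) gchoose Suc n) = ((1/2 - 1) gchoose n) * ((1/2 - 1 - real n) / (real n + 1))"
      using gbinomial_mult_1[of "1/2 - 1::real" n] by (simp add: field_simps)
    moreover have "(real n + 1/2) / (real n + 1) = - ((1/2 - 1 - real n) / (real n + 1))"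
      by (simp add: field_simps)
    ultimately have "(-1) ^ Suc n * ((1/2 - 1) gchoose Suc n :: real)
        = ((-1) ^ n * ((1/2 - 1) gchoose n)) * ((real n + 1/2) / (real n + 1))"
      by simp
    also have "\<dots> \<ge> 0" by (rule mult_nonneg_nonneg[OF Suc]) auto
    finally show ?case .
  qed simp
  then show ?thesis using gbinomial_sum_lower_neg[of "1/2::real" n] by (simp add: sqrt_coeff_def)
qed

lemma sum_abs_sqrt_coeff: "(\<Sum>k\<le>n. \<bar>sqrt_coeff k\<bar>) \<le> 2"
proof -
  have "(\<Sum>k\<le>n. \<bar>sqrt_coeff k\<bar>) = (\<Sum>k\<le>n. (if k = 0 then 2 else 0) - sqrt_coeff k)"
    using sqrt_coeff_nonpos by (intro sum.cong) auto
  also have "\<dots> = 2 - (\<Sum>k\<le>n. sqrt_coeff k)" by (simp add: sum_subtractf sum.delta)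
  finally show ?thesis using sum_sqrt_coeff_nonneg[of n] by simp
qed

lemma summable_abs_sqrt_coeff: "summable (\<lambda>k. \<bar>sqrt_coeff k\<bar>)"
proof (rule summableI_nonneg_bounded)
  fix n
  show "(\<Sum>k<n. \<bar>sqrt_coeff k\<bar>) \<le> 2"
    using sum_abs_sqrt_coeff[of n] sum_mono2[of "{..n}" "{..<n}" "\<lambda>k. \<bar>sqrt_coeff k\<bar>"] by fastforce
qed simp

text \<open>Squaring the series gives 1 - t: this is Vandermonde's identity for 1/2 + 1/2 = 1, and
  the binomial coefficients of 1 vanish beyond k = 1.\<close>

lemma sqrt_coeff_conv:
  "(\<Sum>i\<le>k. sqrt_coeff i * sqrt_coeff (k - i)) = (if k = 0 then 1 else if k = 1 then -1 else 0)"
proof -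
  have "(\<Sum>i\<le>k. sqrt_coeff i * sqrt_coeff (k - i))
      = (\<Sum>i\<le>k. (1/2 gchoose i) * (1/2 gchoose (k - i))) * (-1) ^ k"
    unfolding sum_distrib_right
    by (rule sum.cong) (auto simp: sqrt_coeff_def power_add[symmetric])
  also have "(\<Sum>i\<le>k. (1/2 gchoose i) * (1/2 gchoose (k - i))) = ((1::real) gchoose k)"
    using gbinomial_Vandermonde[of "1/2::real" "1/2" k] by (simp add: atMost_atLeast0)
  also have "((1::real) gchoose k) = real (1 choose k)"
    using binomial_gbinomial[of 1 k, where 'a = real] by simp
  finally show ?thesis
    by (cases k rule: nat.exhaust) (auto simp: binomial_eq_0)
qed

lemma linear_funpow: "linear (B :: 'a::real_vector \<Rightarrow> 'a) \<Longrightarrow> linear (B ^^ k)"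
  by (induction k) (auto simp: linear_compose real_vector.linear_id)

lemma symmetric_funpow:
  assumes "\<And>x y. B x \<bullet> y = x \<bullet> B y"
  shows "(B ^^ k) x \<bullet> y = x \<bullet> (B ^^ k) y"
proof (induction k arbitrary: x y)
  case (Suc k)
  have "(B ^^ Suc k) x \<bullet> y = x \<bullet> (B ^^ k) (B y)" by (simp add: assms Suc)
  then show ?case by (simp add: funpow_swap1)
qed simp

lemma commute_funpow:
  assumes "\<And>x. L (B x) = B (L x)"
  shows "L ((B ^^ k) x) = (B ^^ k) (L x)"
  by (induction k) (auto simp: assms)

lemma invariant_funpow: "(\<And>x. x \<in> H \<Longrightarrow> B x \<in> H) \<Longrightarrow> x \<in> H \<Longrightarrow> (B ^^ k) x \<in> H"
  by (induction k) auto

section \<open>The square root of 1 - B for a symmetric contraction B\<close>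

context
  fixes B :: "'a::{real_inner,banach} \<Rightarrow> 'a"
  assumes linB: "linear B" and contr: "\<And>x. norm (B x) \<le> norm x"
    and symB: "\<And>x y. B x \<bullet> y = x \<bullet> B y"
begin

definition sqrt_one_minus :: "'a \<Rightarrow> 'a" where
  "sqrt_one_minus x = suminf (\<lambda>k. sqrt_coeff k *\<^sub>R (B ^^ k) x)"

lemma norm_funpow_contr: "norm ((B ^^ k) x) \<le> norm x"
  by (induction k) (auto intro: order_trans[OF contr])

lemma sqrt_one_minus_sums: "(\<lambda>k. sqrt_coeff k *\<^sub>R (B ^^ k) x) sums sqrt_one_minus x"
proof -
  have "summable (\<lambda>k. norm (sqrt_coeff k *\<^sub>R (B ^^ k) x))"
  proof (rule summable_comparison_test')
    show "summable (\<lambda>k. \<bar>sqrt_coeff k\<bar> * norm x)"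
      by (rule summable_mult2[OF summable_abs_sqrt_coeff])
  qed (auto intro!: mult_left_mono norm_funpow_contr)
  then show ?thesis unfolding sqrt_one_minus_def by (rule summable_sums[OF summable_norm_cancel])
qed

lemma sqrt_one_minus_bounded_linear_commute:
  assumes "bounded_linear L" "\<And>x. L (B x) = B (L x)"
  shows "L (sqrt_one_minus x) = sqrt_one_minus (L x)"
proof -
  have "(\<lambda>k. sqrt_coeff k *\<^sub>R (B ^^ k) (L x)) sums L (sqrt_one_minus x)"
    using bounded_linear.sums[OF assms(1) sqrt_one_minus_sums[of x]]
    by (simp add: linear_simps[OF assms(1)] commute_funpow[of L B, OF assms(2)])
  then show ?thesis using sums_unique2 sqrt_one_minus_sums by blast
qed

lemma linear_sqrt_one_minus: "linear sqrt_one_minus"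
proof (rule linearI)
  interpret B: linear "B ^^ k" for k by (rule linear_funpow[OF linB])
  show "sqrt_one_minus (x + y) = sqrt_one_minus x + sqrt_one_minus y" for x y
    using sums_unique2[OF sums_add[OF sqrt_one_minus_sums[of x] sqrt_one_minus_sums[of y]]]
      sqrt_one_minus_sums[of "x + y"] by (simp add: B.add scaleR_add_right)
  show "sqrt_one_minus (c *\<^sub>R x) = c *\<^sub>R sqrt_one_minus x" for c x
    using sums_unique2[OF bounded_linear.sums[OF bounded_linear_scaleR_right sqrt_one_minus_sums[of x]]]
      sqrt_one_minus_sums[of "c *\<^sub>R x"] by (simp add: B.scaleR mult.commute)
qed

lemma sqrt_one_minus_sym: "sqrt_one_minus x \<bullet> y = x \<bullet> sqrt_one_minus y"
proof -
  have "(\<lambda>k. sqrt_coeff k * ((B ^^ k) x \<bullet> y)) sums (sqrt_one_minus x \<bullet> y)"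
    using bounded_linear.sums[OF bounded_linear_inner_left sqrt_one_minus_sums[of x]] by simp
  moreover have "(\<lambda>k. sqrt_coeff k * (x \<bullet> (B ^^ k) y)) sums (x \<bullet> sqrt_one_minus y)"
    using bounded_linear.sums[OF bounded_linear_inner_right sqrt_one_minus_sums[of y]] by simp
  ultimately show ?thesis using sums_unique2 by (simp add: symmetric_funpow[of B, OF symB])
qed

text \<open>For k \<ge> 1 the coefficients are nonpositive and B ^ k x . x \<le> x . x, so every
  partial sum is at least the partial sum of the coefficients times x . x, which is
  nonnegative.\<close>

lemma sqrt_one_minus_nonneg: "0 \<le> sqrt_one_minus x \<bullet> x"
proof -
  have "(\<lambda>k. sqrt_coeff k * ((B ^^ k) x \<bullet> x)) sums (sqrt_one_minus x \<bullet> x)"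
    using bounded_linear.sums[OF bounded_linear_inner_left sqrt_one_minus_sums[of x]] by simp
  then have lim: "(\<lambda>n. \<Sum>k\<le>n. sqrt_coeff k * ((B ^^ k) x \<bullet> x)) \<longlonglongrightarrow> sqrt_one_minus x \<bullet> x"
    by (simp add: sums_def_le)
  have "0 \<le> (\<Sum>k\<le>n. sqrt_coeff k * ((B ^^ k) x \<bullet> x))" for n
  proof -
    have "(\<Sum>k\<le>n. sqrt_coeff k) * (x \<bullet> x) \<le> (\<Sum>k\<le>n. sqrt_coeff k * ((B ^^ k) x \<bullet> x))"
      unfolding sum_distrib_right
    proof (rule sum_mono)
      fix k
      have "(B ^^ k) x \<bullet> x \<le> norm ((B ^^ k) x) * norm x" by (rule norm_cauchy_schwarz)
      also have "\<dots> \<le> x \<bullet> x"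
        using mult_right_mono[OF norm_funpow_contr[of k x] norm_ge_zero[of x]]
        by (simp add: dot_square_norm power2_eq_square)
      finally show "sqrt_coeff k * (x \<bullet> x) \<le> sqrt_coeff k * ((B ^^ k) x \<bullet> x)"
        using sqrt_coeff_nonpos[of k] by (cases "k = 0") (auto intro: mult_left_mono_neg)
    qed
    then show ?thesis using sum_sqrt_coeff_nonneg[of n]
      by (meson inner_ge_zero mult_nonneg_nonneg order_trans)
  qed
  then show ?thesis by (intro LIMSEQ_le_const[OF lim]) auto
qed

lemma sqrt_one_minus_mem:
  assumes "subspace H" "closed H" "\<And>x. x \<in> H \<Longrightarrow> B x \<in> H" "x \<in> H"
  shows "sqrt_one_minus x \<in> H"
proof -
  have lim: "(\<lambda>n. \<Sum>k<n. sqrt_coeff k *\<^sub>R (B ^^ k) x) \<longlonglongrightarrow> sqrt_one_minus x"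
    using sqrt_one_minus_sums[of x] by (simp add: sums_def)
  have mem: "(\<Sum>k<n. sqrt_coeff k *\<^sub>R (B ^^ k) x) \<in> H" for n
    using assms by (intro subspace_sum subspace_mul invariant_funpow) auto
  show ?thesis by (rule closed_sequentially[OF assms(2) mem lim])
qed

text \<open>Cauchy product of an operator series with itself. The square partial sums
  \<open>P n (P n x)\<close> tend to the left side, the triangular ones equal x - B x from n = 2 on,
  and their difference is dominated by the corresponding difference for the scalar series of
  absolute values, where Cauchy's theorem applies.\<close>

lemma sqrt_one_minus_square: "sqrt_one_minus (sqrt_one_minus x) = x - B x"
proof -
  interpret B: linear "B ^^ k" for k by (rule linear_funpow[OF linB])
  define P where "P n x = (\<Sum>k<n. sqrt_coeff k *\<^sub>R (B ^^ k) x)" for n x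
  have P_lim: "(\<lambda>n. P n x) \<longlonglongrightarrow> sqrt_one_minus x" for x
    using sqrt_one_minus_sums[of x] by (simp add: sums_def P_def)
  have P_diff: "P n (x - y) = P n x - P n y" for n x y
    by (simp add: P_def B.diff scaleR_diff_right sum_subtractf)
  have P_norm: "norm (P n x) \<le> 2 * norm x" for n x
  proof -
    have "norm (P n x) \<le> (\<Sum>k<n. \<bar>sqrt_coeff k\<bar> * norm x)" unfolding P_def
      by (intro sum_norm_le) (auto intro!: mult_left_mono norm_funpow_contr)
    also have "\<dots> \<le> (\<Sum>k\<le>n. \<bar>sqrt_coeff k\<bar>) * norm x"
      unfolding sum_distrib_right by (intro sum_mono2) auto
    also have "\<dots> \<le> 2 * norm x" by (intro mult_right_mono sum_abs_sqrt_coeff) auto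
    finally show ?thesis .
  qed
  \<comment> \<open>The operators \<open>P n\<close> are bounded by 2 uniformly in n, so the inner
    partial sum may be replaced by its limit.\<close>
  have "(\<lambda>n. P n (P n x - sqrt_one_minus x)) \<longlonglongrightarrow> 0"
  proof (rule Lim_null_comparison)
    show "\<forall>\<^sub>F n in sequentially. norm (P n (P n x - sqrt_one_minus x)) \<le> 2 * norm (P n x - sqrt_one_minus x)"
      using P_norm by simp
    show "(\<lambda>n. 2 * norm (P n x - sqrt_one_minus x)) \<longlonglongrightarrow> 0"
      using P_lim[of x] by (intro tendsto_mult_right_zero tendsto_norm_zero) (simp add: LIM_zero)
  qed
  from tendsto_add[OF this P_lim[of "sqrt_one_minus x"]]
  have 1: "(\<lambda>n. P n (P n x)) \<longlonglongrightarrow> sqrt_one_minus (sqrt_one_minus x)"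
    by (simp add: P_diff)
  define g where "g i j = (sqrt_coeff i * sqrt_coeff j) *\<^sub>R (B ^^ (i + j)) x" for i j
  define s where "s = suminf (\<lambda>k. \<bar>sqrt_coeff k\<bar>)"
  define h where "h i j = \<bar>sqrt_coeff i\<bar> * \<bar>sqrt_coeff j\<bar>" for i j
  let ?T = "\<lambda>n. {(i, j). i + j < (n::nat)}"
  have PP: "P n (P n x) = (\<Sum>(i,j)\<in>{..<n}\<times>{..<n}. g i j)" for n
    by (simp add: P_def g_def B.sum B.scaleR scaleR_sum_right sum.cartesian_product funpow_add mult.commute
        del: funpow.simps)
  have finT: "finite (?T n)" for n by (rule finite_subset[of _ "{..<n}\<times>{..<n}"]) auto
  have sub: "?T n \<subseteq> {..<n}\<times>{..<n}" for n by auto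
  have tri: "(\<Sum>(i,j)\<in>?T n. g i j) = x - B x" if "n \<ge> 2" for n
  proof -
    have "(\<Sum>(i,j)\<in>?T n. g i j) = (\<Sum>k<n. \<Sum>i\<le>k. g i (k - i))" by (rule sum.triangle_reindex)
    also have "\<dots> = (\<Sum>k<n. (\<Sum>i\<le>k. sqrt_coeff i * sqrt_coeff (k - i)) *\<^sub>R (B ^^ k) x)"
      by (simp add: g_def scaleR_sum_left)
    also have "\<dots> = (\<Sum>k\<in>{0,1}. (\<Sum>i\<le>k. sqrt_coeff i * sqrt_coeff (k - i)) *\<^sub>R (B ^^ k) x)"
      by (rule sum.mono_neutral_right) (use that in \<open>auto simp: sqrt_coeff_conv\<close>)
    also have "\<dots> = x - B x" unfolding sqrt_coeff_conv by simp
    finally show ?thesis .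
  qed
  have "(\<lambda>n. P n (P n x) - (\<Sum>(i,j)\<in>?T n. g i j)) \<longlonglongrightarrow> 0"
  proof (rule Lim_null_comparison)
    show "\<forall>\<^sub>F n in sequentially. norm (P n (P n x) - (\<Sum>(i,j)\<in>?T n. g i j))
        \<le> ((\<Sum>k<n. \<bar>sqrt_coeff k\<bar>) * (\<Sum>k<n. \<bar>sqrt_coeff k\<bar>) - (\<Sum>k<n. \<Sum>i\<le>k. h i (k - i))) * norm x"
    proof (rule always_eventually, rule allI)
      fix n
      have "P n (P n x) - (\<Sum>(i,j)\<in>?T n. g i j) = (\<Sum>(i,j)\<in>{..<n}\<times>{..<n} - ?T n. g i j)"
        unfolding PP by (subst sum_diff[OF _ sub]) auto
      also have "norm \<dots> \<le> (\<Sum>(i,j)\<in>{..<n}\<times>{..<n} - ?T n. h i j * norm x)"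
        by (rule sum_norm_le) (auto simp: g_def h_def abs_mult intro!: mult_left_mono norm_funpow_contr)
      also have "\<dots> = ((\<Sum>(i,j)\<in>{..<n}\<times>{..<n}. h i j) - (\<Sum>(i,j)\<in>?T n. h i j)) * norm x"
        by (subst sum_diff[OF _ sub]) (auto simp: case_prod_unfold sum_distrib_right left_diff_distrib)
      also have "(\<Sum>(i,j)\<in>{..<n}\<times>{..<n}. h i j) = (\<Sum>k<n. \<bar>sqrt_coeff k\<bar>) * (\<Sum>k<n. \<bar>sqrt_coeff k\<bar>)"
        by (simp add: h_def sum_product sum.cartesian_product)
      also have "(\<Sum>(i,j)\<in>?T n. h i j) = (\<Sum>k<n. \<Sum>i\<le>k. h i (k - i))" by (rule sum.triangle_reindex)
      finally show "norm (P n (P n x) - (\<Sum>(i,j)\<in>?T n. g i j))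
        \<le> ((\<Sum>k<n. \<bar>sqrt_coeff k\<bar>) * (\<Sum>k<n. \<bar>sqrt_coeff k\<bar>) - (\<Sum>k<n. \<Sum>i\<le>k. h i (k - i))) * norm x" .
    qed
    have l1: "(\<lambda>n. \<Sum>k<n. \<bar>sqrt_coeff k\<bar>) \<longlonglongrightarrow> s"
      using summable_LIMSEQ[OF summable_abs_sqrt_coeff] by (simp add: s_def)
    have "(\<lambda>k. \<Sum>i\<le>k. h i (k - i)) sums (s * s)"
      unfolding s_def h_def
      by (rule Cauchy_product_sums) (use summable_abs_sqrt_coeff in auto)
    then have l2: "(\<lambda>n. \<Sum>k<n. \<Sum>i\<le>k. h i (k - i)) \<longlonglongrightarrow> s * s" by (simp add: sums_def)
    show "(\<lambda>n. ((\<Sum>k<n. \<bar>sqrt_coeff k\<bar>) * (\<Sum>k<n. \<bar>sqrt_coeff k\<bar>) - (\<Sum>k<n. \<Sum>i\<le>k. h i (k - i))) * norm x) \<longlonglongrightarrow> 0"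
      by (rule tendsto_eq_rhs) (rule tendsto_mult[OF tendsto_diff[OF tendsto_mult[OF l1 l1] l2] tendsto_const], simp)
  qed
  from tendsto_diff[OF 1 this]
  have "(\<lambda>n. \<Sum>(i,j)\<in>?T n. g i j) \<longlonglongrightarrow> sqrt_one_minus (sqrt_one_minus x)" by simp
  moreover have "(\<lambda>n. \<Sum>(i,j)\<in>?T n. g i j) \<longlonglongrightarrow> x - B x"
    by (rule tendsto_eventually) (use tri in \<open>auto simp: eventually_sequentially\<close>)
  ultimately show ?thesis using LIMSEQ_unique by blast
qed

end

section \<open>Positive operators\<close>

locale positive_operator =
  fixes T :: "'a::{real_inner,banach} \<Rightarrow> 'a"
  assumes bounded_linear_T: "bounded_linear T"
    and sym: "T x \<bullet> y = x \<bullet> T y"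
    and nonneg: "0 \<le> T x \<bullet> x"
begin

lemma linear_T: "linear T"
  by (rule bounded_linear.linear[OF bounded_linear_T])

lemma linear_pow: "linear (T ^^ k)"
  by (rule linear_funpow[OF linear_T])

text \<open>The discriminant of the nonnegative quadratic T (x + t y) . (x + t y) in t. When T y . y
  = 0 it is affine in t, and boundedness below forces its slope to vanish.\<close>

lemma form_cauchy_schwarz: "(T x \<bullet> y)\<^sup>2 \<le> (T x \<bullet> x) * (T y \<bullet> y)"
proof -
  have q: "0 \<le> T x \<bullet> x + 2 * t * (T x \<bullet> y) + t\<^sup>2 * (T y \<bullet> y)" for t
  proof -
    have "T (x + t *\<^sub>R y) \<bullet> (x + t *\<^sub>R y) = T x \<bullet> x + 2 * t * (T x \<bullet> y) + t\<^sup>2 * (T y \<bullet> y)"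
      using sym[of y x]
      by (simp add: linear_add[OF linear_T] linear_scale[OF linear_T] inner_add
          algebra_simps power2_eq_square inner_commute)
    then show ?thesis using nonneg by metis
  qed
  show ?thesis
  proof (cases "T y \<bullet> y = 0")
    case True
    have "T x \<bullet> y = 0"
    proof (rule ccontr)
      assume "T x \<bullet> y \<noteq> 0"
      then show False using q[of "- (T x \<bullet> x + 1) / (2 * (T x \<bullet> y))"] True by (simp add: field_simps)
    qed
    then show ?thesis using True by simp
  next
    case False
    then have "T y \<bullet> y > 0" using nonneg[of y] by simp
    then show ?thesis using q[of "- (T x \<bullet> y) / (T y \<bullet> y)"]
      by (simp add: field_simps power2_eq_square)
  qed
qed

text \<open>The Cauchy-Schwarz inequality for the form at w and T w gives norm (T w) ^ 4 \<le> (T w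
  . w) (T (T w) . T w). Invariance of W allows the form bound to be used at T w as well as at
  w.\<close>

lemma norm_le_on_invariant:
  assumes "\<And>w. w \<in> W \<Longrightarrow> T w \<in> W" "\<And>w. w \<in> W \<Longrightarrow> T w \<bullet> w \<le> l * (w \<bullet> w)" "w \<in> W" "l \<ge> 0"
  shows "norm (T w) \<le> l * norm w"
proof (cases "T w = 0")
  case False
  define n where "n = T w \<bullet> T w"
  have n: "n > 0" using False by (simp add: n_def)
  have "n\<^sup>2 \<le> (T w \<bullet> w) * (T (T w) \<bullet> T w)" unfolding n_def by (rule form_cauchy_schwarz)
  also have "\<dots> \<le> (l * (w \<bullet> w)) * (l * n)" unfolding n_def
    using assms by (intro mult_mono nonneg) auto
  finally have "n \<le> (l * norm w)\<^sup>2"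
    using n by (simp add: power2_eq_square dot_square_norm mult_ac)
  then show ?thesis unfolding n_def dot_square_norm
    by (rule power2_le_imp_le) (use assms in auto)
qed (use assms in simp)

lemma norm_pow_le_on_invariant:
  assumes W: "\<And>w. w \<in> W \<Longrightarrow> T w \<in> W" and "\<And>w. w \<in> W \<Longrightarrow> T w \<bullet> w \<le> l * (w \<bullet> w)" and w: "w \<in> W" and "l \<ge> 0"
  shows "norm ((T ^^ k) w) \<le> l ^ k * norm w"
proof (induction k)
  case (Suc k)
  have "(T ^^ k) w \<in> W" by (rule invariant_funpow[of W T, OF W w])
  then have "norm ((T ^^ Suc k) w) \<le> l * norm ((T ^^ k) w)"
    using norm_le_on_invariant[of W l, OF W assms(2) _ \<open>l \<ge> 0\<close>] by simp
  also have "\<dots> \<le> l * (l ^ k * norm w)" by (rule mult_left_mono[OF Suc \<open>l \<ge> 0\<close>])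
  finally show ?case by (simp add: mult_ac)
qed simp

lemma norm_pow_ge_on_invariant:
  assumes W: "\<And>w. w \<in> W \<Longrightarrow> T w \<in> W" and ge: "\<And>w. w \<in> W \<Longrightarrow> T w \<bullet> w \<ge> l * (w \<bullet> w)" and w: "w \<in> W" and "l \<ge> 0"
  shows "norm ((T ^^ k) w) \<ge> l ^ k * norm w"
proof (induction k)
  case (Suc k)
  define u where "u = (T ^^ k) w"
  have "u \<in> W" unfolding u_def by (rule invariant_funpow[of W T, OF W w])
  then have "l * (norm u * norm u) \<le> norm (T u) * norm u"
    using order_trans[OF ge[of u] norm_cauchy_schwarz[of "T u" u]]
    by (simp add: dot_square_norm power2_eq_square)
  then have "l * norm u \<le> norm (T u)"
    by (cases "norm u = 0") (auto simp: mult_le_cancel_right mult.assoc[symmetric] simp del: norm_eq_zero)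
  moreover have "l ^ Suc k * norm w \<le> l * norm u"
    using mult_left_mono[OF Suc \<open>l \<ge> 0\<close>] by (simp add: u_def mult_ac)
  ultimately show ?case by (simp add: u_def)
qed simp

text \<open>Induction in steps of two, since T ^ (k + 2) w . w = T ^ k (T w) . T w and the norm of T
  w is controlled by the bounds on W. Odd powers are thereby reduced to T itself.\<close>

lemma pow_form_bounds:
  assumes W: "\<And>w. w \<in> W \<Longrightarrow> T w \<in> W" and w: "w \<in> W" and lm: "0 \<le> l" "0 \<le> m"
    and lo: "\<And>w. w \<in> W \<Longrightarrow> l * (w \<bullet> w) \<le> T w \<bullet> w" and up: "\<And>w. w \<in> W \<Longrightarrow> T w \<bullet> w \<le> m * (w \<bullet> w)"
  shows "l ^ k * (w \<bullet> w) \<le> (T ^^ k) w \<bullet> w \<and> (T ^^ k) w \<bullet> w \<le> m ^ k * (w \<bullet> w)"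
  using w
proof (induction k arbitrary: w rule: induct_nat_012)
  case (ge2 k)
  have e: "(T ^^ Suc (Suc k)) w \<bullet> w = (T ^^ k) (T w) \<bullet> T w"
    using sym[of "(T ^^ k) (T w)" w] by (simp add: funpow_swap1)
  have n: "norm (T w) \<ge> l * norm w" "norm (T w) \<le> m * norm w"
    using norm_pow_ge_on_invariant[of W l w 1, OF W lo ge2.prems lm(1)]
      norm_le_on_invariant[of W m w, OF W up ge2.prems lm(2)] by auto
  have n2: "l\<^sup>2 * (w \<bullet> w) \<le> T w \<bullet> T w" "T w \<bullet> T w \<le> m\<^sup>2 * (w \<bullet> w)"
    using power_mono[OF n(1), of 2] power_mono[OF n(2), of 2] lm
    by (auto simp: dot_square_norm power_mult_distrib)
  have "l ^ k * (l\<^sup>2 * (w \<bullet> w)) \<le> l ^ k * (T w \<bullet> T w)" using n2 lm by (intro mult_left_mono) auto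
  moreover have "m ^ k * (T w \<bullet> T w) \<le> m ^ k * (m\<^sup>2 * (w \<bullet> w))" using n2 lm by (intro mult_left_mono) auto
  ultimately show ?case using ge2.IH(1)[OF W[OF ge2.prems]] unfolding e
    by (simp add: power2_eq_square mult_ac)
next
  case 1 then show ?case using lo up by simp
qed simp

end

section \<open>Growth spaces: spectral subspaces described by growth rates\<close>

locale positive_operator_on = positive_operator T for T :: "'a::{real_inner,banach} \<Rightarrow> 'a" +
  fixes H :: "'a set"
  assumes subspace_H: "subspace H" and closed_H: "closed H" and T_H: "x \<in> H \<Longrightarrow> T x \<in> H"
begin

text \<open>The constant C is left free, which makes closure under sums immediate. That C = norm x
  always suffices, as shown in \<open>growth_space_eq\<close>, is what yields closedness and
  monotonicity in l.\<close>

definition growth_space :: "real \<Rightarrow> 'a set" where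
  "growth_space l = {x \<in> H. \<exists>C. \<forall>k. norm ((T ^^ k) x) \<le> C * l ^ k}"

text \<open>The sequence \<open>norm (T ^ k x)\<close> is log-convex, so an exponential rate bounds its first ratio.\<close>

lemma growth_space_norm_le:
  assumes "x \<in> growth_space l" "l \<ge> 0"
  shows "norm (T x) \<le> l * norm x"
proof (rule ccontr)
  assume "\<not> norm (T x) \<le> l * norm x"
  then have gt: "l * norm x < norm (T x)" by simp
  have x: "norm x > 0" using gt linear_0[OF linear_T] by (cases "x = 0") auto
  define q where "q = norm (T x) / norm x"
  have q: "q > l" using gt x by (simp add: q_def field_simps)
  have conv: "(norm ((T ^^ Suc k) x))\<^sup>2 \<le> norm ((T ^^ k) x) * norm ((T ^^ Suc (Suc k)) x)" for k
  proof -
    have "(norm ((T ^^ Suc k) x))\<^sup>2 = (T ^^ k) x \<bullet> (T ^^ Suc (Suc k)) x"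
      by (simp add: power2_norm_eq_inner sym)
    then show ?thesis using norm_cauchy_schwarz by metis
  qed
  have step: "norm ((T ^^ Suc k) x) \<ge> q * norm ((T ^^ k) x) \<and> norm ((T ^^ k) x) > 0" for k
  proof (induction k)
    case 0 then show ?case using x by (simp add: q_def)
  next
    case (Suc k)
    have pos: "norm ((T ^^ Suc k) x) > 0"
      using Suc q \<open>l \<ge> 0\<close> mult_pos_pos[of q "norm ((T ^^ k) x)"] by linarith
    have "q * norm ((T ^^ k) x) * norm ((T ^^ Suc k) x) \<le> norm ((T ^^ Suc k) x) * norm ((T ^^ Suc k) x)"
      using Suc pos by (intro mult_right_mono) auto
    also have "\<dots> \<le> norm ((T ^^ k) x) * norm ((T ^^ Suc (Suc k)) x)"
      using conv[of k] by (simp add: power2_eq_square)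
    finally have "norm ((T ^^ k) x) * (q * norm ((T ^^ Suc k) x))
        \<le> norm ((T ^^ k) x) * norm ((T ^^ Suc (Suc k)) x)" by (simp add: mult_ac)
    then show ?case using pos Suc by (simp add: mult_le_cancel_left)
  qed
  have growth: "norm ((T ^^ k) x) \<ge> q ^ k * norm x" for k
  proof (induction k)
    case (Suc k)
    have "q ^ Suc k * norm x \<le> q * norm ((T ^^ k) x)"
      using mult_left_mono[OF Suc, of q] q \<open>l \<ge> 0\<close> by (simp add: mult_ac)
    then show ?case using step[of k] by linarith
  qed simp
  obtain C where C: "\<And>k. norm ((T ^^ k) x) \<le> C * l ^ k" using assms by (auto simp: growth_space_def)
  have le: "q ^ k * norm x \<le> C * l ^ k" for k using growth C order_trans by blast
  show False
  proof (cases "l = 0")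
    case True
    then show False using le[of 1] q x by (simp add: mult_le_0_iff)
  next
    case False
    then have l: "l > 0" using assms by simp
    obtain k where k: "C / norm x < (q / l) ^ k"
      using real_arch_pow[of "q / l" "C / norm x"] q l by (auto simp: field_simps)
    then have "C * l ^ k < q ^ k * norm x" using x l by (simp add: field_simps power_divide)
    then show False using le[of k] by simp
  qed
qed

lemma growth_space_T: "x \<in> growth_space l \<Longrightarrow> T x \<in> growth_space l"
proof -
  assume x: "x \<in> growth_space l"
  then obtain C where C: "\<And>k. norm ((T ^^ k) x) \<le> C * l ^ k" by (auto simp: growth_space_def)
  have "norm ((T ^^ k) (T x)) \<le> (C * l) * l ^ k" for k
    using C[of "Suc k"] by (simp add: funpow_swap1 mult_ac)
  then show ?thesis using x T_H by (auto simp: growth_space_def)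
qed

lemma growth_space_pow_le:
  assumes x: "x \<in> growth_space l" and l: "l \<ge> 0"
  shows "norm ((T ^^ k) x) \<le> l ^ k * norm x"
proof (induction k)
  case (Suc k)
  have "(T ^^ k) x \<in> growth_space l" by (rule invariant_funpow[of _ T, OF growth_space_T x])
  from growth_space_norm_le[OF this l]
  have "norm ((T ^^ Suc k) x) \<le> l * norm ((T ^^ k) x)" by simp
  also have "\<dots> \<le> l * (l ^ k * norm x)" by (rule mult_left_mono[OF Suc l])
  finally show ?case by (simp add: mult_ac)
qed simp

lemma growth_space_eq:
  "l \<ge> 0 \<Longrightarrow> growth_space l = {x \<in> H. \<forall>k. norm ((T ^^ k) x) \<le> l ^ k * norm x}"
  using growth_space_pow_le unfolding growth_space_def by (auto simp: mult.commute)

lemma growth_space_subset: "growth_space l \<subseteq> H"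
  by (auto simp: growth_space_def)

lemma growth_space_form_le:
  assumes "x \<in> growth_space l" "l \<ge> 0"
  shows "T x \<bullet> x \<le> l * (x \<bullet> x)"
proof -
  have "T x \<bullet> x \<le> norm (T x) * norm x" by (rule norm_cauchy_schwarz)
  also have "\<dots> \<le> l * norm x * norm x" by (intro mult_right_mono growth_space_norm_le assms) auto
  finally show ?thesis by (simp add: dot_square_norm power2_eq_square mult_ac)
qed

lemma subspace_growth_space: assumes l: "l \<ge> 0" shows "subspace (growth_space l)"
  unfolding Real_Vector_Spaces.subspace_def
proof (intro conjI ballI allI)
  interpret P: linear "T ^^ k" for k by (rule linear_pow)
  show "0 \<in> growth_space l"
    using subspace_0[OF subspace_H] by (auto simp: growth_space_def P.zero intro!: exI[of _ 0])
  fix x y :: 'a and c :: real assume x: "x \<in> growth_space l"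
  then obtain C where C: "\<And>k. norm ((T ^^ k) x) \<le> C * l ^ k" by (auto simp: growth_space_def)
  have "norm ((T ^^ k) (c *\<^sub>R x)) \<le> (\<bar>c\<bar> * C) * l ^ k" for k
    using mult_left_mono[OF C[of k], of "\<bar>c\<bar>"] by (simp add: P.scaleR mult_ac)
  then show "c *\<^sub>R x \<in> growth_space l"
    using x subspace_mul[OF subspace_H] unfolding growth_space_def by blast
  assume y: "y \<in> growth_space l"
  then obtain C' where C': "\<And>k. norm ((T ^^ k) y) \<le> C' * l ^ k" by (auto simp: growth_space_def)
  have "norm ((T ^^ k) (x + y)) \<le> (C + C') * l ^ k" for k
    using norm_triangle_ineq[of "(T ^^ k) x" "(T ^^ k) y"] C[of k] C'[of k]
    by (simp add: P.add distrib_right)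
  then show "x + y \<in> growth_space l"
    using x y subspace_add[OF subspace_H] unfolding growth_space_def by blast
qed

lemma bounded_linear_pow: "bounded_linear (T ^^ k)"
  by (induction k) (auto intro: bounded_linear_compose[OF bounded_linear_T]
      simp: bounded_linear_ident id_def o_def)

lemma closed_growth_space: assumes l: "l \<ge> 0" shows "closed (growth_space l)"
proof -
  have "growth_space l = H \<inter> (\<Inter>k. {x. norm ((T ^^ k) x) \<le> l ^ k * norm x})"
    by (auto simp: growth_space_eq[OF l])
  moreover have "closed {x. norm ((T ^^ k) x) \<le> l ^ k * norm x}" for k
    using linear_continuous_on[OF bounded_linear_pow[of k], of UNIV]
    by (intro closed_Collect_le continuous_intros) auto
  ultimately show ?thesis using closed_H by (auto intro!: closed_Int closed_INT)
qed

lemma growth_space_mono: assumes "0 \<le> l" "l \<le> m" shows "growth_space l \<subseteq> growth_space m"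
proof -
  have "l ^ k * norm x \<le> m ^ k * norm x" for k and x :: 'a
    using assms by (intro mult_right_mono power_mono) auto
  then show ?thesis using assms by (auto simp: growth_space_eq intro: order_trans)
qed

text \<open>This is the source of right continuity of the projections: the bounds norm (T ^ k x)
  \<le> m ^ k norm x pass to the limit m -> l for each fixed k.\<close>

lemma growth_space_Inter:
  assumes l: "0 \<le> l" and x: "\<And>m. m > l \<Longrightarrow> x \<in> growth_space m"
  shows "x \<in> growth_space l"
proof -
  have xH: "x \<in> H" using x[of "l + 1"] growth_space_subset by auto
  have "norm ((T ^^ k) x) \<le> l ^ k * norm x" for k
  proof (rule tendsto_lowerbound)
    show "((\<lambda>m. m ^ k * norm x) \<longlongrightarrow> l ^ k * norm x) (at_right l)"
      by (intro tendsto_intros tendsto_ident_at)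
    show "\<forall>\<^sub>F m in at_right l. norm ((T ^^ k) x) \<le> m ^ k * norm x"
      using growth_space_pow_le[OF x] l by (auto simp: eventually_at_filter)
  qed simp
  then show ?thesis using xH l by (simp add: growth_space_eq)
qed

lemma growth_space_UNIV:
  assumes "\<And>x. norm (T x) \<le> K * norm x" "0 \<le> K" "K \<le> l"
  shows "growth_space l = H"
proof -
  have "norm ((T ^^ k) x) \<le> K ^ k * norm x" for k x
  proof (induction k)
    case (Suc k)
    have "norm ((T ^^ Suc k) x) \<le> K * norm ((T ^^ k) x)" by (simp add: assms)
    also have "\<dots> \<le> K * (K ^ k * norm x)" by (rule mult_left_mono[OF Suc \<open>0 \<le> K\<close>])
    finally show ?case by (simp add: mult_ac)
  qed simp
  then have "growth_space K = H" using assms by (auto simp: growth_space_eq)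
  then show ?thesis using growth_space_mono[OF assms(2,3)] growth_space_subset by blast
qed

text \<open>An operator commuting with T changes the norm of T ^ k x by a bounded factor only, which
  does not raise its growth rate. The case of interest is multiplication by a complex
  scalar.\<close>

lemma growth_space_commute:
  assumes L: "bounded_linear L" "\<And>x. L (T x) = T (L x)" "\<And>x. x \<in> H \<Longrightarrow> L x \<in> H" and l: "0 \<le> l"
    and x: "x \<in> growth_space l"
  shows "L x \<in> growth_space l"
proof -
  obtain B where B: "\<And>x. norm (L x) \<le> norm x * B" using bounded_linear.bounded[OF L(1)] by blast
  have B0: "B \<ge> 0" if "x \<noteq> 0"
    using order_trans[OF norm_ge_zero B[of x]] that by (simp add: zero_le_mult_iff)
  have "norm ((T ^^ k) (L x)) \<le> (B * norm x) * l ^ k" for k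
  proof (cases "x = 0")
    case True then show ?thesis
      using linear_0[OF bounded_linear.linear[OF L(1)]] linear_0[OF linear_pow] by simp
  next
    case False
    have "norm ((T ^^ k) (L x)) = norm (L ((T ^^ k) x))" by (simp add: commute_funpow[of L T, OF L(2)])
    also have "\<dots> \<le> norm ((T ^^ k) x) * B" by (rule B)
    also have "\<dots> \<le> (l ^ k * norm x) * B" using B0[OF False] by (intro mult_right_mono growth_space_pow_le x l)
    finally show ?thesis by (simp add: mult_ac)
  qed
  then show ?thesis using x L(3) by (auto simp: growth_space_def)
qed

text \<open>
  With \<open>R = T - l\<close>, the operator \<open>\<bar>R\<bar> - R\<close> has its range in the growth space of \<open>l\<close>, because
  \<open>R\<close> equals \<open>-\<bar>R\<bar>\<close> there.  So it kills the orthogonal complement, on which therefore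
  \<open>R = \<bar>R\<bar> \<ge> 0\<close>.
\<close>

lemma growth_space_orth_ge:
  assumes l: "0 \<le> l" and x: "x \<in> H" "\<And>v. v \<in> growth_space l \<Longrightarrow> x \<bullet> v = 0"
  shows "T x \<bullet> x \<ge> l * (x \<bullet> x)"
proof -
  define R where "R x = T x - l *\<^sub>R x" for x
  obtain K where K: "K > 0" "\<And>x. norm (T x) \<le> norm x * K"
    using bounded_linear.pos_bounded[OF bounded_linear_T] by blast
  define c where "c = K + l"
  have c: "c > 0" using K l by (simp add: c_def)
  have linR: "linear R" unfolding R_def
    by (intro linear_compose_sub linear_T linear_compose_scale_right linear_ident[unfolded id_def])
  interpret R: linear R by (rule linR)
  interpret T: linear T by (rule linear_T)
  have symR: "R x \<bullet> y = x \<bullet> R y" for x y by (simp add: R_def inner_diff sym)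
  have normR: "norm (R x) \<le> c * norm x" for x
    using norm_triangle_ineq4[of "T x" "l *\<^sub>R x"] K(2)[of x] l by (simp add: R_def c_def algebra_simps)
  \<comment> \<open>Chosen so that 1 - B = (R / c) ^ 2, where c bounds the norm of R; then B is a
    positive contraction and c times the square root of 1 - B is \<bar>R\<bar>, denoted P
    below.\<close>
  define B where "B x = x - (1 / c\<^sup>2) *\<^sub>R R (R x)" for x
  have linB: "linear B" unfolding B_def
    by (rule linearI) (simp_all add: R.add R.scaleR algebra_simps)
  have symB: "B x \<bullet> y = x \<bullet> B y" for x y
    by (simp add: B_def inner_diff symR)
  have Bform: "B x \<bullet> x = x \<bullet> x - (norm (R x))\<^sup>2 / c\<^sup>2" for x
    by (simp add: B_def inner_diff symR power2_norm_eq_inner)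
  have RR: "(norm (R x))\<^sup>2 \<le> c\<^sup>2 * (x \<bullet> x)" for x
    using power_mono[OF normR norm_ge_zero, of x 2] by (simp add: power_mult_distrib dot_square_norm)
  interpret B: positive_operator B
  proof (rule positive_operator.intro)
    have "norm (B x) \<le> norm x * 2" for x
    proof -
      have "norm ((1 / c\<^sup>2) *\<^sub>R R (R x)) \<le> (1 / c\<^sup>2) * (c * (c * norm x))"
        using order_trans[OF normR[of "R x"] mult_left_mono[OF normR[of x], of c]] c
        by (simp add: divide_right_mono)
      also have "\<dots> = norm x" using c by (simp add: power2_eq_square)
      finally show ?thesis using norm_triangle_ineq4[of x "(1 / c\<^sup>2) *\<^sub>R R (R x)"] by (simp add: B_def)
    qed
    then show "bounded_linear B"
      using linB by (auto simp: bounded_linear_def bounded_linear_axioms_def)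
    show "B x \<bullet> y = x \<bullet> B y" for x y by (rule symB)
    show "0 \<le> B x \<bullet> x" for x using RR[of x] c by (simp add: Bform field_simps)
  qed
  have contr: "norm (B x) \<le> norm x" for x
    using B.norm_le_on_invariant[of UNIV 1 x] by (simp add: Bform)
  note hyps = linB contr symB
  define S where "S = sqrt_one_minus B"
  define P where "P x = c *\<^sub>R S x" for x
  interpret S: linear S unfolding S_def by (rule linear_sqrt_one_minus[OF hyps])
  have SS: "S (S x) = (1 / c\<^sup>2) *\<^sub>R R (R x)" for x
  proof -
    have "x - B x = (1 / c\<^sup>2) *\<^sub>R R (R x)" by (simp add: B_def)
    then show ?thesis using sqrt_one_minus_square[OF hyps, of x] by (simp only: S_def)
  qed
  have PP: "P (P x) = R (R x)" for x using c by (simp add: P_def S.scaleR SS power2_eq_square)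
  have RT: "R (T x) = T (R x)" for x by (simp add: R_def T.diff T.scaleR)
  have blR: "bounded_linear R" unfolding R_def
    by (intro bounded_linear_sub bounded_linear_T bounded_linear_scaleR_right)
  have BT: "T (B x) = B (T x)" for x by (simp add: B_def T.diff T.scaleR RT)
  have BR: "R (B x) = B (R x)" for x by (simp add: B_def R.diff R.scaleR)
  have PT: "T (P x) = P (T x)" for x
    using sqrt_one_minus_bounded_linear_commute[OF hyps bounded_linear_T BT, of x]
    by (simp add: P_def S_def T.scaleR)
  have PR: "R (P x) = P (R x)" for x
    using sqrt_one_minus_bounded_linear_commute[OF hyps blR BR, of x]
    by (simp add: P_def S_def R.scaleR)
  have RH: "R x \<in> H" if "x \<in> H" for x
    using that T_H subspace_H unfolding R_def by (intro subspace_diff subspace_mul) auto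
  have BH: "B x \<in> H" if "x \<in> H" for x
    using that RH subspace_H unfolding B_def by (intro subspace_diff subspace_mul) auto
  define D where "D x = P x - R x" for x
  have DT: "T (D x) = D (T x)" for x by (simp add: D_def T.diff PT RT)
  have DH: "D x \<in> H" if "x \<in> H" for x
    using that T_H subspace_H sqrt_one_minus_mem[OF hyps subspace_H closed_H BH that]
    unfolding D_def P_def R_def S_def by (intro subspace_diff subspace_mul) auto
  have Pnn: "0 \<le> P x \<bullet> x" for x
    using sqrt_one_minus_nonneg[OF hyps, of x] c by (simp add: P_def S_def)
  have symD: "D x \<bullet> y = x \<bullet> D y" for x y
    using sqrt_one_minus_sym[OF hyps, of x y] by (simp add: D_def P_def S_def inner_diff symR)
  \<comment> \<open>R (P - R) = P R - P ^ 2 = - P (P - R), because P and R commute and have the same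
    square.\<close>
  have RD: "R (D x) = - P (D x)" for x
  proof -
    have "R (D x) + P (D x) = 0"
      by (simp add: D_def R.diff PR P_def S.diff scaleR_diff_right) (simp add: PP[unfolded P_def] PR[unfolded P_def])
    then show ?thesis by (simp add: eq_neg_iff_add_eq_0)
  qed
  have form: "T (D x) \<bullet> D x \<le> l * (D x \<bullet> D x)" for x
  proof -
    have "T (D x) \<bullet> D x - l * (D x \<bullet> D x) = R (D x) \<bullet> D x" by (simp add: R_def inner_diff)
    also have "\<dots> \<le> 0" using Pnn[of "D x"] by (simp add: RD)
    finally show ?thesis by simp
  qed
  have DV: "D y \<in> growth_space l" if y: "y \<in> H" for y
  proof -
    have "norm ((T ^^ k) (D y)) \<le> l ^ k * norm (D y)" for k
      by (rule norm_pow_le_on_invariant[of "range D"]) (use form l DT in auto)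
    then show ?thesis using DH[OF y] l by (simp add: growth_space_eq)
  qed
  have "D x \<bullet> D x = x \<bullet> D (D x)" by (rule symD)
  also have "\<dots> = 0" using DV[OF DH[OF x(1)]] x(2) by simp
  finally have "R x = P x" by (simp add: D_def)
  then have "0 \<le> R x \<bullet> x" using Pnn by simp
  then show ?thesis by (simp add: R_def inner_diff)
qed

end

section \<open>Riemann-Stieltjes sums\<close>

text \<open>Since F vanishes on the negative axis, \<open>F 0\<close> is the mass of the atom at 0;
  in the applications it is the part of the mass that comes from the kernel of an operator.\<close>

locale distribution_function =
  fixes F :: "real \<Rightarrow> real" and K c :: real
  assumes F_mono: "\<And>x y. x \<le> y \<Longrightarrow> F x \<le> F y"
    and F_right_cont: "\<And>a. continuous (at_right a) F"
    and F_neg: "\<And>t. t < 0 \<Longrightarrow> F t = 0"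
    and F_top: "\<And>t. K \<le> t \<Longrightarrow> F t = c"
    and K_pos: "0 < K"
begin

abbreviation "M \<equiv> interval_measure F"

lemma F_nonneg: "0 \<le> F t"
  using F_neg[of "min t (-1)"] F_mono[of "min t (-1)" t] by simp

lemma emeasure_Ioc: "a \<le> b \<Longrightarrow> emeasure M {a<..b} = ennreal (F b - F a)"
  by (rule emeasure_interval_measure_Ioc) (use F_mono F_right_cont in auto)

lemma AE_in_Icc: "AE t in M. 0 \<le> t \<and> t \<le> K"
proof -
  \<comment> \<open>Null intervals that exhaust the negative axis must end strictly below 0, because
    there may be an atom at 0.\<close>
  have n1: "{- real (Suc n) <.. - (1 / real (Suc n))} \<in> null_sets M" for n
    by (auto simp: null_sets_def emeasure_Ioc F_neg field_simps)
  have n2: "{K <.. K + real n} \<in> null_sets M" for n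
    by (auto simp: null_sets_def emeasure_Ioc F_top)
  have null: "(\<Union>n. {- real (Suc n) <.. - (1 / real (Suc n))}) \<union> (\<Union>n. {K <.. K + real n}) \<in> null_sets M"
    by (intro null_sets.Un null_sets_UN n1 n2)
  show ?thesis
  proof (rule AE_I'[OF null], rule subsetI)
    fix t assume "t \<in> {t \<in> space M. \<not> (0 \<le> t \<and> t \<le> K)}"
    then consider "t < 0" | "K < t" by auto
    then show "t \<in> (\<Union>n. {- real (Suc n) <.. - (1 / real (Suc n))}) \<union> (\<Union>n. {K <.. K + real n})"
    proof cases
      case 1
      obtain n where n: "max (- t) (1 / (- t)) < real n" using reals_Archimedean2 by blast
      then have "1 / (- t) < real n" by simp
      then have "1 < real n * (- t)" using 1 by (subst (asm) pos_divide_less_eq) auto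
      then have "1 < real (Suc n) * (- t)" using 1 by (simp add: algebra_simps)
      then have "t \<le> - (1 / real (Suc n))" using 1 by (simp add: field_simps)
      moreover have "- real (Suc n) < t" using n by simp
      ultimately have "t \<in> {- real (Suc n) <.. - (1 / real (Suc n))}"
        by (simp only: greaterThanAtMost_iff)
      then show ?thesis by (intro UnI1 UN_I[of n]) auto
    next
      case 2
      obtain n where "t - K < real n" using reals_Archimedean2 by blast
      then show ?thesis using 2 by (intro UnI2 UN_I[of n]) auto
    qed
  qed
qed

lemma emeasure_M: "S \<in> sets borel \<Longrightarrow> {-1<..K} \<subseteq> S \<Longrightarrow> emeasure M S = ennreal c"
proof -
  assume S: "S \<in> sets borel" "{-1<..K} \<subseteq> S"
  have "emeasure M S = emeasure M {-1<..K}"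
  proof (rule emeasure_eq_AE)
    show "AE t in M. t \<in> S \<longleftrightarrow> t \<in> {-1<..K}" using AE_in_Icc by eventually_elim (use S in auto)
  qed (use S in auto)
  also have "\<dots> = ennreal c" using K_pos by (simp add: emeasure_Ioc F_neg F_top)
  finally show ?thesis .
qed

lemma finite_M: "finite_measure M"
  by (rule finite_measureI) (simp add: emeasure_M)

sublocale finite_measure M by (rule finite_M)

lemma measure_Ioc: "a \<le> b \<Longrightarrow> measure M {a<..b} = F b - F a"
  using F_mono by (simp add: measure_def emeasure_Ioc)

lemma measure_atMost: "0 \<le> l \<Longrightarrow> measure M {..l} = F l"
proof -
  assume l: "0 \<le> l"
  have "measure M {..l} = measure M {-1<..l}"
    by (rule measure_eq_AE) (use AE_in_Icc in auto)
  then show ?thesis using l by (simp add: measure_Ioc F_neg)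
qed

lemma measure_M: "measure M UNIV = c"
  using emeasure_M[of UNIV] F_nonneg[of K] F_top[of K] by (simp add: measure_def)

text \<open>Riemann-Stieltjes sums over the partition of the interval from 0 to K into N equal
  parts, with tags \<open>s N j\<close>. The half-open cells miss the point 0, whose mass enters
  through the separate first term.\<close>

definition rs_sum :: "(nat \<Rightarrow> nat \<Rightarrow> real) \<Rightarrow> (real \<Rightarrow> real) \<Rightarrow> nat \<Rightarrow> real" where
  "rs_sum s g N = g 0 * F 0
     + (\<Sum>j<N. g (s N j) * (F (real (Suc j) * K / real N) - F (real j * K / real N)))"

text \<open>The sum is the integral of the step function \<open>G N\<close>. Almost everywhere
  \<open>G N t\<close> is the value of g at a point within K / N of t, so continuity gives pointwise
  convergence, and boundedness of g on the interval gives domination.\<close>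

lemma rs_sum_tendsto:
  assumes s: "\<And>N j. j < N \<Longrightarrow> real j * K / real N \<le> s N j \<and> s N j \<le> real (Suc j) * K / real N"
    and g: "continuous_on UNIV g"
  shows "rs_sum s g \<longlonglongrightarrow> (LINT t|M. g t)"
proof -
  define G where "G N t = g 0 * indicator {-1<..0} t
    + (\<Sum>j<N. g (s N j) * indicator {real j * K / real N<..real (Suc j) * K / real N} t)" for N and t :: real
  have le: "real j * K / real N \<le> real (Suc j) * K / real N" for j N
    using K_pos by (intro divide_right_mono mult_right_mono) auto
  have intG: "(LINT t|M. G N t) = rs_sum s g N" for N
  proof -
    have i: "integrable M (\<lambda>t. (a::real) * indicator {u<..v} t)" for a u v
      by (intro integrable_mult_right integrable_real_indicator) (auto simp: less_top[symmetric])
    let ?I = "\<lambda>j. {real j * K / real N<..real (Suc j) * K / real N}"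
    have "(LINT t|M. G N t) = (LINT t|M. g 0 * indicator {-1<..0} t)
        + (LINT t|M. (\<Sum>j<N. g (s N j) * indicator (?I j) t))"
      unfolding G_def by (rule Bochner_Integration.integral_add[OF i Bochner_Integration.integrable_sum[OF i]])
    also have "(LINT t|M. (\<Sum>j<N. g (s N j) * indicator (?I j) t))
        = (\<Sum>j<N. LINT t|M. g (s N j) * indicator (?I j) t)"
      by (rule Bochner_Integration.integral_sum[OF i])
    also have "\<dots> = (\<Sum>j<N. g (s N j) * (F (real (Suc j) * K / real N) - F (real j * K / real N)))"
      by (rule sum.cong) (simp_all add: measure_Ioc[OF le] del: of_nat_Suc)
    also have "(LINT t|M. g 0 * indicator {-1<..0} t) = g 0 * F 0"
      by (simp add: measure_Ioc F_neg)
    finally show ?thesis by (simp only: rs_sum_def)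
  qed
  obtain B where B: "\<And>t. 0 \<le> t \<Longrightarrow> t \<le> K \<Longrightarrow> \<bar>g t\<bar> \<le> B"
  proof -
    have "compact (g ` {0..K})"
      by (rule compact_continuous_image[OF continuous_on_subset[OF g]]) auto
    then have "bounded (g ` {0..K})" by (rule compact_imp_bounded)
    then obtain B where "\<forall>x\<in>g ` {0..K}. norm x \<le> B" by (auto simp: bounded_iff)
    then show thesis using that[of B] by auto
  qed
  have val: "\<exists>u. 0 \<le> u \<and> u \<le> K \<and> \<bar>u - t\<bar> \<le> K / real N \<and> G N t = g u"
    if t: "0 \<le> t" "t \<le> K" and N: "N > 0" for t N
  proof (cases "t = 0")
    case True
    have "G N t = g 0" unfolding G_def True
      using K_pos by (simp add: indicator_def sum.neutral divide_less_0_iff mult_less_0_iff not_less)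
    then show ?thesis using True K_pos by (intro exI[of _ 0]) auto
  next
    case False
    \<comment> \<open>The index of the cell that contains t; cells are closed on the right, so it is
      the ceiling minus 1.\<close>
    define i where "i = nat (\<lceil>t * real N / K\<rceil>) - 1"
    have pos: "t * real N / K > 0" using False t N K_pos by simp
    have ceil: "real (Suc i) = of_int \<lceil>t * real N / K\<rceil>" using pos by (simp add: i_def)
    have i1: "real i * K / real N < t"
    proof -
      have "real i < t * real N / K" using ceil ceiling_correct[of "t * real N / K"] by simp
      then show ?thesis using K_pos N by (simp add: field_simps)
    qed
    have i2: "t \<le> real (Suc i) * K / real N"
    proof -
      have "t * real N / K \<le> real (Suc i)" using ceil ceiling_correct[of "t * real N / K"] by simp
      then show ?thesis using K_pos N by (simp add: field_simps)
    qed
    have iN: "i < N"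
    proof -
      have "real i * K / real N < K" using i1 t(2) by linarith
      then have "real i * K < real N * K" using N by (simp add: pos_divide_less_eq mult.commute)
      then show ?thesis using K_pos by simp
    qed
    have ind: "indicator {real j * K / real N<..real (Suc j) * K / real N} t = (if j = i then 1 else (0::real))" for j
    proof (cases "j = i")
      case False
      then consider "Suc j \<le> i" | "Suc i \<le> j" by linarith
      then show ?thesis
      proof cases
        case 1
        have "real (Suc j) * K / real N \<le> real i * K / real N" using 1 K_pos
          by (intro divide_right_mono mult_right_mono) auto
        then show ?thesis using i1 False by (simp add: indicator_def)
      next
        case 2
        have "real (Suc i) * K / real N \<le> real j * K / real N" using 2 K_pos
          by (intro divide_right_mono mult_right_mono) auto
        then show ?thesis using i2 False by (simp add: indicator_def)
      qed
    qed (use i1 i2 in simp)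
    have "(\<Sum>j<N. g (s N j) * indicator {real j * K / real N<..real (Suc j) * K / real N} t)
        = (\<Sum>j<N. if j = i then g (s N j) else 0)"
      by (rule sum.cong) (simp_all only: ind mult_1_right mult_zero_right split: if_split, simp)
    also have "\<dots> = g (s N i)" using iN by simp
    finally have G: "G N t = g (s N i)" using False t by (simp add: G_def indicator_def del: of_nat_Suc)
    have e: "real N * K / real N = K" using N by simp
    have "real (Suc i) * K / real N \<le> real N * K / real N"
      using iN K_pos by (intro divide_right_mono mult_right_mono) auto
    moreover have "real (Suc i) * K / real N = real i * K / real N + K / real N"
      by (simp add: field_simps add_divide_distrib)
    moreover have "real i * K / real N \<ge> 0" using K_pos by simp
    ultimately have "0 \<le> s N i" "s N i \<le> K" "\<bar>s N i - t\<bar> \<le> K / real N"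
      using s[OF iN] i1 i2 e by linarith+
    with G show ?thesis by blast
  qed
  have "(\<lambda>N. LINT t|M. G (Suc N) t) \<longlonglongrightarrow> (LINT t|M. g t)"
  proof (rule integral_dominated_convergence)
    show "g \<in> borel_measurable M"
      using borel_measurable_continuous_onI[OF g] by simp
    show "(\<lambda>t. G (Suc i) t) \<in> borel_measurable M" for i unfolding G_def by measurable
    show "integrable M (\<lambda>t. B)" by simp
    show "AE t in M. (\<lambda>N. G (Suc N) t) \<longlonglongrightarrow> g t"
    proof (rule AE_mp[OF AE_in_Icc], rule AE_I2, rule impI)
      fix t assume t: "0 \<le> t \<and> t \<le> K"
      then have "\<forall>N. \<exists>u. 0 \<le> u \<and> u \<le> K \<and> \<bar>u - t\<bar> \<le> K / real (Suc N) \<and> G (Suc N) t = g u"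
        using val[of t "Suc N" for N] by blast
      then obtain u where u: "\<And>N. \<bar>u N - t\<bar> \<le> K / real (Suc N)" "\<And>N. G (Suc N) t = g (u N)"
        by metis
      have "u \<longlonglongrightarrow> t"
      proof (rule LIM_zero_cancel, rule Lim_null_comparison)
        show "\<forall>\<^sub>F N in sequentially. norm (u N - t) \<le> K / real (Suc N)" using u(1) by simp
        show "(\<lambda>N. K / real (Suc N)) \<longlonglongrightarrow> 0"
          using LIMSEQ_Suc[OF lim_const_over_n[of K]] by simp
      qed
      then have "(\<lambda>N. g (u N)) \<longlonglongrightarrow> g t"
        using g by (simp add: continuous_on_eq_continuous_at isCont_tendsto_compose)
      then show "(\<lambda>N. G (Suc N) t) \<longlonglongrightarrow> g t" by (simp add: u(2))
    qed
    show "AE t in M. norm (G (Suc i) t) \<le> B" for i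
    proof (rule AE_mp[OF AE_in_Icc], rule AE_I2, rule impI)
      fix t assume t: "0 \<le> t \<and> t \<le> K"
      then obtain u where "0 \<le> u" "u \<le> K" "G (Suc i) t = g u" using val[of t "Suc i"] by blast
      then show "norm (G (Suc i) t) \<le> B" using B by simp
    qed
  qed
  then have "(\<lambda>N. rs_sum s g (Suc N)) \<longlonglongrightarrow> (LINT t|M. g t)" by (simp add: intG)
  then show ?thesis by (rule LIMSEQ_imp_Suc)
qed

lemma integral_le_of_const:
  assumes l: "0 \<le> l" and Fl: "\<And>t. l \<le> t \<Longrightarrow> F t = c"
  shows "(LINT t|M. t) \<le> l * c"
proof -
  have "AE t in M. t \<le> l"
  proof -
    have n2: "{l <.. l + real n} \<in> null_sets M" for n
      by (auto simp: null_sets_def emeasure_Ioc Fl)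
    have null: "(\<Union>n. {l <.. l + real n}) \<in> null_sets M" by (rule null_sets_UN[OF n2])
    show ?thesis
    proof (rule AE_I'[OF null], rule subsetI)
      fix t assume "t \<in> {t \<in> space M. \<not> t \<le> l}"
      moreover obtain n where "t - l < real n" using reals_Archimedean2 by blast
      ultimately have "t \<in> {l <.. l + real n}" by simp
      then show "t \<in> (\<Union>n. {l <.. l + real n})" by blast
    qed
  qed
  then have ae: "AE t in M. norm t \<le> l" using AE_in_Icc by eventually_elim auto
  have "integrable M (\<lambda>t. t)"
    by (rule Bochner_Integration.integrable_bound[of M "\<lambda>_. l"]) (use ae l in auto)
  then have "(LINT t|M. t) \<le> (LINT t|M. l)"
    by (rule integral_mono_AE) (use ae in auto)
  then show ?thesis by (simp add: measure_M mult.commute)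
qed

lemma integrable_continuous:
  assumes g: "continuous_on UNIV (g :: real \<Rightarrow> real)"
  shows "integrable M g"
proof -
  have "compact (g ` {0..K})"
    by (rule compact_continuous_image[OF continuous_on_subset[OF g]]) auto
  then have "bounded (g ` {0..K})" by (rule compact_imp_bounded)
  then obtain B where B: "\<forall>x\<in>g ` {0..K}. norm x \<le> B" by (auto simp: bounded_iff)
  show ?thesis
  proof (rule Bochner_Integration.integrable_bound[of M "\<lambda>_. B"])
    show "AE t in M. norm (g t) \<le> norm B" using AE_in_Icc by eventually_elim (use B in force)
  qed (use borel_measurable_continuous_onI[OF g] in auto)
qed

lemma integral_ge_of_zero:
  assumes l: "0 \<le> l" and Fl: "\<And>t. t \<le> l \<Longrightarrow> F t = 0"
  shows "(LINT t|M. t) \<ge> l * c"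
proof -
  have null: "{-1<..l} \<in> null_sets M"
    using l by (auto simp: null_sets_def emeasure_Ioc Fl)
  have "AE t in M. t \<notin> {-1<..l}" by (rule AE_not_in[OF null])
  then have "AE t in M. l \<le> t" using AE_in_Icc by eventually_elim auto
  then have "(LINT t|M. l) \<le> (LINT t|M. t)"
    by (intro integral_mono_AE integrable_continuous) auto
  then show ?thesis by (simp add: measure_M mult.commute)
qed

end

section \<open>Resolutions of the identity\<close>

text \<open>Everything is demanded on the subspace H only. This allows families of functions on
  \<open>ell2 I\<close>, transported to a larger Hilbert space, to be compared with the projections
  onto growth spaces.\<close>

locale resolution =
  fixes H :: "'a::{real_inner,banach} set" and E :: "real \<Rightarrow> 'a \<Rightarrow> 'a"
  assumes subspace_H: "subspace H"
    and E_H: "x \<in> H \<Longrightarrow> E l x \<in> H"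
    and E_add: "x \<in> H \<Longrightarrow> y \<in> H \<Longrightarrow> E l (x + y) = E l x + E l y"
    and E_scaleR: "x \<in> H \<Longrightarrow> E l (c *\<^sub>R x) = c *\<^sub>R E l x"
    and E_idem: "x \<in> H \<Longrightarrow> E l (E l x) = E l x"
    and E_sym: "x \<in> H \<Longrightarrow> y \<in> H \<Longrightarrow> E l x \<bullet> y = x \<bullet> E l y"
    and E_mono: "l \<le> m \<Longrightarrow> x \<in> H \<Longrightarrow> E m (E l x) = E l x"
    and E_right: "x \<in> H \<Longrightarrow> ((\<lambda>m. norm (E m x - E l x)) \<longlongrightarrow> 0) (at_right l)"
    and E_neg: "l < 0 \<Longrightarrow> x \<in> H \<Longrightarrow> E l x = 0"
    and E_top: "\<exists>K. \<forall>l\<ge>K. \<forall>x\<in>H. E l x = x"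
begin

lemma E_0: "E l 0 = 0"
  using E_scaleR[of 0 l 0] subspace_0[OF subspace_H] by simp

lemma E_diff: "x \<in> H \<Longrightarrow> y \<in> H \<Longrightarrow> E l (x - y) = E l x - E l y"
  using E_add[of x "(-1) *\<^sub>R y" l] E_scaleR[of y l "-1"] subspace_mul[OF subspace_H, of y "-1"] by simp

lemma eq_if_inner_eq:
  assumes "x \<in> H" "y \<in> H" "\<And>z. z \<in> H \<Longrightarrow> x \<bullet> z = y \<bullet> z"
  shows "x = y"
proof -
  have "x - y \<in> H" using assms by (intro subspace_diff subspace_H)
  then have "(x - y) \<bullet> (x - y) = 0" using assms(3) by (simp add: inner_diff_left)
  then show ?thesis by simp
qed

lemma E_mono': "l \<le> m \<Longrightarrow> x \<in> H \<Longrightarrow> E l (E m x) = E l x"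
  by (rule eq_if_inner_eq) (simp_all add: E_H E_sym E_mono)

lemma form_eq: "x \<in> H \<Longrightarrow> E l x \<bullet> x = (norm (E l x))\<^sup>2"
  using E_sym[of "E l x" x l] by (simp add: E_H E_idem power2_norm_eq_inner)

lemma form_diff:
  "l \<le> m \<Longrightarrow> x \<in> H \<Longrightarrow> E m x \<bullet> x - E l x \<bullet> x = (norm (E m x - E l x))\<^sup>2"
proof -
  assume lm: "l \<le> m" and x: "x \<in> H"
  have "E m x \<bullet> E l x = E l x \<bullet> x"
    using E_sym[of "E l x" x m] lm x by (simp add: E_H E_mono inner_commute)
  then show ?thesis
    using form_eq[OF x, of l] form_eq[OF x, of m]
    by (simp add: power2_norm_eq_inner inner_diff inner_commute)
qed

lemma distribution_function_form:
  assumes x: "x \<in> H" and K: "0 < K" "\<And>l. K \<le> l \<Longrightarrow> E l x = x"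
  shows "distribution_function (\<lambda>t. E t x \<bullet> x) K (x \<bullet> x)"
proof
  show "E s x \<bullet> x \<le> E t x \<bullet> x" if "s \<le> t" for s t
    using form_diff[OF that x] zero_le_power2[of "norm (E t x - E s x)"] by linarith
  show "continuous (at_right a) (\<lambda>t. E t x \<bullet> x)" for a
    unfolding continuous_within
  proof (rule tendsto_inner[OF _ tendsto_const])
    show "((\<lambda>t. E t x) \<longlongrightarrow> E a x) (at_right a)"
      using tendsto_norm_zero_cancel[OF E_right[OF x]] by (simp add: LIM_zero_iff)
  qed
qed (use assms E_neg in auto)

lemma E_top_pos: "\<exists>K>0. \<forall>l x. K \<le> l \<longrightarrow> x \<in> H \<longrightarrow> E l x = x"
proof -
  obtain K where "\<forall>l\<ge>K. \<forall>x\<in>H. E l x = x" using E_top by blast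
  then show ?thesis by (intro exI[of _ "max K 1"]) auto
qed

end

text \<open>That E belongs to T is expressed by commutation and by form bounds on ranges and kernels
  rather than by an integral. \<open>moments\<close> recovers the integral formulas from this, and
  \<open>bounded_resolutionI\<close> derives it from the formula for k = 1.\<close>

locale bounded_resolution = resolution H E + positive_operator T
  for H :: "'a::{real_inner,banach} set" and E T +
  assumes T_H: "x \<in> H \<Longrightarrow> T x \<in> H"
    and T_E: "x \<in> H \<Longrightarrow> T (E l x) = E l (T x)"
    and T_le: "0 \<le> l \<Longrightarrow> x \<in> H \<Longrightarrow> E l x = x \<Longrightarrow> T x \<bullet> x \<le> l * (x \<bullet> x)"
    and T_ge: "0 \<le> l \<Longrightarrow> x \<in> H \<Longrightarrow> E l x = 0 \<Longrightarrow> l * (x \<bullet> x) \<le> T x \<bullet> x"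
begin

lemma pow_H: "x \<in> H \<Longrightarrow> (T ^^ k) x \<in> H"
  by (rule invariant_funpow[OF T_H])

lemma pow_E: "x \<in> H \<Longrightarrow> (T ^^ k) (E l x) = E l ((T ^^ k) x)"
  by (induction k) (simp_all add: T_E pow_H)

lemma pow_diff: "(T ^^ k) (x - y) = (T ^^ k) x - (T ^^ k) y"
  by (rule linear_diff[OF linear_pow])

text \<open>On the range of E 0 the form of T is squeezed between 0 and 0. The factor 0 ^ k is 1 for
  k = 0, so the atom at 0 contributes its mass to the zeroth moment and nothing to the
  others.\<close>

lemma moment_0: "x \<in> H \<Longrightarrow> (T ^^ k) (E 0 x) \<bullet> x = 0 ^ k * (E 0 x \<bullet> x)"
proof -
  assume x: "x \<in> H"
  define u where "u = E 0 x"
  have u: "u \<in> H" "E 0 u = u" using x by (simp_all add: u_def E_H E_idem)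
  have "0 ^ k * (u \<bullet> u) \<le> (T ^^ k) u \<bullet> u \<and> (T ^^ k) u \<bullet> u \<le> 0 ^ k * (u \<bullet> u)"
    by (rule pow_form_bounds[of "{w \<in> H. E 0 w = w}"])
       (use u T_H T_E[symmetric] T_le[of 0] nonneg in auto)
  moreover have "(T ^^ k) u \<bullet> u = (T ^^ k) u \<bullet> x"
    using E_sym[of "(T ^^ k) u" x 0] u x by (simp add: u_def[symmetric] pow_H pow_E[symmetric])
  ultimately show ?thesis
    using form_eq[OF x, of 0] by (simp add: u_def power2_norm_eq_inner)
qed

text \<open>w = E m x - E l x lies in the range of E m and the kernel of E l, where the form of T
  has bounds l and m; \<open>pow_form_bounds\<close> raises these to the k-th power.\<close>

lemma moment_increment:
  fixes k :: nat
  assumes x: "x \<in> H" and lm: "0 \<le> l" "l \<le> m"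
  defines "d \<equiv> (T ^^ k) (E m x) \<bullet> x - (T ^^ k) (E l x) \<bullet> x"
  shows "l ^ k * (E m x \<bullet> x - E l x \<bullet> x) \<le> d \<and> d \<le> m ^ k * (E m x \<bullet> x - E l x \<bullet> x)"
proof -
  define w where "w = E m x - E l x"
  have w: "w \<in> H" "E m w = w" "E l w = 0"
    using x lm by (simp_all add: w_def E_H E_idem E_diff E_mono E_mono' subspace_diff[OF subspace_H])
  have "l ^ k * (w \<bullet> w) \<le> (T ^^ k) w \<bullet> w \<and> (T ^^ k) w \<bullet> w \<le> m ^ k * (w \<bullet> w)"
    by (rule pow_form_bounds[of "{w \<in> H. E m w = w \<and> E l w = 0}"])
       (use w lm T_H T_E[symmetric] T_le[of m] T_ge[of l] linear_0[OF linear_T] in auto)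
  moreover have "(T ^^ k) w \<bullet> w = d"
  proof -
    have "(T ^^ k) w \<bullet> w = E m ((T ^^ k) w) \<bullet> x - E l ((T ^^ k) w) \<bullet> x"
      using E_sym[of "(T ^^ k) w" x m] E_sym[of "(T ^^ k) w" x l] w x
      by (simp add: pow_H w_def[symmetric] inner_diff_right[symmetric])
    also have "\<dots> = (T ^^ k) w \<bullet> x"
      using w by (simp add: pow_E[symmetric] linear_0[OF linear_pow])
    finally show ?thesis by (simp add: d_def w_def pow_diff inner_diff_left)
  qed
  moreover have "w \<bullet> w = E m x \<bullet> x - E l x \<bullet> x"
    using form_diff[OF lm(2) x] by (simp add: w_def power2_norm_eq_inner)
  ultimately show ?thesis by simp
qed

text \<open>T ^ k x . x telescopes over the partition, and each increment lies between the terms of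
  the sums with left and right tags; both sums converge to the integral.\<close>

theorem moments:
  assumes x: "x \<in> H"
  shows "(T ^^ k) x \<bullet> x = (LINT t|interval_measure (\<lambda>t. E t x \<bullet> x). t ^ k)"
proof -
  obtain K where K: "0 < K" "\<And>l x. K \<le> l \<Longrightarrow> x \<in> H \<Longrightarrow> E l x = x" using E_top_pos by blast
  interpret D: distribution_function "\<lambda>t. E t x \<bullet> x" K "x \<bullet> x"
    by (rule distribution_function_form) (use x K in auto)
  define sL where "sL N j = real j * K / real N" for N j :: nat
  define sR where "sR N j = real (Suc j) * K / real N" for N j :: nat
  have mono: "real j * K / real N \<le> real (Suc j) * K / real N" for j N
    using K by (intro divide_right_mono mult_right_mono) auto
  have nn: "0 \<le> real j * K / real N" for j N using K by simp
  have c: "continuous_on UNIV (\<lambda>t::real. t ^ k)" by (intro continuous_intros)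
  have limL: "D.rs_sum sL (\<lambda>t. t ^ k) \<longlonglongrightarrow> (LINT t|D.M. t ^ k)"
    by (rule D.rs_sum_tendsto[OF _ c]) (use mono in \<open>auto simp: sL_def\<close>)
  have limR: "D.rs_sum sR (\<lambda>t. t ^ k) \<longlonglongrightarrow> (LINT t|D.M. t ^ k)"
    by (rule D.rs_sum_tendsto[OF _ c]) (use mono in \<open>auto simp: sR_def\<close>)
  define G where "G t = (T ^^ k) (E t x) \<bullet> x" for t
  have Q: "(T ^^ k) x \<bullet> x = 0 ^ k * (E 0 x \<bullet> x)
      + (\<Sum>j<N. G (real (Suc j) * K / real N) - G (real j * K / real N))" if "N > 0" for N
  proof -
    have "(\<Sum>j<N. G (real (Suc j) * K / real N) - G (real j * K / real N)) = G K - G 0"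
      using sum_lessThan_telescope[of "\<lambda>j. G (real j * K / real N)" N] that by simp
    then show ?thesis using moment_0[OF x] K(2)[OF order_refl x] by (simp add: G_def)
  qed
  have inc: "(sL N j) ^ k * (E (real (Suc j) * K / real N) x \<bullet> x - E (real j * K / real N) x \<bullet> x)
         \<le> G (real (Suc j) * K / real N) - G (real j * K / real N)"
       "G (real (Suc j) * K / real N) - G (real j * K / real N)
         \<le> (sR N j) ^ k * (E (real (Suc j) * K / real N) x \<bullet> x - E (real j * K / real N) x \<bullet> x)" for N j
    using moment_increment[OF x nn[of j N] mono[of j N], of k] by (auto simp: sL_def sR_def G_def)
  have "D.rs_sum sL (\<lambda>t. t ^ k) N \<le> (T ^^ k) x \<bullet> x" if "N > 0" for N
    unfolding Q[OF that] D.rs_sum_def by (intro add_left_mono sum_mono inc)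
  then have "(LINT t|D.M. t ^ k) \<le> (T ^^ k) x \<bullet> x"
    by (intro LIMSEQ_le_const2[OF limL]) (auto intro!: exI[of _ 1])
  moreover have "(T ^^ k) x \<bullet> x \<le> D.rs_sum sR (\<lambda>t. t ^ k) N" if "N > 0" for N
    unfolding Q[OF that] D.rs_sum_def by (intro add_left_mono sum_mono inc)
  then have "(T ^^ k) x \<bullet> x \<le> (LINT t|D.M. t ^ k)"
    by (intro LIMSEQ_le_const[OF limR]) (auto intro!: exI[of _ 1])
  ultimately show ?thesis by simp
qed

end

text \<open>
  If \<open>x\<close> lies in the range of \<open>E l\<close> and \<open>y = x - E' m x\<close> with \<open>l < m\<close>, then
  \<open>m ^ k * norm y \<le> norm (T ^ k y) \<le> l ^ k * norm x\<close> for all \<open>k\<close>, so \<open>y = 0\<close>.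
\<close>

lemma bounded_resolution_range_subset:
  assumes E: "bounded_resolution H E T" and E': "bounded_resolution H E' T"
    and lm: "0 \<le> l" "l < m" and x: "x \<in> H" "E l x = x"
  shows "E' m x = x"
proof -
  interpret E: bounded_resolution H E T by fact
  interpret E': bounded_resolution H E' T by fact
  define y where "y = x - E' m x"
  have y: "y \<in> H" "E' m y = 0"
    using x by (simp_all add: y_def E'.E_H E'.E_diff E'.E_idem subspace_diff[OF E.subspace_H])
  have "m ^ k * norm y \<le> l ^ k * norm x" for k
  proof -
    have "m ^ k * norm y \<le> norm ((T ^^ k) y)"
      by (rule E.norm_pow_ge_on_invariant[of "{w \<in> H. E' m w = 0}"])
         (use y lm E.T_H E'.T_E[symmetric] E'.T_ge[of m] linear_0[OF E.linear_T] in auto)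
    \<comment> \<open>T ^ k y is the component of T ^ k x in the kernel of E' m, since T ^ k
      commutes with E' m; an orthogonal component is not longer than the whole vector.\<close>
    also have "(norm ((T ^^ k) y))\<^sup>2 \<le> (norm ((T ^^ k) x))\<^sup>2"
    proof -
      define v where "v = (T ^^ k) x"
      have v: "v \<in> H" using x E.pow_H by (simp add: v_def)
      have "(T ^^ k) y = v - E' m v" using x by (simp add: y_def v_def E.pow_diff E'.pow_E)
      then have "(norm ((T ^^ k) y))\<^sup>2 = (norm v)\<^sup>2 - (norm (E' m v))\<^sup>2"
        using E'.form_eq[OF v, of m] by (simp add: power2_norm_eq_inner inner_diff inner_commute)
      then show ?thesis by (simp add: v_def)
    qed
    then have "norm ((T ^^ k) y) \<le> norm ((T ^^ k) x)" by (rule power2_le_imp_le) simp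
    also have "norm ((T ^^ k) x) \<le> l ^ k * norm x"
      by (rule E.norm_pow_le_on_invariant[of "{w \<in> H. E l w = w}"])
         (use x lm E.T_H E.T_E[symmetric] E.T_le[of l] in auto)
    finally show ?thesis .
  qed
  then have "norm y \<le> (l / m) ^ k * norm x" for k
    using lm by (simp add: field_simps power_divide)
  moreover have "(\<lambda>k. (l / m) ^ k * norm x) \<longlonglongrightarrow> 0 * norm x"
    using lm by (intro tendsto_intros LIMSEQ_realpow_zero) auto
  ultimately have "norm y \<le> 0 * norm x" by (intro LIMSEQ_le_const) auto
  then show ?thesis by (simp add: y_def)
qed

text \<open>The previous lemma puts the range of E l into that of E' m for m > l; right continuity
  of E' brings m down to l.\<close>

lemma bounded_resolution_le:
  assumes E: "bounded_resolution H E T" and E': "bounded_resolution H E' T" and x: "x \<in> H"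
  shows "E' l (E l x) = E l x"
proof -
  interpret E: bounded_resolution H E T by fact
  interpret E': bounded_resolution H E' T by fact
  show ?thesis
  proof (cases "l < 0")
    case True then show ?thesis using x by (simp add: E.E_neg E'.E_0)
  next
    case False
    define u where "u = E l x"
    have u: "u \<in> H" "E l u = u" using x by (simp_all add: u_def E.E_H E.E_idem)
    have "((\<lambda>m. norm (E' m u - E' l u)) \<longlongrightarrow> norm (u - E' l u)) (at_right l)"
    proof (rule tendsto_eventually)
      show "\<forall>\<^sub>F m in at_right l. norm (E' m u - E' l u) = norm (u - E' l u)"
        using bounded_resolution_range_subset[OF E E' _ _ u] False
        by (auto simp: eventually_at_filter)
    qed
    from tendsto_unique[OF _ this E'.E_right[OF u(1)]] show ?thesis by (simp add: u_def)
  qed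
qed

text \<open>Orthogonal projections whose ranges contain each other coincide; symmetry turns the
  inclusion of ranges into a statement about the other order of composition.\<close>

theorem bounded_resolution_unique:
  assumes E: "bounded_resolution H E T" and E': "bounded_resolution H E' T" and x: "x \<in> H"
  shows "E l x = E' l x"
proof -
  interpret E: bounded_resolution H E T by fact
  interpret E': bounded_resolution H E' T by fact
  show ?thesis
  proof (rule E.eq_if_inner_eq)
    fix z assume z: "z \<in> H"
    have "E l x \<bullet> z = x \<bullet> E' l (E l z)" using x z by (simp add: E.E_sym bounded_resolution_le[OF E E'])
    also have "\<dots> = E l (E' l x) \<bullet> z"
      using x z by (simp add: E.E_sym E'.E_sym E.E_H E'.E_H)
    also have "\<dots> = E' l x \<bullet> z" using x by (simp add: bounded_resolution_le[OF E' E])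
    finally show "E l x \<bullet> z = E' l x \<bullet> z" .
  qed (use x E.E_H E'.E_H in auto)
qed

text \<open>
  For \<open>x\<close> in the range of \<open>E l\<close> and \<open>y\<close> in its kernel the form \<open>E t\<close> is additive on
  \<open>x + y\<close>; integrating shows that \<open>T x\<close> is orthogonal to \<open>y\<close>, so \<open>T\<close> commutes with \<open>E l\<close>.
\<close>

lemma bounded_resolutionI:
  fixes H :: "'a::{real_inner,banach} set"
  assumes "resolution H E" and "positive_operator T" and T_H: "\<And>x. x \<in> H \<Longrightarrow> T x \<in> H"
    and int: "\<And>x. x \<in> H \<Longrightarrow> T x \<bullet> x = (LINT t|interval_measure (\<lambda>t. E t x \<bullet> x). t)"
  shows "bounded_resolution H E T"
proof -
  interpret resolution H E by fact
  interpret positive_operator T by fact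
  obtain K where K: "0 < K" "\<And>l x. K \<le> l \<Longrightarrow> x \<in> H \<Longrightarrow> E l x = x" using E_top_pos by blast
  have D: "distribution_function (\<lambda>t. E t x \<bullet> x) K (x \<bullet> x)" if "x \<in> H" for x
    by (rule distribution_function_form) (use that K in auto)
  define s where "s N j = real j * K / real N" for N j :: nat
  have s: "real j * K / real N \<le> s N j \<and> s N j \<le> real (Suc j) * K / real N" for N j
    using K unfolding s_def by (intro conjI divide_right_mono mult_right_mono) auto
  have orth: "T x \<bullet> y = 0" if x: "x \<in> H" "E l x = x" and y: "y \<in> H" "E l y = 0" for x y l
  proof -
    have xy: "x + y \<in> H" using x y by (intro subspace_add subspace_H)
    \<comment> \<open>For t \<le> l the vector E t x stays in the range of E l and so is orthogonal
      to y; for t > l it is x itself.\<close>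
    have cross: "E t x \<bullet> y = 0" for t
    proof (cases "t \<le> l")
      case True
      have "E t x \<bullet> y = E l (E t x) \<bullet> y" using True x by (simp add: E_mono)
      also have "\<dots> = 0" using y x by (simp add: E_sym E_H)
      finally show ?thesis .
    next
      case False
      then have "E t x = x" using E_mono[of l t x] x by simp
      then show ?thesis using E_sym[of x y l] x y by simp
    qed
    then have F: "E t (x + y) \<bullet> (x + y) = E t x \<bullet> x + E t y \<bullet> y" for t
      using E_sym[of x y t] x y by (simp add: E_add inner_add inner_commute)
    interpret Dx: distribution_function "\<lambda>t. E t x \<bullet> x" K "x \<bullet> x" by (rule D) fact
    interpret Dy: distribution_function "\<lambda>t. E t y \<bullet> y" K "y \<bullet> y" by (rule D) fact
    interpret Dxy: distribution_function "\<lambda>t. E t (x + y) \<bullet> (x + y)" K "(x + y) \<bullet> (x + y)"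
      by (rule D) fact
    have c: "continuous_on UNIV (\<lambda>t::real. t)" by (intro continuous_intros)
    have eq: "Dxy.rs_sum s (\<lambda>t. t) = (\<lambda>N. Dx.rs_sum s (\<lambda>t. t) N + Dy.rs_sum s (\<lambda>t. t) N)"
      unfolding Dxy.rs_sum_def Dx.rs_sum_def Dy.rs_sum_def unfolding F by (rule ext) (simp add: sum.distrib[symmetric] algebra_simps)
    have "Dxy.rs_sum s (\<lambda>t. t) \<longlonglongrightarrow> T x \<bullet> x + T y \<bullet> y"
      unfolding eq using tendsto_add[OF Dx.rs_sum_tendsto[OF s c] Dy.rs_sum_tendsto[OF s c]] x y
      by (simp add: int)
    moreover have "Dxy.rs_sum s (\<lambda>t. t) \<longlonglongrightarrow> T (x + y) \<bullet> (x + y)"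
      using Dxy.rs_sum_tendsto[OF s c] xy by (simp add: int)
    ultimately have "T (x + y) \<bullet> (x + y) = T x \<bullet> x + T y \<bullet> y" by (rule LIMSEQ_unique[rotated])
    then show ?thesis using sym[of y x]
      by (simp add: linear_add[OF linear_T] inner_add inner_commute)
  qed
  show ?thesis
  proof unfold_locales
    show "x \<in> H \<Longrightarrow> T x \<in> H" for x by (rule T_H)
    show "T (E l x) = E l (T x)" if x: "x \<in> H" for x l
    proof -
      define a where "a = E l x"
      define b where "b = x - a"
      have a: "a \<in> H" "E l a = a" using x by (simp_all add: a_def E_H E_idem)
      have b: "b \<in> H" "E l b = 0"
        using x a by (simp_all add: b_def E_diff subspace_diff[OF subspace_H]) (simp add: a_def)
      have "E l (T a) = T a"
      proof -
        define d where "d = T a - E l (T a)"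
        have d: "d \<in> H" "E l d = 0"
          using a by (simp_all add: d_def T_H E_H E_diff E_idem subspace_diff[OF subspace_H])
        have "d \<bullet> d = T a \<bullet> d - T a \<bullet> E l d"
          using E_sym[of "T a" d l] a d T_H by (simp add: d_def inner_diff_left)
        also have "\<dots> = 0" using orth[OF a d] d by simp
        finally show ?thesis by (simp add: d_def)
      qed
      moreover have "E l (T b) = 0"
      proof -
        define e where "e = E l (T b)"
        have e: "e \<in> H" "E l e = e" using b by (simp_all add: e_def T_H E_H E_idem)
        have "e \<bullet> e = T b \<bullet> e" using E_sym[of "T b" e l] b e T_H by (simp add: e_def)
        also have "\<dots> = T e \<bullet> b" using sym[of b e] by (simp add: inner_commute)
        also have "\<dots> = 0" by (rule orth[OF e b])
        finally show ?thesis by (simp add: e_def)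
      qed
      moreover have "T x = T a + T b" by (simp add: b_def linear_diff[OF linear_T])
      then have "E l (T x) = E l (T a) + E l (T b)" using E_add[of "T a" "T b" l] a b T_H by simp
      ultimately show ?thesis by (simp add: a_def)
    qed
    show "T x \<bullet> x \<le> l * (x \<bullet> x)" if l: "0 \<le> l" and x: "x \<in> H" "E l x = x" for l x
    proof -
      interpret Dx: distribution_function "\<lambda>t. E t x \<bullet> x" K "x \<bullet> x" by (rule D) fact
      have "E t x = x" if "l \<le> t" for t using E_mono[OF that x(1)] x by simp
      then show ?thesis using Dx.integral_le_of_const[OF l] x by (simp add: int)
    qed
    show "l * (x \<bullet> x) \<le> T x \<bullet> x" if l: "0 \<le> l" and x: "x \<in> H" "E l x = 0" for l x
    proof -
      interpret Dx: distribution_function "\<lambda>t. E t x \<bullet> x" K "x \<bullet> x" by (rule D) fact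
      have "E t x = 0" if "t \<le> l" for t using E_mono'[OF that x(1)] x by (simp add: E_0)
      then show ?thesis using Dx.integral_ge_of_zero[OF l] x by (simp add: int)
    qed
  qed
qed

section \<open>Existence: projections onto growth spaces form a resolution\<close>

context positive_operator_on
begin

definition growth_projection :: "real \<Rightarrow> 'a \<Rightarrow> 'a" where
  "growth_projection l x = (if l < 0 then 0 else oproj (growth_space l) x)"

text \<open>Along r n = l + 1 / (n + 1) the norms of the projections of x decrease. By Pythagoras
  the differences of projections are controlled by differences of squared norms, so the projections
  converge. The limit lies in all growth spaces above l, hence in that of l, and inherits the
  orthogonality relations.\<close>

lemma growth_projection_decreasing_limit:
  assumes l: "0 \<le> l"
  shows "((\<lambda>m. norm (growth_projection m x - growth_projection l x)) \<longlongrightarrow> 0) (at_right l)"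
proof -
  note sub = subspace_growth_space and cl = closed_growth_space
  define P where "P m = oproj (growth_space m) x" for m
  define r where "r n = l + 1 / real (Suc n)" for n
  have r: "l < r n" "0 \<le> r n" for n using l by (simp_all add: r_def add_nonneg_nonneg)
  have rdec: "r n \<le> r k" if "k \<le> n" for k n using that by (simp add: r_def field_simps)
  have diff: "(norm (P m' - P m))\<^sup>2 = (norm (P m'))\<^sup>2 - (norm (P m))\<^sup>2" if m: "0 \<le> m" "m \<le> m'" for m m'
  proof -
    have m': "0 \<le> m'" using m by simp
    have "P m \<in> growth_space m'" using growth_space_mono[OF m] oproj[OF sub[OF m(1)] cl[OF m(1)]] by (auto simp: P_def)
    from oproj_orth[OF sub[OF m'] cl[OF m'] this]
    have a: "x \<bullet> P m = P m' \<bullet> P m" by (simp add: P_def inner_diff_left)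
    have b: "x \<bullet> P m = P m \<bullet> P m"
      using oproj_orth[OF sub[OF m(1)] cl[OF m(1)] oproj[OF sub[OF m(1)] cl[OF m(1)]], of x x] by (simp add: P_def inner_diff_left)
    show ?thesis using a b by (simp add: power2_norm_eq_inner inner_diff inner_commute)
  qed
  have mono: "(norm (P m))\<^sup>2 \<le> (norm (P m'))\<^sup>2" if m: "0 \<le> m" "m \<le> m'" for m m'
    using diff[OF m] zero_le_power2[of "norm (P m' - P m)"] by linarith
  have "decseq (\<lambda>n. (norm (P (r n)))\<^sup>2)" unfolding decseq_def by (intro allI impI mono r rdec)
  then obtain L where L: "(\<lambda>n. (norm (P (r n)))\<^sup>2) \<longlonglongrightarrow> L" "\<And>n. L \<le> (norm (P (r n)))\<^sup>2"
    using decseq_convergent[of "\<lambda>n. (norm (P (r n)))\<^sup>2" 0] by auto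
  have "Cauchy (\<lambda>n. P (r n))"
  proof (rule metric_CauchyI)
    fix e :: real assume e: "0 < e"
    then have "L < L + e\<^sup>2" by simp
    from order_tendstoD(2)[OF L(1) this] obtain M where M: "\<And>n. n \<ge> M \<Longrightarrow> (norm (P (r n)))\<^sup>2 < L + e\<^sup>2"
      by (auto simp: eventually_sequentially)
    have *: "dist (P (r m)) (P (r n)) < e" if "M \<le> m" "m \<le> n" for m n
    proof -
      have "(norm (P (r m) - P (r n)))\<^sup>2 < e\<^sup>2"
        using diff[OF r(2) rdec[OF that(2)]] M[OF that(1)] L(2)[of n] by linarith
      then show ?thesis using e by (simp add: dist_norm power2_less_imp_less)
    qed
    show "\<exists>M. \<forall>m\<ge>M. \<forall>n\<ge>M. dist (P (r m)) (P (r n)) < e"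
    proof (intro exI allI impI)
      fix m n assume "M \<le> m" "M \<le> n"
      then show "dist (P (r m)) (P (r n)) < e" using *[of m n] *[of n m] by (cases "m \<le> n") (auto simp: dist_commute)
    qed
  qed
  then obtain y where y: "(\<lambda>n. P (r n)) \<longlonglongrightarrow> y" using convergent_eq_Cauchy by blast
  have P_in: "P m \<in> growth_space m" if "0 \<le> m" for m
    using oproj[OF sub[OF that] cl[OF that]] by (simp add: P_def)
  have y_in: "y \<in> growth_space m" if m: "m > l" for m
  proof -
    have m0: "0 \<le> m" using m l by simp
    have "r \<longlonglongrightarrow> l + 0" unfolding r_def by (intro tendsto_intros LIMSEQ_Suc lim_1_over_n)
    then have "\<forall>\<^sub>F n in sequentially. r n < m" using m by (intro order_tendstoD) auto
    then have "\<forall>\<^sub>F n in sequentially. P (r n) \<in> growth_space m"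
    proof eventually_elim
      case (elim n)
      then show ?case using P_in[OF r(2)[of n]] growth_space_mono[OF r(2)[of n], of m] by auto
    qed
    then show ?thesis by (rule Lim_in_closed_set[OF cl[OF m0] _ sequentially_bot y])
  qed
  have "P l = y" unfolding P_def
  proof (rule oproj_unique[OF sub[OF l] cl[OF l]])
    show "y \<in> growth_space l" by (rule growth_space_Inter[OF l y_in])
    fix v assume v: "v \<in> growth_space l"
    have "(\<lambda>n. (x - P (r n)) \<bullet> v) \<longlonglongrightarrow> (x - y) \<bullet> v" by (intro tendsto_intros y)
    moreover have "(x - P (r n)) \<bullet> v = 0" for n
      unfolding P_def using v growth_space_mono[OF l less_imp_le[OF r(1)[of n]]]
      by (intro oproj_orth[OF sub[OF r(2)] cl[OF r(2)]]) auto
    ultimately show "(x - y) \<bullet> v = 0" by (simp add: LIMSEQ_const_iff)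
  qed
  have lim: "(\<lambda>n. norm (P (r n) - P l)) \<longlonglongrightarrow> 0"
    using y \<open>P l = y\<close> by (simp add: LIM_zero tendsto_norm_zero)
  \<comment> \<open>Monotonicity of the norms carries the convergence from the sequence r over to
    all m close to l.\<close>
  show ?thesis
  proof (rule tendstoI)
    fix e :: real assume "0 < e"
    then have "\<forall>\<^sub>F n in sequentially. norm (P (r n) - P l) < e" using order_tendstoD(2)[OF lim] by blast
    then obtain n where n: "norm (P (r n) - P l) < e" by (auto simp: eventually_sequentially)
    have "norm (P m - P l) < e" if m: "l < m" "m < r n" for m
    proof -
      have "(norm (P m - P l))\<^sup>2 \<le> (norm (P (r n) - P l))\<^sup>2"
        using diff[of l m] diff[of l "r n"] mono[of m "r n"] m l by simp
      then have "norm (P m - P l) \<le> norm (P (r n) - P l)" by (rule power2_le_imp_le) simp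
      then show ?thesis using n by simp
    qed
    then show "\<forall>\<^sub>F m in at_right l. dist (norm (growth_projection m x - growth_projection l x)) 0 < e"
      using l r(1)[of n] unfolding eventually_at_right_field growth_projection_def P_def
      by (intro exI[of _ "r n"]) auto
  qed
qed

theorem bounded_resolution_growth_projection: "bounded_resolution H growth_projection T"
proof -
  obtain K where K: "K > 0" "\<And>x. norm (T x) \<le> norm x * K"
    using bounded_linear.pos_bounded[OF bounded_linear_T] by blast
  note sub = subspace_growth_space and cl = closed_growth_space
  note facts = oproj_add[OF sub cl] oproj_scaleR[OF sub cl] oproj_fixed[OF sub cl] oproj_sym[OF sub cl]
    oproj[OF sub cl]
  show ?thesis
  proof unfold_locales
    fix l m :: real and x y :: 'a
    show "growth_projection l x \<in> H" using growth_space_subset[of l] facts(5)[of l x] subspace_0[OF subspace_H]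
      by (auto simp: growth_projection_def)
    show "growth_projection l (growth_projection l x) = growth_projection l x" by (simp add: growth_projection_def facts)
    show "growth_projection l x \<bullet> y = x \<bullet> growth_projection l y" by (simp add: growth_projection_def facts)
    show "growth_projection m (growth_projection l x) = growth_projection l x" if "l \<le> m"
    proof (cases "l < 0")
      case True
      then show ?thesis using oproj_fixed[OF sub cl subspace_0[OF sub], of m] by (simp add: growth_projection_def)
    next
      case False
      then show ?thesis using that growth_space_mono[of l m] facts(5)[of l x]
        by (auto simp: growth_projection_def intro!: oproj_fixed[OF sub cl])
    qed
    show "((\<lambda>m. norm (growth_projection m x - growth_projection l x)) \<longlongrightarrow> 0) (at_right l)"
    proof (cases "l < 0")
      case True
      then have "\<forall>\<^sub>F m in at_right l. norm (growth_projection m x - growth_projection l x) = 0"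
        unfolding eventually_at_right_field by (intro exI[of _ 0]) (auto simp: growth_projection_def)
      then show ?thesis by (rule tendsto_eventually)
    qed (simp add: growth_projection_decreasing_limit)
    show "\<exists>K. \<forall>l\<ge>K. \<forall>x\<in>H. growth_projection l x = x"
    proof (intro exI allI ballI impI)
      fix l x assume "K \<le> l" "x \<in> H"
      then show "growth_projection l x = x" using growth_space_UNIV[of K l] K
        by (auto simp: growth_projection_def mult.commute intro!: oproj_fixed[OF subspace_H closed_H])
    qed
    show "T (growth_projection l x) = growth_projection l (T x)"
    proof (cases "l < 0")
      case False
      have "oproj (growth_space l) (T x) = T (oproj (growth_space l) x)"
      proof (rule oproj_commute[OF sub cl linear_T])
        show "T u \<bullet> v = 0" if "\<And>v. v \<in> growth_space l \<Longrightarrow> u \<bullet> v = 0" "v \<in> growth_space l" for u v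
          using that growth_space_T by (simp add: sym)
      qed (use False growth_space_T in auto)
      then show ?thesis using False by (simp add: growth_projection_def)
    qed (simp add: growth_projection_def linear_0[OF linear_T])
    show "T x \<bullet> x \<le> l * (x \<bullet> x)" if "0 \<le> l" "growth_projection l x = x"
      using that facts(5)[of l x] by (intro growth_space_form_le) (auto simp: growth_projection_def)
    show "l * (x \<bullet> x) \<le> T x \<bullet> x" if "0 \<le> l" "x \<in> H" "growth_projection l x = 0"
      using that oproj_eq_0_iff[OF sub cl, of l x] by (intro growth_space_orth_ge) (auto simp: growth_projection_def)
  qed (auto simp: growth_projection_def facts subspace_H intro: T_H)
qed

end

section \<open>The Hilbert space of square summable functions\<close>

text \<open>The index type is taken as a whole so that the result can be an instance of
  \<open>real_inner\<close> and \<open>banach\<close>; functions on a set I of indices form the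
  closed subspace \<open>supported I\<close>.\<close>

typedef 'i l2 = "{x :: 'i \<Rightarrow> complex. (\<lambda>i. (cmod (x i))\<^sup>2) summable_on UNIV}"
  morphisms coord Abs_l2
  by (rule exI[of _ "\<lambda>_. 0"]) simp

setup_lifting type_definition_l2

lemma coord_summable: "(\<lambda>i. (cmod (coord x i))\<^sup>2) summable_on A"
  using coord[of x] by (auto intro: summable_on_subset_banach)

lemma l2_eqI: "(\<And>i. coord x i = coord y i) \<Longrightarrow> x = y"
  using coord_inject by blast

lemma square_summable_add:
  assumes "(\<lambda>i. (cmod (x i))\<^sup>2) summable_on A" "(\<lambda>i. (cmod (y i))\<^sup>2) summable_on A"
  shows "(\<lambda>i. (cmod (x i + y i))\<^sup>2) summable_on A"
proof (rule summable_on_comparison_test)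
  show "(\<lambda>i. 2 * (cmod (x i))\<^sup>2 + 2 * (cmod (y i))\<^sup>2) summable_on A"
    by (intro summable_on_add summable_on_cmult_right assms)
  show "(cmod (x i + y i))\<^sup>2 \<le> 2 * (cmod (x i))\<^sup>2 + 2 * (cmod (y i))\<^sup>2" for i
  proof -
    have "(cmod (x i + y i))\<^sup>2 \<le> (cmod (x i) + cmod (y i))\<^sup>2"
      by (intro power_mono norm_triangle_ineq) auto
    also have "\<dots> \<le> 2 * (cmod (x i))\<^sup>2 + 2 * (cmod (y i))\<^sup>2"
      using zero_le_power2[of "cmod (x i) - cmod (y i)"] by (simp add: power2_sum power2_diff)
    finally show ?thesis .
  qed
qed auto

lemma square_summable_mult:
  assumes "(\<lambda>i. (cmod (x i))\<^sup>2) summable_on A"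
  shows "(\<lambda>i. (cmod (c * x i))\<^sup>2) summable_on A"
  using summable_on_cmult_right[OF assms, of "(cmod c)\<^sup>2"] by (simp add: norm_mult power_mult_distrib)

lemma square_summable_prod:
  assumes "(\<lambda>i. (cmod (x i))\<^sup>2) summable_on A" "(\<lambda>i. (cmod (y i))\<^sup>2) summable_on A"
  shows "(\<lambda>i. x i * cnj (y i)) summable_on A"
proof (rule abs_summable_summable, rule Infinite_Sum.abs_summable_on_comparison_test')
  show "(\<lambda>i. (cmod (x i))\<^sup>2 + (cmod (y i))\<^sup>2) summable_on A"
    by (intro summable_on_add assms)
  show "norm (x i * cnj (y i)) \<le> (cmod (x i))\<^sup>2 + (cmod (y i))\<^sup>2" for i
    using zero_le_power2[of "cmod (x i) - cmod (y i)"] mult_nonneg_nonneg[of "cmod (x i)" "cmod (y i)"]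
    by (simp add: norm_mult power2_diff del: mult_nonneg_nonneg)
qed

lemmas coord_prod_summable = square_summable_prod[OF coord_summable coord_summable]

instantiation l2 :: (type) real_vector
begin

lift_definition zero_l2 :: "'a l2" is "\<lambda>_. 0" by simp
lift_definition plus_l2 :: "'a l2 \<Rightarrow> 'a l2 \<Rightarrow> 'a l2" is "\<lambda>x y i. x i + y i"
  by (rule square_summable_add)
lift_definition uminus_l2 :: "'a l2 \<Rightarrow> 'a l2" is "\<lambda>x i. - x i" by simp
lift_definition minus_l2 :: "'a l2 \<Rightarrow> 'a l2 \<Rightarrow> 'a l2" is "\<lambda>x y i. x i - y i"
  using square_summable_add[of _ UNIV "\<lambda>i. - _ i"] by simp
lift_definition scaleR_l2 :: "real \<Rightarrow> 'a l2 \<Rightarrow> 'a l2" is "\<lambda>r x i. of_real r * x i"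
  by (rule square_summable_mult)

instance
  by standard (transfer; simp add: algebra_simps fun_eq_iff)+

end

lift_definition cscale :: "complex \<Rightarrow> 'a l2 \<Rightarrow> 'a l2" is "\<lambda>c x i. c * x i"
  by (rule square_summable_mult)

lemmas coord_simps = zero_l2.rep_eq plus_l2.rep_eq uminus_l2.rep_eq minus_l2.rep_eq scaleR_l2.rep_eq
  cscale.rep_eq

definition cinner :: "'a l2 \<Rightarrow> 'a l2 \<Rightarrow> complex" where
  "cinner x y = (\<Sum>\<^sub>\<infinity>i. coord x i * cnj (coord y i))"

lemma cinner_add: "cinner (x + y) z = cinner x z + cinner y z"
  unfolding cinner_def coord_simps distrib_right by (intro infsum_add coord_prod_summable)

lemma cinner_cscale: "cinner (cscale c x) z = c * cinner x z"
  unfolding cinner_def coord_simps mult.assoc by (rule infsum_cmult_right')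

lemma cinner_commute: "cinner x y = cnj (cinner y x)"
  unfolding cinner_def by (subst infsum_cnj[symmetric]) (simp add: mult.commute)

lemma cinner_self: "cinner x x = of_real (\<Sum>\<^sub>\<infinity>i. (cmod (coord x i))\<^sup>2)"
proof -
  have "((\<lambda>i. complex_of_real ((cmod (coord x i))\<^sup>2)) has_sum
      complex_of_real (\<Sum>\<^sub>\<infinity>i. (cmod (coord x i))\<^sup>2)) UNIV"
    unfolding has_sum_of_real_iff by (rule has_sum_infsum[OF coord_summable])
  from infsumI[OF this] show ?thesis
    unfolding cinner_def by (simp add: complex_norm_square[symmetric])
qed

instantiation l2 :: (type) real_inner
begin

definition "inner_l2 (x :: 'a l2) y = Re (cinner x y)"
definition "norm_l2 (x :: 'a l2) = sqrt (inner x x)"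
definition "sgn_l2 (x :: 'a l2) = x /\<^sub>R norm x"
definition "dist_l2 (x :: 'a l2) y = norm (x - y)"
definition "uniformity_l2 = (INF e\<in>{0 <..}. principal {(x :: 'a l2, y). dist x y < e})"
definition "open_l2 (U :: 'a l2 set) = (\<forall>x\<in>U. eventually (\<lambda>(x', y). x' = x \<longrightarrow> y \<in> U) uniformity)"

instance
proof
  fix x y z :: "'a l2" and r :: real
  show "x \<bullet> y = y \<bullet> x" unfolding inner_l2_def by (subst cinner_commute) simp
  show "(x + y) \<bullet> z = x \<bullet> z + y \<bullet> z" by (simp add: inner_l2_def cinner_add)
  have "r *\<^sub>R x = cscale (of_real r) x" by (rule l2_eqI) (simp add: coord_simps)
  then show "r *\<^sub>R x \<bullet> y = r * (x \<bullet> y)" by (simp add: inner_l2_def cinner_cscale)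
  show "0 \<le> x \<bullet> x" by (simp add: inner_l2_def cinner_self infsum_nonneg)
  show "x \<bullet> x = 0 \<longleftrightarrow> x = 0"
  proof
    assume "x \<bullet> x = 0"
    then have "(\<Sum>\<^sub>\<infinity>i. (cmod (coord x i))\<^sup>2) = 0" by (simp add: inner_l2_def cinner_self)
    then have "(cmod (coord x i))\<^sup>2 = 0" for i
      by (rule nonneg_infsum_le_0D[OF order.eq_iff[THEN iffD1, THEN conjunct1]]) (auto intro: coord_summable)
    then show "x = 0" by (intro l2_eqI) (simp add: coord_simps)
  qed (simp add: inner_l2_def cinner_def coord_simps)
qed (simp_all add: norm_l2_def sgn_l2_def dist_l2_def uniformity_l2_def open_l2_def)

end

lemma norm_l2_square: "(norm (x :: 'a l2))\<^sup>2 = (\<Sum>\<^sub>\<infinity>i. (cmod (coord x i))\<^sup>2)"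
  by (simp add: power2_norm_eq_inner inner_l2_def cinner_self)

lemma sum_coord_le: "finite F \<Longrightarrow> (\<Sum>i\<in>F. (cmod (coord x i))\<^sup>2) \<le> (norm x)\<^sup>2"
  unfolding norm_l2_square by (rule finite_sum_le_infsum) (auto intro: coord_summable)

lemma coord_le: "cmod (coord x i) \<le> norm x"
  using sum_coord_le[of "{i}" x] by (auto intro: power2_le_imp_le)

lemma norm_cscale: "norm (cscale c x) = cmod c * norm x"
proof -
  have "(norm (cscale c x))\<^sup>2 = (cmod c * norm x)\<^sup>2"
    unfolding power_mult_distrib norm_l2_square coord_simps norm_mult
    by (rule infsum_cmult_right')
  then show ?thesis by (subst (asm) power2_eq_iff_nonneg) auto
qed

text \<open>Coordinates of a Cauchy sequence converge. Estimates for finite partial sums survive the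
  limit with the same bound and then hold for the infinite sum, which gives both membership and
  convergence in norm.\<close>

instance l2 :: (type) banach
proof
  fix xs :: "nat \<Rightarrow> 'a l2" assume xs: "Cauchy xs"
  have "Cauchy (\<lambda>n. coord (xs n) i)" for i
  proof (rule metric_CauchyI)
    fix e :: real assume "0 < e"
    then obtain M where M: "\<And>m n. m \<ge> M \<Longrightarrow> n \<ge> M \<Longrightarrow> dist (xs m) (xs n) < e"
      using metric_CauchyD[OF xs] by blast
    have "dist (coord (xs m) i) (coord (xs n) i) \<le> dist (xs m) (xs n)" for m n
      using coord_le[of "xs m - xs n" i] by (simp add: dist_norm coord_simps)
    then show "\<exists>M. \<forall>m\<ge>M. \<forall>n\<ge>M. dist (coord (xs m) i) (coord (xs n) i) < e"
      using M by (meson le_less_trans)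
  qed
  then have "\<exists>y. (\<lambda>n. coord (xs n) i) \<longlonglongrightarrow> y" for i using convergent_eq_Cauchy by blast
  then obtain y where y: "\<And>i. (\<lambda>n. coord (xs n) i) \<longlonglongrightarrow> y i" by metis
  have fin: "(\<Sum>i\<in>F. (cmod (y i - coord (xs n) i))\<^sup>2) \<le> e\<^sup>2"
    if M: "\<And>m. m \<ge> M \<Longrightarrow> norm (xs m - xs n) \<le> e" and F: "finite F" for F n M e
  proof (rule LIMSEQ_le_const2)
    show "(\<lambda>m. \<Sum>i\<in>F. (cmod (coord (xs m) i - coord (xs n) i))\<^sup>2) \<longlonglongrightarrow> (\<Sum>i\<in>F. (cmod (y i - coord (xs n) i))\<^sup>2)"
      by (intro tendsto_intros y)
    show "\<exists>N. \<forall>m\<ge>N. (\<Sum>i\<in>F. (cmod (coord (xs m) i - coord (xs n) i))\<^sup>2) \<le> e\<^sup>2"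
    proof (intro exI allI impI)
      fix m assume "M \<le> m"
      have "(\<Sum>i\<in>F. (cmod (coord (xs m) i - coord (xs n) i))\<^sup>2) \<le> (norm (xs m - xs n))\<^sup>2"
        using sum_coord_le[OF F, of "xs m - xs n"] by (simp add: coord_simps)
      also have "\<dots> \<le> e\<^sup>2" using M[OF \<open>M \<le> m\<close>] by (intro power_mono) auto
      finally show "(\<Sum>i\<in>F. (cmod (coord (xs m) i - coord (xs n) i))\<^sup>2) \<le> e\<^sup>2" .
    qed
  qed
  have summ: "(\<lambda>i. (cmod (y i - coord (xs n) i))\<^sup>2) summable_on UNIV"
    and bound: "(\<Sum>\<^sub>\<infinity>i. (cmod (y i - coord (xs n) i))\<^sup>2) \<le> e\<^sup>2"
    if M: "\<And>m. m \<ge> M \<Longrightarrow> norm (xs m - xs n) \<le> e" for n M e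
  proof -
    show s: "(\<lambda>i. (cmod (y i - coord (xs n) i))\<^sup>2) summable_on UNIV"
      by (rule nonneg_bdd_above_summable_on) (auto intro!: bdd_aboveI[of _ "e\<^sup>2"] fin[OF M])
    show "(\<Sum>\<^sub>\<infinity>i. (cmod (y i - coord (xs n) i))\<^sup>2) \<le> e\<^sup>2"
      by (rule infsum_le_finite_sums[OF s]) (auto intro: fin[OF M])
  qed
  have cau: "\<exists>M. \<forall>n\<ge>M. \<forall>m\<ge>M. norm (xs m - xs n) \<le> e" if "e > 0" for e
    using metric_CauchyD[OF xs that] by (auto simp: dist_norm intro: less_imp_le)
  obtain M where M: "\<And>n m. n \<ge> M \<Longrightarrow> m \<ge> M \<Longrightarrow> norm (xs m - xs n) \<le> 1" using cau[of 1] by auto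
  have "(\<lambda>i. (cmod ((y i - coord (xs M) i) + coord (xs M) i))\<^sup>2) summable_on UNIV"
    by (rule square_summable_add[OF summ[of M M 1] coord_summable]) (use M in auto)
  then have "coord (Abs_l2 y) = y" by (intro Abs_l2_inverse) simp
  then have *: "(norm (Abs_l2 y - xs n))\<^sup>2 = (\<Sum>\<^sub>\<infinity>i. (cmod (y i - coord (xs n) i))\<^sup>2)" for n
    unfolding norm_l2_square coord_simps by simp
  have "xs \<longlonglongrightarrow> Abs_l2 y"
  proof (rule metric_LIMSEQ_I)
    fix e :: real assume e: "0 < e"
    then obtain M where M: "\<And>n m. n \<ge> M \<Longrightarrow> m \<ge> M \<Longrightarrow> norm (xs m - xs n) \<le> e / 2" using cau[of "e / 2"] by auto
    have "dist (xs n) (Abs_l2 y) < e" if "n \<ge> M" for n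
    proof -
      have "(norm (Abs_l2 y - xs n))\<^sup>2 \<le> (e / 2)\<^sup>2" unfolding *
        by (rule bound[of M]) (use M that in auto)
      then have "norm (Abs_l2 y - xs n) \<le> e / 2" by (rule power2_le_imp_le) (use e in simp)
      then show ?thesis using e by (simp add: dist_norm norm_minus_commute)
    qed
    then show "\<exists>no. \<forall>n\<ge>no. dist (xs n) (Abs_l2 y) < e" by blast
  qed
  then show "convergent xs" by (auto simp: convergent_def)
qed

subsection \<open>Functions supported in a fixed index set\<close>

definition supported :: "'i set \<Rightarrow> 'i l2 set" where
  "supported I = {x. \<forall>i. i \<notin> I \<longrightarrow> coord x i = 0}"

lemma subspace_supported: "subspace (supported I)"
  by (auto simp: supported_def Real_Vector_Spaces.subspace_def coord_simps)

lemma closed_supported: "closed (supported I :: 'a l2 set)"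
proof -
  have "continuous_on UNIV (\<lambda>x :: 'a l2. coord x i)" for i
  proof -
    have "bounded_linear (\<lambda>x::'a l2. coord x i)"
      by (rule bounded_linear_intro[of _ 1]) (auto simp: coord_simps coord_le scaleR_conv_of_real)
    then show ?thesis by (rule linear_continuous_on)
  qed
  then have "closed {x :: 'a l2. coord x i = 0}" for i
    by (intro closed_Collect_eq continuous_on_const) auto
  moreover have "supported I = (\<Inter>i\<in>-I. {x. coord x i = 0})" by (auto simp: supported_def)
  ultimately show ?thesis by (auto intro!: closed_INT)
qed

lemma coord_Abs_l2: "f \<in> ell2 I \<Longrightarrow> coord (Abs_l2 f) = f"
proof (rule Abs_l2_inverse, rule CollectI)
  assume "f \<in> ell2 I"
  then have f: "\<And>i. i \<notin> I \<Longrightarrow> f i = 0" "(\<lambda>i. (cmod (f i))\<^sup>2) summable_on I"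
    by (auto simp: ell2_def)
  have "(\<lambda>i. (cmod (f i))\<^sup>2) summable_on I \<longleftrightarrow> (\<lambda>i. (cmod (f i))\<^sup>2) summable_on UNIV"
    by (rule summable_on_cong_neutral) (use f in auto)
  with f show "(\<lambda>i. (cmod (f i))\<^sup>2) summable_on UNIV" by simp
qed

lemma Abs_l2_supported: "f \<in> ell2 I \<Longrightarrow> Abs_l2 f \<in> supported I"
  by (simp add: supported_def coord_Abs_l2) (simp add: ell2_def)

lemma coord_supported: "x \<in> supported I \<Longrightarrow> coord x \<in> ell2 I"
  using coord_summable by (auto simp: supported_def ell2_def)

lemma ell2_inner_coord:
  assumes "x \<in> supported I" "y \<in> supported I"
  shows "ell2_inner I (coord x) (coord y) = cinner x y"
  unfolding ell2_inner_def cinner_def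
  by (rule infsum_cong_neutral) (use assms in \<open>auto simp: supported_def\<close>)

lemma ell2_norm_coord:
  assumes "x \<in> supported I"
  shows "ell2_norm I (coord x) = norm x"
proof -
  have "(\<Sum>\<^sub>\<infinity>i\<in>I. (cmod (coord x i))\<^sup>2) = (norm x)\<^sup>2"
    unfolding norm_l2_square by (rule infsum_cong_neutral) (use assms in \<open>auto simp: supported_def\<close>)
  then show ?thesis by (simp add: ell2_norm_def)
qed

text \<open>The imaginary part is the real inner product with \<i> y, so identities for the real
  inner product that hold on complex subspaces imply their complex versions.\<close>

lemma cinner_complex: "cinner x y = Complex (x \<bullet> y) (x \<bullet> cscale \<i> y)"
proof -
  have "cinner x (cscale \<i> y) = - \<i> * cinner x y"
    using cinner_commute[of x "cscale \<i> y"] cinner_commute[of x y] by (simp add: cinner_cscale)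
  then show ?thesis by (simp add: complex_eq_iff inner_l2_def)
qed

lemma cscale_inner: "cscale c x \<bullet> y = x \<bullet> cscale (cnj c) y"
proof -
  have "cinner x (cscale (cnj c) y) = c * cinner x y"
    using cinner_commute[of x "cscale (cnj c) y"] cinner_commute[of x y] by (simp add: cinner_cscale)
  then show ?thesis by (simp add: inner_l2_def cinner_cscale)
qed

lemma bounded_linear_cscale: "bounded_linear (cscale c)"
  by (rule bounded_linear_intro[of _ "cmod c"])
     (auto intro!: l2_eqI simp: coord_simps algebra_simps norm_cscale)

lemma cscale_supported: "x \<in> supported I \<Longrightarrow> cscale c x \<in> supported I"
  by (simp add: supported_def coord_simps)

section \<open>Spectral families of positive operators\<close>

locale positive_ell2_operator =
  fixes I :: "'i set" and T :: "('i \<Rightarrow> complex) \<Rightarrow> 'i \<Rightarrow> complex"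
  assumes T_ell2: "f \<in> ell2 I \<Longrightarrow> T f \<in> ell2 I"
    and T_add: "f \<in> ell2 I \<Longrightarrow> g \<in> ell2 I \<Longrightarrow> T (\<lambda>i. f i + g i) = (\<lambda>i. T f i + T g i)"
    and T_scale: "f \<in> ell2 I \<Longrightarrow> T (\<lambda>i. c * f i) = (\<lambda>i. c * T f i)"
    and T_bounded: "\<exists>B. \<forall>f\<in>ell2 I. ell2_norm I (T f) \<le> B * ell2_norm I f"
    and T_sym: "f \<in> ell2 I \<Longrightarrow> g \<in> ell2 I \<Longrightarrow> ell2_inner I (T f) g = ell2_inner I f (T g)"
    and T_pos: "f \<in> ell2 I \<Longrightarrow> 0 \<le> Re (ell2_inner I (T f) f)"
begin

definition cut :: "'i l2 \<Rightarrow> 'i l2" where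
  "cut x = Abs_l2 (\<lambda>i. if i \<in> I then coord x i else 0)"

text \<open>T is controlled only on \<open>ell2 I\<close>. Precomposing with \<open>cut\<close>, the
  orthogonal projection onto \<open>supported I\<close>, gives an operator on the whole Hilbert
  space that is positive there.\<close>

definition lift_T :: "'i l2 \<Rightarrow> 'i l2" where
  "lift_T x = Abs_l2 (T (coord (cut x)))"

lemma cut_fun_ell2: "(\<lambda>i. if i \<in> I then coord x i else 0) \<in> ell2 I"
proof -
  have "(\<lambda>i. (cmod (if i \<in> I then coord x i else 0))\<^sup>2) summable_on I
      \<longleftrightarrow> (\<lambda>i. (cmod (coord x i))\<^sup>2) summable_on I"
    by (rule summable_on_cong) auto
  then show ?thesis using coord_summable by (auto simp: ell2_def)
qed

lemma coord_cut: "coord (cut x) = (\<lambda>i. if i \<in> I then coord x i else 0)"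
  unfolding cut_def by (rule coord_Abs_l2[OF cut_fun_ell2])

lemma cut_supported: "cut x \<in> supported I"
  by (simp add: supported_def coord_cut)

lemma cut_fixed: "x \<in> supported I \<Longrightarrow> cut x = x"
  by (rule l2_eqI) (auto simp: coord_cut supported_def)

lemma cut_ell2: "coord (cut x) \<in> ell2 I"
  by (rule coord_supported[OF cut_supported])

lemma cut_add: "cut (x + y) = cut x + cut y"
  by (rule l2_eqI) (simp add: coord_cut coord_simps)

lemma cut_cscale: "cut (cscale c x) = cscale c (cut x)"
  by (rule l2_eqI) (simp add: coord_cut coord_simps)

lemma norm_cut_le: "norm (cut x) \<le> norm x"
proof (rule power2_le_imp_le)
  show "(norm (cut x))\<^sup>2 \<le> (norm x)\<^sup>2"
    unfolding norm_l2_square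
  proof (rule infsum_mono)
    show "(cmod (coord (cut x) i))\<^sup>2 \<le> (cmod (coord x i))\<^sup>2" for i by (simp add: coord_cut)
  qed (rule coord_summable)+
qed simp

lemma cinner_cut: "y \<in> supported I \<Longrightarrow> cinner (cut x) y = cinner x y"
  unfolding cinner_def by (rule infsum_cong) (auto simp: coord_cut supported_def)

lemma coord_lift_T: "coord (lift_T x) = T (coord (cut x))"
  unfolding lift_T_def by (rule coord_Abs_l2[OF T_ell2[OF cut_ell2]])

lemma lift_T_supported: "lift_T x \<in> supported I"
  unfolding lift_T_def by (rule Abs_l2_supported[OF T_ell2[OF cut_ell2]])

lemma lift_T_add: "lift_T (x + y) = lift_T x + lift_T y"
  by (rule l2_eqI) (simp add: coord_lift_T cut_add coord_simps T_add[OF cut_ell2 cut_ell2, symmetric]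
      plus_l2.rep_eq[abs_def])

lemma lift_T_cscale: "lift_T (cscale c x) = cscale c (lift_T x)"
  by (rule l2_eqI) (simp add: coord_lift_T cut_cscale coord_simps T_scale[OF cut_ell2, symmetric]
      cscale.rep_eq[abs_def])

lemma scaleR_cscale: "r *\<^sub>R x = cscale (of_real r) x"
  by (rule l2_eqI) (simp add: coord_simps)

lemma cinner_lift_T:
  assumes "x \<in> supported I" "y \<in> supported I"
  shows "cinner (lift_T x) y = ell2_inner I (T (coord x)) (coord y)"
  using ell2_inner_coord[OF lift_T_supported assms(2), of x] assms
  by (simp add: coord_lift_T cut_fixed)

lemma cinner_lift_T_sym: "cinner (lift_T x) y = cinner x (lift_T y)"
proof -
  have "cinner (lift_T x) y = cinner (lift_T x) (cut y)"
    using cinner_cut[OF lift_T_supported, of y x] cinner_commute by metis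
  also have "\<dots> = cinner (lift_T (cut x)) (cut y)"
    by (simp add: lift_T_def cut_fixed[OF cut_supported])
  also have "\<dots> = cinner (cut x) (lift_T (cut y))"
    using T_sym[OF cut_ell2[of x] cut_ell2[of y]] cinner_lift_T[OF cut_supported cut_supported, of x y]
      cinner_lift_T[OF cut_supported cut_supported, of y x]
      T_sym[OF cut_ell2[of y] cut_ell2[of x]] ell2_inner_coord[OF cut_supported lift_T_supported, of x "cut y"]
    by (simp add: coord_lift_T cut_fixed[OF cut_supported])
  also have "\<dots> = cinner x (lift_T y)"
    by (simp add: lift_T_def cut_fixed[OF cut_supported] cinner_cut[OF Abs_l2_supported[OF T_ell2[OF cut_ell2]]])
  finally show ?thesis .
qed

lemma positive_operator_lift_T: "positive_operator lift_T"
proof (rule positive_operator.intro)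
  obtain B where B: "\<And>f. f \<in> ell2 I \<Longrightarrow> ell2_norm I (T f) \<le> B * ell2_norm I f"
    using T_bounded by blast
  show "bounded_linear lift_T"
  proof (rule bounded_linear_intro[of _ "\<bar>B\<bar>"])
    show "lift_T (x + y) = lift_T x + lift_T y" for x y by (rule lift_T_add)
    show "lift_T (r *\<^sub>R x) = r *\<^sub>R lift_T x" for r x by (simp add: scaleR_cscale lift_T_cscale)
    fix x
    have "norm (lift_T x) \<le> B * norm (cut x)"
      using B[OF cut_ell2[of x]] ell2_norm_coord[OF lift_T_supported, of x] ell2_norm_coord[OF cut_supported, of x]
      by (simp add: coord_lift_T)
    also have "\<dots> \<le> \<bar>B\<bar> * norm x"
      by (intro mult_mono norm_cut_le) auto
    finally show "norm (lift_T x) \<le> norm x * \<bar>B\<bar>" by (simp add: mult.commute)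
  qed
  show "lift_T x \<bullet> y = x \<bullet> lift_T y" for x y by (simp add: inner_l2_def cinner_lift_T_sym)
  show "0 \<le> lift_T x \<bullet> x" for x
  proof -
    have "cinner (lift_T x) x = cinner (lift_T (cut x)) (cut x)"
      using cinner_cut[OF lift_T_supported, of x x] cinner_commute[of "lift_T x"]
      by (simp add: lift_T_def cut_fixed[OF cut_supported])
    then show ?thesis
      using T_pos[OF cut_ell2[of x]] by (simp add: inner_l2_def cinner_lift_T cut_supported)
  qed
qed

sublocale P: positive_operator_on lift_T "supported I"
  by (intro positive_operator_on.intro positive_operator_on_axioms.intro positive_operator_lift_T
      subspace_supported closed_supported lift_T_supported)

text \<open>The value 0 outside \<open>ell2 I\<close> is the one that \<open>orth_projection\<close>
  prescribes, so that uniqueness can hold as an equality of functions.\<close>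

definition spectral :: "real \<Rightarrow> ('i \<Rightarrow> complex) \<Rightarrow> 'i \<Rightarrow> complex" where
  "spectral l f = (if f \<in> ell2 I then coord (P.growth_projection l (Abs_l2 f)) else (\<lambda>_. 0))"

sublocale R: bounded_resolution "supported I" P.growth_projection lift_T
  by (rule P.bounded_resolution_growth_projection)

text \<open>Multiplication by c commutes with the lifted operator, so growth spaces are complex
  subspaces. Its adjoint is multiplication by the conjugate, so orthogonal complements are preserved
  too, and the projection commutes with it.\<close>

lemma growth_projection_cscale: "P.growth_projection l (cscale c x) = cscale c (P.growth_projection l x)"
proof (cases "l < 0")
  case False
  then have l: "0 \<le> l" by simp
  note sub = P.subspace_growth_space[OF l] and cl = P.closed_growth_space[OF l]
  have inv: "cscale c x \<in> P.growth_space l" if "x \<in> P.growth_space l" for c x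
    by (rule P.growth_space_commute[OF bounded_linear_cscale _ cscale_supported l that])
       (simp_all add: lift_T_cscale)
  have "oproj (P.growth_space l) (cscale c x) = cscale c (oproj (P.growth_space l) x)"
  proof (rule oproj_commute[OF sub cl bounded_linear.linear[OF bounded_linear_cscale]])
    show "cscale c u \<bullet> v = 0"
      if "\<And>v. v \<in> P.growth_space l \<Longrightarrow> u \<bullet> v = 0" "v \<in> P.growth_space l" for u v
      using that inv by (simp add: cscale_inner)
  qed (rule inv)
  then show ?thesis using False by (simp add: P.growth_projection_def)
next
  case True
  then show ?thesis by (simp add: P.growth_projection_def) (rule l2_eqI, simp add: coord_simps)
qed

lemma ell2_add: "f \<in> ell2 I \<Longrightarrow> g \<in> ell2 I \<Longrightarrow> (\<lambda>i. f i + g i) \<in> ell2 I"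
  by (auto simp: ell2_def intro: square_summable_add)

lemma ell2_scale: "f \<in> ell2 I \<Longrightarrow> (\<lambda>i. c * f i) \<in> ell2 I"
  by (auto simp: ell2_def intro: square_summable_mult)

lemma Abs_l2_add: "f \<in> ell2 I \<Longrightarrow> g \<in> ell2 I \<Longrightarrow> Abs_l2 (\<lambda>i. f i + g i) = Abs_l2 f + Abs_l2 g"
  by (rule l2_eqI) (simp add: coord_simps coord_Abs_l2[OF ell2_add] coord_Abs_l2)

lemma Abs_l2_scale: "f \<in> ell2 I \<Longrightarrow> Abs_l2 (\<lambda>i. c * f i) = cscale c (Abs_l2 f)"
  by (rule l2_eqI) (simp add: coord_simps coord_Abs_l2[OF ell2_scale] coord_Abs_l2)

lemma Abs_l2_coord: "Abs_l2 (coord x) = x"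
  by (rule coord_inverse)

lemma ell2_inner_Abs: "f \<in> ell2 I \<Longrightarrow> g \<in> ell2 I \<Longrightarrow> ell2_inner I f g = cinner (Abs_l2 f) (Abs_l2 g)"
  using ell2_inner_coord[OF Abs_l2_supported Abs_l2_supported, of f I g] by (simp add: coord_Abs_l2)

lemma ell2_norm_Abs: "f \<in> ell2 I \<Longrightarrow> ell2_norm I f = norm (Abs_l2 f)"
  using ell2_norm_coord[OF Abs_l2_supported, of f I] by (simp add: coord_Abs_l2)

lemma spectral_ell2: "spectral l f \<in> ell2 I"
  using R.E_H[OF Abs_l2_supported, of f l] coord_supported
  by (auto simp: spectral_def) (auto simp: ell2_def)

lemma Abs_l2_spectral: "f \<in> ell2 I \<Longrightarrow> Abs_l2 (spectral l f) = P.growth_projection l (Abs_l2 f)"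
  by (simp add: spectral_def Abs_l2_coord)

lemma spectral_form:
  "f \<in> ell2 I \<Longrightarrow> Re (ell2_inner I (spectral l f) f) = P.growth_projection l (Abs_l2 f) \<bullet> Abs_l2 f"
  by (simp add: ell2_inner_Abs spectral_ell2 Abs_l2_spectral inner_l2_def)

lemma Abs_l2_T: "f \<in> ell2 I \<Longrightarrow> Abs_l2 (T f) = lift_T (Abs_l2 f)"
  by (simp add: lift_T_def cut_fixed Abs_l2_supported coord_Abs_l2)

lemma T_pow_ell2: "f \<in> ell2 I \<Longrightarrow> (T ^^ k) f \<in> ell2 I"
  by (induction k) (auto intro: T_ell2)

lemma Abs_l2_T_pow: "f \<in> ell2 I \<Longrightarrow> Abs_l2 ((T ^^ k) f) = (lift_T ^^ k) (Abs_l2 f)"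
  by (induction k) (simp_all add: Abs_l2_T T_pow_ell2)

lemma spectral_moments:
  assumes f: "f \<in> ell2 I"
  shows "Re (ell2_inner I ((T ^^ k) f) f)
    = (LINT t|interval_measure (\<lambda>l. Re (ell2_inner I (spectral l f) f)). t ^ k)"
  using R.moments[OF Abs_l2_supported[OF f], of k]
  by (simp add: spectral_form f ell2_inner_Abs T_pow_ell2 Abs_l2_T_pow inner_l2_def[symmetric])

lemma orth_projection_spectral: "orth_projection I (spectral l)"
proof -
  note A = Abs_l2_supported
  have eq: "u = v" if "Abs_l2 u = Abs_l2 v" "u \<in> ell2 I" "v \<in> ell2 I" for u v
    using that coord_Abs_l2 by metis
  show ?thesis unfolding orth_projection_def
  proof (intro conjI ballI allI impI)
    fix x y c assume x: "x \<in> ell2 I"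
    show "spectral l (\<lambda>i. c * x i) = (\<lambda>i. c * spectral l x i)"
      by (rule eq) (simp_all add: x ell2_scale spectral_ell2 Abs_l2_spectral Abs_l2_scale growth_projection_cscale)
    show "spectral l (spectral l x) = spectral l x"
      by (rule eq) (simp_all add: x spectral_ell2 Abs_l2_spectral R.E_idem A)
    assume y: "y \<in> ell2 I"
    show "spectral l (\<lambda>i. x i + y i) = (\<lambda>i. spectral l x i + spectral l y i)"
      by (rule eq) (simp_all add: x y ell2_add spectral_ell2 Abs_l2_spectral Abs_l2_add R.E_add A)
    have "cinner (P.growth_projection l (Abs_l2 x)) (Abs_l2 y) = cinner (Abs_l2 x) (P.growth_projection l (Abs_l2 y))"
      unfolding cinner_complex
      using R.E_sym[OF A[OF x] A[OF y], of l] R.E_sym[OF A[OF x] cscale_supported[OF A[OF y]], of l \<i>]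
      by (simp add: growth_projection_cscale)
    then show "ell2_inner I (spectral l x) y = ell2_inner I x (spectral l y)"
      by (simp add: x y ell2_inner_Abs spectral_ell2 Abs_l2_spectral)
  qed (auto simp: spectral_ell2, simp add: spectral_def)
qed

lemma ell2_inner_T_real: "f \<in> ell2 I \<Longrightarrow> ell2_inner I (T f) f = of_real (Re (ell2_inner I (T f) f))"
proof -
  assume f: "f \<in> ell2 I"
  have "ell2_inner I (T f) f = cnj (ell2_inner I (T f) f)"
    using T_sym[OF f f] cinner_commute[of "Abs_l2 (T f)" "Abs_l2 f"] f
    by (simp add: ell2_inner_Abs T_ell2)
  then show ?thesis by (simp add: complex_eq_iff)
qed

lemma spectral_family_spectral: "spectral_family I T spectral"
  unfolding spectral_family_def
proof (intro conjI allI ballI impI)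
  note A = Abs_l2_supported
  fix l m :: real and x assume x: "x \<in> ell2 I"
  have eq: "u = v" if "Abs_l2 u = Abs_l2 v" "u \<in> ell2 I" "v \<in> ell2 I" for u v
    using that coord_Abs_l2 by metis
  show "spectral m (spectral l x) = spectral l x" if "l \<le> m"
    by (rule eq) (simp_all add: x spectral_ell2 Abs_l2_spectral R.E_mono[OF that] A)
  have "ell2_norm I (\<lambda>i. spectral m x i - spectral l x i)
      = norm (P.growth_projection m (Abs_l2 x) - P.growth_projection l (Abs_l2 x))" for m
  proof -
    define d where "d = P.growth_projection m (Abs_l2 x) - P.growth_projection l (Abs_l2 x)"
    have "d \<in> supported I"
      unfolding d_def by (intro subspace_diff subspace_supported R.E_H A x)
    moreover have "coord d = (\<lambda>i. spectral m x i - spectral l x i)"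
      using x by (simp add: d_def spectral_def minus_l2.rep_eq[abs_def] fun_eq_iff)
    ultimately show ?thesis using ell2_norm_coord d_def by metis
  qed
  then show "((\<lambda>m. ell2_norm I (\<lambda>i. spectral m x i - spectral l x i)) \<longlongrightarrow> 0) (at_right l)"
    using R.E_right[OF A[OF x], of l] by simp
  show "spectral l x = (\<lambda>i. 0)" if "l < 0"
    using R.E_neg[OF that A[OF x]] x by (simp add: spectral_def zero_l2.rep_eq)
  show "ell2_inner I (T x) x =
      of_real (LINT t|interval_measure (\<lambda>l. Re (ell2_inner I (spectral l x) x)). t)"
    using spectral_moments[OF x, of 1] ell2_inner_T_real[OF x] by simp
next
  obtain K where K: "\<And>l x. K \<le> l \<Longrightarrow> x \<in> supported I \<Longrightarrow> P.growth_projection l x = x"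
    using R.E_top by blast
  show "\<exists>K. \<forall>l\<ge>K. \<forall>x\<in>ell2 I. spectral l x = x"
    by (intro exI[of _ K] allI ballI impI) (simp add: spectral_def K Abs_l2_supported coord_Abs_l2)
qed (rule orth_projection_spectral)

text \<open>An arbitrary spectral family is transported to \<open>supported I\<close> as
  \<open>D\<close>. The weak integral formula turns it into a bounded resolution of the lifted
  operator, and \<open>bounded_resolution_unique\<close> identifies it with the growth
  projections.\<close>

lemma spectral_family_unique:
  assumes E: "spectral_family I T E"
  shows "E l = spectral l"
proof
  fix f
  note A = Abs_l2_supported
  note E' = E[unfolded spectral_family_def]
  have op: "orth_projection I (E l)" for l using E' by blast
  note op' = op[unfolded orth_projection_def]
  have e1: "E l x \<in> ell2 I" if "x \<in> ell2 I" for l x using op' that by blast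
  have e2: "E l (\<lambda>i. x i + y i) = (\<lambda>i. E l x i + E l y i)" if "x \<in> ell2 I" "y \<in> ell2 I" for l x y
    using op'[of l] that by blast
  have e3: "E l (\<lambda>i. c * x i) = (\<lambda>i. c * E l x i)" if "x \<in> ell2 I" for l x c
    using op'[of l] that by blast
  have e4: "E l (E l x) = E l x" if "x \<in> ell2 I" for l x using op'[of l] that by blast
  have e5: "ell2_inner I (E l x) y = ell2_inner I x (E l y)" if "x \<in> ell2 I" "y \<in> ell2 I" for l x y
    using op'[of l] that by blast
  have e6: "E l x = (\<lambda>i. 0)" if "x \<notin> ell2 I" for l x using op'[of l] that by blast
  have f1: "E m (E l x) = E l x" if "l \<le> m" "x \<in> ell2 I" for l m x using E' that by blast
  have f2: "((\<lambda>m. ell2_norm I (\<lambda>i. E m x i - E l x i)) \<longlongrightarrow> 0) (at_right l)" if "x \<in> ell2 I" for l x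
    using E' that by blast
  have f3: "E l x = (\<lambda>i. 0)" if "l < 0" "x \<in> ell2 I" for l x using E' that by blast
  have f4: "\<exists>K. \<forall>l\<ge>K. \<forall>x\<in>ell2 I. E l x = x" using E' by blast
  have f5: "ell2_inner I (T x) x = of_real (LINT t|interval_measure (\<lambda>l. Re (ell2_inner I (E l x) x)). t)"
    if "x \<in> ell2 I" for x using E' that by blast
  define D where "D l x = Abs_l2 (E l (coord x))" for l x
  have cD: "coord (D l x) = E l (coord x)" if "x \<in> supported I" for l x
    unfolding D_def by (rule coord_Abs_l2[OF e1[OF coord_supported[OF that]]])
  have DH: "D l x \<in> supported I" if "x \<in> supported I" for l x
    unfolding D_def by (rule A[OF e1[OF coord_supported[OF that]]])
  note cs = coord_supported
  have "resolution (supported I) D"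
  proof (rule resolution.intro)
    fix l m c :: real and x y assume x: "x \<in> supported I"
    show "D l x \<in> supported I" by (rule DH[OF x])
    show "D l (c *\<^sub>R x) = c *\<^sub>R D l x"
    proof -
      have "c *\<^sub>R x \<in> supported I" using x subspace_supported by (rule subspace_mul[rotated])
      moreover have "coord (c *\<^sub>R x) = (\<lambda>i. of_real c * coord x i)" by (simp add: coord_simps fun_eq_iff)
      ultimately show ?thesis using e3[OF cs[OF x]] by (intro l2_eqI) (simp add: cD x coord_simps)
    qed
    show "D l (D l x) = D l x" by (rule l2_eqI) (simp add: cD DH x e4 cs)
    show "D m (D l x) = D l x" if "l \<le> m" by (rule l2_eqI) (simp add: cD DH x f1 cs that)
    show "((\<lambda>m. norm (D m x - D l x)) \<longlongrightarrow> 0) (at_right l)"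
    proof -
      have "norm (D m x - D l x) = ell2_norm I (\<lambda>i. E m (coord x) i - E l (coord x) i)" for m
      proof -
        have "coord (D m x - D l x) = (\<lambda>i. E m (coord x) i - E l (coord x) i)"
          by (simp add: coord_simps cD x fun_eq_iff)
        then show ?thesis
          using ell2_norm_coord[of "D m x - D l x" I] DH[OF x] subspace_diff[OF subspace_supported] by metis
      qed
      then show ?thesis using f2[OF cs[OF x], of l] by simp
    qed
    show "D l x = 0" if "l < 0" using f3[OF that cs[OF x]] by (intro l2_eqI) (simp add: cD x coord_simps)
    assume y: "y \<in> supported I"
    show "D l (x + y) = D l x + D l y"
    proof -
      have "x + y \<in> supported I" by (rule subspace_add[OF subspace_supported x y])
      moreover have "coord (x + y) = (\<lambda>i. coord x i + coord y i)" by (simp add: coord_simps fun_eq_iff)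
      ultimately show ?thesis using e2[OF cs[OF x] cs[OF y]] by (intro l2_eqI) (simp add: cD x y coord_simps)
    qed
    show "D l x \<bullet> y = x \<bullet> D l y"
      using e5[OF cs[OF x] cs[OF y], of l] ell2_inner_coord[OF DH[OF x] y, of l] ell2_inner_coord[OF x DH[OF y], of l]
      by (simp add: cD x y inner_l2_def)
  next
    obtain K where K: "\<And>l x. K \<le> l \<Longrightarrow> x \<in> ell2 I \<Longrightarrow> E l x = x" using f4 by blast
    show "\<exists>K. \<forall>l\<ge>K. \<forall>x\<in>supported I. D l x = x"
      by (intro exI[of _ K] allI ballI impI) (simp add: D_def K cs Abs_l2_coord)
  qed (rule subspace_supported)
  moreover have "lift_T x \<bullet> x = (LINT t|interval_measure (\<lambda>t. D t x \<bullet> x). t)" if x: "x \<in> supported I" for x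
  proof -
    have "lift_T x \<bullet> x = Re (ell2_inner I (T (coord x)) (coord x))"
      by (simp add: inner_l2_def cinner_lift_T x)
    moreover have "Re (ell2_inner I (E t (coord x)) (coord x)) = D t x \<bullet> x" for t
      using ell2_inner_coord[OF DH[OF x] x, of t] by (simp add: cD x inner_l2_def)
    ultimately show ?thesis using f5[OF cs[OF x]] by simp
  qed
  ultimately have D: "bounded_resolution (supported I) D lift_T"
    by (intro bounded_resolutionI positive_operator_lift_T lift_T_supported)
  show "E l f = spectral l f"
  proof (cases "f \<in> ell2 I")
    case True
    have "coord (D l (Abs_l2 f)) = coord (P.growth_projection l (Abs_l2 f))"
      using bounded_resolution_unique[OF D P.bounded_resolution_growth_projection A[OF True]] by simp
    then show ?thesis using True by (simp add: cD A coord_Abs_l2 spectral_def)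
  qed (simp add: e6 spectral_def)
qed

theorem spectral_projection_eq: "spectral_projection I T l = spectral l"
  unfolding spectral_projection_def
proof (rule the_equality)
  show "\<exists>E. spectral_family I T E \<and> spectral l = E l" using spectral_family_spectral by blast
  show "P = spectral l" if "\<exists>E. spectral_family I T E \<and> P = E l" for P
    using that spectral_family_unique by blast
qed

text \<open>One K for all f is what allows the distribution functions of several unit vectors to be
  added later.\<close>

lemma spectral_distribution_function:
  "\<exists>K>0. \<forall>f\<in>ell2 I. distribution_function (\<lambda>l. Re (ell2_inner I (spectral l f) f)) K ((ell2_norm I f)\<^sup>2)"
proof -
  obtain K where K: "0 < K" "\<And>l x. K \<le> l \<Longrightarrow> x \<in> supported I \<Longrightarrow> P.growth_projection l x = x"
    using R.E_top_pos by blast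
  show ?thesis
  proof (intro exI[of _ K] conjI ballI K)
    fix f assume f: "f \<in> ell2 I"
    show "distribution_function (\<lambda>l. Re (ell2_inner I (spectral l f) f)) K ((ell2_norm I f)\<^sup>2)"
      using R.distribution_function_form[OF Abs_l2_supported[OF f] K(1)] K(2) f
      by (simp add: spectral_form ell2_norm_Abs power2_norm_eq_inner Abs_l2_supported)
  qed
qed

end

section \<open>Matrices over group rings\<close>

lemma has_sum_finite_sum:
  fixes f :: "'a \<Rightarrow> 'b \<Rightarrow> 'c::topological_comm_monoid_add"
  assumes "finite A" "\<And>a. a \<in> A \<Longrightarrow> (f a has_sum c a) B"
  shows "((\<lambda>b. \<Sum>a\<in>A. f a b) has_sum (\<Sum>a\<in>A. c a)) B"
  using assms by (induction A rule: finite_induct) (auto intro: has_sum_add)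

lemma has_sum_Times_finite:
  fixes f :: "'a \<times> 'b \<Rightarrow> 'c::topological_comm_monoid_add"
  assumes "finite A" "\<And>a. a \<in> A \<Longrightarrow> ((\<lambda>b. f (a, b)) has_sum c a) B"
  shows "(f has_sum (\<Sum>a\<in>A. c a)) (A \<times> B)"
proof -
  have "(f has_sum c a) (Pair a ` B)" if "a \<in> A" for a
    using assms(2)[OF that] by (subst has_sum_reindex) (auto simp: inj_on_def o_def)
  then have "(f has_sum (\<Sum>a\<in>A. c a)) (\<Union>a\<in>A. Pair a ` B)"
    by (intro sum_has_sum assms(1)) auto
  moreover have "(\<Union>a\<in>A. Pair a ` B) = A \<times> B" by auto
  ultimately show ?thesis by simp
qed

definition gr_entries :: "('g, 'm) monoid_scheme \<Rightarrow> nat \<Rightarrow> nat \<Rightarrow> 'g gr_mat \<Rightarrow> bool" where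
  "gr_entries G r s A \<longleftrightarrow> (\<forall>i<r. \<forall>j<s. A i j \<in> group_ring G)"

definition gr_one :: "('g, 'm) monoid_scheme \<Rightarrow> 'g gr_mat" where
  "gr_one G = (\<lambda>i j g. if i = j \<and> g = \<one>\<^bsub>G\<^esub> then 1 else 0)"

primrec gr_pow :: "('g, 'm) monoid_scheme \<Rightarrow> nat \<Rightarrow> 'g gr_mat \<Rightarrow> nat \<Rightarrow> 'g gr_mat" where
  "gr_pow G r C 0 = gr_one G"
| "gr_pow G r C (Suc k) = gr_mult G r (gr_pow G r C k) C"

context group
begin

lemma gr_entriesD:
  assumes "gr_entries G r s A" "i < r" "j < s"
  shows "finite {g. A i j g \<noteq> 0}" "A i j g \<noteq> 0 \<Longrightarrow> g \<in> carrier G"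
  using assms by (auto simp: gr_entries_def group_ring_def)

lemma gr_mult_support:
  assumes A: "gr_entries G r s A" and B: "gr_entries G s t B" and il: "i < r" "l < t"
  shows "{k. gr_mult G s A B i l k \<noteq> 0}
    \<subseteq> (\<Union>j<s. (\<lambda>(u, v). u \<otimes> v) ` ({u. A i j u \<noteq> 0} \<times> {v. B j l v \<noteq> 0}))"
proof
  fix k assume "k \<in> {k. gr_mult G s A B i l k \<noteq> 0}"
  then have ne: "gr_mult G s A B i l k \<noteq> 0" by simp
  then have k: "k \<in> carrier G" by (auto simp: gr_mult_def split: if_splits)
  with ne have "(\<Sum>j<s. \<Sum>u | A i j u \<noteq> 0. A i j u * B j l (inv u \<otimes> k)) \<noteq> 0" by (simp add: gr_mult_def)
  from sum.not_neutral_contains_not_neutral[OF this] obtain j where j: "j < s" "(\<Sum>u | A i j u \<noteq> 0. A i j u * B j l (inv u \<otimes> k)) \<noteq> 0"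
    by auto
  from sum.not_neutral_contains_not_neutral[OF j(2)] obtain u where u: "A i j u \<noteq> 0" "B j l (inv u \<otimes> k) \<noteq> 0"
    by auto
  have "u \<in> carrier G" using gr_entriesD(2)[OF A il(1) j(1) u(1)] .
  then have "k = u \<otimes> (inv u \<otimes> k)" using k by (simp add: m_assoc[symmetric])
  then show "k \<in> (\<Union>j<s. (\<lambda>(u, v). u \<otimes> v) ` ({u. A i j u \<noteq> 0} \<times> {v. B j l v \<noteq> 0}))"
    using j(1) u by force
qed

lemma gr_entries_mult:
  assumes A: "gr_entries G r s A" and B: "gr_entries G s t B"
  shows "gr_entries G r t (gr_mult G s A B)"
  unfolding gr_entries_def group_ring_def
proof (intro allI impI CollectI conjI)
  fix i l assume il: "i < r" "l < t"
  show "finite {g. gr_mult G s A B i l g \<noteq> 0}"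
    by (rule finite_subset[OF gr_mult_support[OF A B il]])
       (use gr_entriesD(1)[OF A il(1)] gr_entriesD(1)[OF B _ il(2)] in auto)
qed (auto simp: gr_mult_def split: if_splits)

lemma gr_adjoint_neq_0_iff: "gr_adjoint G A j i g \<noteq> 0 \<longleftrightarrow> g \<in> carrier G \<and> A i j (inv g) \<noteq> 0"
  by (simp add: gr_adjoint_def)

lemma gr_adjoint_support:
  assumes "gr_entries G r s A" "i < r" "j < s"
  shows "{g. gr_adjoint G A j i g \<noteq> 0} = m_inv G ` {g. A i j g \<noteq> 0}"
  using gr_entriesD(2)[OF assms] by (force simp: gr_adjoint_neq_0_iff image_iff)

lemma gr_entries_adjoint:
  assumes A: "gr_entries G r s A"
  shows "gr_entries G s r (gr_adjoint G A)"
  unfolding gr_entries_def group_ring_def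
  using gr_adjoint_support[OF A] gr_entriesD(1)[OF A] by (auto simp: gr_adjoint_neq_0_iff)

lemma gr_entries_one: "gr_entries G r r (gr_one G)"
  unfolding gr_entries_def group_ring_def by (auto simp: gr_one_def)

lemma gr_entries_pow: "gr_entries G r r C \<Longrightarrow> gr_entries G r r (gr_pow G r C k)"
  by (induction k) (auto intro: gr_entries_one gr_entries_mult)

text \<open>Summing over the support of a product against a weight \<phi> becomes a sum over pairs
  of support elements, although several pairs may have the same product and cancel. The weights used
  later are translates of a vector and indicators of a coset condition.\<close>

lemma sum_gr_mult:
  assumes A: "gr_entries G r s A" and B: "gr_entries G s t B" and il: "i < r" "l < t"
  shows "(\<Sum>k | gr_mult G s A B i l k \<noteq> 0. \<phi> k * gr_mult G s A B i l k)
    = (\<Sum>j<s. \<Sum>u | A i j u \<noteq> 0. \<Sum>v | B j l v \<noteq> 0. \<phi> (u \<otimes> v) * (A i j u * B j l v))"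
proof -
  note fA = gr_entriesD(1)[OF A il(1)] and fB = gr_entriesD(1)[OF B _ il(2)]
  note cA = gr_entriesD(2)[OF A il(1)] and cB = gr_entriesD(2)[OF B _ il(2)]
  define K where "K = (\<Union>j<s. (\<lambda>(u, v). u \<otimes> v) ` ({u. A i j u \<noteq> 0} \<times> {v. B j l v \<noteq> 0}))"
  have finK: "finite K" unfolding K_def using fA fB by auto
  have K: "K \<subseteq> carrier G" unfolding K_def using cA cB by auto
  have "(\<Sum>k | gr_mult G s A B i l k \<noteq> 0. \<phi> k * gr_mult G s A B i l k)
      = (\<Sum>k\<in>K. \<phi> k * gr_mult G s A B i l k)"
    by (rule sum.mono_neutral_left[OF finK]) (use gr_mult_support[OF A B il] in \<open>auto simp: K_def\<close>)
  also have "\<dots> = (\<Sum>k\<in>K. \<Sum>j<s. \<Sum>u | A i j u \<noteq> 0. \<phi> k * (A i j u * B j l (inv u \<otimes> k)))"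
    by (rule sum.cong) (use K in \<open>auto simp: gr_mult_def sum_distrib_left\<close>)
  also have "\<dots> = (\<Sum>j<s. \<Sum>u | A i j u \<noteq> 0. \<Sum>k\<in>K. \<phi> k * (A i j u * B j l (inv u \<otimes> k)))"
    by (subst sum.swap) (intro sum.cong refl sum.swap)
  also have "\<dots> = (\<Sum>j<s. \<Sum>u | A i j u \<noteq> 0. \<Sum>v | B j l v \<noteq> 0. \<phi> (u \<otimes> v) * (A i j u * B j l v))"
  proof (rule sum.cong[OF refl], rule sum.cong[OF refl])
    fix j u assume j: "j \<in> {..<s}" and u: "u \<in> {u. A i j u \<noteq> 0}"
    have ug: "u \<in> carrier G" using cA[of j u] j u by simp
    have inj: "inj_on (\<lambda>v. u \<otimes> v) {v. B j l v \<noteq> 0}"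
      using ug cB[of j] j by (intro inj_onI) auto
    have "(\<Sum>v | B j l v \<noteq> 0. \<phi> (u \<otimes> v) * (A i j u * B j l v))
        = (\<Sum>v | B j l v \<noteq> 0. \<phi> (u \<otimes> v) * (A i j u * B j l (inv u \<otimes> (u \<otimes> v))))"
      by (rule sum.cong) (use ug cB[of j] j in \<open>auto simp: m_assoc[symmetric]\<close>)
    also have "\<dots> = (\<Sum>k\<in>(\<lambda>v. u \<otimes> v) ` {v. B j l v \<noteq> 0}. \<phi> k * (A i j u * B j l (inv u \<otimes> k)))"
      by (subst sum.reindex[OF inj]) (simp add: o_def)
    also have "\<dots> = (\<Sum>k\<in>K. \<phi> k * (A i j u * B j l (inv u \<otimes> k)))"
    proof (rule sum.mono_neutral_left[OF finK])
      show "(\<lambda>v. u \<otimes> v) ` {v. B j l v \<noteq> 0} \<subseteq> K" using j u by (auto simp: K_def)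
      show "\<forall>k\<in>K - (\<lambda>v. u \<otimes> v) ` {v. B j l v \<noteq> 0}. \<phi> k * (A i j u * B j l (inv u \<otimes> k)) = 0"
      proof
        fix k assume k: "k \<in> K - (\<lambda>v. u \<otimes> v) ` {v. B j l v \<noteq> 0}"
        then have "k = u \<otimes> (inv u \<otimes> k)" using ug K by (auto simp: m_assoc[symmetric])
        then have "B j l (inv u \<otimes> k) = 0" using k by blast
        then show "\<phi> k * (A i j u * B j l (inv u \<otimes> k)) = 0" by simp
      qed
    qed
    finally show "(\<Sum>k\<in>K. \<phi> k * (A i j u * B j l (inv u \<otimes> k)))
      = (\<Sum>v | B j l v \<noteq> 0. \<phi> (u \<otimes> v) * (A i j u * B j l v))" by simp
  qed
  finally show ?thesis .
qed

lemma gr_rmult_mult: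
  assumes A: "gr_entries G r s A" and B: "gr_entries G s t B"
  shows "gr_rmult G r t (gr_mult G s A B) x = gr_rmult G s t B (gr_rmult G r s A x)"
proof
  fix p show "gr_rmult G r t (gr_mult G s A B) x p = gr_rmult G s t B (gr_rmult G r s A x) p"
  proof (cases "p \<in> gr_index G t")
    case False then show ?thesis by (cases p) (auto simp: gr_rmult_def)
  next
    case True
    then obtain l h where p: "p = (l, h)" "l < t" "h \<in> carrier G" by (auto simp: gr_index_def)
    have "gr_rmult G r t (gr_mult G s A B) x p
       = (\<Sum>i<r. \<Sum>j<s. \<Sum>u | A i j u \<noteq> 0. \<Sum>v | B j l v \<noteq> 0. x (i, h \<otimes> inv (u \<otimes> v)) * (A i j u * B j l v))"
      using True p by (simp add: gr_rmult_def sum_gr_mult[OF A B _ p(2)])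
    also have "\<dots> = (\<Sum>i<r. \<Sum>j<s. \<Sum>u | A i j u \<noteq> 0. \<Sum>v | B j l v \<noteq> 0.
        x (i, h \<otimes> inv v \<otimes> inv u) * A i j u * B j l v)"
    proof (intro sum.cong refl)
      fix i j u v assume "i \<in> {..<r}" "j \<in> {..<s}" "u \<in> {u. A i j u \<noteq> 0}" "v \<in> {v. B j l v \<noteq> 0}"
      then have "u \<in> carrier G" "v \<in> carrier G"
        using gr_entriesD(2)[OF A] gr_entriesD(2)[OF B _ p(2)] by auto
      then show "x (i, h \<otimes> inv (u \<otimes> v)) * (A i j u * B j l v) = x (i, h \<otimes> inv v \<otimes> inv u) * A i j u * B j l v"
        using p(3) by (simp add: inv_mult_group m_assoc)
    qed
    also have "\<dots> = (\<Sum>j<s. \<Sum>i<r. \<Sum>u | A i j u \<noteq> 0. \<Sum>v | B j l v \<noteq> 0.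
        x (i, h \<otimes> inv v \<otimes> inv u) * A i j u * B j l v)" by (rule sum.swap)
    also have "\<dots> = (\<Sum>j<s. \<Sum>i<r. \<Sum>v | B j l v \<noteq> 0. \<Sum>u | A i j u \<noteq> 0.
        x (i, h \<otimes> inv v \<otimes> inv u) * A i j u * B j l v)" by (intro sum.cong refl sum.swap)
    also have "\<dots> = (\<Sum>j<s. \<Sum>v | B j l v \<noteq> 0. \<Sum>i<r. \<Sum>u | A i j u \<noteq> 0.
        x (i, h \<otimes> inv v \<otimes> inv u) * A i j u * B j l v)" by (intro sum.cong refl sum.swap)
    also have "\<dots> = gr_rmult G s t B (gr_rmult G r s A x) p"
    proof -
      have "h \<otimes> inv v \<in> carrier G" if "j < s" "B j l v \<noteq> 0" for j v
        using gr_entriesD(2)[OF B that(1) p(2) that(2)] p(3) by simp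
      then show ?thesis using True p by (auto simp: gr_rmult_def gr_index_def sum_distrib_right intro!: sum.cong)
    qed
    finally show ?thesis .
  qed
qed

text \<open>Right multiplication acts on a row of a matrix as the matrix product does. Iterated on
  the unit vectors it identifies the powers of the operator with the rows of
  \<open>gr_pow\<close>.\<close>

lemma gr_rmult_row:
  assumes Y: "gr_entries G q r Y" and C: "gr_entries G r t C" and i: "i < q"
  shows "gr_rmult G r t C (\<lambda>(j, h). if (j, h) \<in> gr_index G r then Y i j h else 0)
    = (\<lambda>(l, h). if (l, h) \<in> gr_index G t then gr_mult G r Y C i l h else 0)"
proof (rule ext, clarify)
  fix l h
  show "gr_rmult G r t C (\<lambda>(j, h). if (j, h) \<in> gr_index G r then Y i j h else 0) (l, h)
    = (if (l, h) \<in> gr_index G t then gr_mult G r Y C i l h else 0)"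
  proof (cases "(l, h) \<in> gr_index G t")
    case False then show ?thesis by (auto simp: gr_rmult_def)
  next
    case True
    then have lh: "l < t" "h \<in> carrier G" by (auto simp: gr_index_def)
    have "(\<Sum>k | C j l k \<noteq> 0. (if h \<otimes> inv k \<in> carrier G then Y i j (h \<otimes> inv k) else 0) * C j l k)
        = (\<Sum>u | Y i j u \<noteq> 0. Y i j u * C j l (inv u \<otimes> h))" if j: "j < r" for j
    proof -
      have e1: "inv (h \<otimes> inv k) \<otimes> h = k" if "k \<in> carrier G" for k
        using that lh by (simp add: inv_mult_group m_assoc)
      have e2: "h \<otimes> inv (inv u \<otimes> h) = u" if "u \<in> carrier G" for u
        using that lh by (simp add: inv_mult_group m_assoc[symmetric])
      note cX = gr_entriesD(2)[OF Y i j] and cC = gr_entriesD(2)[OF C j lh(1)]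
      have "(\<Sum>k | C j l k \<noteq> 0. (if h \<otimes> inv k \<in> carrier G then Y i j (h \<otimes> inv k) else 0) * C j l k)
          = (\<Sum>k | C j l k \<noteq> 0 \<and> Y i j (h \<otimes> inv k) \<noteq> 0. Y i j (h \<otimes> inv k) * C j l k)"
        by (rule sum.mono_neutral_cong_right) (use gr_entriesD(1)[OF C j lh(1)] cC lh in auto)
      also have "\<dots> = (\<Sum>u | Y i j u \<noteq> 0 \<and> C j l (inv u \<otimes> h) \<noteq> 0. Y i j u * C j l (inv u \<otimes> h))"
        by (rule sum.reindex_bij_witness[where i = "\<lambda>u. inv u \<otimes> h" and j = "\<lambda>k. h \<otimes> inv k"])
           (use cX cC e1 e2 in auto)
      also have "\<dots> = (\<Sum>u | Y i j u \<noteq> 0. Y i j u * C j l (inv u \<otimes> h))"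
        by (rule sum.mono_neutral_left) (use gr_entriesD(1)[OF Y i j] in auto)
      finally show ?thesis .
    qed
    then show ?thesis using True lh
      by (simp add: gr_rmult_def gr_mult_def gr_index_def)
  qed
qed

lemma bij_betw_rmult: "k \<in> carrier G \<Longrightarrow> bij_betw (\<lambda>h. h \<otimes> k) (carrier G) (carrier G)"
  by (rule bij_betw_byWitness[where f' = "\<lambda>h. h \<otimes> inv k"]) (auto simp: m_assoc)

text \<open>Each coordinate of x A is a finite combination of right translates of x. Cauchy-Schwarz
  over the support of A bounds its square, and translation is injective, so each translate
  contributes at most the squared norm of x. Stating the bound for finite sets yields summability
  and the norm estimate at once.\<close>

lemma gr_rmult_square_summable:
  assumes A: "gr_entries G r s A"
  shows "\<exists>B\<ge>0. \<forall>x\<in>ell2 (gr_index G r). \<forall>F. finite F \<longrightarrow> F \<subseteq> gr_index G s \<longrightarrow>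
    (\<Sum>p\<in>F. (cmod (gr_rmult G r s A x p))\<^sup>2) \<le> B\<^sup>2 * (ell2_norm (gr_index G r) x)\<^sup>2"
proof -
  define P where "P j = (SIGMA i:{..<r}. {k. A i j k \<noteq> 0})" for j
  have finP: "finite (P j)" if "j < s" for j
    unfolding P_def using gr_entriesD(1)[OF A _ that] by (intro finite_SigmaI) auto
  define w where "w j = (\<Sum>(i,k)\<in>P j. (cmod (A i j k))\<^sup>2)" for j
  have w: "w j \<ge> 0" for j unfolding w_def by (intro sum_nonneg) auto
  define B where "B = sqrt (\<Sum>j<s. w j * real (card (P j)))"
  have B: "B \<ge> 0" "B\<^sup>2 = (\<Sum>j<s. w j * real (card (P j)))"
    unfolding B_def using w by (auto intro!: sum_nonneg)
  show ?thesis
  proof (intro exI[of _ B] conjI ballI allI impI B(1))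
    fix x F assume x: "x \<in> ell2 (gr_index G r)" and F: "finite F" "F \<subseteq> gr_index G s"
    define N where "N = (ell2_norm (gr_index G r) x)\<^sup>2"
    have sx: "(\<lambda>p. (cmod (x p))\<^sup>2) summable_on gr_index G r" using x by (simp add: ell2_def)
    have N: "N = (\<Sum>\<^sub>\<infinity>p\<in>gr_index G r. (cmod (x p))\<^sup>2)"
      by (simp add: N_def ell2_norm_def infsum_nonneg)
    have fin_le: "(\<Sum>p\<in>S. (cmod (x p))\<^sup>2) \<le> N" if "finite S" "S \<subseteq> gr_index G r" for S
      unfolding N by (rule finite_sum_le_infsum[OF sx]) (use that in auto)
    define Fj where "Fj j = {h. (j, h) \<in> F}" for j
    have Fj: "finite (Fj j)" "Fj j \<subseteq> carrier G" for j
      using F finite_vimageI[OF F(1), of "Pair j"] by (auto simp: Fj_def gr_index_def vimage_def inj_on_def)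
    have Feq: "F = (SIGMA j:{..<s}. Fj j)" using F(2) by (auto simp: Fj_def gr_index_def)
    have bound: "(cmod (gr_rmult G r s A x (j, h)))\<^sup>2 \<le> w j * (\<Sum>(i,k)\<in>P j. (cmod (x (i, h \<otimes> inv k)))\<^sup>2)"
      if "j < s" "h \<in> carrier G" for j h
    proof -
      have "gr_rmult G r s A x (j, h) = (\<Sum>(i,k)\<in>P j. x (i, h \<otimes> inv k) * A i j k)"
        unfolding P_def using that gr_entriesD(1)[OF A _ that(1)]
        by (subst sum.Sigma[symmetric]) (auto simp: gr_rmult_def gr_index_def)
      then have "cmod (gr_rmult G r s A x (j, h)) \<le> (\<Sum>(i,k)\<in>P j. cmod (A i j k) * cmod (x (i, h \<otimes> inv k)))"
        by (simp add: case_prod_unfold) (rule sum_norm_le, simp add: norm_mult)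
      then have "(cmod (gr_rmult G r s A x (j, h)))\<^sup>2 \<le> (\<Sum>(i,k)\<in>P j. cmod (A i j k) * cmod (x (i, h \<otimes> inv k)))\<^sup>2"
        by (rule power_mono) simp
      also have "\<dots> \<le> w j * (\<Sum>(i,k)\<in>P j. (cmod (x (i, h \<otimes> inv k)))\<^sup>2)"
        unfolding w_def using Cauchy_Schwarz_ineq_sum[of "\<lambda>(i,k). cmod (A i j k)" "\<lambda>(i,k). cmod (x (i, h \<otimes> inv k))" "P j"]
        by (simp add: case_prod_unfold)
      finally show ?thesis .
    qed
    have "(\<Sum>p\<in>F. (cmod (gr_rmult G r s A x p))\<^sup>2) = (\<Sum>j<s. \<Sum>h\<in>Fj j. (cmod (gr_rmult G r s A x (j, h)))\<^sup>2)"
      unfolding Feq using Fj by (subst sum.Sigma) auto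
    also have "\<dots> \<le> (\<Sum>j<s. \<Sum>h\<in>Fj j. w j * (\<Sum>(i,k)\<in>P j. (cmod (x (i, h \<otimes> inv k)))\<^sup>2))"
      using Fj by (intro sum_mono bound) auto
    also have "\<dots> = (\<Sum>j<s. w j * (\<Sum>(i,k)\<in>P j. \<Sum>h\<in>Fj j. (cmod (x (i, h \<otimes> inv k)))\<^sup>2))"
      unfolding sum_distrib_left[symmetric] case_prod_unfold by (subst sum.swap) simp
    also have "\<dots> \<le> (\<Sum>j<s. w j * (\<Sum>(i,k)\<in>P j. N))"
    proof (rule sum_mono, rule mult_left_mono[OF _ w], rule sum_mono)
      fix j p assume j: "j \<in> {..<s}" and p: "p \<in> P j"
      obtain i k where [simp]: "p = (i, k)" by (cases p)
      have ik: "i < r" "k \<in> carrier G" using p j gr_entriesD(2)[OF A] by (auto simp: P_def)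
      have inj: "inj_on (\<lambda>h. (i, h \<otimes> inv k)) (Fj j)"
        using inj_on_subset[OF bij_betw_imp_inj_on[OF bij_betw_rmult[OF inv_closed[OF ik(2)]]] Fj(2)[of j]]
        by (auto simp: inj_on_def)
      have "(\<Sum>h\<in>Fj j. (cmod (x (i, h \<otimes> inv k)))\<^sup>2) = (\<Sum>p\<in>(\<lambda>h. (i, h \<otimes> inv k)) ` Fj j. (cmod (x p))\<^sup>2)"
        by (subst sum.reindex[OF inj]) simp
      also have "\<dots> \<le> N" by (rule fin_le) (use Fj ik in \<open>auto simp: gr_index_def\<close>)
      finally show "(case p of (i, k) \<Rightarrow> \<Sum>h\<in>Fj j. (cmod (x (i, h \<otimes> inv k)))\<^sup>2) \<le> (case p of (i, k) \<Rightarrow> N)"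
        by simp
    qed
    also have "\<dots> = B\<^sup>2 * N" by (simp add: B(2) sum_distrib_left mult_ac case_prod_unfold)
    finally show "(\<Sum>p\<in>F. (cmod (gr_rmult G r s A x p))\<^sup>2) \<le> B\<^sup>2 * (ell2_norm (gr_index G r) x)\<^sup>2"
      by (simp add: N_def)
  qed
qed

lemma gr_rmult_ell2:
  assumes A: "gr_entries G r s A" and x: "x \<in> ell2 (gr_index G r)"
  shows "gr_rmult G r s A x \<in> ell2 (gr_index G s)"
proof -
  obtain B where B: "\<And>F. finite F \<Longrightarrow> F \<subseteq> gr_index G s \<Longrightarrow>
    (\<Sum>p\<in>F. (cmod (gr_rmult G r s A x p))\<^sup>2) \<le> B\<^sup>2 * (ell2_norm (gr_index G r) x)\<^sup>2"
    using gr_rmult_square_summable[OF A] x by blast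
  have "(\<lambda>p. (cmod (gr_rmult G r s A x p))\<^sup>2) summable_on gr_index G s"
    by (rule nonneg_bdd_above_summable_on) (auto intro!: bdd_aboveI B)
  then show ?thesis by (auto simp: ell2_def gr_rmult_def)
qed

lemma gr_rmult_bounded:
  assumes A: "gr_entries G r s A"
  shows "\<exists>B\<ge>0. \<forall>x\<in>ell2 (gr_index G r). ell2_norm (gr_index G s) (gr_rmult G r s A x) \<le> B * ell2_norm (gr_index G r) x"
proof -
  obtain B where B: "B \<ge> 0" "\<And>x F. x \<in> ell2 (gr_index G r) \<Longrightarrow> finite F \<Longrightarrow> F \<subseteq> gr_index G s \<Longrightarrow>
    (\<Sum>p\<in>F. (cmod (gr_rmult G r s A x p))\<^sup>2) \<le> B\<^sup>2 * (ell2_norm (gr_index G r) x)\<^sup>2"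
    using gr_rmult_square_summable[OF A] by blast
  show ?thesis
  proof (intro exI[of _ B] conjI ballI B(1))
    fix x assume x: "x \<in> ell2 (gr_index G r)"
    have s: "(\<lambda>p. (cmod (gr_rmult G r s A x p))\<^sup>2) summable_on gr_index G s"
      using gr_rmult_ell2[OF A x] by (simp add: ell2_def)
    have "(\<Sum>\<^sub>\<infinity>p\<in>gr_index G s. (cmod (gr_rmult G r s A x p))\<^sup>2) \<le> B\<^sup>2 * (ell2_norm (gr_index G r) x)\<^sup>2"
      by (rule infsum_le_finite_sums[OF s]) (use B(2)[OF x] in auto)
    then have "ell2_norm (gr_index G s) (gr_rmult G r s A x) \<le> sqrt (B\<^sup>2 * (ell2_norm (gr_index G r) x)\<^sup>2)"
      unfolding ell2_norm_def[of "gr_index G s"] by simp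
    also have "\<dots> = B * ell2_norm (gr_index G r) x"
      using B(1) by (simp add: real_sqrt_mult ell2_norm_def infsum_nonneg)
    finally show "ell2_norm (gr_index G s) (gr_rmult G r s A x) \<le> B * ell2_norm (gr_index G r) x" .
  qed
qed

text \<open>Both inner products equal the finite sum of A i j k times the correlation
  \<open>c i j k\<close> of x and y at shift k; the two forms of c differ by the translation h -> h
  inv k.\<close>

lemma gr_rmult_adjoint:
  assumes A: "gr_entries G r s A" and x: "x \<in> ell2 (gr_index G r)" and y: "y \<in> ell2 (gr_index G s)"
  shows "ell2_inner (gr_index G s) (gr_rmult G r s A x) y
    = ell2_inner (gr_index G r) x (gr_rmult G s r (gr_adjoint G A) y)"
proof -
  define c where "c i j k = (\<Sum>\<^sub>\<infinity>h\<in>carrier G. x (i, h) * cnj (y (j, h \<otimes> k)))" for i j k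
  have sx: "(\<lambda>h. (cmod (x (i, h)))\<^sup>2) summable_on carrier G" if "i < r" for i
  proof -
    have "(\<lambda>p. (cmod (x p))\<^sup>2) summable_on Pair i ` carrier G"
      by (rule summable_on_subset_banach[of _ "gr_index G r"]) (use x that in \<open>auto simp: ell2_def gr_index_def\<close>)
    then show ?thesis by (subst (asm) summable_on_reindex) (auto simp: inj_on_def o_def)
  qed
  have sy: "(\<lambda>h. (cmod (y (j, h \<otimes> k)))\<^sup>2) summable_on carrier G" if "j < s" "k \<in> carrier G" for j k
  proof -
    have "(\<lambda>p. (cmod (y p))\<^sup>2) summable_on Pair j ` carrier G"
      by (rule summable_on_subset_banach[of _ "gr_index G s"]) (use y that in \<open>auto simp: ell2_def gr_index_def\<close>)
    then have "(\<lambda>h. (cmod (y (j, h)))\<^sup>2) summable_on carrier G"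
      by (subst (asm) summable_on_reindex) (auto simp: inj_on_def o_def)
    then show ?thesis
      using summable_on_reindex_bij_betw[OF bij_betw_rmult[OF that(2)], of "\<lambda>h. (cmod (y (j, h)))\<^sup>2"] by simp
  qed
  have c1: "((\<lambda>h. x (i, h) * cnj (y (j, h \<otimes> k))) has_sum c i j k) (carrier G)"
    if "i < r" "j < s" "k \<in> carrier G" for i j k
    unfolding c_def by (rule has_sum_infsum) (rule square_summable_prod[OF sx[OF that(1)] sy[OF that(2,3)]])
  have c2: "((\<lambda>h. x (i, h \<otimes> inv k) * cnj (y (j, h))) has_sum c i j k) (carrier G)"
    if "i < r" "j < s" "k \<in> carrier G" for i j k
  proof -
    have "((\<lambda>h. x (i, h \<otimes> inv k) * cnj (y (j, h \<otimes> inv k \<otimes> k))) has_sum c i j k) (carrier G)"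
      using c1[OF that] has_sum_reindex_bij_betw[OF bij_betw_rmult[of "inv k"],
          of "\<lambda>h. x (i, h) * cnj (y (j, h \<otimes> k))"] that by simp
    then show ?thesis by (rule has_sum_cong[THEN iffD1, rotated]) (use that in \<open>simp add: m_assoc\<close>)
  qed
  have "((\<lambda>p. gr_rmult G r s A x p * cnj (y p)) has_sum
      (\<Sum>j<s. \<Sum>i<r. \<Sum>k | A i j k \<noteq> 0. A i j k * c i j k)) ({..<s} \<times> carrier G)"
  proof (rule has_sum_Times_finite)
    fix j assume j: "j \<in> {..<s}"
    have "((\<lambda>h. \<Sum>i<r. \<Sum>k | A i j k \<noteq> 0. A i j k * (x (i, h \<otimes> inv k) * cnj (y (j, h)))) has_sum
      (\<Sum>i<r. \<Sum>k | A i j k \<noteq> 0. A i j k * c i j k)) (carrier G)"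
      using j gr_entriesD[OF A] by (intro has_sum_finite_sum has_sum_cmult_right c2) auto
    then show "((\<lambda>h. gr_rmult G r s A x (j, h) * cnj (y (j, h))) has_sum
      (\<Sum>i<r. \<Sum>k | A i j k \<noteq> 0. A i j k * c i j k)) (carrier G)"
      by (rule has_sum_cong[THEN iffD1, rotated])
         (use j in \<open>simp add: gr_rmult_def gr_index_def sum_distrib_left sum_distrib_right mult_ac\<close>)
  qed simp
  then have 1: "ell2_inner (gr_index G s) (gr_rmult G r s A x) y
      = (\<Sum>j<s. \<Sum>i<r. \<Sum>k | A i j k \<noteq> 0. A i j k * c i j k)"
    unfolding ell2_inner_def gr_index_def by (rule infsumI)
  have "((\<lambda>p. x p * cnj (gr_rmult G s r (gr_adjoint G A) y p)) has_sum
      (\<Sum>i<r. \<Sum>j<s. \<Sum>k | A i j k \<noteq> 0. A i j k * c i j k)) ({..<r} \<times> carrier G)"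
  proof (rule has_sum_Times_finite)
    fix i assume i: "i \<in> {..<r}"
    have *: "(\<Sum>k | gr_adjoint G A j i k \<noteq> 0. y (j, h \<otimes> inv k) * gr_adjoint G A j i k)
        = (\<Sum>k | A i j k \<noteq> 0. y (j, h \<otimes> k) * cnj (A i j k))" if j: "j < s" for j h
    proof -
      have ii: "i < r" using i by simp
      note cA = gr_entriesD(2)[OF A ii j]
      have inj: "inj_on (m_inv G) {k. A i j k \<noteq> 0}" using cA by (auto intro!: inj_onI dest: inv_inj[THEN inj_onD])
      show ?thesis unfolding gr_adjoint_support[OF A ii j] sum.reindex[OF inj] o_def
        by (rule sum.cong) (use cA in \<open>auto simp: gr_adjoint_def\<close>)
    qed
    have "((\<lambda>h. \<Sum>j<s. \<Sum>k | A i j k \<noteq> 0. A i j k * (x (i, h) * cnj (y (j, h \<otimes> k)))) has_sum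
      (\<Sum>j<s. \<Sum>k | A i j k \<noteq> 0. A i j k * c i j k)) (carrier G)"
      using i gr_entriesD[OF A] by (intro has_sum_finite_sum has_sum_cmult_right c1) auto
    then show "((\<lambda>h. x (i, h) * cnj (gr_rmult G s r (gr_adjoint G A) y (i, h))) has_sum
      (\<Sum>j<s. \<Sum>k | A i j k \<noteq> 0. A i j k * c i j k)) (carrier G)"
    proof (rule has_sum_cong[THEN iffD1, rotated])
      fix h assume h: "h \<in> carrier G"
      have "gr_rmult G s r (gr_adjoint G A) y (i, h)
          = (\<Sum>j<s. \<Sum>k | A i j k \<noteq> 0. y (j, h \<otimes> k) * cnj (A i j k))"
        using i h by (simp add: gr_rmult_def gr_index_def *)
      then show "(\<Sum>j<s. \<Sum>k | A i j k \<noteq> 0. A i j k * (x (i, h) * cnj (y (j, h \<otimes> k))))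
          = x (i, h) * cnj (gr_rmult G s r (gr_adjoint G A) y (i, h))"
        by (simp add: sum_distrib_left mult_ac)
    qed
  qed simp
  then have 2: "ell2_inner (gr_index G r) x (gr_rmult G s r (gr_adjoint G A) y)
      = (\<Sum>i<r. \<Sum>j<s. \<Sum>k | A i j k \<noteq> 0. A i j k * c i j k)"
    unfolding ell2_inner_def gr_index_def by (rule infsumI)
  show ?thesis unfolding 1 2 by (rule sum.swap)
qed

end

section \<open>The spectral distribution function\<close>

context group
begin

text \<open>Since x (A B) = (x A) B, the operator is right multiplication by A followed by its
  adjoint, so its form at f is the squared norm of f A.\<close>

lemma positive_ell2_operator_gr_rmult:
  assumes A: "gr_entries G r s A"
  shows "positive_ell2_operator (gr_index G r) (gr_rmult G r r (gr_mult G s A (gr_adjoint G A)))"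
proof
  let ?I = "gr_index G r" and ?T = "gr_rmult G r r (gr_mult G s A (gr_adjoint G A))"
  note A' = gr_entries_adjoint[OF A]
  have T: "?T x = gr_rmult G s r (gr_adjoint G A) (gr_rmult G r s A x)" for x
    by (rule gr_rmult_mult[OF A A'])
  fix f g :: "nat \<times> 'a \<Rightarrow> complex" and c assume f: "f \<in> ell2 ?I"
  show "?T f \<in> ell2 ?I" unfolding T by (intro gr_rmult_ell2 A A' f)
  show "?T (\<lambda>i. c * f i) = (\<lambda>i. c * ?T f i)"
    by (auto simp: gr_rmult_def sum_distrib_left mult.assoc)
  have adj: "ell2_inner ?I (?T f) g = ell2_inner (gr_index G s) (gr_rmult G r s A f) (gr_rmult G r s A g)"
    if g: "g \<in> ell2 ?I" and f: "f \<in> ell2 ?I" for f g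
  proof -
    have "ell2_inner (gr_index G s) (gr_rmult G r s A g) (gr_rmult G r s A f) = ell2_inner ?I g (?T f)"
      unfolding T by (rule gr_rmult_adjoint[OF A g gr_rmult_ell2[OF A f]])
    moreover have "ell2_inner J u v = cnj (ell2_inner J v u)" for J :: "(nat \<times> 'a) set" and u v
      unfolding ell2_inner_def by (subst infsum_cnj[symmetric]) (simp add: mult.commute)
    ultimately show ?thesis by metis
  qed
  show "0 \<le> Re (ell2_inner ?I (?T f) f)"
  proof -
    define u where "u = gr_rmult G r s A f"
    have eq: "ell2_inner ?I (?T f) f = (\<Sum>\<^sub>\<infinity>p\<in>gr_index G s. of_real ((cmod (u p))\<^sup>2))"
      unfolding adj[OF f f] by (simp add: ell2_inner_def u_def complex_norm_square del: of_real_power)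
    have "((\<lambda>p. complex_of_real ((cmod (u p))\<^sup>2)) has_sum
        complex_of_real (\<Sum>\<^sub>\<infinity>p\<in>gr_index G s. (cmod (u p))\<^sup>2)) (gr_index G s)"
      unfolding has_sum_of_real_iff using gr_rmult_ell2[OF A f]
      by (intro has_sum_infsum) (simp add: ell2_def u_def)
    from eq infsumI[OF this]
    show ?thesis by (simp add: infsum_nonneg del: of_real_power)
  qed
  assume g: "g \<in> ell2 ?I"
  show "?T (\<lambda>i. f i + g i) = (\<lambda>i. ?T f i + ?T g i)"
    by (auto simp: gr_rmult_def sum.distrib distrib_right)
  show "ell2_inner ?I (?T f) g = ell2_inner ?I f (?T g)"
    unfolding adj[OF g f] unfolding T by (rule gr_rmult_adjoint[OF A f gr_rmult_ell2[OF A g]])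
next
  let ?I = "gr_index G r" and ?T = "gr_rmult G r r (gr_mult G s A (gr_adjoint G A))"
  show "\<exists>B. \<forall>f\<in>ell2 ?I. ell2_norm ?I (?T f) \<le> B * ell2_norm ?I f"
    using gr_rmult_bounded[OF gr_entries_mult[OF A gr_entries_adjoint[OF A]]] by blast
qed

lemma distribution_function_sum:
  assumes "\<And>i::nat. i < r \<Longrightarrow> distribution_function (F i) K (1::real)" and K: "0 < K"
  shows "distribution_function (\<lambda>t. \<Sum>i<r. F i t) K (real r)"
proof
  fix x y :: real assume "x \<le> y"
  then show "(\<Sum>i<r. F i x) \<le> (\<Sum>i<r. F i y)"
    using assms by (intro sum_mono) (auto dest: distribution_function.F_mono)
next
  show "continuous (at_right a) (\<lambda>t. \<Sum>i<r. F i t)" for a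
    using assms by (intro continuous_sum) (auto dest: distribution_function.F_right_cont)
next
  show "(\<Sum>i<r. F i t) = 0" if "t < 0" for t
    using assms(1) that by (intro sum.neutral) (auto dest: distribution_function.F_neg)
  have "(\<Sum>i<r. F i t) = (\<Sum>i<r. 1)" if "K \<le> t" for t
    using assms(1) that by (intro sum.cong) (auto dest: distribution_function.F_top)
  then show "(\<Sum>i<r. F i t) = real r" if "K \<le> t" for t using that by simp
qed (rule K)

text \<open>Riemann-Stieltjes sums are linear in the distribution function, so additivity of the
  integral in the measure follows by passing to the limit on both sides.\<close>

lemma integral_distribution_function_sum:
  fixes g :: "real \<Rightarrow> real"
  assumes F: "\<And>i::nat. i < r \<Longrightarrow> distribution_function (F i) K (1::real)" and K: "0 < K"
    and g: "continuous_on UNIV g"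
  shows "(LINT t|interval_measure (\<lambda>t. \<Sum>i<r. F i t). g t) = (\<Sum>i<r. LINT t|interval_measure (F i). g t)"
proof -
  interpret S: distribution_function "\<lambda>t. \<Sum>i<r. F i t" K "real r"
    by (rule distribution_function_sum[OF F K])
  define s where "s N j = real j * K / real N" for N j :: nat
  have s: "real j * K / real N \<le> s N j \<and> s N j \<le> real (Suc j) * K / real N" for N j
    using K unfolding s_def by (intro conjI divide_right_mono mult_right_mono) auto
  have eq: "S.rs_sum s g = (\<lambda>N. \<Sum>i<r. distribution_function.rs_sum (F i) K s g N)"
  proof
    fix N
    have "(\<Sum>i<r. distribution_function.rs_sum (F i) K s g N)
      = (\<Sum>i<r. g 0 * F i 0 + (\<Sum>j<N. g (s N j) * (F i (real (Suc j) * K / real N) - F i (real j * K / real N))))"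
      by (rule sum.cong[OF refl]) (use F in \<open>simp add: distribution_function.rs_sum_def[OF F]\<close>)
    also have "\<dots> = S.rs_sum s g N"
      unfolding S.rs_sum_def sum.distrib sum_subtractf[symmetric] sum_distrib_left
      by (subst sum.swap) simp
    finally show "S.rs_sum s g N = (\<Sum>i<r. distribution_function.rs_sum (F i) K s g N)" by simp
  qed
  have "S.rs_sum s g \<longlonglongrightarrow> (\<Sum>i<r. LINT t|interval_measure (F i). g t)"
    unfolding eq by (intro tendsto_sum distribution_function.rs_sum_tendsto[OF F s g]) simp
  then show ?thesis using S.rs_sum_tendsto[OF s g] LIMSEQ_unique by blast
qed

lemma unit_vector:
  assumes "i < r"
  defines "\<delta> \<equiv> indicator {(i, \<one>)} :: nat \<times> 'a \<Rightarrow> complex"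
  shows "\<delta> \<in> ell2 (gr_index G r)" "ell2_inner (gr_index G r) f \<delta> = f (i, \<one>)" "ell2_norm (gr_index G r) \<delta> = 1"
proof -
  have mem: "(i, \<one>) \<in> gr_index G r" using assms by (simp add: gr_index_def)
  have s: "((\<lambda>p. (cmod (\<delta> p))\<^sup>2) has_sum 1) (gr_index G r)"
    by (subst has_sum_cong_neutral[where T = "{(i, \<one>)}" and g = "\<lambda>_. 1"])
       (use mem in \<open>auto simp: \<delta>_def indicator_def intro: has_sum_finiteI\<close>)
  show "\<delta> \<in> ell2 (gr_index G r)"
    using has_sum_imp_summable[OF s] mem by (auto simp: ell2_def \<delta>_def indicator_def)
  show "ell2_norm (gr_index G r) \<delta> = 1" using infsumI[OF s] by (simp add: ell2_norm_def)
  have "((\<lambda>p. f p * cnj (\<delta> p)) has_sum f (i, \<one>)) (gr_index G r)"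
    by (subst has_sum_cong_neutral[where T = "{(i, \<one>)}" and g = f])
       (use mem in \<open>auto simp: \<delta>_def indicator_def intro: has_sum_finiteI\<close>)
  then show "ell2_inner (gr_index G r) f \<delta> = f (i, \<one>)" unfolding ell2_inner_def by (rule infsumI)
qed

lemma gr_rmult_pow_unit:
  assumes C: "gr_entries G r r C" and i: "i < r"
  shows "(gr_rmult G r r C ^^ k) (indicator {(i, \<one>)})
    = (\<lambda>(j, h). if (j, h) \<in> gr_index G r then gr_pow G r C k i j h else 0)"
proof (induction k)
  case 0
  show ?case using i by (auto simp: gr_one_def gr_index_def indicator_def fun_eq_iff)
next
  case (Suc k)
  show ?case
    using gr_rmult_row[OF gr_entries_pow[OF C] C i, of k] Suc by (simp only: funpow.simps o_apply gr_pow.simps)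
qed

text \<open>\<Phi> is the sum of the distribution functions of the r unit vectors at the identity
  element. Its moments are diagonal coefficients of powers of C, because C ^ k applied to a unit
  vector is a row of the matrix C ^ k. The argument \<open>l\<^sup>2\<close> of \<Phi> comes from
  passing from singular values of A to the spectrum of C.\<close>

theorem spectral_distribution_moments:
  assumes A: "gr_entries G r s A"
  defines "C \<equiv> gr_mult G s A (gr_adjoint G A)"
  shows "\<exists>\<Phi> K. distribution_function \<Phi> K (real r) \<and> (\<forall>l. spectral_distribution G r s A l = \<Phi> (l\<^sup>2)) \<and>
    (\<forall>k. (LINT t|interval_measure \<Phi>. t ^ k) = Re (\<Sum>i<r. gr_pow G r C k i i \<one>))"
proof -
  let ?I = "gr_index G r"
  let ?\<delta> = "\<lambda>i. indicator {(i, \<one>)} :: nat \<times> 'a \<Rightarrow> complex"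
  have C: "gr_entries G r r C" unfolding C_def by (intro gr_entries_mult A gr_entries_adjoint)
  interpret T: positive_ell2_operator ?I "gr_rmult G r r C"
    unfolding C_def by (rule positive_ell2_operator_gr_rmult[OF A])
  obtain K where K: "K > 0" "\<And>f. f \<in> ell2 ?I \<Longrightarrow>
      distribution_function (\<lambda>l. Re (ell2_inner ?I (T.spectral l f) f)) K ((ell2_norm ?I f)\<^sup>2)"
    using T.spectral_distribution_function by blast
  define F where "F i t = Re (ell2_inner ?I (T.spectral t (?\<delta> i)) (?\<delta> i))" for i t
  have F: "distribution_function (F i) K 1" if "i < r" for i
    using K(2)[OF unit_vector(1)[OF that]] unit_vector(3)[OF that] by (simp add: F_def[abs_def])
  define \<Phi> where "\<Phi> t = (\<Sum>i<r. F i t)" for t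
  have "distribution_function \<Phi> K (real r)"
    unfolding \<Phi>_def[abs_def] by (rule distribution_function_sum[OF F K(1)])
  moreover have "spectral_distribution G r s A l = \<Phi> (l\<^sup>2)" for l
    by (simp add: spectral_distribution_def vn_trace_def C_def[symmetric] T.spectral_projection_eq \<Phi>_def F_def)
  moreover have "(LINT t|interval_measure \<Phi>. t ^ k) = Re (\<Sum>i<r. gr_pow G r C k i i \<one>)" for k
  proof -
    have c: "continuous_on UNIV (\<lambda>t::real. t ^ k)" by (intro continuous_intros)
    have "(LINT t|interval_measure \<Phi>. t ^ k) = (\<Sum>i<r. LINT t|interval_measure (F i). t ^ k)"
      unfolding \<Phi>_def[abs_def] by (rule integral_distribution_function_sum[OF F K(1) c])
    also have "\<dots> = (\<Sum>i<r. Re (gr_pow G r C k i i \<one>))"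
    proof (rule sum.cong[OF refl])
      fix i assume "i \<in> {..<r}"
      then have i: "i < r" by simp
      have "(LINT t|interval_measure (F i). t ^ k) = Re (ell2_inner ?I ((gr_rmult G r r C ^^ k) (?\<delta> i)) (?\<delta> i))"
        unfolding T.spectral_moments[OF unit_vector(1)[OF i]] F_def[abs_def] by simp
      then show "(LINT t|interval_measure (F i). t ^ k) = Re (gr_pow G r C k i i \<one>)"
        unfolding unit_vector(2)[OF i] gr_rmult_pow_unit[OF C i] using i by (simp add: gr_index_def)
    qed
    finally show ?thesis by simp
  qed
  ultimately show ?thesis by blast
qed

end

section \<open>Hermitian matrices\<close>

text \<open>Gaussian elimination: a functional with nonzero coefficient at p is solved for x p,
  which removes p from the index set and one functional from the list. The lemma serves both to find
  annihilating polynomials and to compare eigenvalue counts.\<close>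

lemma ex_common_zero:
  fixes \<phi> :: "'b \<Rightarrow> 'a \<Rightarrow> 'c::field"
  assumes "finite B" "finite S" "card B < card S"
  shows "\<exists>x. (\<exists>i\<in>S. x i \<noteq> 0) \<and> (\<forall>i. i \<notin> S \<longrightarrow> x i = 0) \<and> (\<forall>b\<in>B. (\<Sum>i\<in>S. \<phi> b i * x i) = 0)"
  using assms
proof (induction B arbitrary: S \<phi> rule: finite_induct)
  case empty
  then obtain p where "p \<in> S" by fastforce
  then show ?case by (intro exI[of _ "\<lambda>i. if i = p then 1 else 0"]) auto
next
  case (insert b B)
  show ?case
  proof (cases "\<forall>i\<in>S. \<phi> b i = 0")
    case True
    have "card B < card S" using insert by simp
    from insert.IH[OF insert.prems(1) this, of \<phi>] True show ?thesis by auto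
  next
    case False
    then obtain p where p: "p \<in> S" "\<phi> b p \<noteq> 0" by blast
    define \<psi> where "\<psi> c i = \<phi> c i - \<phi> c p * \<phi> b i / \<phi> b p" for c i
    have "card B < card (S - {p})" using insert p by simp
    from insert.IH[OF _ this, of \<psi>] insert.prems obtain x where
      x: "\<exists>i\<in>S - {p}. x i \<noteq> 0" "\<And>i. i \<notin> S - {p} \<Longrightarrow> x i = 0"
         "\<And>c. c \<in> B \<Longrightarrow> (\<Sum>i\<in>S - {p}. \<psi> c i * x i) = 0" by auto
    define y where "y = x(p := - (\<Sum>i\<in>S - {p}. \<phi> b i * x i) / \<phi> b p)"
    have split: "(\<Sum>i\<in>S. \<phi> c i * y i)
        = (\<Sum>i\<in>S - {p}. \<phi> c i * x i) - \<phi> c p * (\<Sum>i\<in>S - {p}. \<phi> b i * x i) / \<phi> b p" for c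
    proof -
      have "(\<Sum>i\<in>S. \<phi> c i * y i) = \<phi> c p * y p + (\<Sum>i\<in>S - {p}. \<phi> c i * y i)"
        by (rule sum.remove[OF insert.prems(1) p(1)])
      also have "(\<Sum>i\<in>S - {p}. \<phi> c i * y i) = (\<Sum>i\<in>S - {p}. \<phi> c i * x i)"
        by (rule sum.cong) (auto simp: y_def)
      finally show ?thesis by (simp add: y_def)
    qed
    have "(\<Sum>i\<in>S. \<phi> b i * y i) = 0" unfolding split using p by simp
    moreover have "(\<Sum>i\<in>S. \<phi> c i * y i) = 0" if "c \<in> B" for c
    proof -
      have "(\<Sum>i\<in>S - {p}. \<psi> c i * x i) = (\<Sum>i\<in>S - {p}. \<phi> c i * x i) - \<phi> c p * (\<Sum>i\<in>S - {p}. \<phi> b i * x i) / \<phi> b p"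
      proof -
        have "\<psi> c i * x i = \<phi> c i * x i - \<phi> c p / \<phi> b p * (\<phi> b i * x i)" for i
          by (simp add: \<psi>_def left_diff_distrib)
        then show ?thesis by (simp only: sum_subtractf sum_distrib_left[symmetric]) simp
      qed
      then show ?thesis unfolding split using x(3)[OF that] by simp
    qed
    moreover have "\<exists>i\<in>S. y i \<noteq> 0" using x(1) by (auto simp: y_def)
    moreover have "\<forall>i. i \<notin> S \<longrightarrow> y i = 0" using x(2) p by (auto simp: y_def)
    ultimately show ?thesis by (intro exI[of _ y]) auto
  qed
qed

locale hermitian_form =
  fixes n :: nat and h :: "nat \<Rightarrow> nat \<Rightarrow> complex"
  assumes hermitian: "i < n \<Longrightarrow> j < n \<Longrightarrow> h i j = cnj (h j i)"
begin

definition app :: "(nat \<Rightarrow> complex) \<Rightarrow> nat \<Rightarrow> complex" where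
  "app x = (\<lambda>i. if i < n then \<Sum>j<n. h i j * x j else 0)"

definition ip :: "(nat \<Rightarrow> complex) \<Rightarrow> (nat \<Rightarrow> complex) \<Rightarrow> complex" where
  "ip x y = (\<Sum>i<n. x i * cnj (y i))"

lemma ip_app: "ip (app x) y = ip x (app y)"
proof -
  have "ip (app x) y = (\<Sum>i<n. \<Sum>j<n. h i j * x j * cnj (y i))"
    by (simp add: ip_def app_def sum_distrib_right)
  also have "\<dots> = (\<Sum>j<n. \<Sum>i<n. x j * cnj (h j i * y i))"
    by (subst sum.swap) (intro sum.cong refl, simp add: hermitian[symmetric])
  also have "\<dots> = ip x (app y)" by (simp add: ip_def app_def sum_distrib_left)
  finally show ?thesis .
qed

lemma app_lin: "app (\<lambda>i. \<Sum>k\<in>F. c k * y k i) = (\<lambda>i. \<Sum>k\<in>F. c k * app (y k) i)"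
proof
  fix i show "app (\<lambda>i. \<Sum>k\<in>F. c k * y k i) i = (\<Sum>k\<in>F. c k * app (y k) i)"
    unfolding app_def by (auto simp: sum_distrib_left mult_ac intro: sum.swap)
qed

lemma ip_lin: "ip (\<lambda>i. \<Sum>k\<in>F. c k * y k i) z = (\<Sum>k\<in>F. c k * ip (y k) z)"
  unfolding ip_def sum_distrib_left sum_distrib_right by (subst sum.swap) (simp add: mult.assoc)

lemma ip_scale: "ip (\<lambda>i. c * x i) y = c * ip x y" "ip x (\<lambda>i. c * y i) = cnj c * ip x y"
  by (simp_all add: ip_def sum_distrib_left mult_ac)

lemma ip_commute: "ip x y = cnj (ip y x)"
  by (simp add: ip_def mult.commute)

lemma ip_self: "ip x x = of_real (\<Sum>i<n. (cmod (x i))\<^sup>2)"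
  by (simp add: ip_def complex_norm_square[symmetric])

text \<open>The value p(app) x of a polynomial in the operator; the fixed cutoff M, larger than the
  degrees in question, keeps the length of the sum independent of p.\<close>

definition act :: "nat \<Rightarrow> complex poly \<Rightarrow> (nat \<Rightarrow> complex) \<Rightarrow> nat \<Rightarrow> complex" where
  "act M p x = (\<lambda>i. \<Sum>k<M. poly.coeff p k * (app ^^ k) x i)"

lemma act_pCons_0:
  assumes "Polynomial.degree q < M"
  shows "act (Suc M) (pCons 0 q) x = app (act (Suc M) q x)"
proof
  fix i
  have "act (Suc M) (pCons 0 q) x i = (\<Sum>k<M. poly.coeff q k * (app ^^ Suc k) x i)"
    unfolding act_def by (subst sum.lessThan_Suc_shift) simp
  also have "\<dots> = (\<Sum>k<Suc M. poly.coeff q k * app ((app ^^ k) x) i)"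
    using assms by (simp add: coeff_eq_0)
  also have "\<dots> = app (act (Suc M) q x) i" unfolding act_def app_lin ..
  finally show "act (Suc M) (pCons 0 q) x i = app (act (Suc M) q x) i" .
qed

text \<open>Split off a root e of an annihilating polynomial, p = (X - e) q. Either q(app) x is
  nonzero and then an eigenvector for e, or q also annihilates x and has smaller degree.\<close>

lemma ex_eigenvector_poly:
  assumes "p \<noteq> 0" "Polynomial.degree p < M" "act M p x = (\<lambda>_. 0)" "x \<noteq> (\<lambda>_. 0)"
  shows "\<exists>q e. act M q x \<noteq> (\<lambda>_. 0) \<and> app (act M q x) = (\<lambda>i. e * act M q x i)"
  using assms
proof (induction "Polynomial.degree p" arbitrary: p rule: less_induct)
  case less
  show ?case
  proof (cases "Polynomial.degree p = 0")
    case True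
    then obtain a where a: "p = [:a:]" using degree_eq_zeroE by blast
    have "act M p x = (\<lambda>i. a * x i)"
    proof
      fix i
      have "act M p x i = (\<Sum>k\<in>{0}. poly.coeff p k * (app ^^ k) x i)"
        unfolding act_def a using less.prems(2)
        by (intro sum.mono_neutral_right) (auto simp: coeff_pCons split: nat.splits)
      then show "act M p x i = a * x i" by (simp add: a)
    qed
    then show ?thesis using less.prems a by (auto simp: fun_eq_iff)
  next
    case False
    then have "\<not> constant (poly p)" by (simp add: constant_degree)
    then obtain e where "poly p e = 0" using fundamental_theorem_of_algebra by blast
    then obtain q where q: "p = [:-e, 1:] * q" by (auto simp: poly_eq_0_iff_dvd)
    have q0: "q \<noteq> 0" using q less.prems(1) by auto
    have degq: "Polynomial.degree p = Suc (Polynomial.degree q)" unfolding q using q0 by (subst degree_mult_eq) auto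
    obtain M' where M: "M = Suc M'" using less.prems(2) by (cases M) auto
    have "act M p x i = act M (pCons 0 q) x i - e * act M q x i" for i
    proof -
      have "poly.coeff p k * (app ^^ k) x i
          = poly.coeff (pCons 0 q) k * (app ^^ k) x i - e * (poly.coeff q k * (app ^^ k) x i)" for k
        unfolding q by (simp add: left_diff_distrib mult.assoc)
      then show ?thesis by (simp only: act_def sum_subtractf sum_distrib_left)
    qed
    moreover have "act M (pCons 0 q) x = app (act M q x)"
      using act_pCons_0[of q M' x] less.prems(2) degq M by simp
    ultimately have "act M p x = (\<lambda>i. app (act M q x) i - e * act M q x i)"
      by (simp add: fun_eq_iff)
    then have e: "app (act M q x) = (\<lambda>i. e * act M q x i)"
      using less.prems(3) by (auto simp: fun_eq_iff)
    show ?thesis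
    proof (cases "act M q x = (\<lambda>_. 0)")
      case True
      then show ?thesis using less.hyps[of q] q0 degq less.prems by simp
    next
      case False then show ?thesis using e by blast
    qed
  qed
qed

text \<open>The orthogonal complement of the earlier eigenvectors is invariant. For a nonzero x in
  it the n + 1 vectors app ^ j x with j \<le> n are dependent, which provides an annihilating
  polynomial of degree at most n. The eigenvector found from it is a combination of these vectors
  and so stays in the complement.\<close>

lemma ex_eigenvector_orthogonal:
  assumes k: "k < n" and v: "\<And>a. a < k \<Longrightarrow> app (v a) = (\<lambda>i. of_real (d a) * v a i)"
  shows "\<exists>w e. ip w w = 1 \<and> app w = (\<lambda>i. e * w i) \<and> (\<forall>a<k. ip w (v a) = 0) \<and> (\<forall>i\<ge>n. w i = 0)"
proof -
  obtain x where x: "\<exists>i\<in>{..<n}. x i \<noteq> 0" "\<And>i. i \<notin> {..<n} \<Longrightarrow> x i = 0"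
      "\<And>a. a < k \<Longrightarrow> (\<Sum>i<n. cnj (v a i) * x i) = 0"
    using ex_common_zero[of "{..<k}" "{..<n}" "\<lambda>a i. cnj (v a i)"] k by auto
  have ipx: "ip ((app ^^ j) x) (v a) = 0" if a: "a < k" for j a
  proof (induction j)
    case 0 then show ?case using x(3)[OF a] by (simp add: ip_def mult.commute)
  next
    case (Suc j)
    then show ?case using v[OF a] by (simp add: ip_app ip_scale)
  qed
  have supp: "(app ^^ j) x i = 0" if "i \<ge> n" for i j
    using that x(2) by (cases j) (auto simp: app_def)
  have "\<exists>c. (\<exists>j\<in>{..<Suc n}. c j \<noteq> 0) \<and> (\<forall>j. j \<notin> {..<Suc n} \<longrightarrow> c j = 0) \<and>
      (\<forall>i\<in>{..<n}. (\<Sum>j\<in>{..<Suc n}. (app ^^ j) x i * c j) = 0)"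
    by (rule ex_common_zero) auto
  then obtain c where c0: "\<exists>j\<in>{..<Suc n}. c j \<noteq> 0" "\<forall>j. j \<notin> {..<Suc n} \<longrightarrow> c j = 0"
      "\<forall>i\<in>{..<n}. (\<Sum>j\<in>{..<Suc n}. (app ^^ j) x i * c j) = 0" by blast
  then have c: "\<exists>j<Suc n. c j \<noteq> 0" "\<And>j. j \<ge> Suc n \<Longrightarrow> c j = 0"
      "\<And>i. i < n \<Longrightarrow> (\<Sum>j<Suc n. (app ^^ j) x i * c j) = 0" by auto
  define p where "p = Abs_poly c"
  have cp: "poly.coeff p = c" unfolding p_def by (rule coeff_Abs_poly[of n]) (use c(2) in auto)
  have "p \<noteq> 0" using c(1) cp by (metis coeff_0)
  moreover have "Polynomial.degree p < Suc n" using degree_le[of n p] c(2) cp by (auto simp: less_Suc_eq_le)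
  moreover have "act (Suc n) p x = (\<lambda>_. 0)"
  proof
    fix i show "act (Suc n) p x i = 0"
      unfolding act_def cp using c(3)[of i] supp[of i] by (cases "i < n") (auto simp: mult.commute)
  qed
  moreover have "x \<noteq> (\<lambda>_. 0)" using x(1) by auto
  ultimately obtain q e where q: "act (Suc n) q x \<noteq> (\<lambda>_. 0)"
      "app (act (Suc n) q x) = (\<lambda>i. e * act (Suc n) q x i)"
    using ex_eigenvector_poly by blast
  define u where "u = act (Suc n) q x"
  have u0: "u i = 0" if "i \<ge> n" for i using that supp by (simp add: u_def act_def)
  define N where "N = (\<Sum>i<n. (cmod (u i))\<^sup>2)"
  have "N > 0"
  proof -
    obtain i where i: "u i \<noteq> 0" using q(1) by (auto simp: u_def)
    then have "i < n" using u0 by (meson not_less)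
    then have "(cmod (u i))\<^sup>2 \<le> N" unfolding N_def by (intro member_le_sum) auto
    moreover have "(cmod (u i))\<^sup>2 > 0" using i by simp
    ultimately show ?thesis by linarith
  qed
  define w where "w i = of_real (1 / sqrt N) * u i" for i
  have "ip w w = 1"
  proof -
    have "ip w w = of_real (1 / sqrt N) * (cnj (of_real (1 / sqrt N)) * ip u u)"
      unfolding w_def[abs_def] ip_scale ..
    also have "ip u u = of_real N" by (simp only: ip_self N_def)
    also have "of_real (1 / sqrt N) * (cnj (of_real (1 / sqrt N)) * of_real N) = complex_of_real (1 / sqrt N * (1 / sqrt N * N))"
      by (simp only: complex_cnj_complex_of_real of_real_mult)
    also have "1 / sqrt N * (1 / sqrt N * N) = 1" using \<open>N > 0\<close> by (simp add: real_div_sqrt)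
    finally show ?thesis by simp
  qed
  moreover have "app w = (\<lambda>i. e * w i)"
    using app_lin[of "\<lambda>_. of_real (1 / sqrt N)" "\<lambda>_. u" "{0::nat}"] q(2)
    by (simp add: w_def[abs_def] u_def[symmetric] mult_ac)
  moreover have "ip w (v a) = 0" if "a < k" for a
  proof -
    have "ip u (v a) = 0" unfolding u_def act_def ip_lin using ipx[OF that] by simp
    then show ?thesis unfolding w_def[abs_def] ip_scale by simp
  qed
  moreover have "w i = 0" if "i \<ge> n" for i using u0[OF that] by (simp add: w_def)
  ultimately show ?thesis by blast
qed

lemma ex_orthonormal_eigenvectors:
  "k \<le> n \<Longrightarrow> \<exists>v d. \<forall>a<k. app (v a) = (\<lambda>i. of_real (d a) * v a i) \<and> (\<forall>b<k. ip (v a) (v b) = (if a = b then 1 else 0))"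
proof (induction k)
  case (Suc k)
  then obtain v d where vd: "\<And>a. a < k \<Longrightarrow> app (v a) = (\<lambda>i. of_real (d a) * v a i)"
    "\<And>a b. a < k \<Longrightarrow> b < k \<Longrightarrow> ip (v a) (v b) = (if a = b then 1 else 0)" by auto
  from ex_eigenvector_orthogonal[of k v d] vd(1) Suc.prems obtain w e where
    w: "ip w w = 1" "app w = (\<lambda>i. e * w i)" "\<And>a. a < k \<Longrightarrow> ip w (v a) = 0" by auto
  have "e = cnj e" using ip_app[of w w] w(1) unfolding w(2) ip_scale by simp
  then have real: "e = of_real (Re e)" by (simp add: complex_eq_iff)
  have w': "ip (v a) w = 0" if "a < k" for a using w(3)[OF that] ip_commute[of "v a" w] by simp
  show ?case
    by (rule exI[of _ "v(k := w)"], rule exI[of _ "d(k := Re e)"])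
       (use vd w w' real in \<open>auto simp: less_Suc_eq\<close>)
qed simp

end

text \<open>\<open>similar_mat_wit\<close> includes the equations making the adjoint of V a
  two-sided inverse, so V is unitary and d lists the eigenvalues.\<close>

definition unitary_diagonalization :: "complex mat \<Rightarrow> complex mat \<Rightarrow> (nat \<Rightarrow> real) \<Rightarrow> bool" where
  "unitary_diagonalization H V d \<longleftrightarrow> (let n = dim_row H; L = mat_diag n (\<lambda>a. complex_of_real (d a)) in
     similar_mat_wit H L V (mat_adjoint V) )"

lemma mat_adjoint_dims [simp]: "dim_row (mat_adjoint A) = dim_col A" "dim_col (mat_adjoint A) = dim_row A"
  by (simp_all add: mat_adjoint_def)

lemma mat_adjoint_carrier: "A \<in> carrier_mat n m \<Longrightarrow> mat_adjoint A \<in> carrier_mat m n"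
  by (auto intro: carrier_matI)

lemma mat_adjoint_index: "i < dim_col A \<Longrightarrow> j < dim_row A \<Longrightarrow> mat_adjoint A $$ (i, j) = cnj (A $$ (j, i))"
  for A :: "complex mat"
  by (simp add: mat_adjoint_def mat_of_rows_index)

lemma ex_unitary_diagonalization:
  fixes H :: "complex mat"
  assumes H: "H \<in> carrier_mat n n" and herm: "\<And>i j. i < n \<Longrightarrow> j < n \<Longrightarrow> H $$ (i, j) = cnj (H $$ (j, i))"
  shows "\<exists>V d. unitary_diagonalization H V d"
proof -
  interpret hermitian_form n "\<lambda>i j. H $$ (i, j)" by standard (rule herm)
  obtain v d where v: "\<And>a. a < n \<Longrightarrow> app (v a) = (\<lambda>i. of_real (d a) * v a i)"
     "\<And>a b. a < n \<Longrightarrow> b < n \<Longrightarrow> ip (v a) (v b) = (if a = b then 1 else 0)"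
    using ex_orthonormal_eigenvectors[of n] by auto
  define V where "V = Matrix.mat n n (\<lambda>(i, a). v a i)"
  define L where "L = mat_diag n (\<lambda>a. complex_of_real (d a))"
  have V: "V \<in> carrier_mat n n" and L: "L \<in> carrier_mat n n" by (auto simp: V_def L_def)
  have V': "mat_adjoint V \<in> carrier_mat n n" by (rule mat_adjoint_carrier[OF V])
  have VV: "mat_adjoint V * V = 1\<^sub>m n"
  proof (rule eq_matI)
    fix a b assume "a < dim_row (1\<^sub>m n)" "b < dim_col (1\<^sub>m n)"
    then have ab: "a < n" "b < n" by auto
    have "(mat_adjoint V * V) $$ (a, b) = (\<Sum>i<n. cnj (v a i) * v b i)"
      using ab V by (simp add: scalar_prod_def mat_adjoint_index V_def atLeast0LessThan)
    also have "\<dots> = ip (v b) (v a)" by (simp add: ip_def mult.commute)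
    finally show "(mat_adjoint V * V) $$ (a, b) = 1\<^sub>m n $$ (a, b)" using v(2)[of b a] ab by auto
  qed (use V V' in auto)
  have VV': "V * mat_adjoint V = 1\<^sub>m n" by (rule mat_mult_left_right_inverse[OF V' V VV])
  have HV: "H * V = V * L"
  proof (rule eq_matI)
    fix i a assume "i < dim_row (V * L)" "a < dim_col (V * L)"
    then have ia: "i < n" "a < n" using V L by auto
    have "(H * V) $$ (i, a) = app (v a) i"
      using ia H by (simp add: scalar_prod_def V_def app_def atLeast0LessThan)
    also have "\<dots> = (V * L) $$ (i, a)"
      unfolding v(1)[OF ia(2)] L_def mat_diag_mult_right[OF V] using ia by (simp add: V_def)
    finally show "(H * V) $$ (i, a) = (V * L) $$ (i, a)" .
  qed (use H V L in auto)
  have "H = H * (V * mat_adjoint V)" using H by (simp add: VV')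
  also have "\<dots> = H * V * mat_adjoint V" by (rule assoc_mult_mat[OF H V V', symmetric])
  also have "\<dots> = V * L * mat_adjoint V" unfolding HV ..
  finally have "similar_mat_wit H L V (mat_adjoint V)"
    unfolding similar_mat_wit_def Let_def using H V V' L VV VV' by auto
  then have "unitary_diagonalization H V d" using H by (simp add: unitary_diagonalization_def L_def)
  then show ?thesis by blast
qed

text \<open>The kernel is computed through a row echelon form: the matrix \<open>E\<close>, with one
  unit row for each a such that f a is nonzero, is in echelon form and has the same kernel as the
  diagonal matrix.\<close>

lemma kernel_dim_mat_diag: "kernel_dim (mat_diag n f :: complex mat) = card {a. a < n \<and> f a = 0}"
proof -
  define zs where "zs = filter (\<lambda>a. f a \<noteq> 0) [0..<n]"
  define l where "l = length zs"
  have zs: "set zs = {a. a < n \<and> f a \<noteq> 0}" "sorted_wrt (<) zs" "distinct zs"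
    unfolding zs_def by (auto simp: sorted_wrt_filter)
  have nth: "zs ! i < n" "f (zs ! i) \<noteq> 0" if "i < l" for i
    using nth_mem[of i zs] that zs(1) by (auto simp: l_def)
  have ln: "l \<le> n" unfolding l_def zs_def using length_filter_le[of _ "[0..<n]"] by simp
  define E where "E = Matrix.mat n n (\<lambda>(i, j). if i < l \<and> j = zs ! i then 1 else 0 :: complex)"
  have E: "E \<in> carrier_mat n n" by (simp add: E_def)
  have "pivot_fun E (\<lambda>i. if i < l then zs ! i else n) n"
  proof (rule pivot_funI[of _ n])
    fix i assume "i < n"
    show "(if i < l then zs ! i else n) \<le> n" using nth(1)[of i] by (auto intro: less_imp_le)
    show "E $$ (i, j) = 0" if "j < (if i < l then zs ! i else n)" for j
      using that \<open>i < n\<close> nth(1)[of i] by (auto simp: E_def split: if_splits)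
    show "(if i < l then zs ! i else n) < (if Suc i < l then zs ! Suc i else n) \<or> (if Suc i < l then zs ! Suc i else n) = n"
      using sorted_wrt_nth_less[OF zs(2), of i "Suc i"] by (auto simp: l_def)
    assume lt: "(if i < l then zs ! i else n) < n"
    show "E $$ (i, if i < l then zs ! i else n) = 1" using lt \<open>i < n\<close> by (auto simp: E_def split: if_splits)
    show "E $$ (i', if i < l then zs ! i else n) = 0" if "i' < n" "i' \<noteq> i" for i'
      using lt that \<open>i < n\<close> nth_eq_iff_index_eq[OF zs(3), of i i'] by (auto simp: E_def l_def split: if_splits)
  qed (use E in auto)
  then have ref: "row_echelon_form E" using E unfolding row_echelon_form_def by auto
  have rowE: "row E i \<noteq> 0\<^sub>v n \<longleftrightarrow> i < l" if "i < n" for i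
  proof
    assume ne: "row E i \<noteq> 0\<^sub>v n"
    show "i < l"
    proof (rule ccontr)
      assume "\<not> i < l"
      then have "row E i = 0\<^sub>v n" using that by (intro eq_vecI) (auto simp: E_def)
      then show False using ne by simp
    qed
  next
    assume i: "i < l"
    then have "row E i $ (zs ! i) = 1" using that nth(1)[OF i] by (simp add: E_def)
    then show "row E i \<noteq> 0\<^sub>v n" using nth(1)[OF i] by auto
  qed
  have "{i. i < n \<and> row E i \<noteq> 0\<^sub>v n} = {i. i < n \<and> i < l}" using rowE by blast
  also have "\<dots> = {..<l}" using ln by auto
  finally have "{i. i < n \<and> row E i \<noteq> 0\<^sub>v n} = {..<l}" .
  then have dimE: "kernel.dim n E = n - l" using find_base_vectors(6)[OF ref E] by simp
  have D: "mat_diag n f \<in> carrier_mat n n" by simp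
  have "mat_kernel (mat_diag n f) = mat_kernel E"
  proof -
    have kE: "v \<in> mat_kernel E \<longleftrightarrow> v \<in> carrier_vec n \<and> (\<forall>i<l. v $ (zs ! i) = 0)" for v
    proof -
      have "(E *\<^sub>v v) $ i = (if i < l then v $ (zs ! i) else 0)" if "v \<in> carrier_vec n" "i < n" for i
      proof -
        have "(E *\<^sub>v v) $ i = (\<Sum>j<n. (if i < l \<and> j = zs ! i then 1 else 0) * v $ j)"
          using that by (simp add: E_def scalar_prod_def atLeast0LessThan)
        also have "\<dots> = (\<Sum>j<n. if j = zs ! i then (if i < l then v $ j else 0) else 0)"
          by (rule sum.cong) auto
        also have "\<dots> = (if i < l then v $ (zs ! i) else 0)"
          using nth(1)[of i] by (cases "i < l") auto
        finally show ?thesis .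
      qed
      then have "E *\<^sub>v v = 0\<^sub>v n \<longleftrightarrow> (\<forall>i<l. v $ (zs ! i) = 0)" if "v \<in> carrier_vec n"
        using that E ln unfolding vec_eq_iff by (auto simp del: index_mult_mat_vec)
      then show ?thesis unfolding mat_kernel[OF E] by auto
    qed
    have kD: "v \<in> mat_kernel (mat_diag n f) \<longleftrightarrow> v \<in> carrier_vec n \<and> (\<forall>i<n. f i * v $ i = 0)" for v
    proof -
      have "(mat_diag n f *\<^sub>v v) $ i = f i * v $ i" if "v \<in> carrier_vec n" "i < n" for i
      proof -
        have "(mat_diag n f *\<^sub>v v) $ i = (\<Sum>j<n. (if i = j then f j else 0) * v $ j)"
          using that by (simp add: mat_diag_def scalar_prod_def atLeast0LessThan)
        also have "\<dots> = (\<Sum>j<n. if j = i then f j * v $ j else 0)" by (rule sum.cong) auto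
        finally show ?thesis using that by simp
      qed
      then have "mat_diag n f *\<^sub>v v = 0\<^sub>v n \<longleftrightarrow> (\<forall>i<n. f i * v $ i = 0)" if "v \<in> carrier_vec n"
        using that carrier_matD[OF D] unfolding vec_eq_iff by (auto simp del: index_mult_mat_vec)
      then show ?thesis unfolding mat_kernel[OF D] by auto
    qed
    have "(\<forall>i<l. v $ (zs ! i) = 0) \<longleftrightarrow> (\<forall>i<n. f i * v $ i = 0)" for v :: "complex vec"
    proof -
      have "(\<forall>i<l. v $ (zs ! i) = 0) \<longleftrightarrow> (\<forall>a\<in>set zs. v $ a = 0)"
        by (simp add: l_def all_set_conv_all_nth)
      then show ?thesis using zs(1) by auto
    qed
    then show ?thesis using kE kD by blast
  qed
  then have "kernel_dim (mat_diag n f) = n - l"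
    unfolding kernel_dim_def using dimE D by (simp add: mat_diag_def)
  moreover have "l = card {a. a < n \<and> f a \<noteq> 0}"
    using distinct_card[OF zs(3)] zs(1) by (simp add: l_def)
  moreover have "n = card {a. a < n \<and> f a \<noteq> 0} + card {a. a < n \<and> f a = 0}"
  proof -
    have "{..<n} = {a. a < n \<and> f a \<noteq> 0} \<union> {a. a < n \<and> f a = 0}" by auto
    then have "card {..<n} = card ({a. a < n \<and> f a \<noteq> 0} \<union> {a. a < n \<and> f a = 0})" by simp
    also have "\<dots> = card {a. a < n \<and> f a \<noteq> 0} + card {a. a < n \<and> f a = 0}"
      by (rule card_Un_disjoint) auto
    finally show ?thesis by simp
  qed
  ultimately show ?thesis by linarith
qed

lemma sum_squares_expand:
  fixes v :: "'a \<Rightarrow> nat \<Rightarrow> complex" and x :: "nat \<Rightarrow> complex" and w :: "'a \<Rightarrow> real"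
  shows "of_real (\<Sum>a\<in>F. w a * (cmod (\<Sum>i<n. v a i * x i))\<^sup>2)
    = (\<Sum>i<n. \<Sum>j<n. x i * cnj (x j) * (\<Sum>a\<in>F. v a i * of_real (w a) * cnj (v a j)))"
proof -
  have "complex_of_real (\<Sum>a\<in>F. w a * (cmod (\<Sum>i<n. v a i * x i))\<^sup>2)
      = (\<Sum>a\<in>F. of_real (w a) * ((\<Sum>i<n. v a i * x i) * cnj (\<Sum>j<n. v a j * x j)))"
    unfolding of_real_sum of_real_mult complex_norm_square ..
  also have "\<dots> = (\<Sum>a\<in>F. \<Sum>i<n. \<Sum>j<n. x i * cnj (x j) * (v a i * of_real (w a) * cnj (v a j)))"
  proof (rule sum.cong[OF refl])
    fix a
    have "(\<Sum>i<n. v a i * x i) * cnj (\<Sum>j<n. v a j * x j) = (\<Sum>i<n. \<Sum>j<n. (v a i * x i) * cnj (v a j * x j))"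
      unfolding cnj_sum by (rule sum_product)
    then show "of_real (w a) * ((\<Sum>i<n. v a i * x i) * cnj (\<Sum>j<n. v a j * x j))
        = (\<Sum>i<n. \<Sum>j<n. x i * cnj (x j) * (v a i * of_real (w a) * cnj (v a j)))"
      by (simp only: sum_distrib_left complex_cnj_mult mult_ac)
  qed
  also have "\<dots> = (\<Sum>i<n. \<Sum>a\<in>F. \<Sum>j<n. x i * cnj (x j) * (v a i * of_real (w a) * cnj (v a j)))"
    by (rule sum.swap)
  also have "\<dots> = (\<Sum>i<n. \<Sum>j<n. \<Sum>a\<in>F. x i * cnj (x j) * (v a i * of_real (w a) * cnj (v a j)))"
    by (intro sum.cong refl sum.swap)
  finally show ?thesis by (simp only: sum_distrib_left)
qed

text \<open>The spectral data of the Gram matrix that are used later, phrased for row vectors x: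
  \<phi> a is the a-th coordinate of x V for a unitary V, so the squared norms of x and x M become
  sums of squares with weights 1 and d a. Traces feed the moments, kernel dimensions the
  multiplicity of the smallest singular value.\<close>

theorem gram_spectrum:
  fixes M :: "complex mat"
  assumes M: "M \<in> carrier_mat n m"
  defines "H \<equiv> M * mat_adjoint M"
  shows "\<exists>\<phi> d. (\<forall>a<n. 0 \<le> d a) \<and>
    (\<forall>x. (\<Sum>a<n. (cmod (\<Sum>i<n. \<phi> a i * x i))\<^sup>2) = (\<Sum>i<n. (cmod (x i))\<^sup>2)) \<and>
    (\<forall>x. (\<Sum>a<n. d a * (cmod (\<Sum>i<n. \<phi> a i * x i))\<^sup>2) = (\<Sum>b<m. (cmod (\<Sum>i<n. M $$ (i, b) * x i))\<^sup>2)) \<and>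
    (\<forall>k. (\<Sum>i<n. (H ^\<^sub>m k) $$ (i, i)) = of_real (\<Sum>a<n. d a ^ k)) \<and>
    (\<forall>e. eigenvalue H e \<longleftrightarrow> (\<exists>a<n. e = of_real (d a))) \<and>
    (\<forall>t. kernel_dim (H - of_real t \<cdot>\<^sub>m 1\<^sub>m n) = card {a. a < n \<and> d a = t})"
proof -
  note M' = mat_adjoint_carrier[OF M]
  have H: "H \<in> carrier_mat n n" unfolding H_def using M M' by auto
  have Hij: "H $$ (i, j) = (\<Sum>b<m. M $$ (i, b) * cnj (M $$ (j, b)))" if "i < n" "j < n" for i j
    using that M unfolding H_def by (simp add: scalar_prod_def mat_adjoint_index atLeast0LessThan)
  have "H $$ (i, j) = cnj (H $$ (j, i))" if "i < n" "j < n" for i j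
    using that by (simp add: Hij mult.commute)
  from ex_unitary_diagonalization[OF H this] obtain V d where "unitary_diagonalization H V d" by blast
  then have wit: "similar_mat_wit H (mat_diag n (\<lambda>a. complex_of_real (d a))) V (mat_adjoint V)"
    using H by (simp add: unitary_diagonalization_def)
  note W = similar_mat_witD2[OF H wit]
  have V: "V \<in> carrier_mat n n" using W by auto
  note V' = mat_adjoint_carrier[OF V]
  have entry: "(V * mat_diag n f * mat_adjoint V) $$ (i, j) = (\<Sum>a<n. V $$ (i, a) * f a * cnj (V $$ (j, a)))"
    if "i < n" "j < n" for f i j
    using that V unfolding mat_diag_mult_right[OF V]
    by (simp add: scalar_prod_def mat_adjoint_index atLeast0LessThan)
  have orth: "(\<Sum>i<n. V $$ (i, a) * cnj (V $$ (i, b))) = (if a = b then 1 else 0)" if "a < n" "b < n" for a b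
  proof -
    have "(\<Sum>i<n. V $$ (i, a) * cnj (V $$ (i, b))) = (mat_adjoint V * V) $$ (b, a)"
      using that V by (simp add: scalar_prod_def mat_adjoint_index atLeast0LessThan mult.commute)
    then show ?thesis using W(2) that by auto
  qed
  have Hd: "H $$ (i, j) = (\<Sum>a<n. V $$ (i, a) * of_real (d a) * cnj (V $$ (j, a)))" if "i < n" "j < n" for i j
    using entry[OF that] W(3) by simp
  have one: "(\<Sum>a<n. V $$ (i, a) * of_real 1 * cnj (V $$ (j, a))) = (if i = j then 1 else 0)" if "i < n" "j < n" for i j
  proof -
    have "(V * mat_adjoint V) $$ (i, j) = (\<Sum>a<n. V $$ (i, a) * cnj (V $$ (j, a)))"
      using that V by (simp add: scalar_prod_def mat_adjoint_index atLeast0LessThan)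
    then show ?thesis using W(1) that by simp
  qed
  define \<phi> where "\<phi> a i = V $$ (i, a)" for a i
  have parseval: "(\<Sum>a<n. (cmod (\<Sum>i<n. \<phi> a i * x i))\<^sup>2) = (\<Sum>i<n. (cmod (x i))\<^sup>2)" for x
  proof -
    have "complex_of_real (\<Sum>a<n. 1 * (cmod (\<Sum>i<n. \<phi> a i * x i))\<^sup>2)
      = (\<Sum>i<n. \<Sum>j<n. x i * cnj (x j) * (if i = j then 1 else 0))"
      unfolding sum_squares_expand \<phi>_def by (intro sum.cong refl) (simp add: one[simplified])
    also have "\<dots> = of_real (\<Sum>i<n. (cmod (x i))\<^sup>2)"
      by (simp add: complex_norm_square[symmetric] if_distrib[of "\<lambda>c. _ * c"] sum.delta cong: if_cong)
    finally show ?thesis by (simp only: of_real_eq_iff mult_1)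
  qed
  have form: "(\<Sum>a<n. d a * (cmod (\<Sum>i<n. \<phi> a i * x i))\<^sup>2) = (\<Sum>b<m. (cmod (\<Sum>i<n. M $$ (i, b) * x i))\<^sup>2)" for x
  proof -
    have "complex_of_real (\<Sum>a<n. d a * (cmod (\<Sum>i<n. \<phi> a i * x i))\<^sup>2)
      = (\<Sum>i<n. \<Sum>j<n. x i * cnj (x j) * H $$ (i, j))"
      unfolding sum_squares_expand \<phi>_def by (intro sum.cong refl) (simp add: Hd)
    also have "\<dots> = (\<Sum>i<n. \<Sum>j<n. x i * cnj (x j) * (\<Sum>b<m. M $$ (i, b) * of_real 1 * cnj (M $$ (j, b))))"
      by (intro sum.cong refl) (simp add: Hij)
    also have "\<dots> = of_real (\<Sum>b<m. 1 * (cmod (\<Sum>i<n. M $$ (i, b) * x i))\<^sup>2)"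
      unfolding sum_squares_expand[of "\<lambda>_. 1" "\<lambda>b i. M $$ (i, b)"] ..
    finally show ?thesis by (simp only: of_real_eq_iff mult_1)
  qed
  \<comment> \<open>Test the form on the conjugate of the a-th column of V: there all coordinates
    but the a-th vanish.\<close>
  have nonneg: "0 \<le> d a" if a: "a < n" for a
  proof -
    have "(\<Sum>b<n. d b * (cmod (\<Sum>i<n. \<phi> b i * cnj (V $$ (i, a))))\<^sup>2) = (\<Sum>b<n. if b = a then d a else 0)"
      using a by (intro sum.cong refl) (auto simp: \<phi>_def orth)
    then have "d a = (\<Sum>b<m. (cmod (\<Sum>i<n. M $$ (i, b) * cnj (V $$ (i, a))))\<^sup>2)"
      using form[of "\<lambda>i. cnj (V $$ (i, a))"] a by simp
    then show ?thesis by (simp add: sum_nonneg)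
  qed
  have diag_pow: "mat_diag n f ^\<^sub>m k = mat_diag n (\<lambda>a. f a ^ k)" for f :: "nat \<Rightarrow> complex" and k
  proof (induction k)
    case 0 then show ?case by (intro eq_matI) (auto simp: mat_diag_def)
  next
    case (Suc k)
    have "mat_diag n f ^\<^sub>m Suc k = mat_diag n (\<lambda>a. f a ^ k) * mat_diag n f" by (simp add: Suc)
    also have "\<dots> = mat_diag n (\<lambda>a. f a ^ Suc k)"
      unfolding mat_diag_mult_left[OF mat_diag_dim] by (intro eq_matI) (auto simp: mat_diag_def)
    finally show ?case .
  qed
  have trace: "(\<Sum>i<n. (H ^\<^sub>m k) $$ (i, i)) = of_real (\<Sum>a<n. d a ^ k)" for k
  proof -
    have "similar_mat_wit (H ^\<^sub>m k) (mat_diag n (\<lambda>a. of_real (d a) ^ k)) V (mat_adjoint V)"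
      using similar_mat_wit_pow[OF wit, of k] by (simp add: diag_pow)
    then have "H ^\<^sub>m k = V * mat_diag n (\<lambda>a. of_real (d a) ^ k) * mat_adjoint V"
      unfolding similar_mat_wit_def Let_def by auto
    then have "(\<Sum>i<n. (H ^\<^sub>m k) $$ (i, i)) = (\<Sum>i<n. \<Sum>a<n. V $$ (i, a) * of_real (d a) ^ k * cnj (V $$ (i, a)))"
      by (simp add: entry)
    also have "\<dots> = (\<Sum>a<n. of_real (d a) ^ k * (\<Sum>i<n. V $$ (i, a) * cnj (V $$ (i, a))))"
      by (subst sum.swap) (simp add: sum_distrib_left mult_ac)
    finally show ?thesis by (simp add: orth)
  qed
  have eig: "eigenvalue H e \<longleftrightarrow> (\<exists>a<n. e = of_real (d a))" for e
  proof -
    have sim: "similar_mat H (mat_diag n (\<lambda>a. complex_of_real (d a)))"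
      using wit unfolding similar_mat_def by blast
    have ut: "upper_triangular (mat_diag n (\<lambda>a. complex_of_real (d a)))"
      by (auto simp: upper_triangular_def mat_diag_def)
    have "char_poly H = (\<Prod>a\<leftarrow>diag_mat (mat_diag n (\<lambda>a. complex_of_real (d a))). [:- a, 1:])"
      unfolding char_poly_similar[OF sim] by (rule char_poly_upper_triangular[OF mat_diag_dim ut])
    also have "diag_mat (mat_diag n (\<lambda>a. complex_of_real (d a))) = map (\<lambda>a. of_real (d a)) [0..<n]"
      by (simp add: diag_mat_def mat_diag_def)
    finally have cp: "char_poly H = (\<Prod>a\<leftarrow>map (\<lambda>a. of_real (d a)) [0..<n]. [:- a, 1:])" .
    show ?thesis unfolding eigenvalue_root_char_poly[OF H] cp
      by (simp add: poly_prod_list prod_list_zero_iff o_def) force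
  qed
  have ker: "kernel_dim (H - of_real t \<cdot>\<^sub>m 1\<^sub>m n) = card {a. a < n \<and> d a = t}" for t
  proof -
    have e1: "H - of_real t \<cdot>\<^sub>m 1\<^sub>m n = char_matrix H (of_real t)"
      using H by (intro eq_matI) (auto simp: char_matrix_def)
    have e2: "char_matrix (mat_diag n (\<lambda>a. of_real (d a))) (of_real t) = mat_diag n (\<lambda>a. complex_of_real (d a - t))"
      by (intro eq_matI) (auto simp: char_matrix_def mat_diag_def)
    have wit': "similar_mat_wit (char_matrix H (of_real t)) (mat_diag n (\<lambda>a. complex_of_real (d a - t))) V (mat_adjoint V)"
      using similar_mat_wit_char_matrix[OF wit, of "of_real t"] by (simp only: e2)
    have cm: "char_matrix H (of_real t) \<in> carrier_mat n n" using H by (simp add: char_matrix_def)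
    have "kernel_dim (char_matrix H (of_real t)) = kernel_dim (mat_diag n (\<lambda>a. complex_of_real (d a - t)))"
      using similar_mat_wit_kernel_dim[OF cm wit'] carrier_matD[OF cm] by (simp add: kernel_dim_def mat_diag_def)
    then show ?thesis unfolding e1 kernel_dim_mat_diag by simp
  qed
  show ?thesis using nonneg parseval form trace eig ker by (intro exI[of _ \<phi>] exI[of _ d]) blast
qed

text \<open>
  Courant-Fischer in counting form: if the claim failed, fewer than \<open>n\<close> functionals would cut out
  a space on which both forms could be compared, and a nonzero \<open>x\<close> in it would contradict the
  bounds.
\<close>

lemma count_eigenvalues_le:
  fixes \<phi> :: "'a \<Rightarrow> nat \<Rightarrow> complex" and \<psi> :: "'b \<Rightarrow> nat \<Rightarrow> complex"
  assumes fin: "finite D" "finite J" and card: "card D = n" "card J = n"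
    and K: "0 \<le> K1" "0 \<le> K2" and t: "0 \<le> t"
    and norm1: "\<And>x. (\<Sum>a\<in>D. (cmod (\<Sum>i<n. \<phi> a i * x i))\<^sup>2) \<le> K1 * (\<Sum>b\<in>J. (cmod (\<Sum>i<n. \<psi> b i * x i))\<^sup>2)"
    and inj: "\<And>x i. (\<And>b. b \<in> J \<Longrightarrow> (\<Sum>i<n. \<psi> b i * x i) = 0) \<Longrightarrow> i < n \<Longrightarrow> x i = 0"
    and form: "\<And>x. (\<Sum>b\<in>J. p b * (cmod (\<Sum>i<n. \<psi> b i * x i))\<^sup>2) \<le> K2 * (\<Sum>a\<in>D. d a * (cmod (\<Sum>i<n. \<phi> a i * x i))\<^sup>2)"
  shows "card {a \<in> D. d a \<le> t} \<le> card {b \<in> J. p b \<le> K1 * K2 * t}"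
proof (rule ccontr)
  let ?L = "K1 * K2 * t"
  assume "\<not> card {a \<in> D. d a \<le> t} \<le> card {b \<in> J. p b \<le> ?L}"
  then have lt: "card {b \<in> J. p b \<le> ?L} < card {a \<in> D. d a \<le> t}" by simp
  \<comment> \<open>Functionals that are to vanish at x: the \<phi> a with d a > t, and the \<psi> b
    with small p b. By the negated claim there are fewer than n of them.\<close>
  define B where "B = Inl ` {a \<in> D. \<not> d a \<le> t} \<union> Inr ` {b \<in> J. p b \<le> ?L}"
  define \<theta> where "\<theta> = (\<lambda>c. case c of Inl a \<Rightarrow> \<phi> a | Inr b \<Rightarrow> \<psi> b)"
  have "card B = card {a \<in> D. \<not> d a \<le> t} + card {b \<in> J. p b \<le> ?L}"
    unfolding B_def using fin by (subst card_Un_disjoint) (auto simp: card_image)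
  moreover have "card {a \<in> D. \<not> d a \<le> t} + card {a \<in> D. d a \<le> t} = n"
  proof -
    have "D = {a \<in> D. \<not> d a \<le> t} \<union> {a \<in> D. d a \<le> t}" by auto
    then have "card D = card ({a \<in> D. \<not> d a \<le> t} \<union> {a \<in> D. d a \<le> t})" by simp
    also have "\<dots> = card {a \<in> D. \<not> d a \<le> t} + card {a \<in> D. d a \<le> t}"
      by (rule card_Un_disjoint) (use fin in auto)
    finally show ?thesis using card by simp
  qed
  ultimately have "card B < card {..<n}" using lt by simp
  moreover have "finite B" using fin by (simp add: B_def)
  ultimately obtain x where x: "\<exists>i\<in>{..<n}. x i \<noteq> 0" "\<forall>c\<in>B. (\<Sum>i<n. \<theta> c i * x i) = 0"
    using ex_common_zero[of B "{..<n}" \<theta>] by blast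
  have x1: "(\<Sum>i<n. \<phi> a i * x i) = 0" if "a \<in> D" "\<not> d a \<le> t" for a
    using x(2) that by (force simp: B_def \<theta>_def)
  have x2: "(\<Sum>i<n. \<psi> b i * x i) = 0" if "b \<in> J" "p b \<le> ?L" for b
    using x(2) that by (force simp: B_def \<theta>_def)
  define N where "N = (\<Sum>b\<in>J. (cmod (\<Sum>i<n. \<psi> b i * x i))\<^sup>2)"
  have "?L * N < (\<Sum>b\<in>J. p b * (cmod (\<Sum>i<n. \<psi> b i * x i))\<^sup>2)"
    unfolding N_def sum_distrib_left
  proof (rule sum_strict_mono_ex1[OF fin(2)])
    show "\<forall>b\<in>J. ?L * (cmod (\<Sum>i<n. \<psi> b i * x i))\<^sup>2 \<le> p b * (cmod (\<Sum>i<n. \<psi> b i * x i))\<^sup>2"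
    proof
      fix b assume "b \<in> J"
      then show "?L * (cmod (\<Sum>i<n. \<psi> b i * x i))\<^sup>2 \<le> p b * (cmod (\<Sum>i<n. \<psi> b i * x i))\<^sup>2"
        using x2[of b] by (cases "p b \<le> ?L") (auto intro: mult_right_mono)
    qed
    obtain b where b: "b \<in> J" "(\<Sum>i<n. \<psi> b i * x i) \<noteq> 0" using inj[of x] x(1) by blast
    then have "\<not> p b \<le> ?L" using x2 by blast
    then have "?L * (cmod (\<Sum>i<n. \<psi> b i * x i))\<^sup>2 < p b * (cmod (\<Sum>i<n. \<psi> b i * x i))\<^sup>2"
      using b(2) by (intro mult_strict_right_mono) auto
    then show "\<exists>b\<in>J. ?L * (cmod (\<Sum>i<n. \<psi> b i * x i))\<^sup>2 < p b * (cmod (\<Sum>i<n. \<psi> b i * x i))\<^sup>2"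
      using b(1) by blast
  qed
  also have "\<dots> \<le> K2 * (\<Sum>a\<in>D. d a * (cmod (\<Sum>i<n. \<phi> a i * x i))\<^sup>2)" by (rule form)
  also have "\<dots> \<le> K2 * (\<Sum>a\<in>D. t * (cmod (\<Sum>i<n. \<phi> a i * x i))\<^sup>2)"
  proof (intro mult_left_mono K sum_mono)
    fix a assume "a \<in> D"
    then show "d a * (cmod (\<Sum>i<n. \<phi> a i * x i))\<^sup>2 \<le> t * (cmod (\<Sum>i<n. \<phi> a i * x i))\<^sup>2"
      using x1[of a] by (cases "d a \<le> t") (auto intro: mult_right_mono)
  qed
  also have "\<dots> = K2 * (t * (\<Sum>a\<in>D. (cmod (\<Sum>i<n. \<phi> a i * x i))\<^sup>2))" by (simp add: sum_distrib_left)
  also have "\<dots> \<le> K2 * (t * (K1 * N))" unfolding N_def by (intro mult_left_mono norm1 K t)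
  finally show False by (simp add: mult_ac)
qed

section \<open>Matrices over finite quotients\<close>

lemma sum_block:
  assumes "c > (0::nat)"
  shows "(\<Sum>a<r * c. f (a div c) (a mod c)) = (\<Sum>i<r. \<Sum>u<c. f i u)"
proof -
  have "(\<Sum>i<r. \<Sum>u<c. f i u) = (\<Sum>(i, u)\<in>{..<r} \<times> {..<c}. f i u)" by (simp add: sum.cartesian_product)
  also have "\<dots> = (\<Sum>a<r * c. f (a div c) (a mod c))"
  proof (rule sum.reindex_bij_witness[where i = "\<lambda>a. (a div c, a mod c)" and j = "\<lambda>(i, u). i * c + u"])
    fix p assume p: "p \<in> {..<r} \<times> {..<c}"
    then obtain i u where [simp]: "p = (i, u)" and iu: "i < r" "u < c" by auto
    have "i * c + u < (i + 1) * c" using iu by simp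
    also have "\<dots> \<le> r * c" using iu by (intro mult_right_mono) auto
    finally show "(case p of (i, u) \<Rightarrow> i * c + u) \<in> {..<r * c}" by simp
    show "((case p of (i, u) \<Rightarrow> i * c + u) div c, (case p of (i, u) \<Rightarrow> i * c + u) mod c) = p" using iu by simp
    show "f ((case p of (i, u) \<Rightarrow> i * c + u) div c) ((case p of (i, u) \<Rightarrow> i * c + u) mod c) = (case p of (i, u) \<Rightarrow> f i u)"
      using iu by simp
  qed (use assms in \<open>auto simp: less_mult_imp_div_less\<close>)
  finally show ?thesis by simp
qed

text \<open>A name for the enumeration that \<open>regular_mat\<close> chooses, so that matrices
  over one quotient group can be multiplied and compared entrywise.\<close>

definition enum_list :: "('q, 'm) monoid_scheme \<Rightarrow> 'q list" where
  "enum_list Q = (SOME qs. distinct qs \<and> set qs = carrier Q)"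

lemma enum_list:
  assumes "finite (carrier Q)"
  shows "distinct (enum_list Q)" "set (enum_list Q) = carrier Q" "length (enum_list Q) = card (carrier Q)"
proof -
  have "distinct (enum_list Q) \<and> set (enum_list Q) = carrier Q"
    unfolding enum_list_def by (rule someI_ex) (use finite_distinct_list[OF assms] in blast)
  then show "distinct (enum_list Q)" "set (enum_list Q) = carrier Q" "length (enum_list Q) = card (carrier Q)"
    using distinct_card by fastforce+
qed

lemma regular_mat_eq:
  "regular_mat Q r s A = block_mat r s (length (enum_list Q))
     (\<lambda>i j u v. A i j (inv\<^bsub>Q\<^esub> (enum_list Q ! u) \<otimes>\<^bsub>Q\<^esub> enum_list Q ! v))"
  by (simp add: regular_mat_def enum_list_def Let_def)

declare mult_FactGroup [simp del] one_FactGroup [simp del]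

locale finite_quotient = normal +
  assumes finite_rcosets: "finite (rcosets H)"
begin

abbreviation "Q \<equiv> G Mod H"
abbreviation "qs \<equiv> enum_list Q"
abbreviation "c \<equiv> card (rcosets H)"

definition qreg :: "nat \<Rightarrow> nat \<Rightarrow> 'a gr_mat \<Rightarrow> complex mat" where
  "qreg r s A = regular_mat Q r s (gr_mat_proj G H A)"

lemma carrier_Q: "carrier Q = rcosets H"
  by (simp add: FactGroup_def)

sublocale Q: group Q by (rule factorgroup_is_group)

lemma qs: "distinct qs" "set qs = carrier Q" "length qs = c"
  using enum_list[of Q] finite_rcosets by (simp_all add: carrier_Q)

lemma qs_nth: "u < c \<Longrightarrow> qs ! u \<in> carrier Q"
  using qs by (metis nth_mem)

lemma qs_eq_iff: "u < c \<Longrightarrow> v < c \<Longrightarrow> qs ! u = qs ! v \<longleftrightarrow> u = v"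
  using qs by (simp add: nth_eq_iff_index_eq)

lemma sum_qs: "(\<Sum>u<c. f (qs ! u)) = (\<Sum>q\<in>carrier Q. f q)"
  using sum.reindex_bij_betw[OF bij_betw_nth[OF qs(1) refl qs(2)[symmetric]], of f]
  unfolding qs(3) .

lemma c_pos: "0 < c"
  using Q.one_closed finite_rcosets by (auto simp: carrier_Q card_gt_0_iff)

lemma coset_closed: "g \<in> carrier G \<Longrightarrow> H #> g \<in> carrier Q"
  by (simp add: carrier_Q rcosetsI subset)

lemma coset_mult: "g \<in> carrier G \<Longrightarrow> h \<in> carrier G \<Longrightarrow> (H #> g) \<otimes>\<^bsub>Q\<^esub> (H #> h) = H #> (g \<otimes> h)"
  by (simp add: FactGroup_def rcos_sum)

lemma coset_one: "\<one>\<^bsub>Q\<^esub> = H #> \<one>"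
  by (simp add: FactGroup_def coset_mult_one subset)

lemma coset_inv: "g \<in> carrier G \<Longrightarrow> inv\<^bsub>Q\<^esub> (H #> g) = H #> inv g"
  by (rule Q.inv_equality) (simp_all add: coset_closed coset_mult coset_one)

lemma coset_eq_one_iff: "g \<in> carrier G \<Longrightarrow> H #> g = \<one>\<^bsub>Q\<^esub> \<longleftrightarrow> g \<in> H"
  using rcos_const[of g] rcos_self[of g H] subgroup_axioms
  by (auto simp: coset_one coset_mult_one[OF subset] is_group)

lemma mem_coset_iff: "g \<in> carrier G \<Longrightarrow> p \<in> carrier Q \<Longrightarrow> g \<in> p \<longleftrightarrow> H #> g = p"
proof -
  assume g: "g \<in> carrier G" and "p \<in> carrier Q"
  then obtain h where h: "h \<in> carrier G" "p = H #> h" by (auto simp: carrier_Q RCOSETS_def)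
  show ?thesis unfolding h(2)
    using repr_independence[OF _ h(1) subgroup_axioms, of g] rcos_self[OF g subgroup_axioms] by auto
qed

lemma dim_qreg [simp]: "dim_row (qreg r s A) = r * c" "dim_col (qreg r s A) = s * c"
  by (simp_all add: qreg_def regular_mat_eq block_mat_def qs(3))

lemma qreg_carrier: "qreg r s A \<in> carrier_mat (r * c) (s * c)"
  by (rule carrier_matI) simp_all

text \<open>g lies in the coset inv (qs ! u) (qs ! v) exactly if right multiplication by the coset
  of g takes qs ! u to qs ! v. In this form the summand of g carries a condition that behaves well
  under products of group elements.\<close>

lemma qreg_index:
  assumes A: "gr_entries G r s A" and ab: "a < r * c" "b < s * c"
  shows "qreg r s A $$ (a, b) = (\<Sum>g | A (a div c) (b div c) g \<noteq> 0.
     if qs ! (a mod c) \<otimes>\<^bsub>Q\<^esub> (H #> g) = qs ! (b mod c) then A (a div c) (b div c) g else 0)"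
proof -
  define i j u v where iuv: "i = a div c" "j = b div c" "u = a mod c" "v = b mod c"
  have lt: "i < r" "j < s" "u < c" "v < c"
    using ab c_pos by (auto simp: iuv less_mult_imp_div_less)
  note fin = gr_entriesD(1)[OF A lt(1,2)] and mem = gr_entriesD(2)[OF A lt(1,2)]
  define p where "p = inv\<^bsub>Q\<^esub> (qs ! u) \<otimes>\<^bsub>Q\<^esub> qs ! v"
  have p: "p \<in> carrier Q" using qs_nth lt by (simp add: p_def)
  have iff: "g \<in> p \<longleftrightarrow> qs ! u \<otimes>\<^bsub>Q\<^esub> (H #> g) = qs ! v" if "A i j g \<noteq> 0" for g
  proof -
    have g: "g \<in> carrier G" by (rule mem[OF that])
    have "g \<in> p \<longleftrightarrow> H #> g = p" by (rule mem_coset_iff[OF g p])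
    also have "\<dots> \<longleftrightarrow> qs ! u \<otimes>\<^bsub>Q\<^esub> (H #> g) = qs ! v"
      using qs_nth[OF lt(3)] qs_nth[OF lt(4)] coset_closed[OF g]
      by (auto simp: p_def Q.m_assoc[symmetric] Q.inv_solve_left)
    finally show ?thesis .
  qed
  have "qreg r s A $$ (a, b) = gr_proj G H (A i j) p"
    using ab by (simp add: qreg_def regular_mat_eq block_mat_def qs(3) gr_mat_proj_def iuv p_def)
  also have "\<dots> = (\<Sum>g | g \<in> p \<and> A i j g \<noteq> 0. A i j g)" using p by (simp add: gr_proj_def)
  also have "{g. g \<in> p \<and> A i j g \<noteq> 0} = {g \<in> {g. A i j g \<noteq> 0}. qs ! u \<otimes>\<^bsub>Q\<^esub> (H #> g) = qs ! v}" using iff by auto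
  finally show ?thesis unfolding iuv[symmetric] sum.inter_filter[OF fin] .
qed

text \<open>The regular representation is multiplicative. After expanding, the intermediate index of
  the matrix product is determined by u and g, and the remaining sum over pairs (g, h) is the one in
  \<open>sum_gr_mult\<close>, weighted by the indicator that the coset of the product takes qs ! u
  to qs ! v.\<close>

lemma qreg_mult:
  assumes A: "gr_entries G r s A" and B: "gr_entries G s t B"
  shows "qreg r t (gr_mult G s A B) = qreg r s A * qreg s t B"
proof (rule eq_matI)
  fix a b assume "a < dim_row (qreg r s A * qreg s t B)" "b < dim_col (qreg r s A * qreg s t B)"
  then have ab: "a < r * c" "b < t * c" by auto
  define i l u v where iuv: "i = a div c" "l = b div c" "u = a mod c" "v = b mod c"
  have lt: "i < r" "l < t" "u < c" "v < c" using ab c_pos by (auto simp: iuv less_mult_imp_div_less)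
  define q where "q g = H #> g" for g
  have q: "q g \<in> carrier Q" if "g \<in> carrier G" for g using coset_closed[OF that] by (simp add: q_def)
  let ?f = "\<lambda>j g x. if qs ! u \<otimes>\<^bsub>Q\<^esub> q g = x then A i j g else 0"
  let ?g = "\<lambda>j h x. if x \<otimes>\<^bsub>Q\<^esub> q h = qs ! v then B j l h else 0"
  note cA = gr_entriesD(2)[OF A lt(1)] and cB = gr_entriesD(2)[OF B _ lt(2)]
  have "(qreg r s A * qreg s t B) $$ (a, b) = (\<Sum>k<s * c. qreg r s A $$ (a, k) * qreg s t B $$ (k, b))"
    using ab by (simp add: scalar_prod_def atLeast0LessThan)
  also have "\<dots> = (\<Sum>k<s * c. (\<Sum>g | A i (k div c) g \<noteq> 0. ?f (k div c) g (qs ! (k mod c)))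
      * (\<Sum>h | B (k div c) l h \<noteq> 0. ?g (k div c) h (qs ! (k mod c))))"
    by (rule sum.cong[OF refl]) (simp add: qreg_index[OF A ab(1)] qreg_index[OF B _ ab(2)] iuv q_def cong del: if_weak_cong)
  also have "\<dots> = (\<Sum>j<s. \<Sum>w<c. (\<Sum>g | A i j g \<noteq> 0. ?f j g (qs ! w))
      * (\<Sum>h | B j l h \<noteq> 0. ?g j h (qs ! w)))"
    by (rule sum_block[OF c_pos])
  also have "\<dots> = (\<Sum>j<s. \<Sum>g | A i j g \<noteq> 0. \<Sum>h | B j l h \<noteq> 0.
      (if qs ! u \<otimes>\<^bsub>Q\<^esub> q (g \<otimes> h) = qs ! v then 1 else 0) * (A i j g * B j l h))"
  proof (rule sum.cong[OF refl])
    fix j assume "j \<in> {..<s}"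
    then have j: "j < s" by simp
    have "(\<Sum>w<c. (\<Sum>g | A i j g \<noteq> 0. ?f j g (qs ! w))
        * (\<Sum>h | B j l h \<noteq> 0. ?g j h (qs ! w)))
      = (\<Sum>w<c. \<Sum>g | A i j g \<noteq> 0. \<Sum>h | B j l h \<noteq> 0. ?f j g (qs ! w)
         * ?g j h (qs ! w))"
      by (simp only: sum_product)
    also have "\<dots> = (\<Sum>g | A i j g \<noteq> 0. \<Sum>w<c. \<Sum>h | B j l h \<noteq> 0. ?f j g (qs ! w)
         * ?g j h (qs ! w))" by (rule sum.swap)
    also have "\<dots> = (\<Sum>g | A i j g \<noteq> 0. \<Sum>h | B j l h \<noteq> 0. \<Sum>w<c. ?f j g (qs ! w)
         * ?g j h (qs ! w))" by (intro sum.cong refl sum.swap)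
    also have "\<dots> = (\<Sum>g | A i j g \<noteq> 0. \<Sum>h | B j l h \<noteq> 0.
      (if qs ! u \<otimes>\<^bsub>Q\<^esub> q (g \<otimes> h) = qs ! v then 1 else 0) * (A i j g * B j l h))"
    proof (rule sum.cong[OF refl], rule sum.cong[OF refl])
      fix g h assume "g \<in> {g. A i j g \<noteq> 0}" "h \<in> {h. B j l h \<noteq> 0}"
      then have gh: "g \<in> carrier G" "h \<in> carrier G" using cA[OF j] cB[OF j] by auto
      define w0 where "w0 = qs ! u \<otimes>\<^bsub>Q\<^esub> q g"
      have w0: "w0 \<in> carrier Q" using qs_nth[OF lt(3)] q[OF gh(1)] by (simp add: w0_def)
      have e: "w0 \<otimes>\<^bsub>Q\<^esub> q h = qs ! u \<otimes>\<^bsub>Q\<^esub> q (g \<otimes> h)"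
        using qs_nth[OF lt(3)] q gh by (simp add: w0_def Q.m_assoc coset_mult[symmetric] q_def[symmetric] flip: q_def)
           (simp add: q_def coset_mult)
      have "(\<Sum>w<c. (if w0 = qs ! w then A i j g else 0) * ?g j h (qs ! w))
          = (\<Sum>x\<in>carrier Q. (if w0 = x then A i j g else 0) * (if x \<otimes>\<^bsub>Q\<^esub> q h = qs ! v then B j l h else 0))"
        by (rule sum_qs[of "\<lambda>x. (if w0 = x then A i j g else 0) * (if x \<otimes>\<^bsub>Q\<^esub> q h = qs ! v then B j l h else 0)"])
      also have "\<dots> = (\<Sum>x\<in>carrier Q. if x = w0 then A i j g * (if w0 \<otimes>\<^bsub>Q\<^esub> q h = qs ! v then B j l h else 0) else 0)"
        by (rule sum.cong) auto
      also have "\<dots> = A i j g * (if w0 \<otimes>\<^bsub>Q\<^esub> q h = qs ! v then B j l h else 0)"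
        using w0 finite_rcosets by (simp add: carrier_Q)
      finally show "(\<Sum>w<c. ?f j g (qs ! w) * ?g j h (qs ! w))
        = (if qs ! u \<otimes>\<^bsub>Q\<^esub> q (g \<otimes> h) = qs ! v then 1 else 0) * (A i j g * B j l h)"
        unfolding e by (simp add: w0_def)
    qed
    finally show "(\<Sum>w<c. (\<Sum>g | A i j g \<noteq> 0. ?f j g (qs ! w))
        * (\<Sum>h | B j l h \<noteq> 0. ?g j h (qs ! w)))
      = (\<Sum>g | A i j g \<noteq> 0. \<Sum>h | B j l h \<noteq> 0.
      (if qs ! u \<otimes>\<^bsub>Q\<^esub> q (g \<otimes> h) = qs ! v then 1 else 0) * (A i j g * B j l h))" .
  qed
  also have "\<dots> = (\<Sum>k | gr_mult G s A B i l k \<noteq> 0. (if qs ! u \<otimes>\<^bsub>Q\<^esub> q k = qs ! v then 1 else 0) * gr_mult G s A B i l k)"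
    by (rule sum_gr_mult[OF A B lt(1,2), symmetric])
  also have "\<dots> = qreg r t (gr_mult G s A B) $$ (a, b)"
    unfolding qreg_index[OF gr_entries_mult[OF A B] ab] iuv[symmetric] q_def
    by (intro sum.cong) auto
  finally show "qreg r t (gr_mult G s A B) $$ (a, b) = (qreg r s A * qreg s t B) $$ (a, b)" by simp
qed simp_all

lemma qreg_adjoint:
  assumes A: "gr_entries G r s A"
  shows "qreg s r (gr_adjoint G A) = mat_adjoint (qreg r s A)"
proof (rule eq_matI)
  fix b a assume "b < dim_row (mat_adjoint (qreg r s A))" "a < dim_col (mat_adjoint (qreg r s A))"
  then have ab: "a < r * c" "b < s * c" by auto
  define i j u v where iuv: "i = a div c" "j = b div c" "u = a mod c" "v = b mod c"
  have lt: "i < r" "j < s" "u < c" "v < c" using ab c_pos by (auto simp: iuv less_mult_imp_div_less)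
  note cA = gr_entriesD(2)[OF A lt(1,2)]
  have inj: "inj_on (m_inv G) {g. A i j g \<noteq> 0}" using cA by (auto intro!: inj_onI dest: inv_inj[THEN inj_onD])
  have "qreg s r (gr_adjoint G A) $$ (b, a) = (\<Sum>g | gr_adjoint G A j i g \<noteq> 0.
      if qs ! v \<otimes>\<^bsub>Q\<^esub> (H #> g) = qs ! u then gr_adjoint G A j i g else 0)"
    unfolding qreg_index[OF gr_entries_adjoint[OF A] ab(2,1)] iuv ..
  also have "\<dots> = (\<Sum>g | A i j g \<noteq> 0. if qs ! v \<otimes>\<^bsub>Q\<^esub> (H #> inv g) = qs ! u then cnj (A i j g) else 0)"
    unfolding gr_adjoint_support[OF A lt(1,2)] sum.reindex[OF inj] o_def
    by (rule sum.cong) (use cA in \<open>auto simp: gr_adjoint_def\<close>)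
  also have "\<dots> = (\<Sum>g | A i j g \<noteq> 0. if qs ! u \<otimes>\<^bsub>Q\<^esub> (H #> g) = qs ! v then cnj (A i j g) else 0)"
  proof (rule sum.cong[OF refl])
    fix g assume "g \<in> {g. A i j g \<noteq> 0}"
    then have g: "g \<in> carrier G" using cA by simp
    have "qs ! v \<otimes>\<^bsub>Q\<^esub> inv\<^bsub>Q\<^esub> (H #> g) = qs ! u \<longleftrightarrow> qs ! u \<otimes>\<^bsub>Q\<^esub> (H #> g) = qs ! v"
      using qs_nth[OF lt(3)] qs_nth[OF lt(4)] coset_closed[OF g] by (metis Q.inv_solve_right)
    then show "(if qs ! v \<otimes>\<^bsub>Q\<^esub> (H #> inv g) = qs ! u then cnj (A i j g) else 0)
        = (if qs ! u \<otimes>\<^bsub>Q\<^esub> (H #> g) = qs ! v then cnj (A i j g) else 0)"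
      by (simp add: coset_inv[OF g])
  qed
  also have "\<dots> = cnj (qreg r s A $$ (a, b))"
    unfolding qreg_index[OF A ab] iuv by (simp add: if_distrib[of cnj] cong: if_cong)
  finally show "qreg s r (gr_adjoint G A) $$ (b, a) = mat_adjoint (qreg r s A) $$ (b, a)"
    using ab by (simp add: mat_adjoint_index)
qed simp_all

lemma qreg_one: "qreg r r (gr_one G) = 1\<^sub>m (r * c)"
proof (rule eq_matI)
  fix a b assume "a < dim_row (1\<^sub>m (r * c))" "b < dim_col (1\<^sub>m (r * c))"
  then have ab: "a < r * c" "b < r * c" by auto
  have supp: "{g. gr_one G i j g \<noteq> 0} = (if i = j then {\<one>} else {})" for i j by (auto simp: gr_one_def)
  have "a mod c < c" "b mod c < c" using c_pos by auto
  then have "qs ! (a mod c) \<otimes>\<^bsub>Q\<^esub> (H #> \<one>) = qs ! (b mod c) \<longleftrightarrow> a mod c = b mod c"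
    using qs_nth by (simp add: coset_one[symmetric] qs_eq_iff)
  moreover have "a = b \<longleftrightarrow> a div c = b div c \<and> a mod c = b mod c"
    by (metis div_mult_mod_eq)
  ultimately show "qreg r r (gr_one G) $$ (a, b) = 1\<^sub>m (r * c) $$ (a, b)"
    unfolding qreg_index[OF gr_entries_one ab] supp using ab by (auto simp: gr_one_def)
qed simp_all

lemma qreg_pow:
  assumes C: "gr_entries G r r C"
  shows "qreg r r (gr_pow G r C k) = qreg r r C ^\<^sub>m k"
  by (induction k) (simp_all add: qreg_one qreg_mult[OF gr_entries_pow[OF C] C])

text \<open>A group element contributes to a diagonal entry exactly if its coset is the identity,
  and then it does so in all c positions of the block.\<close>

lemma qreg_trace:
  assumes A: "gr_entries G r r A"
  shows "(\<Sum>a<r * c. qreg r r A $$ (a, a)) = of_nat c * (\<Sum>i<r. \<Sum>g | A i i g \<noteq> 0 \<and> g \<in> H. A i i g)"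
proof -
  have "(\<Sum>a<r * c. qreg r r A $$ (a, a)) = (\<Sum>a<r * c. (\<Sum>g | A (a div c) (a div c) g \<noteq> 0.
     if qs ! (a mod c) \<otimes>\<^bsub>Q\<^esub> (H #> g) = qs ! (a mod c) then A (a div c) (a div c) g else 0))"
    by (intro sum.cong refl) (simp add: qreg_index[OF A])
  also have "\<dots> = (\<Sum>i<r. \<Sum>u<c. \<Sum>g | A i i g \<noteq> 0. if qs ! u \<otimes>\<^bsub>Q\<^esub> (H #> g) = qs ! u then A i i g else 0)"
    by (rule sum_block[OF c_pos])
  also have "\<dots> = (\<Sum>i<r. \<Sum>u<c. \<Sum>g | A i i g \<noteq> 0 \<and> g \<in> H. A i i g)"
  proof (rule sum.cong[OF refl], rule sum.cong[OF refl])
    fix i u assume "i \<in> {..<r}" "u \<in> {..<c}"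
    then have iu: "i < r" "u < c" by auto
    have "qs ! u \<otimes>\<^bsub>Q\<^esub> (H #> g) = qs ! u \<longleftrightarrow> g \<in> H" if "A i i g \<noteq> 0" for g
    proof -
      have g: "g \<in> carrier G" by (rule gr_entriesD(2)[OF A iu(1,1) that])
      have "qs ! u \<otimes>\<^bsub>Q\<^esub> (H #> g) = qs ! u \<longleftrightarrow> H #> g = \<one>\<^bsub>Q\<^esub>"
        using qs_nth[OF iu(2)] coset_closed[OF g] by simp
      then show ?thesis using coset_eq_one_iff[OF g] by simp
    qed
    then have "(\<Sum>g | A i i g \<noteq> 0. if qs ! u \<otimes>\<^bsub>Q\<^esub> (H #> g) = qs ! u then A i i g else 0)
        = (\<Sum>g | A i i g \<noteq> 0. if g \<in> H then A i i g else 0)" by (intro sum.cong) auto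
    also have "\<dots> = (\<Sum>g | A i i g \<noteq> 0 \<and> g \<in> H. A i i g)"
      using sum.inter_filter[OF gr_entriesD(1)[OF A iu(1,1)], of "A i i" "\<lambda>g. g \<in> H"] by simp
    finally show "(\<Sum>g | A i i g \<noteq> 0. if qs ! u \<otimes>\<^bsub>Q\<^esub> (H #> g) = qs ! u then A i i g else 0)
        = (\<Sum>g | A i i g \<noteq> 0 \<and> g \<in> H. A i i g)" .
  qed
  finally show ?thesis by (simp add: sum_distrib_left)
qed

text \<open>If H meets the supports of the diagonal entries of C ^ k only in the identity, the
  normalized trace over the quotient is exactly the trace over the group. For fixed k this can be
  achieved by making H small.\<close>

lemma gram_trace:
  assumes A: "gr_entries G r s A"
  defines "C \<equiv> gr_mult G s A (gr_adjoint G A)"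
  defines "M \<equiv> qreg r s A"
  assumes triv: "\<And>i g. i < r \<Longrightarrow> gr_pow G r C k i i g \<noteq> 0 \<Longrightarrow> g \<in> H \<Longrightarrow> g = \<one>"
  shows "(\<Sum>a<r * c. ((M * mat_adjoint M) ^\<^sub>m k) $$ (a, a)) = of_nat c * (\<Sum>i<r. gr_pow G r C k i i \<one>)"
proof -
  note A' = gr_entries_adjoint[OF A]
  have C: "gr_entries G r r C" unfolding C_def by (rule gr_entries_mult[OF A A'])
  have "M * mat_adjoint M = qreg r r C"
    unfolding M_def C_def qreg_mult[OF A A'] qreg_adjoint[OF A] ..
  then have "(\<Sum>a<r * c. ((M * mat_adjoint M) ^\<^sub>m k) $$ (a, a)) = (\<Sum>a<r * c. qreg r r (gr_pow G r C k) $$ (a, a))"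
    by (simp add: qreg_pow[OF C])
  also have "\<dots> = of_nat c * (\<Sum>i<r. \<Sum>g | gr_pow G r C k i i g \<noteq> 0 \<and> g \<in> H. gr_pow G r C k i i g)"
    by (rule qreg_trace[OF gr_entries_pow[OF C]])
  also have "(\<Sum>i<r. \<Sum>g | gr_pow G r C k i i g \<noteq> 0 \<and> g \<in> H. gr_pow G r C k i i g) = (\<Sum>i<r. gr_pow G r C k i i \<one>)"
  proof (rule sum.cong[OF refl])
    fix i assume i: "i \<in> {..<r}"
    have "(\<Sum>g | gr_pow G r C k i i g \<noteq> 0 \<and> g \<in> H. gr_pow G r C k i i g) = (\<Sum>g\<in>{\<one>}. gr_pow G r C k i i g)"
    proof (rule sum.mono_neutral_left)
      show "{g. gr_pow G r C k i i g \<noteq> 0 \<and> g \<in> H} \<subseteq> {\<one>}" using triv i by blast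
    qed auto
    then show "(\<Sum>g | gr_pow G r C k i i g \<noteq> 0 \<and> g \<in> H. gr_pow G r C k i i g) = gr_pow G r C k i i \<one>" by simp
  qed
  finally show ?thesis .
qed

end

section \<open>Convergence of moments\<close>

lemma ex_polynomial_approximation:
  fixes f :: "real \<Rightarrow> real"
  assumes "continuous_on {0..b} f" "0 < e"
  shows "\<exists>a n. \<forall>x\<in>{0..b}. \<bar>f x - (\<Sum>i\<le>n. a i * x ^ i)\<bar> < e"
proof -
  obtain g where g: "real_polynomial_function g" "\<And>x. x \<in> {0..b} \<Longrightarrow> \<bar>f x - g x\<bar> < e"
    using Stone_Weierstrass_real_polynomial_function[OF _ assms, of thesis] by auto
  then obtain a n where "g = (\<lambda>x. \<Sum>i\<le>n. a i * x ^ i)"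
    using real_polynomial_function_iff_sum by blast
  then show ?thesis using g(2) by blast
qed

text \<open>Finite spectra d m, normalized by c m, whose k-th moments agree with that of \<Phi> from
  some m on that may depend on k. The common bound K' on all spectra is what makes polynomial
  approximation uniform in m.\<close>

locale moment_approximation = distribution_function \<Phi> K c0 for \<Phi> K c0 +
  fixes c n :: "nat \<Rightarrow> nat" and d :: "nat \<Rightarrow> nat \<Rightarrow> real" and K' :: real
  assumes d_nonneg: "a < n m \<Longrightarrow> 0 \<le> d m a" and d_le: "a < n m \<Longrightarrow> d m a \<le> K'"
    and moment: "\<forall>\<^sub>F m in sequentially. (\<Sum>a<n m. d m a ^ k) / real (c m) = (LINT t|interval_measure \<Phi>. t ^ k)"
begin

abbreviation avg :: "nat \<Rightarrow> (real \<Rightarrow> real) \<Rightarrow> real" where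
  "avg m f \<equiv> (\<Sum>a<n m. f (d m a)) / real (c m)"

lemma eventually_mass: "\<forall>\<^sub>F m in sequentially. real (n m) / real (c m) = c0"
  using moment[of 0] by (simp add: measure_M)

lemma avg_tendsto:
  assumes f: "continuous_on UNIV f"
  shows "(\<lambda>m. avg m f) \<longlonglongrightarrow> (LINT t|M. f t)"
proof (rule tendstoI)
  fix e :: real assume e: "0 < e"
  have c0: "0 \<le> c0" using F_nonneg[of K] F_top[of K] by simp
  \<comment> \<open>Replacing f by a polynomial costs at most e' c0 < e / 2 in the average and in
    the integral; the summand 1 admits c0 = 0.\<close>
  define e' where "e' = e / (4 * (c0 + 1))"
  have e': "0 < e'" "e' * c0 < e / 2"
  proof -
    show "0 < e'" using e c0 by (simp add: e'_def)
    have "e' * c0 = e / 4 * (c0 / (c0 + 1))" by (simp add: e'_def)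
    also have "\<dots> \<le> e / 4 * 1" using e c0 by (intro mult_left_mono) auto
    finally show "e' * c0 < e / 2" using e by simp
  qed
  obtain a N where aN: "\<And>x. 0 \<le> x \<Longrightarrow> x \<le> max K K' \<Longrightarrow> \<bar>f x - (\<Sum>i\<le>N. a i * x ^ i)\<bar> < e'"
    using ex_polynomial_approximation[OF continuous_on_subset[OF f] e'(1), of "max K K'"] by fastforce
  define p where "p x = (\<Sum>i\<le>N. a i * x ^ i)" for x
  have p: "continuous_on UNIV p" unfolding p_def by (intro continuous_intros)
  have "\<forall>\<^sub>F m in sequentially. \<forall>k\<in>{..N}. (\<Sum>a<n m. d m a ^ k) / real (c m) = (LINT t|M. t ^ k)"
    by (rule eventually_ball_finite) (use moment in auto)
  then show "\<forall>\<^sub>F m in sequentially. dist (avg m f) (LINT t|M. f t) < e"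
    using eventually_mass
  proof eventually_elim
    case (elim m)
    have ip: "(LINT t|M. p t) = (\<Sum>i\<le>N. a i * (LINT t|M. t ^ i))"
      unfolding p_def by (subst Bochner_Integration.integral_sum)
        (auto intro!: integrable_mult_right integrable_continuous continuous_intros)
    have "avg m p = (\<Sum>i\<le>N. a i * ((\<Sum>x<n m. d m x ^ i) / real (c m)))"
      unfolding p_def by (subst sum.swap) (simp add: sum_distrib_left sum_divide_distrib)
    also have "\<dots> = (LINT t|M. p t)" unfolding ip using elim(1) by simp
    finally have 1: "avg m p = (LINT t|M. p t)" .
    have 2: "\<bar>avg m f - avg m p\<bar> \<le> e' * c0"
    proof -
      have "\<bar>\<Sum>x<n m. f (d m x) - p (d m x)\<bar> \<le> (\<Sum>x<n m. e')"
      proof (rule order_trans[OF sum_abs sum_mono])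
        fix x assume "x \<in> {..<n m}"
        then have "0 \<le> d m x" "d m x \<le> max K K'" using d_nonneg d_le[of x m] by auto
        then show "\<bar>f (d m x) - p (d m x)\<bar> \<le> e'" unfolding p_def by (rule less_imp_le[OF aN])
      qed
      then have "\<bar>avg m f - avg m p\<bar> \<le> real (n m) * e' / real (c m)"
        by (simp add: diff_divide_distrib[symmetric] sum_subtractf divide_right_mono)
      also have "real (n m) * e' / real (c m) = e' * (real (n m) / real (c m))" by simp
      finally show ?thesis unfolding elim(2) .
    qed
    have 3: "\<bar>(LINT t|M. f t) - (LINT t|M. p t)\<bar> \<le> e' * c0"
    proof -
      have "(LINT t|M. f t) - (LINT t|M. p t) = (LINT t|M. f t - p t)"
        by (rule Bochner_Integration.integral_diff[symmetric]) (intro integrable_continuous f p)+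
      also have "\<bar>\<dots>\<bar> \<le> (LINT t|M. \<bar>f t - p t\<bar>)" by (rule integral_abs_bound)
      also have "\<dots> \<le> (LINT t|M. e')"
      proof (rule integral_mono_AE)
        show "AE t in M. \<bar>f t - p t\<bar> \<le> e'" using AE_in_Icc
          by eventually_elim (use aN in \<open>auto simp: p_def intro!: less_imp_le\<close>)
      qed (auto intro!: integrable_continuous continuous_intros f p)
      finally show ?thesis by (simp add: measure_M mult.commute)
    qed
    show ?case using 1 2 3 e'(2) by (simp add: dist_real_def)
  qed
qed

text \<open>The ramp \<open>g s\<close> is 1 up to s and 0 from 2 s on, hence lies between the
  indicators of t \<le> s and t \<le> 2 s. Averages of this continuous function converge, and the
  factor 2 in the threshold takes care of jumps of \<Phi>.\<close>

lemma count_sandwich: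
  assumes l: "0 < l" and e: "0 < e"
  shows "\<forall>\<^sub>F m in sequentially. \<Phi> l \<le> real (card {a. a < n m \<and> d m a \<le> 2 * l}) / real (c m) + e"
    and "\<forall>\<^sub>F m in sequentially. real (card {a. a < n m \<and> d m a \<le> l / 2}) / real (c m) \<le> \<Phi> l + e"
proof -
  define g where "g s t = max 0 (min 1 (2 - t / s))" for s t :: real
  have g: "continuous_on UNIV (g s)" if "s > 0" for s unfolding g_def using that by (intro continuous_intros) auto
  have g1: "g s t = 1" if "s > 0" "t \<le> s" for s t using that by (simp add: g_def)
  have g0: "g s t = 0" if "s > 0" "2 * s \<le> t" for s t using that by (simp add: g_def field_simps)
  have gb: "0 \<le> g s t" "g s t \<le> 1" for s t by (simp_all add: g_def)
  have card_sum: "real (card {a. a < n m \<and> d m a \<le> s}) = (\<Sum>a<n m. if d m a \<le> s then 1 else 0)" for m s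
    by (simp add: sum.If_cases Int_def)
  have ind: "(LINT t|M. indicator {..l} t) = \<Phi> l" using measure_atMost[of l] l by simp
  have intind: "integrable M (indicator {..l} :: real \<Rightarrow> real)"
    by (rule integrable_real_indicator) (auto simp: less_top[symmetric])
  have "\<forall>\<^sub>F m in sequentially. \<bar>avg m (g l) - (LINT t|M. g l t)\<bar> < e"
    using tendstoD[OF avg_tendsto[OF g[OF l]] e] by (simp add: dist_real_def)
  then show "\<forall>\<^sub>F m in sequentially. \<Phi> l \<le> real (card {a. a < n m \<and> d m a \<le> 2 * l}) / real (c m) + e"
  proof eventually_elim
    case (elim m)
    have "(LINT t|M. indicator {..l} t) \<le> (LINT t|M. g l t)"
      by (rule integral_mono[OF intind integrable_continuous[OF g[OF l]]]) (use g1[OF l] gb in \<open>auto simp: indicator_def\<close>)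
    moreover have "avg m (g l) \<le> real (card {a. a < n m \<and> d m a \<le> 2 * l}) / real (c m)"
      unfolding card_sum
    proof (intro divide_right_mono sum_mono)
      show "g l (d m a) \<le> (if d m a \<le> 2 * l then 1 else 0)" for a using g0[OF l, of "d m a"] gb[of l "d m a"] by auto
    qed simp
    ultimately show ?case using elim ind by linarith
  qed
  have l2: "l / 2 > 0" using l by simp
  have "\<forall>\<^sub>F m in sequentially. \<bar>avg m (g (l / 2)) - (LINT t|M. g (l / 2) t)\<bar> < e"
    using tendstoD[OF avg_tendsto[OF g[OF l2]] e] by (simp add: dist_real_def)
  then show "\<forall>\<^sub>F m in sequentially. real (card {a. a < n m \<and> d m a \<le> l / 2}) / real (c m) \<le> \<Phi> l + e"
  proof eventually_elim
    case (elim m)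
    have "(LINT t|M. g (l / 2) t) \<le> (LINT t|M. indicator {..l} t)"
    proof (rule integral_mono[OF integrable_continuous[OF g[OF l2]] intind])
      show "g (l / 2) t \<le> indicator {..l} t" for t
        using g0[OF l2, of t] gb[of "l / 2" t] by (cases "t \<le> l") (auto simp: indicator_def)
    qed
    moreover have "real (card {a. a < n m \<and> d m a \<le> l / 2}) / real (c m) \<le> avg m (g (l / 2))"
      unfolding card_sum
    proof (intro divide_right_mono sum_mono)
      show "(if d m a \<le> l / 2 then 1 else 0) \<le> g (l / 2) (d m a)" for a using g1[OF l2, of "d m a"] gb[of "l / 2" "d m a"] by auto
    qed simp
    ultimately show ?case using elim ind by linarith
  qed
qed

end

section \<open>Roots of unity\<close>

text \<open>The chord has length 2 \<bar>sin (x / 2)\<bar>. With y = x / 2 and \<bar>y\<bar> \<le>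
  2, Taylor's remainder \<bar>y\<bar> ^ 3 / 6 is at most 2 \<bar>y\<bar> / 3, which leaves \<bar>sin
  y\<bar> \<ge> \<bar>y\<bar> / 3.\<close>

lemma cis_near_one: assumes "\<bar>x\<bar> \<le> pi" shows "\<bar>x\<bar> / 3 \<le> cmod (cis x - 1)" and "cmod (cis x - 1) \<le> \<bar>x\<bar>"
proof -
  have n: "cmod (cis x - 1) = 2 * \<bar>sin (x / 2)\<bar>"
  proof -
    have "(cmod (cis x - 1))\<^sup>2 = (cos x - 1)\<^sup>2 + (sin x)\<^sup>2" by (simp add: cmod_power2)
    also have "\<dots> = 2 - 2 * cos x" using sin_cos_squared_add[of x] by (simp add: power2_diff)
    also have "cos x = 1 - 2 * (sin (x / 2))\<^sup>2" using cos_double_sin[of "x / 2"] by simp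
    finally have "(cmod (cis x - 1))\<^sup>2 = (2 * \<bar>sin (x / 2)\<bar>)\<^sup>2" by (simp add: power_mult_distrib)
    then show ?thesis by (subst (asm) power2_eq_iff_nonneg) auto
  qed
  show "cmod (cis x - 1) \<le> \<bar>x\<bar>" using abs_sin_x_le_abs_x[of "x / 2"] by (simp add: n)
  define y where "y = x / 2"
  have y: "\<bar>y\<bar> \<le> 2" using assms pi_less_4 by (simp add: y_def)
  have "\<bar>sin y - (\<Sum>m<3. sin_coeff m * y ^ m)\<bar> \<le> inverse (fact 3) * \<bar>y\<bar> ^ 3"
    by (rule Maclaurin_sin_bound)
  also have "(\<Sum>m<3. sin_coeff m * y ^ m) = y" by (simp add: numeral_eq_Suc sin_coeff_def)
  also have "inverse (fact 3) * \<bar>y\<bar> ^ 3 \<le> \<bar>y\<bar> * (2 / 3)"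
  proof -
    have "\<bar>y\<bar>\<^sup>2 \<le> 2\<^sup>2" using y by (intro power_mono) auto
    then have "\<bar>y\<bar> * \<bar>y\<bar>\<^sup>2 \<le> \<bar>y\<bar> * 4" by (intro mult_left_mono) auto
    then show ?thesis by (simp add: fact_numeral power3_eq_cube power2_eq_square)
  qed
  finally have "\<bar>y\<bar> / 3 \<le> \<bar>sin y\<bar>" by linarith
  then show "\<bar>x\<bar> / 3 \<le> cmod (cis x - 1)" by (simp add: n y_def)
qed

lemma cis_diff: "cmod (cis x - cis y) = cmod (cis (x - y) - 1)"
proof -
  have "cis x - cis y = cis y * (cis (x - y) - 1)" by (simp add: right_diff_distrib cis_mult)
  then show ?thesis by (simp add: norm_mult)
qed

text \<open>The exponent j of a root of unity is only determined modulo m; it is normalized so that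
  the angle lies within \<pi> of a given \<theta>, where chords and angles are comparable.\<close>

lemma root_of_unity_eq_cis:
  assumes "0 < m" "\<xi> ^ m = 1"
  shows "\<exists>j::int. \<xi> = cis (2 * pi * real_of_int j / real m) \<and> \<bar>2 * pi * real_of_int j / real m - \<theta>\<bar> \<le> pi"
proof -
  obtain k where k: "\<xi> = cis (2 * pi * real k / real m)"
    using Complex.bij_betw_roots_unity[OF assms(1)] assms(2) unfolding bij_betw_def by auto
  define s where "s = 2 * pi * real k / real m - \<theta>"
  define t where "t = \<lfloor>s / (2 * pi) + 1 / 2\<rfloor>"
  have "of_int t \<le> s / (2 * pi) + 1 / 2" "s / (2 * pi) + 1 / 2 < of_int t + 1" unfolding t_def by linarith+
  then have "of_int t * (2 * pi) \<le> s + pi" "s + pi < (of_int t + 1) * (2 * pi)"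
    using pi_gt_zero by (simp_all add: field_simps)
  then have st: "\<bar>s - 2 * pi * of_int t\<bar> \<le> pi" by (simp add: abs_le_iff algebra_simps)
  have e: "2 * pi * real_of_int (int k - t * int m) / real m = 2 * pi * real k / real m - 2 * pi * of_int t"
    using assms(1) by (simp add: field_simps)
  have "cis (2 * pi * real k / real m - 2 * pi * of_int t) = \<xi>"
    unfolding k by (simp add: complex_eq_iff cos_diff sin_diff)
  then show ?thesis using st by (intro exI[of _ "int k - t * int m"]) (simp only: e s_def, simp add: algebra_simps)
qed

lemma card_int_interval_le:
  assumes "u \<le> v" shows "real (card {j::int. u \<le> real_of_int j \<and> real_of_int j \<le> v}) \<le> v - u + 1"
proof -
  have "{j::int. u \<le> real_of_int j \<and> real_of_int j \<le> v} = {\<lceil>u\<rceil>..\<lfloor>v\<rfloor>}" by (auto simp: ceiling_le_iff le_floor_iff)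
  then show ?thesis using assms by (simp add: of_nat_nat) linarith
qed

lemma card_int_interval_ge:
  "real (card {j::int. u \<le> real_of_int j \<and> real_of_int j \<le> v}) \<ge> v - u - 1"
proof -
  have "{j::int. u \<le> real_of_int j \<and> real_of_int j \<le> v} = {\<lceil>u\<rceil>..\<lfloor>v\<rfloor>}" by (auto simp: ceiling_le_iff le_floor_iff)
  then show ?thesis by simp linarith
qed

lemma finite_int_interval: "finite {j::int. u \<le> real_of_int j \<and> real_of_int j \<le> v}"
proof -
  have "{j::int. u \<le> real_of_int j \<and> real_of_int j \<le> v} = {\<lceil>u\<rceil>..\<lfloor>v\<rfloor>}" by (auto simp: ceiling_le_iff le_floor_iff)
  then show ?thesis by simp
qed

text \<open>A chord of length \<rho> spans an angle of at most 3 \<rho>, so j ranges over an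
  interval of length 6 \<rho> m / (2 \<pi>), which is at most \<rho> m because \<pi> > 3.\<close>

lemma card_roots_near_le:
  assumes m: "0 < m" and a: "cmod a = 1" and \<rho>: "0 \<le> \<rho>"
  shows "real (card {\<xi>. \<xi> ^ m = 1 \<and> cmod (\<xi> - a) \<le> \<rho>}) \<le> real m * \<rho> + 1"
proof -
  define \<theta> where "\<theta> = Arg a"
  have a': "a = cis \<theta>" using a cis_Arg[of a] by (cases "a = 0") (auto simp: \<theta>_def sgn_div_norm)
  define J where "J = {j::int. real m * (\<theta> - 3 * \<rho>) / (2 * pi) \<le> real_of_int j \<and> real_of_int j \<le> real m * (\<theta> + 3 * \<rho>) / (2 * pi)}"
  have "{\<xi>. \<xi> ^ m = 1 \<and> cmod (\<xi> - a) \<le> \<rho>} \<subseteq> (\<lambda>j. cis (2 * pi * real_of_int j / real m)) ` J"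
  proof
    fix \<xi> assume "\<xi> \<in> {\<xi>. \<xi> ^ m = 1 \<and> cmod (\<xi> - a) \<le> \<rho>}"
    then have \<xi>: "\<xi> ^ m = 1" "cmod (\<xi> - a) \<le> \<rho>" by auto
    obtain j where j: "\<xi> = cis (2 * pi * real_of_int j / real m)" "\<bar>2 * pi * real_of_int j / real m - \<theta>\<bar> \<le> pi"
      using root_of_unity_eq_cis[OF m \<xi>(1)] by blast
    have "\<bar>2 * pi * real_of_int j / real m - \<theta>\<bar> \<le> 3 * \<rho>"
      using cis_near_one(1)[OF j(2)] \<xi>(2) unfolding a' j(1) cis_diff by simp
    then have "\<theta> - 3 * \<rho> \<le> 2 * pi * real_of_int j / real m" "2 * pi * real_of_int j / real m \<le> \<theta> + 3 * \<rho>"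
      by (simp_all add: abs_le_iff algebra_simps)
    then have "j \<in> J" unfolding J_def using m pi_gt_zero by (simp add: field_simps)
    then show "\<xi> \<in> (\<lambda>j. cis (2 * pi * real_of_int j / real m)) ` J" using j(1) by blast
  qed
  moreover have "finite J" unfolding J_def by (rule finite_int_interval)
  ultimately have "card {\<xi>. \<xi> ^ m = 1 \<and> cmod (\<xi> - a) \<le> \<rho>} \<le> card J" by (rule surj_card_le[rotated])
  also have "real (card J) \<le> real m * (\<theta> + 3 * \<rho>) / (2 * pi) - real m * (\<theta> - 3 * \<rho>) / (2 * pi) + 1"
    unfolding J_def using \<rho> pi_gt_zero by (intro card_int_interval_le divide_right_mono mult_left_mono) auto
  also have "\<dots> = real m * \<rho> * (3 / pi) + 1" by (simp add: field_simps)
  also have "\<dots> \<le> real m * \<rho> * 1 + 1" using pi_gt3 \<rho> by (intro add_right_mono mult_left_mono) auto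
  finally show ?thesis by simp
qed

text \<open>All roots with angle between \<theta> and \<theta> + \<rho> count, since chords are not
  longer than arcs. There are at least m \<rho> / (2 \<pi>) - 1 of them, and 2 \<pi> < 8.\<close>

lemma card_roots_near_ge:
  assumes m: "0 < m" and a: "cmod a = 1" and \<rho>: "0 \<le> \<rho>" "\<rho> \<le> 1"
  shows "real (card {\<xi>. \<xi> ^ m = 1 \<and> cmod (\<xi> - a) \<le> \<rho>}) \<ge> real m * \<rho> / 8 - 1"
proof -
  define \<theta> where "\<theta> = Arg a"
  have a': "a = cis \<theta>" using a cis_Arg[of a] by (cases "a = 0") (auto simp: \<theta>_def sgn_div_norm)
  define J where "J = {j::int. real m * \<theta> / (2 * pi) \<le> real_of_int j \<and> real_of_int j \<le> real m * (\<theta> + \<rho>) / (2 * pi)}"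
  let ?f = "\<lambda>j. cis (2 * pi * real_of_int j / real m)"
  have J: "\<theta> \<le> 2 * pi * real_of_int j / real m \<and> 2 * pi * real_of_int j / real m \<le> \<theta> + \<rho>" if "j \<in> J" for j
    using that m pi_gt_zero by (simp add: J_def field_simps)
  have inj: "inj_on ?f J"
  proof (rule inj_onI)
    fix i j assume ij: "i \<in> J" "j \<in> J" "?f i = ?f j"
    define x where "x = 2 * pi * real_of_int i / real m - 2 * pi * real_of_int j / real m"
    have "\<bar>x\<bar> \<le> pi" unfolding x_def using J[OF ij(1)] J[OF ij(2)] \<rho> pi_gt3 by (intro abs_leI) linarith+
    from cis_near_one(1)[OF this] ij(3) have "x = 0" unfolding x_def cis_diff[symmetric] by simp
    then show "i = j" using m by (simp add: x_def)
  qed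
  have sub: "?f ` J \<subseteq> {\<xi>. \<xi> ^ m = 1 \<and> cmod (\<xi> - a) \<le> \<rho>}"
  proof
    fix \<xi> assume "\<xi> \<in> ?f ` J"
    then obtain j where j: "j \<in> J" "\<xi> = ?f j" by blast
    have "\<xi> ^ m = cis (2 * pi * real_of_int j)" unfolding j(2) Complex.DeMoivre using m by (simp add: mult_ac)
    also have "\<dots> = 1" by (rule cis_multiple_2pi) simp
    finally have 1: "\<xi> ^ m = 1" .
    define x where "x = 2 * pi * real_of_int j / real m - \<theta>"
    have "\<bar>x\<bar> \<le> \<rho>" using J[OF j(1)] by (simp add: x_def)
    then have "cmod (\<xi> - a) \<le> \<rho>"
      using cis_near_one(2)[of x] \<rho> pi_gt3 unfolding a' j(2) cis_diff x_def by linarith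
    with 1 show "\<xi> \<in> {\<xi>. \<xi> ^ m = 1 \<and> cmod (\<xi> - a) \<le> \<rho>}" by simp
  qed
  have "real m * \<rho> / 8 - 1 \<le> real m * (\<theta> + \<rho>) / (2 * pi) - real m * \<theta> / (2 * pi) - 1"
  proof -
    have "real m * \<rho> / 8 \<le> real m * \<rho> / (2 * pi)" using \<rho> pi_less_4 by (intro divide_left_mono) auto
    then show ?thesis by (simp add: field_simps)
  qed
  also have "\<dots> \<le> real (card J)" unfolding J_def by (rule card_int_interval_ge)
  also have "card J = card (?f ` J)" by (rule card_image[OF inj, symmetric])
  also have "card (?f ` J) \<le> card {\<xi>. \<xi> ^ m = 1 \<and> cmod (\<xi> - a) \<le> \<rho>}"
    by (rule card_mono[OF _ sub]) (rule finite_subset[OF _ finite_roots_unity[of m]], use m in auto)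
  finally show ?thesis by simp
qed

text \<open>The replacement for a Baker constant at the zero 1, for which none is assumed.\<close>

lemma root_of_unity_distance_one:
  assumes m: "0 < m" and \<xi>: "\<xi> ^ m = 1" "\<xi> \<noteq> 1"
  shows "1 / real m \<le> cmod (\<xi> - 1)"
proof -
  obtain j where j: "\<xi> = cis (2 * pi * real_of_int j / real m)" "\<bar>2 * pi * real_of_int j / real m - 0\<bar> \<le> pi"
    using root_of_unity_eq_cis[OF m \<xi>(1)] by blast
  have "j \<noteq> 0" using j(1) \<xi>(2) by auto
  then have "1 \<le> \<bar>real_of_int j\<bar>" by linarith
  then have "3 * 1 \<le> 2 * pi * \<bar>real_of_int j\<bar>" using pi_gt3 by (intro mult_mono) auto
  then have "3 / real m \<le> \<bar>2 * pi * real_of_int j / real m\<bar>" using m by (simp add: abs_mult field_simps)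
  then show ?thesis using cis_near_one(1)[of "2 * pi * real_of_int j / real m"] j by simp
qed

text \<open>
  For \<open>\<xi> = exp (2 \<pi> \<i> j / m)\<close>, \<open>log a = \<i> \<theta>\<close> and \<open>log (-1) = (2 k + 1) \<pi> \<i>\<close> take
  \<open>b\<^sub>1 = (2 k + 1) m\<close> and \<open>b\<^sub>2 = -2 j\<close>: then \<open>\<Lambda> = (2 k + 1) m \<i> (\<theta> - 2 \<pi> j / m)\<close>.
\<close>

lemma baker_root_of_unity_distance:
  assumes a: "cmod a = 1" and B: "baker_constant a (-1) D'" and D: "D' \<le> D"
  shows "\<exists>c>0. \<forall>m \<xi>. 0 < m \<longrightarrow> \<xi> ^ m = 1 \<longrightarrow> \<xi> \<noteq> a \<longrightarrow> c * real m powr (- (1 + D)) \<le> cmod (\<xi> - a)"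
proof -
  obtain l1 l2 where l: "exp l1 = a" "exp l2 = -1" and D1: "1 \<le> D'"
    and bak: "\<And>b1 b2 :: int. of_int b1 * l1 + of_int b2 * l2 \<noteq> 0 \<Longrightarrow>
      cmod (of_int b1 * l1 + of_int b2 * l2) > of_int (max \<bar>b1\<bar> \<bar>b2\<bar>) powr (- D')"
    using B unfolding baker_constant_def by blast
  define \<theta> where "\<theta> = Im l1"
  have "Re l1 = 0" using a unfolding l(1)[symmetric] norm_exp_eq_Re by simp
  then have l1: "l1 = \<i> * of_real \<theta>" by (simp add: complex_eq_iff \<theta>_def)
  have a': "a = cis \<theta>" unfolding l(1)[symmetric] l1 by (simp add: cis_conv_exp)
  have "exp l2 = exp (\<i> * of_real pi)" using l(2) by (simp add: exp_pi_i')
  then obtain k :: int where "l2 = \<i> * of_real pi + (of_int (2 * k) * pi) * \<i>" unfolding exp_eq by blast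
  then have l2: "l2 = \<i> * of_real (of_int (2 * k + 1) * pi)" by (simp add: algebra_simps)
  define q where "q = \<bar>real_of_int (2 * k + 1)\<bar>"
  have "2 * k + 1 \<noteq> 0" by presburger
  then have "1 \<le> \<bar>2 * k + 1\<bar>" by linarith
  then have q: "1 \<le> q" unfolding q_def by (metis of_int_1_le_iff of_int_abs)
  \<comment> \<open>Chosen such that max \<bar>b1\<bar> \<bar>b2\<bar> \<le> C m: q bounds
    \<bar>b1\<bar> / m, and the second summand bounds \<bar>b2\<bar> / m because the angle 2 \<pi> j
    / m is within \<pi> of \<theta>.\<close>
  define C where "C = q + (pi + \<bar>\<theta>\<bar>) / pi"
  have C: "1 \<le> C" using q by (simp add: C_def add_increasing2)
  \<comment> \<open>The factor 3 is lost in passing from angle to chord, and q = \<bar>2 k + 1\<bar>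
    in dividing \<Lambda> by (2 k + 1) m.\<close>
  define c where "c = C powr (- D) / (3 * q)"
  have "0 < c" using C q by (simp add: c_def)
  moreover have "c * real m powr (- (1 + D)) \<le> cmod (\<xi> - a)" if m: "0 < m" and \<xi>: "\<xi> ^ m = 1" "\<xi> \<noteq> a" for m \<xi>
  proof -
    obtain j where j: "\<xi> = cis (2 * pi * real_of_int j / real m)" "\<bar>2 * pi * real_of_int j / real m - \<theta>\<bar> \<le> pi"
      using root_of_unity_eq_cis[OF m \<xi>(1)] by blast
    define x where "x = 2 * pi * real_of_int j / real m - \<theta>"
    have x0: "x \<noteq> 0" using \<xi>(2) j(1) a' by (auto simp: x_def)
    have m1: "1 \<le> real m" using m by simp
    define b1 where "b1 = (2 * k + 1) * int m"
    define b2 where "b2 = - 2 * j"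
    have \<Lambda>: "of_int b1 * l1 + of_int b2 * l2 = - \<i> * of_real (of_int (2 * k + 1) * real m * x)"
      using m unfolding l1 l2 b1_def b2_def x_def by (simp add: complex_eq_iff field_simps)
    have "of_int b1 * l1 + of_int b2 * l2 \<noteq> 0" unfolding \<Lambda> using x0 m \<open>2 * k + 1 \<noteq> 0\<close>
      by (simp del: of_int_add of_int_mult)
    from bak[OF this] have big: "of_int (max \<bar>b1\<bar> \<bar>b2\<bar>) powr (- D') < q * real m * \<bar>x\<bar>"
      unfolding \<Lambda> by (simp add: norm_mult q_def abs_mult del: of_int_add of_int_mult)
    have B1: "1 \<le> real_of_int (max \<bar>b1\<bar> \<bar>b2\<bar>)"
    proof -
      have "1 * 1 \<le> \<bar>2 * k + 1\<bar> * int m" using \<open>1 \<le> \<bar>2 * k + 1\<bar>\<close> m by (intro mult_mono) auto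
      then have "1 \<le> \<bar>b1\<bar>" by (simp add: b1_def abs_mult)
      then show ?thesis by linarith
    qed
    have "real_of_int (max \<bar>b1\<bar> \<bar>b2\<bar>) \<le> C * real m"
    proof -
      have "real_of_int \<bar>b1\<bar> = q * real m" by (simp add: b1_def q_def abs_mult)
      moreover have "q * real m \<le> C * real m" by (intro mult_right_mono) (auto simp: C_def)
      moreover have "real_of_int \<bar>b2\<bar> \<le> C * real m"
      proof -
        have "\<bar>2 * pi * real_of_int j / real m\<bar> \<le> pi + \<bar>\<theta>\<bar>" using j(2) by linarith
        then have "2 * pi * \<bar>real_of_int j\<bar> \<le> (pi + \<bar>\<theta>\<bar>) * real m" using m by (simp add: abs_mult field_simps)
        then have "2 * \<bar>real_of_int j\<bar> \<le> (pi + \<bar>\<theta>\<bar>) / pi * real m" by (simp add: field_simps)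
        also have "\<dots> \<le> C * real m" using q by (intro mult_right_mono) (auto simp: C_def)
        finally show ?thesis by (simp add: b2_def abs_mult)
      qed
      ultimately show ?thesis by simp
    qed
    then have "(C * real m) powr (- D') \<le> real_of_int (max \<bar>b1\<bar> \<bar>b2\<bar>) powr (- D')"
      using B1 D1 by (intro powr_mono2') auto
    moreover have "(C * real m) powr (- D) \<le> (C * real m) powr (- D')"
      using D C m1 mult_mono[OF C m1] by (intro powr_mono) auto
    ultimately have "(C * real m) powr (- D) \<le> q * real m * \<bar>x\<bar>" using big by linarith
    then have "C powr (- D) * real m powr (- D) \<le> q * real m * \<bar>x\<bar>" using C by (simp add: powr_mult)
    then have f1: "c * (real m powr (- D) / real m) \<le> \<bar>x\<bar> / 3" using q m by (simp add: c_def field_simps)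
    \<comment> \<open>Dividing \<Lambda> by m to obtain the angle costs the additional power of m,
      so D becomes 1 + D.\<close>
    have f2: "real m powr (- (1 + D)) = real m powr (- D) / real m"
    proof -
      have "- (1 + D) = - D - 1" by simp
      then show ?thesis using m by (simp only: powr_diff) simp
    qed
    have "\<bar>x\<bar> / 3 \<le> cmod (\<xi> - a)"
      using cis_near_one(1)[OF j(2)] unfolding a' j(1) cis_diff x_def by simp
    then show ?thesis using f1 unfolding f2 by linarith
  qed
  ultimately show ?thesis by blast
qed

section \<open>Laurent polynomials on the unit circle\<close>

lemma laurent_eval_superset:
  assumes "finite E" "Poly_Mapping.keys p \<subseteq> E"
  shows "laurent_eval p a = (\<Sum>e\<in>E. Poly_Mapping.lookup p e * a powi e)"
  unfolding laurent_eval_def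
  by (rule sum.mono_neutral_left) (use assms in \<open>auto simp: in_keys_iff\<close>)

lemma laurent_eval_add: "laurent_eval (p + q) a = laurent_eval p a + laurent_eval q a"
proof -
  let ?E = "Poly_Mapping.keys p \<union> Poly_Mapping.keys q"
  have k: "Poly_Mapping.keys (p + q) \<subseteq> ?E" by (rule Poly_Mapping.keys_add)
  show ?thesis
    using laurent_eval_superset[OF _ k, of a] laurent_eval_superset[of ?E p a] laurent_eval_superset[of ?E q a]
    by (simp add: lookup_add distrib_right sum.distrib)
qed

lemma laurent_eval_0 [simp]: "laurent_eval 0 a = 0"
  by (simp add: laurent_eval_def)

lemma laurent_eval_sum: "laurent_eval (\<Sum>i\<in>F. p i) a = (\<Sum>i\<in>F. laurent_eval (p i) a)"
  by (induction F rule: infinite_finite_induct) (auto simp: laurent_eval_add)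

lemma laurent_eval_single: "laurent_eval (Poly_Mapping.single k c) a = c * a powi k"
  by (cases "c = 0") (auto simp: laurent_eval_def)

lemma laurent_poly_sum_single: "(p :: laurent_poly) = (\<Sum>k\<in>Poly_Mapping.keys p. Poly_Mapping.single k (Poly_Mapping.lookup p k))"
proof (rule poly_mapping_eqI)
  fix e
  have "Poly_Mapping.lookup (\<Sum>k\<in>Poly_Mapping.keys p. Poly_Mapping.single k (Poly_Mapping.lookup p k)) e
      = (\<Sum>k\<in>Poly_Mapping.keys p. if k = e then Poly_Mapping.lookup p k else 0)"
    unfolding lookup_sum by (intro sum.cong refl) (simp add: lookup_single when_def)
  also have "\<dots> = Poly_Mapping.lookup p e" by (auto simp: in_keys_iff)
  finally show "Poly_Mapping.lookup p e
      = Poly_Mapping.lookup (\<Sum>k\<in>Poly_Mapping.keys p. Poly_Mapping.single k (Poly_Mapping.lookup p k)) e" by simp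
qed

lemma laurent_eval_mult:
  assumes "a \<noteq> 0" shows "laurent_eval (p * q) a = laurent_eval p a * laurent_eval q a"
proof -
  let ?s = "\<lambda>(p :: laurent_poly) k. Poly_Mapping.single k (Poly_Mapping.lookup p k)"
  have "p * q = (\<Sum>k\<in>Poly_Mapping.keys p. ?s p k) * (\<Sum>l\<in>Poly_Mapping.keys q. ?s q l)"
    using laurent_poly_sum_single[of p] laurent_poly_sum_single[of q] by simp
  also have "\<dots> = (\<Sum>k\<in>Poly_Mapping.keys p. \<Sum>l\<in>Poly_Mapping.keys q. Poly_Mapping.single (k + l) (Poly_Mapping.lookup p k * Poly_Mapping.lookup q l))"
    by (simp add: sum_product mult_single)
  finally have "laurent_eval (p * q) a = (\<Sum>k\<in>Poly_Mapping.keys p. \<Sum>l\<in>Poly_Mapping.keys q.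
      (Poly_Mapping.lookup p k * a powi k) * (Poly_Mapping.lookup q l * a powi l))"
    using assms by (simp add: laurent_eval_sum laurent_eval_single power_int_add mult_ac)
  then show ?thesis by (simp only: laurent_eval_def sum_product)
qed

lemma laurent_eval_1 [simp]: "laurent_eval 1 a = 1"
  using laurent_eval_single[of 0 1 a] by simp

lemma laurent_eval_bounded: "\<exists>B\<ge>0. \<forall>\<xi>. cmod \<xi> = 1 \<longrightarrow> cmod (laurent_eval p \<xi>) \<le> B"
proof (intro exI[of _ "\<Sum>e\<in>Poly_Mapping.keys p. cmod (Poly_Mapping.lookup p e)"] conjI allI impI)
  fix \<xi> :: complex assume \<xi>: "cmod \<xi> = 1"
  have "cmod (laurent_eval p \<xi>) \<le> (\<Sum>e\<in>Poly_Mapping.keys p. cmod (Poly_Mapping.lookup p e * \<xi> powi e))"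
    unfolding laurent_eval_def by (rule norm_sum)
  then show "cmod (laurent_eval p \<xi>) \<le> (\<Sum>e\<in>Poly_Mapping.keys p. cmod (Poly_Mapping.lookup p e))"
    using \<xi> by (simp add: norm_mult norm_power_int)
qed (simp add: sum_nonneg)

text \<open>Multiplication by z ^ N with N minus the lowest exponent clears denominators and leaves
  the modulus on the circle unchanged.\<close>

lemma laurent_to_poly:
  assumes "p \<noteq> 0"
  shows "\<exists>P :: complex poly. P \<noteq> 0 \<and> (\<forall>\<xi>. cmod \<xi> = 1 \<longrightarrow> cmod (poly P \<xi>) = cmod (laurent_eval p \<xi>))"
proof -
  define E where "E = Poly_Mapping.keys p"
  have E: "finite E" "E \<noteq> {}" using assms by (auto simp: E_def)
  define N where "N = - Min E"
  have N: "0 \<le> e + N" if "e \<in> E" for e using Min_le[OF E(1) that] by (simp add: N_def)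
  define P where "P = (\<Sum>e\<in>E. Polynomial.monom (Poly_Mapping.lookup p e) (nat (e + N)))"
  obtain e0 where e0: "e0 \<in> E" using E by blast
  have "poly.coeff P (nat (e0 + N)) = (\<Sum>e\<in>E. if e = e0 then Poly_Mapping.lookup p e else 0)"
    unfolding P_def coeff_sum by (rule sum.cong) (use N e0 in \<open>auto simp: eq_nat_nat_iff\<close>)
  also have "\<dots> \<noteq> 0" using e0 E(1) by (simp add: E_def in_keys_iff)
  finally have "P \<noteq> 0" by auto
  moreover have "cmod (poly P \<xi>) = cmod (laurent_eval p \<xi>)" if \<xi>: "cmod \<xi> = 1" for \<xi>
  proof -
    have \<xi>0: "\<xi> \<noteq> 0" using \<xi> by auto
    have "poly P \<xi> = (\<Sum>e\<in>E. Poly_Mapping.lookup p e * \<xi> powi (e + N))"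
      unfolding P_def poly_sum by (rule sum.cong) (use N in \<open>auto simp: poly_monom power_int_def\<close>)
    also have "\<dots> = laurent_eval p \<xi> * \<xi> powi N"
      using \<xi>0 by (simp add: laurent_eval_def E_def power_int_add sum_distrib_right mult.assoc)
    finally show ?thesis using \<xi> by (simp add: norm_mult norm_power_int)
  qed
  ultimately show ?thesis by blast
qed

section \<open>Zeros of a polynomial on the unit circle and roots of unity near them\<close>

definition poly_circle_zeros :: "complex poly \<Rightarrow> complex set" where
  "poly_circle_zeros P = {a. cmod a = 1 \<and> poly P a = 0}"

definition circle_order :: "complex poly \<Rightarrow> nat" where
  "circle_order P = Max ((\<lambda>a. Polynomial.order a P) ` poly_circle_zeros P)"

locale circle_poly =
  fixes P :: "complex poly"
  assumes P0: "P \<noteq> 0" and Z0: "poly_circle_zeros P \<noteq> {}"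
begin

abbreviation "Z \<equiv> poly_circle_zeros P"
abbreviation "\<mu> \<equiv> circle_order P"

lemma finite_Z: "finite Z"
  using poly_roots_finite[OF P0] by (rule finite_subset[rotated]) (auto simp: poly_circle_zeros_def)

lemma order_le: "a \<in> Z \<Longrightarrow> Polynomial.order a P \<le> \<mu>"
  unfolding circle_order_def using finite_Z by (intro Max_ge) auto

lemma ex_order_eq: "\<exists>a\<in>Z. Polynomial.order a P = \<mu>"
proof -
  have "\<mu> \<in> (\<lambda>a. Polynomial.order a P) ` Z"
    unfolding circle_order_def using finite_Z Z0 by (intro Max_in) auto
  then show ?thesis by auto
qed

lemma mu_pos: "0 < \<mu>"
proof -
  obtain a where a: "a \<in> Z" using Z0 by blast
  then have "Polynomial.order a P \<noteq> 0" using P0 by (simp add: poly_circle_zeros_def order_root)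
  then show ?thesis using order_le[OF a] by linarith
qed

text \<open>Compactness: otherwise there are points f n on the circle with \<bar>P(f n)\<bar>
  smaller than 1 / (n + 1) times every \<bar>f n - a\<bar> ^ \<mu>. A limit point x is a zero of P,
  of some order k \<le> \<mu>; dividing out (z - x) ^ k shows that the cofactor vanishes at x too,
  which is impossible.\<close>

lemma lower: "\<exists>c>0. \<forall>\<xi>. cmod \<xi> = 1 \<longrightarrow> (\<exists>a\<in>Z. c * cmod (\<xi> - a) ^ \<mu> \<le> cmod (poly P \<xi>))"
proof (rule ccontr)
  assume neg: "\<not> ?thesis"
  have "\<exists>\<xi>. cmod \<xi> = 1 \<and> (\<forall>a\<in>Z. cmod (poly P \<xi>) < 1 / real (Suc n) * cmod (\<xi> - a) ^ \<mu>)" for n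
  proof -
    have "0 < 1 / real (Suc n)" by simp
    then show ?thesis using neg not_le by metis
  qed
  then obtain f where f: "\<And>n. cmod (f n) = 1" "\<And>n a. a \<in> Z \<Longrightarrow> cmod (poly P (f n)) < 1 / real (Suc n) * cmod (f n - a) ^ \<mu>"
    by metis
  have "compact (sphere (0::complex) 1)" by simp
  moreover have "\<And>n. f n \<in> sphere 0 1" using f(1) by simp
  ultimately obtain x g where x: "x \<in> sphere 0 1" "strict_mono (g :: nat \<Rightarrow> nat)" "(\<lambda>n. f (g n)) \<longlonglongrightarrow> x"
    unfolding compact_def o_def by blast
  have lim0: "(\<lambda>n. 1 / real (Suc (g n)) * 2 ^ \<mu>) \<longlonglongrightarrow> 0"
  proof -
    have "(\<lambda>n. 1 / real (Suc n)) \<longlonglongrightarrow> 0" by (rule LIMSEQ_Suc[OF lim_1_over_n])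
    from LIMSEQ_subseq_LIMSEQ[OF this x(2)] show ?thesis
      by (intro tendsto_mult_left_zero) (simp add: o_def)
  qed
  have le2: "cmod (f n - a) \<le> 2" if "a \<in> Z" for n a
    using norm_triangle_ineq4[of "f n" a] f(1)[of n] that by (simp add: poly_circle_zeros_def)
  obtain a0 where a0: "a0 \<in> Z" using Z0 by blast
  have "(\<lambda>n. poly P (f (g n))) \<longlonglongrightarrow> 0"
  proof (rule Lim_null_comparison[OF _ lim0], rule always_eventually, rule allI)
    fix n
    have "cmod (f (g n) - a0) ^ \<mu> \<le> 2 ^ \<mu>" by (intro power_mono le2 a0) auto
    then have "1 / real (Suc (g n)) * cmod (f (g n) - a0) ^ \<mu> \<le> 1 / real (Suc (g n)) * 2 ^ \<mu>"
      by (intro mult_left_mono) auto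
    then show "cmod (poly P (f (g n))) \<le> 1 / real (Suc (g n)) * 2 ^ \<mu>" using f(2)[OF a0, of "g n"] by linarith
  qed
  moreover have "(\<lambda>n. poly P (f (g n))) \<longlonglongrightarrow> poly P x" by (intro tendsto_intros x)
  ultimately have "poly P x = 0" using LIMSEQ_unique by blast
  then have xZ: "x \<in> Z" using x(1) by (simp add: poly_circle_zeros_def)
  define k where "k = Polynomial.order x P"
  obtain q where q: "P = [:- x, 1:] ^ k * q" "\<not> [:- x, 1:] dvd q" using order_decomp[OF P0, of x] by (auto simp: k_def)
  have k: "k \<le> \<mu>" unfolding k_def by (rule order_le[OF xZ])
  have "(\<lambda>n. poly q (f (g n))) \<longlonglongrightarrow> 0"
  proof (rule Lim_null_comparison[OF _ lim0], rule always_eventually, rule allI)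
    fix n
    define u where "u = f (g n)"
    have lt: "cmod (poly P u) < 1 / real (Suc (g n)) * cmod (u - x) ^ \<mu>" unfolding u_def by (rule f(2)[OF xZ])
    then have ux: "cmod (u - x) > 0" using mu_pos by (cases "u = x") (auto simp: zero_power)
    have "cmod (poly P u) = cmod (u - x) ^ k * cmod (poly q u)"
      unfolding q(1) by (simp add: poly_power norm_mult norm_power)
    moreover have "cmod (u - x) ^ \<mu> = cmod (u - x) ^ k * cmod (u - x) ^ (\<mu> - k)"
      using k by (simp add: power_add[symmetric])
    ultimately have less: "cmod (u - x) ^ k * cmod (poly q u) < cmod (u - x) ^ k * (1 / real (Suc (g n)) * cmod (u - x) ^ (\<mu> - k))"
      using lt by (simp add: mult_ac)
    have "0 < cmod (u - x) ^ k" using ux by simp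
    from less_imp_le[OF mult_less_cancel_left_pos[OF this, THEN iffD1, OF less]]
    have "cmod (poly q u) \<le> 1 / real (Suc (g n)) * cmod (u - x) ^ (\<mu> - k)" .
    also have "\<dots> \<le> 1 / real (Suc (g n)) * 2 ^ (\<mu> - k)"
      unfolding u_def by (intro mult_left_mono power_mono le2 xZ) auto
    also have "\<dots> \<le> 1 / real (Suc (g n)) * 2 ^ \<mu>" by (intro mult_left_mono power_increasing) auto
    finally show "cmod (poly q (f (g n))) \<le> 1 / real (Suc (g n)) * 2 ^ \<mu>" by (simp only: u_def)
  qed
  moreover have "(\<lambda>n. poly q (f (g n))) \<longlonglongrightarrow> poly q x" by (intro tendsto_intros x)
  ultimately have "poly q x = 0" using LIMSEQ_unique by blast
  then show False using q(2) by (simp add: poly_eq_0_iff_dvd)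
qed

text \<open>At a zero of maximal order \<mu> the cofactor is bounded on the circle. Together with
  \<open>lower\<close> this shows that \<mu> governs how many roots of unity make P small.\<close>

lemma upper: "\<exists>a\<in>Z. \<exists>C>0. \<forall>\<xi>. cmod \<xi> = 1 \<longrightarrow> cmod (poly P \<xi>) \<le> C * cmod (\<xi> - a) ^ \<mu>"
proof -
  obtain a where a: "a \<in> Z" "Polynomial.order a P = \<mu>" using ex_order_eq by blast
  obtain q where q: "P = [:- a, 1:] ^ \<mu> * q" using order_decomp[OF P0, of a] a(2) by auto
  have "compact (poly q ` sphere 0 1)" by (intro compact_continuous_image continuous_intros) simp
  then have "bounded (poly q ` sphere 0 1)" by (rule compact_imp_bounded)
  then obtain C where C: "C > 0" "\<forall>x\<in>poly q ` sphere 0 1. norm x \<le> C" unfolding bounded_pos by blast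
  have "cmod (poly P \<xi>) \<le> C * cmod (\<xi> - a) ^ \<mu>" if "cmod \<xi> = 1" for \<xi>
  proof -
    have "cmod (poly q \<xi>) \<le> C" using C(2) that by simp
    then have "cmod (\<xi> - a) ^ \<mu> * cmod (poly q \<xi>) \<le> cmod (\<xi> - a) ^ \<mu> * C" by (intro mult_left_mono) auto
    moreover have "cmod (poly P \<xi>) = cmod (\<xi> - a) ^ \<mu> * cmod (poly q \<xi>)"
      by (subst q) (simp add: poly_power norm_mult norm_power)
    ultimately show ?thesis by (simp add: mult.commute)
  qed
  then show ?thesis using a(1) C(1) by blast
qed

definition small_roots :: "nat \<Rightarrow> real \<Rightarrow> complex set" where
  "small_roots m t = {\<xi>. \<xi> ^ m = 1 \<and> poly P \<xi> \<noteq> 0 \<and> cmod (poly P \<xi>) \<le> t}"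

lemma cmod_root: "0 < m \<Longrightarrow> \<xi> ^ m = 1 \<Longrightarrow> cmod \<xi> = 1" for \<xi> :: complex
  using norm_power[of \<xi> m] power_eq_imp_eq_base[of "cmod \<xi>" m 1] by simp

lemma finite_roots: "0 < m \<Longrightarrow> finite {\<xi>::complex. \<xi> ^ m = 1}"
  by (rule finite_roots_unity) simp

lemma root_powr: "0 \<le> x \<Longrightarrow> (x powr (1 / real \<mu>)) ^ \<mu> = x"
  using mu_pos by (cases "x = 0") (auto simp: powr_realpow[symmetric] powr_powr)

text \<open>By \<open>lower\<close>, a root \<xi> with \<bar>P(\<xi>)\<bar> \<le> t is within \<rho>
  = (t / c) powr (1 / \<mu>) of some zero, and each zero has at most m \<rho> + 1 roots of unity in
  that range.\<close>

lemma small_roots_upper: "\<exists>C>0. \<forall>m t. 0 < m \<longrightarrow> 0 \<le> t \<longrightarrow> real (card (small_roots m t)) \<le> C * (real m * t powr (1 / real \<mu>) + 1)"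
proof -
  obtain c where c: "c > 0" "\<And>\<xi>. cmod \<xi> = 1 \<Longrightarrow> \<exists>a\<in>Z. c * cmod (\<xi> - a) ^ \<mu> \<le> cmod (poly P \<xi>)" using lower by blast
  define q where "q = (1 / c) powr (1 / real \<mu>)"
  define C where "C = real (card Z) * max q 1"
  have cZ: "0 < card Z" using finite_Z Z0 by (simp add: card_gt_0_iff)
  have "C > 0" using cZ by (simp add: C_def)
  moreover have "real (card (small_roots m t)) \<le> C * (real m * t powr (1 / real \<mu>) + 1)" if m: "0 < m" and t: "0 \<le> t" for m t
  proof -
    define \<rho> where "\<rho> = q * t powr (1 / real \<mu>)"
    have \<rho>: "0 \<le> \<rho>" by (simp add: \<rho>_def q_def)
    have \<rho>\<mu>: "\<rho> ^ \<mu> = t / c"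
      using root_powr[of t] root_powr[of "1 / c"] t c(1) by (simp add: \<rho>_def q_def power_mult_distrib)
    have sub: "small_roots m t \<subseteq> (\<Union>a\<in>Z. {\<xi>. \<xi> ^ m = 1 \<and> cmod (\<xi> - a) \<le> \<rho>})"
    proof
      fix \<xi> assume "\<xi> \<in> small_roots m t"
      then have \<xi>: "\<xi> ^ m = 1" "cmod (poly P \<xi>) \<le> t" by (auto simp: small_roots_def)
      obtain a where a: "a \<in> Z" "c * cmod (\<xi> - a) ^ \<mu> \<le> cmod (poly P \<xi>)" using c(2)[OF cmod_root[OF m \<xi>(1)]] by blast
      then have "cmod (\<xi> - a) ^ \<mu> \<le> \<rho> ^ \<mu>" unfolding \<rho>\<mu> using \<xi>(2) c(1) by (simp add: field_simps)
      then have "cmod (\<xi> - a) \<le> \<rho>" using power_mono_iff[OF norm_ge_zero \<rho> mu_pos] by blast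
      then show "\<xi> \<in> (\<Union>a\<in>Z. {\<xi>. \<xi> ^ m = 1 \<and> cmod (\<xi> - a) \<le> \<rho>})" using a(1) \<xi>(1) by blast
    qed
    have "card (small_roots m t) \<le> card (\<Union>a\<in>Z. {\<xi>. \<xi> ^ m = 1 \<and> cmod (\<xi> - a) \<le> \<rho>})"
      by (rule card_mono[OF _ sub]) (use finite_Z finite_roots[OF m] in auto)
    also have "\<dots> \<le> (\<Sum>a\<in>Z. card {\<xi>. \<xi> ^ m = 1 \<and> cmod (\<xi> - a) \<le> \<rho>})" by (rule card_UN_le[OF finite_Z])
    finally have "real (card (small_roots m t)) \<le> (\<Sum>a\<in>Z. real (card {\<xi>. \<xi> ^ m = 1 \<and> cmod (\<xi> - a) \<le> \<rho>}))"
      by (simp flip: of_nat_sum)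
    also have "\<dots> \<le> (\<Sum>a\<in>Z. real m * \<rho> + 1)"
      by (intro sum_mono card_roots_near_le m \<rho>) (auto simp: poly_circle_zeros_def)
    also have "\<dots> = real (card Z) * (real m * (q * t powr (1 / real \<mu>)) + 1)" by (simp add: \<rho>_def)
    also have "\<dots> \<le> real (card Z) * (max q 1 * (real m * t powr (1 / real \<mu>) + 1))"
    proof (intro mult_left_mono)
      have "q * (real m * t powr (1 / real \<mu>)) \<le> max q 1 * (real m * t powr (1 / real \<mu>))" by (intro mult_right_mono) auto
      then show "real m * (q * t powr (1 / real \<mu>)) + 1 \<le> max q 1 * (real m * t powr (1 / real \<mu>) + 1)"
        by (simp add: distrib_left mult_ac)
    qed simp
    finally show ?thesis by (simp add: C_def mult.assoc)
  qed
  ultimately show ?thesis by blast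
qed

text \<open>Near a zero of order \<mu> all roots of unity within (t / C) powr (1 / \<mu>) have
  \<bar>P\<bar> \<le> t. At most \<open>card Z\<close> of them are zeros of P and have to be
  discounted; t \<le> C keeps the radius at most 1.\<close>

lemma small_roots_lower: "\<exists>c>0. \<exists>C t0. t0 > 0 \<and> (\<forall>m t. 0 < m \<longrightarrow> 0 \<le> t \<longrightarrow> t \<le> t0 \<longrightarrow>
    c * (real m * t powr (1 / real \<mu>)) - C \<le> real (card (small_roots m t)))"
proof -
  obtain a C where aC: "a \<in> Z" "C > 0" "\<And>\<xi>. cmod \<xi> = 1 \<Longrightarrow> cmod (poly P \<xi>) \<le> C * cmod (\<xi> - a) ^ \<mu>"
    using upper by blast
  define q where "q = (1 / C) powr (1 / real \<mu>)"
  have q: "q > 0" using aC by (simp add: q_def)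
  have "q / 8 * (real m * t powr (1 / real \<mu>)) - (1 + real (card Z)) \<le> real (card (small_roots m t))"
    if m: "0 < m" and t: "0 \<le> t" "t \<le> C" for m t
  proof -
    define \<rho> where "\<rho> = q * t powr (1 / real \<mu>)"
    have \<rho>0: "0 \<le> \<rho>" by (simp add: \<rho>_def q_def)
    have \<rho>\<mu>: "\<rho> ^ \<mu> = t / C"
      using root_powr[of t] root_powr[of "1 / C"] t aC(2) by (simp add: \<rho>_def q_def power_mult_distrib)
    have "\<rho> ^ \<mu> \<le> 1 ^ \<mu>" unfolding \<rho>\<mu> using t aC(2) by simp
    then have \<rho>1: "\<rho> \<le> 1" using power_mono_iff[OF \<rho>0 _ mu_pos, of 1] by simp
    have sub: "{\<xi>. \<xi> ^ m = 1 \<and> cmod (\<xi> - a) \<le> \<rho>} \<subseteq> small_roots m t \<union> Z"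
    proof
      fix \<xi> assume "\<xi> \<in> {\<xi>. \<xi> ^ m = 1 \<and> cmod (\<xi> - a) \<le> \<rho>}"
      then have \<xi>: "\<xi> ^ m = 1" "cmod (\<xi> - a) \<le> \<rho>" by auto
      note n1 = cmod_root[OF m \<xi>(1)]
      have "cmod (\<xi> - a) ^ \<mu> \<le> t / C" using power_mono[OF \<xi>(2), of \<mu>] by (simp add: \<rho>\<mu>)
      then have "C * cmod (\<xi> - a) ^ \<mu> \<le> t" using aC(2) by (simp add: field_simps)
      then have "cmod (poly P \<xi>) \<le> t" using aC(3)[OF n1] by linarith
      then show "\<xi> \<in> small_roots m t \<union> Z" using \<xi>(1) n1 by (auto simp: small_roots_def poly_circle_zeros_def)
    qed
    have fin: "finite (small_roots m t)" by (rule finite_subset[OF _ finite_roots[OF m]]) (auto simp: small_roots_def)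
    have "real m * \<rho> / 8 - 1 \<le> real (card {\<xi>. \<xi> ^ m = 1 \<and> cmod (\<xi> - a) \<le> \<rho>})"
      by (rule card_roots_near_ge[OF m _ \<rho>0 \<rho>1]) (use aC(1) in \<open>simp add: poly_circle_zeros_def\<close>)
    also have "card {\<xi>. \<xi> ^ m = 1 \<and> cmod (\<xi> - a) \<le> \<rho>} \<le> card (small_roots m t \<union> Z)"
      by (rule card_mono[OF _ sub]) (use fin finite_Z in auto)
    also have "\<dots> \<le> card (small_roots m t) + card Z" by (rule card_Un_le)
    finally show ?thesis by (simp add: \<rho>_def mult_ac)
  qed
  then show ?thesis using q aC(2) by (intro exI[of _ "q / 8"] conjI exI[of _ "1 + real (card Z)"] exI[of _ C]) auto
qed

text \<open>\<open>lower\<close> turns the distances of \<xi> from the zeros into a bound for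
  \<bar>P(\<xi>)\<bar>, with the exponent multiplied by \<mu>. A common constant is the minimum over
  the finitely many zeros.\<close>

lemma roots_gap:
  assumes B: "\<And>a. a \<in> Z - {1} \<Longrightarrow> baker_constant a (-1) (Dt a)" and D: "\<And>a. a \<in> Z - {1} \<Longrightarrow> Dt a \<le> D" and D1: "1 \<le> D"
  shows "\<exists>c>0. \<forall>m \<xi>. 0 < m \<longrightarrow> \<xi> ^ m = 1 \<longrightarrow> poly P \<xi> \<noteq> 0 \<longrightarrow>
    c * real m powr (- ((1 + D) * real \<mu>)) \<le> cmod (poly P \<xi>)"
proof -
  have "\<exists>c>0. \<forall>m \<xi>. 0 < m \<longrightarrow> \<xi> ^ m = 1 \<longrightarrow> \<xi> \<noteq> a \<longrightarrow> c * real m powr (- (1 + D)) \<le> cmod (\<xi> - a)" if a: "a \<in> Z" for a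
  proof (cases "a = 1")
    case False
    then show ?thesis using a by (intro baker_root_of_unity_distance[OF _ B D]) (auto simp: poly_circle_zeros_def)
  next
    case True
    have f: "1 * real m powr (- (1 + D)) \<le> cmod (\<xi> - a)" if m: "0 < m" and "\<xi> ^ m = 1" "\<xi> \<noteq> a" for m \<xi>
    proof -
      have "real m powr (- (1 + D)) \<le> real m powr (- 1)" using m D1 by (intro powr_mono) auto
      also have "\<dots> = 1 / real m" using m by (simp add: powr_minus_divide)
      also have "\<dots> \<le> cmod (\<xi> - a)" unfolding True by (rule root_of_unity_distance_one) (use that True in auto)
      finally show ?thesis by simp
    qed
    show ?thesis by (intro exI[of _ "1::real"] conjI allI impI f) auto
  qed
  then obtain cc where cc: "\<And>a. a \<in> Z \<Longrightarrow> 0 < cc a"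
    "\<And>a m \<xi>. a \<in> Z \<Longrightarrow> 0 < m \<Longrightarrow> \<xi> ^ m = 1 \<Longrightarrow> \<xi> \<noteq> a \<Longrightarrow> cc a * real m powr (- (1 + D)) \<le> cmod (\<xi> - a)"
    by metis
  define c1 where "c1 = Min (cc ` Z)"
  have c1: "0 < c1" "\<And>a. a \<in> Z \<Longrightarrow> c1 \<le> cc a" unfolding c1_def using cc(1) finite_Z Z0 by auto
  obtain c where c: "c > 0" "\<And>\<xi>. cmod \<xi> = 1 \<Longrightarrow> \<exists>a\<in>Z. c * cmod (\<xi> - a) ^ \<mu> \<le> cmod (poly P \<xi>)" using lower by blast
  have "c * c1 ^ \<mu> * real m powr (- ((1 + D) * real \<mu>)) \<le> cmod (poly P \<xi>)"
    if m: "0 < m" and \<xi>: "\<xi> ^ m = 1" "poly P \<xi> \<noteq> 0" for m \<xi>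
  proof -
    obtain a where a: "a \<in> Z" "c * cmod (\<xi> - a) ^ \<mu> \<le> cmod (poly P \<xi>)" using c(2)[OF cmod_root[OF m \<xi>(1)]] by blast
    have "\<xi> \<noteq> a" using a(1) \<xi>(2) by (auto simp: poly_circle_zeros_def)
    have "c1 * real m powr (- (1 + D)) \<le> cc a * real m powr (- (1 + D))" by (intro mult_right_mono c1 a) auto
    also have "\<dots> \<le> cmod (\<xi> - a)" by (rule cc(2)[OF a(1) m \<xi>(1) \<open>\<xi> \<noteq> a\<close>])
    finally have "(c1 * real m powr (- (1 + D))) ^ \<mu> \<le> cmod (\<xi> - a) ^ \<mu>" using c1(1) by (intro power_mono) auto
    then have "c * (c1 * real m powr (- (1 + D))) ^ \<mu> \<le> cmod (poly P \<xi>)" using a(2) c(1)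
      by (meson less_imp_le mult_left_mono order_trans)
    moreover have "(c1 * real m powr (- (1 + D))) ^ \<mu> = c1 ^ \<mu> * real m powr (- ((1 + D) * real \<mu>))"
    proof -
      have e: "- ((1 + D) * real \<mu>) = - (1 + D) * real \<mu>" by (simp only: mult_minus_left)
      have "(real m powr (- (1 + D))) ^ \<mu> = real m powr (- (1 + D) * real \<mu>)"
        using m by (simp add: powr_realpow[symmetric] powr_powr)
      then show ?thesis unfolding e power_mult_distrib by simp
    qed
    ultimately show ?thesis by (simp add: mult.assoc)
  qed
  moreover have "c * c1 ^ \<mu> > 0" using c c1 by simp
  ultimately show ?thesis by blast
qed

end

section \<open>Counting small singular values\<close>

locale divisor_chain =
  fixes ps :: "laurent_poly list" and R0 :: nat
  assumes len: "length ps \<le> R0" and nz: "0 \<notin> set ps"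
    and chain: "\<And>l. Suc l < length ps \<Longrightarrow> ps ! l dvd ps ! Suc l"
begin

text \<open>The modulus of the l-th diagonal entry of the Smith form at \<xi>; rows beyond the
  invariant factors are zero rows, whence the value 0.\<close>

definition val :: "nat \<times> complex \<Rightarrow> real" where
  "val b = (if fst b < length ps then cmod (laurent_eval (ps ! fst b) (snd b)) else 0)"

definition J :: "nat \<Rightarrow> (nat \<times> complex) set" where
  "J m = {..<R0} \<times> {\<xi>. \<xi> ^ m = 1}"

lemma val_nonneg: "0 \<le> val b"
  by (simp add: val_def)

lemma finite_J: "0 < m \<Longrightarrow> finite (J m)"
  unfolding J_def by (intro finite_cartesian_product finite_roots_unity) auto

lemma card_roots: "0 < m \<Longrightarrow> card {\<xi>::complex. \<xi> ^ m = 1} = m"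
  by (rule Complex.card_roots_unity_eq)

lemma card_J: "0 < m \<Longrightarrow> card (J m) = R0 * m"
  by (simp add: J_def card_cartesian_product card_roots)

lemma norm_root: "0 < m \<Longrightarrow> \<xi> ^ m = 1 \<Longrightarrow> cmod \<xi> = 1" for \<xi> :: complex
  using norm_power[of \<xi> m] power_eq_imp_eq_base[of "cmod \<xi>" m 1] by simp

lemma dvd_last:
  assumes "l < length ps" shows "ps ! l dvd last ps"
proof -
  have *: "i < length ps \<Longrightarrow> l \<le> i \<Longrightarrow> ps ! l dvd ps ! i" for i
  proof (induction i)
    case (Suc i)
    then show ?case using chain[of i] by (cases "l = Suc i") (auto intro: dvd_trans)
  qed simp
  have "last ps = ps ! (length ps - 1)" using assms by (intro last_conv_nth) auto
  then show ?thesis using *[of "length ps - 1"] assms by simp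
qed

text \<open>Every invariant factor divides the last one and the quotient is bounded on the circle,
  so wherever some factor is small the last one is small as well. This is why only zeros of the last
  invariant factor matter.\<close>

lemma last_le: "\<exists>C>0. \<forall>l \<xi>. l < length ps \<longrightarrow> cmod \<xi> = 1 \<longrightarrow> cmod (laurent_eval (last ps) \<xi>) \<le> C * cmod (laurent_eval (ps ! l) \<xi>)"
proof -
  have "\<exists>C\<ge>0. \<forall>\<xi>. cmod \<xi> = 1 \<longrightarrow> cmod (laurent_eval (last ps) \<xi>) \<le> C * cmod (laurent_eval (ps ! l) \<xi>)"
    if l: "l < length ps" for l
  proof -
    obtain q where q: "last ps = ps ! l * q" using dvd_last[OF l] by (auto elim: dvdE)
    obtain B where B: "B \<ge> 0" "\<And>\<xi>. cmod \<xi> = 1 \<Longrightarrow> cmod (laurent_eval q \<xi>) \<le> B" using laurent_eval_bounded by blast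
    have "cmod (laurent_eval (last ps) \<xi>) \<le> B * cmod (laurent_eval (ps ! l) \<xi>)" if \<xi>: "cmod \<xi> = 1" for \<xi>
    proof -
      have "\<xi> \<noteq> 0" using \<xi> by auto
      then show ?thesis unfolding q using mult_right_mono[OF B(2)[OF \<xi>] norm_ge_zero[of "laurent_eval (ps ! l) \<xi>"]]
        by (simp add: laurent_eval_mult norm_mult mult.commute)
    qed
    then show ?thesis using B(1) by blast
  qed
  then obtain C where C: "\<And>l. l < length ps \<Longrightarrow> C l \<ge> 0"
    "\<And>l \<xi>. l < length ps \<Longrightarrow> cmod \<xi> = 1 \<Longrightarrow> cmod (laurent_eval (last ps) \<xi>) \<le> C l * cmod (laurent_eval (ps ! l) \<xi>)" by metis
  define C0 where "C0 = 1 + (\<Sum>l<length ps. C l)"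
  have C0: "C l \<le> C0" if "l < length ps" for l
  proof -
    have "C l \<le> (\<Sum>l<length ps. C l)" using that C(1) by (intro member_le_sum) auto
    then show ?thesis by (simp add: C0_def)
  qed
  have "C0 > 0" unfolding C0_def using C(1) by (intro add_pos_nonneg sum_nonneg) auto
  moreover have "cmod (laurent_eval (last ps) \<xi>) \<le> C0 * cmod (laurent_eval (ps ! l) \<xi>)"
    if "l < length ps" "cmod \<xi> = 1" for l \<xi>
    using C(2)[OF that] mult_right_mono[OF C0[OF that(1)] norm_ge_zero[of "laurent_eval (ps ! l) \<xi>"]] by linarith
  ultimately show ?thesis by blast
qed

text \<open>The zero rows contribute exactly m for each missing invariant factor; zeros of invariant
  factors on the circle add a number that does not grow with m.\<close>

lemma card_val_0:
  assumes m: "0 < m" and Z: "finite (circle_zeros (last ps))" and ne: "ps \<noteq> []"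
  shows "m * (R0 - length ps) \<le> card {b \<in> J m. val b = 0}"
    and "card {b \<in> J m. val b = 0} \<le> m * (R0 - length ps) + length ps * card (circle_zeros (last ps))"
proof -
  let ?A = "{length ps..<R0} \<times> {\<xi>::complex. \<xi> ^ m = 1}"
  let ?B = "{..<length ps} \<times> circle_zeros (last ps)"
  have A: "finite ?A" "card ?A = m * (R0 - length ps)"
    using finite_roots_unity[of m] m by (auto simp: card_cartesian_product card_roots)
  have "?A \<subseteq> {b \<in> J m. val b = 0}" by (auto simp: J_def val_def)
  then have "card ?A \<le> card {b \<in> J m. val b = 0}" using finite_J[OF m] by (intro card_mono) auto
  then show "m * (R0 - length ps) \<le> card {b \<in> J m. val b = 0}" by (simp only: A)
  have "{b \<in> J m. val b = 0} \<subseteq> ?A \<union> ?B"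
  proof
    fix b assume b: "b \<in> {b \<in> J m. val b = 0}"
    obtain l \<xi> where [simp]: "b = (l, \<xi>)" by (cases b)
    have l: "l < R0" "\<xi> ^ m = 1" using b by (auto simp: J_def)
    show "b \<in> ?A \<union> ?B"
    proof (cases "l < length ps")
      case True
      then have z: "laurent_eval (ps ! l) \<xi> = 0" using b by (simp add: val_def)
      have n1: "cmod \<xi> = 1" by (rule norm_root[OF m l(2)])
      then have "\<xi> \<noteq> 0" by auto
      moreover obtain q where "last ps = ps ! l * q" using dvd_last[OF True] by (auto elim: dvdE)
      ultimately have "laurent_eval (last ps) \<xi> = 0" using z by (simp add: laurent_eval_mult)
      then show ?thesis using True n1 by (simp add: circle_zeros_def)
    qed (use l in simp)
  qed
  then have "card {b \<in> J m. val b = 0} \<le> card (?A \<union> ?B)" using A(1) Z by (intro card_mono) auto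
  also have "\<dots> \<le> card ?A + card ?B" by (rule card_Un_le)
  finally show "card {b \<in> J m. val b = 0} \<le> m * (R0 - length ps) + length ps * card (circle_zeros (last ps))"
    by (simp only: A) (simp add: card_cartesian_product)
qed

text \<open>Without zeros on the compact circle the last invariant factor is bounded away from 0,
  and then so are all others: the values have a gap above 0 that is uniform in m.\<close>

lemma no_circle_zeros:
  assumes "ps = [] \<or> circle_zeros (last ps) = {}"
  shows "\<exists>t0>0. \<forall>m>0. {b \<in> J m. 0 < val b \<and> val b \<le> t0} = {} \<and> card {b \<in> J m. val b = 0} = m * (R0 - length ps)"
proof (cases "ps = []")
  case True
  have v: "val b = 0" for b unfolding val_def using True by simp
  have c: "card {b \<in> J m. val b = 0} = m * (R0 - length ps)" if "0 < m" for m
  proof -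
    have l0: "length ps = 0" using True by simp
    have "card {b \<in> J m. val b = 0} = m * (R0 - 0)" using that by (simp add: v card_J mult.commute)
    then show ?thesis by (simp only: l0)
  qed
  show ?thesis by (intro exI[of _ "1::real"] conjI allI impI c) (auto simp: v)
next
  case ne: False
  with assms have Z: "circle_zeros (last ps) = {}" by simp
  have "last ps \<noteq> 0" using nz ne by (metis last_in_set)
  then obtain P where P: "\<And>\<xi>. cmod \<xi> = 1 \<Longrightarrow> cmod (poly P \<xi>) = cmod (laurent_eval (last ps) \<xi>)" using laurent_to_poly by blast
  obtain C where C: "C > 0" "\<And>l \<xi>. l < length ps \<Longrightarrow> cmod \<xi> = 1 \<Longrightarrow> cmod (laurent_eval (last ps) \<xi>) \<le> C * cmod (laurent_eval (ps ! l) \<xi>)"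
    using last_le by blast
  have cont: "continuous_on (sphere 0 1) (\<lambda>\<xi>::complex. cmod (poly P \<xi>))" by (intro continuous_intros)
  have "(1::complex) \<in> sphere 0 1" by simp
  then have "sphere (0::complex) 1 \<noteq> {}" by blast
  from continuous_attains_inf[OF compact_sphere this cont]
  obtain x where x: "x \<in> sphere 0 1" "\<And>\<xi>. \<xi> \<in> sphere 0 1 \<Longrightarrow> cmod (poly P x) \<le> cmod (poly P \<xi>)" by blast
  define v where "v = cmod (poly P x)"
  have "v \<noteq> 0" using P[of x] x(1) Z by (auto simp: v_def circle_zeros_def)
  then have v: "v > 0" by (simp add: v_def)
  have ge: "v / C \<le> cmod (laurent_eval (ps ! l) \<xi>)" if l: "l < length ps" and \<xi>: "cmod \<xi> = 1" for l \<xi>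
  proof -
    have "v \<le> cmod (poly P \<xi>)" using x(2)[of \<xi>] \<xi> by (simp add: v_def)
    also have "\<dots> \<le> C * cmod (laurent_eval (ps ! l) \<xi>)" using C(2)[OF l \<xi>] P[OF \<xi>] by simp
    finally show ?thesis using C(1) by (simp add: field_simps)
  qed
  have vC: "0 < v / (2 * C)" "v / (2 * C) < v / C" using v C(1) by (simp_all add: field_simps)
  show ?thesis
  proof (intro exI[of _ "v / (2 * C)"] conjI allI impI vC(1))
    fix m :: nat assume m: "0 < m"
    show "{b \<in> J m. 0 < val b \<and> val b \<le> v / (2 * C)} = {}"
    proof (rule ccontr)
      assume "\<not> ?thesis"
      then obtain l \<xi> where b: "(l, \<xi>) \<in> J m" "0 < val (l, \<xi>)" "val (l, \<xi>) \<le> v / (2 * C)" by auto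
      then have "l < length ps" by (auto simp: val_def split: if_splits)
      moreover have "cmod \<xi> = 1" using b(1) norm_root[OF m] by (simp add: J_def)
      ultimately have "v / C \<le> val (l, \<xi>)" using ge by (simp add: val_def)
      then show False using b(3) vC by linarith
    qed
    show "card {b \<in> J m. val b = 0} = m * (R0 - length ps)"
      using card_val_0[OF m _ ne] Z by simp
  qed
qed

end

section \<open>Invariant factors with zeros on the unit circle\<close>

locale divisor_chain_zeros = divisor_chain +
  fixes P :: "complex poly"
  assumes ne: "ps \<noteq> []" and P0: "P \<noteq> 0" and P: "\<And>\<xi>. cmod \<xi> = 1 \<Longrightarrow> cmod (poly P \<xi>) = cmod (laurent_eval (last ps) \<xi>)"
    and zeros: "circle_zeros (last ps) \<noteq> {}"
begin

lemma circle_zeros_eq: "poly_circle_zeros P = circle_zeros (last ps)"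
  using P by (force simp: poly_circle_zeros_def circle_zeros_def)

sublocale circle_poly P
  by standard (use P0 zeros circle_zeros_eq in auto)

lemma finite_small_roots: "0 < m \<Longrightarrow> finite (small_roots m t)"
  by (rule finite_subset[OF _ finite_roots]) (auto simp: small_roots_def)

text \<open>A value of size at most t of some invariant factor forces the last one to be at most C t
  at the same \<xi>. The last one may even vanish there although the other does not, hence the
  additional set Z of bounded size.\<close>

lemma count_upper: "\<exists>C>0. \<forall>m t. 0 < m \<longrightarrow> 0 \<le> t \<longrightarrow>
  real (card {b \<in> J m. 0 < val b \<and> val b \<le> t}) \<le> C * (real m * t powr (1 / real \<mu>) + 1)"
proof -
  obtain C where C: "C > 0" "\<And>l \<xi>. l < length ps \<Longrightarrow> cmod \<xi> = 1 \<Longrightarrow> cmod (laurent_eval (last ps) \<xi>) \<le> C * cmod (laurent_eval (ps ! l) \<xi>)"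
    using last_le by blast
  obtain C1 where C1: "C1 > 0" "\<And>m t. 0 < m \<Longrightarrow> 0 \<le> t \<Longrightarrow> real (card (small_roots m t)) \<le> C1 * (real m * t powr (1 / real \<mu>) + 1)"
    using small_roots_upper by blast
  define q where "q = C powr (1 / real \<mu>)"
  define C2 where "C2 = 1 + real (length ps) * (C1 * (q + 1) + real (card Z))"
  have q: "q \<ge> 0" by (simp add: q_def)
  have "C2 > 0" using C1(1) q by (simp add: C2_def add_pos_nonneg)
  moreover have "real (card {b \<in> J m. 0 < val b \<and> val b \<le> t}) \<le> C2 * (real m * t powr (1 / real \<mu>) + 1)"
    if m: "0 < m" and t: "0 \<le> t" for m t
  proof -
    have "{b \<in> J m. 0 < val b \<and> val b \<le> t} \<subseteq> {..<length ps} \<times> (small_roots m (C * t) \<union> Z)"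
    proof
      fix b assume b: "b \<in> {b \<in> J m. 0 < val b \<and> val b \<le> t}"
      obtain l \<xi> where [simp]: "b = (l, \<xi>)" by (cases b)
      have l: "l < length ps" using b by (auto simp: val_def split: if_splits)
      have \<xi>: "\<xi> ^ m = 1" using b by (simp add: J_def)
      note n1 = norm_root[OF m \<xi>]
      have "cmod (laurent_eval (ps ! l) \<xi>) \<le> t" using b l by (simp add: val_def)
      then have "C * cmod (laurent_eval (ps ! l) \<xi>) \<le> C * t" using C(1) by simp
      then have "cmod (poly P \<xi>) \<le> C * t" using C(2)[OF l n1] P[OF n1] by linarith
      then show "b \<in> {..<length ps} \<times> (small_roots m (C * t) \<union> Z)"
        using l \<xi> n1 by (auto simp: small_roots_def poly_circle_zeros_def)
    qed
    then have "card {b \<in> J m. 0 < val b \<and> val b \<le> t} \<le> card ({..<length ps} \<times> (small_roots m (C * t) \<union> Z))"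
      using finite_small_roots[OF m] finite_Z by (intro card_mono) auto
    also have "\<dots> \<le> length ps * (card (small_roots m (C * t)) + card Z)"
      by (simp add: card_cartesian_product card_Un_le)
    finally have "real (card {b \<in> J m. 0 < val b \<and> val b \<le> t})
        \<le> real (length ps) * (real (card (small_roots m (C * t))) + real (card Z))"
      by (simp flip: of_nat_mult of_nat_add)
    also have "\<dots> \<le> real (length ps) * (C1 * (real m * (C * t) powr (1 / real \<mu>) + 1) + real (card Z))"
      using C1(2)[OF m, of "C * t"] C(1) t by (intro mult_left_mono add_right_mono) auto
    also have "\<dots> = real (length ps) * (C1 * (q * (real m * t powr (1 / real \<mu>)) + 1) + real (card Z) * 1)"
      using C(1) t by (simp add: powr_mult q_def mult_ac)
    also have "\<dots> \<le> real (length ps) * (C1 * ((q + 1) * (real m * t powr (1 / real \<mu>) + 1)) + real (card Z) * (real m * t powr (1 / real \<mu>) + 1))"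
    proof (intro mult_left_mono add_mono)
      have "0 \<le> real m * t powr (1 / real \<mu>)" by simp
      then show "q * (real m * t powr (1 / real \<mu>)) + 1 \<le> (q + 1) * (real m * t powr (1 / real \<mu>) + 1)"
        using q by (simp add: algebra_simps)
    qed (use C1 in auto)
    also have "\<dots> = real (length ps) * (C1 * (q + 1) + real (card Z)) * (real m * t powr (1 / real \<mu>) + 1)"
      by (simp add: algebra_simps)
    also have "\<dots> \<le> C2 * (real m * t powr (1 / real \<mu>) + 1)" unfolding C2_def by (intro mult_right_mono) auto
    finally show ?thesis .
  qed
  ultimately show ?thesis by blast
qed

lemma count_lower: "\<exists>c>0. \<exists>C t0. t0 > 0 \<and> (\<forall>m t. 0 < m \<longrightarrow> 0 \<le> t \<longrightarrow> t \<le> t0 \<longrightarrow>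
  c * (real m * t powr (1 / real \<mu>)) - C \<le> real (card {b \<in> J m. 0 < val b \<and> val b \<le> t}))"
proof -
  obtain c C t0 where c: "c > 0" "t0 > 0" "\<And>m t. 0 < m \<Longrightarrow> 0 \<le> t \<Longrightarrow> t \<le> t0 \<Longrightarrow>
    c * (real m * t powr (1 / real \<mu>)) - C \<le> real (card (small_roots m t))" using small_roots_lower by blast
  have "card (small_roots m t) \<le> card {b \<in> J m. 0 < val b \<and> val b \<le> t}" if m: "0 < m" for m t
  proof -
    have l: "length ps - 1 < length ps" "last ps = ps ! (length ps - 1)" using ne by (auto simp: last_conv_nth)
    have "Pair (length ps - 1) ` small_roots m t \<subseteq> {b \<in> J m. 0 < val b \<and> val b \<le> t}"
      using l len P norm_root[OF m] by (auto simp: small_roots_def J_def val_def) (metis norm_eq_zero)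
    then have "card (Pair (length ps - 1) ` small_roots m t) \<le> card {b \<in> J m. 0 < val b \<and> val b \<le> t}"
      using finite_J[OF m] by (intro card_mono) auto
    then show ?thesis by (simp add: card_image inj_on_def)
  qed
  then show ?thesis using c order_trans[OF c(3)] by (intro exI[of _ c] conjI exI[of _ C] exI[of _ t0]) (auto simp: of_nat_mono)
qed

lemma val_gap:
  assumes B: "\<And>a. a \<in> circle_zeros (last ps) - {1} \<Longrightarrow> baker_constant a (-1) (Dt a)"
    and D: "\<And>a. a \<in> circle_zeros (last ps) - {1} \<Longrightarrow> Dt a \<le> D" and D1: "1 \<le> D"
  shows "\<exists>c>0. \<forall>m. \<forall>b\<in>J m. 0 < m \<longrightarrow> 0 < val b \<longrightarrow> c * real m powr (- ((1 + D) * real \<mu>)) \<le> val b"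
proof -
  obtain C where C: "C > 0" "\<And>l \<xi>. l < length ps \<Longrightarrow> cmod \<xi> = 1 \<Longrightarrow> cmod (laurent_eval (last ps) \<xi>) \<le> C * cmod (laurent_eval (ps ! l) \<xi>)"
    using last_le by blast
  obtain c where c: "c > 0" "\<And>m \<xi>. 0 < m \<Longrightarrow> \<xi> ^ m = 1 \<Longrightarrow> poly P \<xi> \<noteq> 0 \<Longrightarrow>
    c * real m powr (- ((1 + D) * real \<mu>)) \<le> cmod (poly P \<xi>)"
    using roots_gap[of Dt D] B D D1 unfolding circle_zeros_eq by blast
  \<comment> \<open>Positive values at zeros of the last invariant factor, where
    \<open>roots_gap\<close> says nothing. They form a finite set independent of m; 1 is inserted so
    that the minimum exists.\<close>
  define V where "V = insert 1 ({v \<in> val ` ({..<length ps} \<times> Z). 0 < v})"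
  have V: "finite V" "V \<noteq> {}" "\<And>v. v \<in> V \<Longrightarrow> 0 < v" unfolding V_def using finite_Z by auto
  define c1 where "c1 = min (c / C) (Min V)"
  have c1: "0 < c1" using V c(1) C(1) by (simp add: c1_def)
  moreover have "c1 * real m powr (- ((1 + D) * real \<mu>)) \<le> val b" if b: "b \<in> J m" and m: "0 < m" and v: "0 < val b" for m b
  proof -
    obtain l \<xi> where [simp]: "b = (l, \<xi>)" by (cases b)
    have l: "l < length ps" using v by (auto simp: val_def split: if_splits)
    have \<xi>: "\<xi> ^ m = 1" using b by (simp add: J_def)
    note n1 = norm_root[OF m \<xi>]
    show ?thesis
    proof (cases "poly P \<xi> = 0")
      case True
      then have "val b \<in> V" using l n1 v by (auto simp: V_def poly_circle_zeros_def)
      then have "c1 \<le> val b" using V(1) by (simp add: c1_def min_le_iff_disj)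
      moreover have "real m powr (- ((1 + D) * real \<mu>)) \<le> 1"
      proof -
        have "real m powr (- ((1 + D) * real \<mu>)) \<le> real m powr 0" using m D1 by (intro powr_mono) auto
        then show ?thesis using m by simp
      qed
      then have "c1 * real m powr (- ((1 + D) * real \<mu>)) \<le> c1 * 1" using c1 by (intro mult_left_mono) auto
      ultimately show ?thesis by linarith
    next
      case False
      have "c1 * real m powr (- ((1 + D) * real \<mu>)) \<le> c / C * real m powr (- ((1 + D) * real \<mu>))"
        by (intro mult_right_mono) (auto simp: c1_def)
      also have "\<dots> \<le> cmod (poly P \<xi>) / C" using c(2)[OF m \<xi> False] C(1) by (simp add: divide_right_mono)
      also have "\<dots> \<le> cmod (laurent_eval (ps ! l) \<xi>)" using C(2)[OF l n1] P[OF n1] C(1) by (simp add: field_simps)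
      also have "\<dots> = val b" using l by (simp add: val_def)
      finally show ?thesis .
    qed
  qed
  ultimately show ?thesis by blast
qed

end

section \<open>Infinite cyclic normal subgroups of finite index\<close>

locale cyclic_restriction = group G for G :: "('g, 'm) monoid_scheme" (structure) +
  fixes z :: 'g and gs :: "'g list"
  assumes z: "z \<in> carrier G" and normal_z: "generate G {z} \<lhd> G" and infinite_z: "infinite (generate G {z})"
    and trans: "coset_transversal G (generate G {z}) gs"
begin

abbreviation "n \<equiv> length gs"

lemma generate_pow_eq: "a \<in> carrier G \<Longrightarrow> generate G {a} = range (\<lambda>k::int. a [^] k)"
  using generate_pow by auto

lemma zpow_closed [simp]: "z [^] (k::int) \<in> carrier G"
  using z by simp

lemma zpow_add: "z [^] (k + l :: int) = z [^] k \<otimes> z [^] l"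
  using z by (simp add: int_pow_mult)

lemma zpow_inj: "z [^] (i::int) = z [^] (j::int) \<longleftrightarrow> i = j"
proof
  have False if ij: "z [^] (i::int) = z [^] (j::int)" "i < j" for i j
  proof -
    define d where "d = j - i"
    have d: "0 < d" using ij by (simp add: d_def)
    have "z [^] i \<otimes> z [^] d = z [^] (i + d)" by (simp add: zpow_add)
    then have "z [^] i \<otimes> z [^] d = z [^] i" using ij(1) by (simp add: d_def)
    then have zd: "z [^] d = \<one>" using r_cancel_one[of "z [^] i" "z [^] d"] by simp
    have *: "z [^] k = z [^] (k mod d)" for k
    proof -
      have "z [^] k = z [^] (d * (k div d) + k mod d)" by simp
      also have "\<dots> = (z [^] d) [^] (k div d) \<otimes> z [^] (k mod d)" using z by (simp only: zpow_add int_pow_pow)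
      also have "\<dots> = z [^] (k mod d)" using zd by simp
      finally show ?thesis .
    qed
    have "generate G {z} \<subseteq> (\<lambda>k. z [^] k) ` {0..<d}"
      unfolding generate_pow_eq[OF z]
    proof (rule image_subsetI)
      fix k :: int
      show "z [^] k \<in> (\<lambda>k. z [^] k) ` {0..<d}"
        by (rule image_eqI[where x = "k mod d"]) (use d * in auto)
    qed
    then show False using infinite_z finite_subset by blast
  qed
  then show "i = j" if "z [^] i = z [^] j" using that by (metis linorder_neqE)
qed simp

lemma gs_closed: "u < n \<Longrightarrow> gs ! u \<in> carrier G"
  using trans by (auto simp: coset_transversal_def)

lemma subgroup_z: "subgroup (generate G {z}) G"
  using normal_z by (rule normal_imp_subgroup)

lemma ex_decomposition: "g \<in> carrier G \<Longrightarrow> \<exists>e u. u < n \<and> g = z [^] (e::int) \<otimes> gs ! u"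
proof -
  assume g: "g \<in> carrier G"
  have "generate G {z} #> g \<in> rcosets (generate G {z})" using g by (auto simp: RCOSETS_def)
  then have "generate G {z} #> g \<in> set (map (\<lambda>g. generate G {z} #> g) gs)"
    using trans by (simp only: coset_transversal_def)
  then obtain u where u: "u < n" "generate G {z} #> g = generate G {z} #> gs ! u"
    unfolding in_set_conv_nth by auto
  have "g \<in> generate G {z} #> gs ! u" using rcos_self[OF g subgroup_z] u(2) by simp
  then show ?thesis using u(1) by (auto simp: r_coset_def generate_pow_eq[OF z])
qed

lemma decomposition_unique:
  assumes "u < n" "v < n" "z [^] (e::int) \<otimes> gs ! u = z [^] (f::int) \<otimes> gs ! v"
  shows "e = f \<and> u = v"
proof -
  have c: "generate G {z} #> (z [^] e \<otimes> gs ! u) = generate G {z} #> gs ! u" if "u < n" for e :: int and u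
  proof -
    have "z [^] e \<in> generate G {z}" unfolding generate_pow_eq[OF z] by (rule range_eqI[OF refl])
    then show ?thesis using coset_mult_assoc[OF subgroup.subset[OF subgroup_z], of "z [^] e" "gs ! u"] gs_closed[OF that]
        subgroup.rcos_const[OF subgroup_z is_group] by simp
  qed
  have "generate G {z} #> gs ! u = generate G {z} #> gs ! v"
    using c[OF assms(1), of e] c[OF assms(2), of f] assms(3) by simp
  then have "map (\<lambda>g. generate G {z} #> g) gs ! u = map (\<lambda>g. generate G {z} #> g) gs ! v" using assms by simp
  then have "u = v" using trans assms(1,2) unfolding coset_transversal_def
    by (metis length_map nth_eq_iff_index_eq)
  then show ?thesis using assms gs_closed[OF assms(1)] by (simp add: zpow_inj)
qed

lemma n_pos: "0 < n"
  using ex_decomposition[OF one_closed] by (metis less_nat_zero_code not_gr_zero)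

definition zsub :: "nat \<Rightarrow> 'g set" where "zsub m = generate G {z [^] (int m)}"

lemma zsub_eq: "zsub m = range (\<lambda>k. z [^] (int m * k))"
  unfolding zsub_def using generate_pow_eq[of "z [^] int m"] z by (simp add: int_pow_pow)

lemma zpow_mem_zsub: "z [^] e \<in> zsub m \<longleftrightarrow> int m dvd e"
  by (auto simp: zsub_eq zpow_inj dvd_def)

lemma subgroup_zsub: "subgroup (zsub m) G"
  unfolding zsub_def by (intro generate_is_subgroup) auto

text \<open>Conjugation by g maps z to some power z ^ f and hence multiplies all exponents by f; so
  every subgroup of the group generated by z is normal in G.\<close>

lemma conj_pow:
  assumes g: "g \<in> carrier G" shows "\<exists>f. \<forall>e::int. g \<otimes> z [^] e \<otimes> inv g = z [^] (f * e)"
proof -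
  have "g \<otimes> z \<otimes> inv g \<in> generate G {z}"
    using normal_z g generate.incl[of z "{z}" G] by (auto simp: normal_inv_iff)
  then obtain f :: int where f: "g \<otimes> z \<otimes> inv g = z [^] f" by (auto simp: generate_pow_eq[OF z])
  have nat: "g \<otimes> z [^] (int k) \<otimes> inv g = z [^] (f * int k)" for k
  proof (induction k)
    case (Suc k)
    have "g \<otimes> z [^] (int (Suc k)) \<otimes> inv g = (g \<otimes> z [^] (int k) \<otimes> inv g) \<otimes> (g \<otimes> z \<otimes> inv g)"
    proof -
      have "z [^] (int (Suc k)) = z [^] (int k) \<otimes> z" using zpow_add[of "int k" 1] z by (simp add: add.commute)
      moreover have "inv g \<otimes> (g \<otimes> (z \<otimes> inv g)) = z \<otimes> inv g"
        using g z by (simp add: m_assoc[symmetric])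
      ultimately show ?thesis using g z by (simp add: m_assoc)
    qed
    also have "\<dots> = z [^] (f * int k + f)" by (simp add: Suc f zpow_add)
    finally show ?case by (simp add: algebra_simps)
  qed (use g in simp)
  have "g \<otimes> z [^] e \<otimes> inv g = z [^] (f * e)" for e :: int
  proof (cases e rule: int_cases2)
    case (nonneg k) then show ?thesis using nat by simp
  next
    case (nonpos k)
    have "g \<otimes> z [^] e \<otimes> inv g = inv (g \<otimes> z [^] (int k) \<otimes> inv g)"
      using g z by (simp add: nonpos inv_mult_group m_assoc int_pow_neg)
    then show ?thesis using z by (simp add: nat nonpos int_pow_neg)
  qed
  then show ?thesis by blast
qed

lemma normal_zsub: "zsub m \<lhd> G"
  unfolding normal_inv_iff
proof (intro conjI subgroup_zsub ballI)
  fix g h assume g: "g \<in> carrier G" and h: "h \<in> zsub m"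
  obtain f where f: "\<And>e::int. g \<otimes> z [^] e \<otimes> inv g = z [^] (f * e)" using conj_pow[OF g] by blast
  obtain k where "h = z [^] (int m * k)" using h by (auto simp: zsub_eq)
  then have "g \<otimes> h \<otimes> inv g = z [^] (int m * (f * k))" by (simp add: f mult_ac)
  then show "g \<otimes> h \<otimes> inv g \<in> zsub m" by (auto simp: zsub_eq)
qed

lemma zsub_coset_eq_iff:
  assumes "u < n" "v < n"
  shows "zsub m #> (z [^] e \<otimes> gs ! u) = zsub m #> (z [^] f \<otimes> gs ! v) \<longleftrightarrow> u = v \<and> int m dvd (e - f)"
proof -
  let ?g = "z [^] e \<otimes> gs ! u" and ?h = "z [^] f \<otimes> gs ! v"
  have gh: "?g \<in> carrier G" "?h \<in> carrier G" using gs_closed assms by auto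
  have "zsub m #> ?g = zsub m #> ?h \<longleftrightarrow> ?g \<in> zsub m #> ?h"
    using repr_independence[OF _ gh(2) subgroup_zsub] rcos_self[OF gh(1) subgroup_zsub] by metis
  also have "\<dots> \<longleftrightarrow> (\<exists>k. ?g = z [^] (int m * k) \<otimes> ?h)" by (auto simp: r_coset_def zsub_eq)
  also have "\<dots> \<longleftrightarrow> (\<exists>k. ?g = z [^] (int m * k + f) \<otimes> gs ! v)"
    using gs_closed[OF assms(2)] by (simp add: zpow_add m_assoc)
  also have "\<dots> \<longleftrightarrow> (\<exists>k. e = int m * k + f \<and> u = v)" using decomposition_unique[OF assms] by blast
  also have "\<dots> \<longleftrightarrow> u = v \<and> int m dvd (e - f)" by (auto simp: dvd_def algebra_simps)
  finally show ?thesis .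
qed

text \<open>Cosets of \<open>zsub m\<close> are labelled by an exponent modulo m and an index into
  the transversal.\<close>

definition pt :: "nat \<Rightarrow> int \<times> nat \<Rightarrow> 'g set" where
  "pt m = (\<lambda>(e, u). zsub m #> (z [^] e \<otimes> gs ! u))"

lemma bij_pt:
  assumes m: "0 < m" shows "bij_betw (pt m) ({0..<int m} \<times> {..<n}) (rcosets (zsub m))"
  unfolding bij_betw_def
proof
  show "inj_on (pt m) ({0..<int m} \<times> {..<n})"
  proof (rule inj_onI)
    fix p q assume pq: "p \<in> {0..<int m} \<times> {..<n}" "q \<in> {0..<int m} \<times> {..<n}" "pt m p = pt m q"
    obtain e u f v where [simp]: "p = (e, u)" "q = (f, v)" by (cases p, cases q)
    have "u = v" "int m dvd (e - f)" using pq by (auto simp: pt_def zsub_coset_eq_iff)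
    moreover have "\<bar>e - f\<bar> < int m" using pq by auto
    ultimately show "p = q" using dvd_imp_le_int[of "e - f" "int m"] by fastforce
  qed
  show "pt m ` ({0..<int m} \<times> {..<n}) = rcosets (zsub m)"
  proof
    show "pt m ` ({0..<int m} \<times> {..<n}) \<subseteq> rcosets (zsub m)"
      using gs_closed by (auto simp: pt_def intro!: rcosetsI[OF subgroup.subset[OF subgroup_zsub]])
    show "rcosets (zsub m) \<subseteq> pt m ` ({0..<int m} \<times> {..<n})"
    proof
      fix p assume "p \<in> rcosets (zsub m)"
      then obtain g where g: "g \<in> carrier G" "p = zsub m #> g" by (auto simp: RCOSETS_def)
      obtain e u where d: "u < n" "g = z [^] (e::int) \<otimes> gs ! u" using ex_decomposition[OF g(1)] by blast
      have "zsub m #> (z [^] (e mod int m) \<otimes> gs ! u) = zsub m #> (z [^] e \<otimes> gs ! u)"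
        unfolding zsub_coset_eq_iff[OF d(1) d(1)] by (simp add: mod_eq_dvd_iff[symmetric])
      then have "p = pt m (e mod int m, u)" by (simp add: pt_def g(2) d(2))
      then show "p \<in> pt m ` ({0..<int m} \<times> {..<n})" using d(1) m by force
    qed
  qed
qed

lemma card_rcosets_zsub: "0 < m \<Longrightarrow> card (rcosets (zsub m)) = n * m" and finite_rcosets_zsub: "0 < m \<Longrightarrow> finite (rcosets (zsub m))"
proof -
  assume m: "0 < m"
  show "card (rcosets (zsub m)) = n * m" using bij_betw_same_card[OF bij_pt[OF m]] by (simp add: card_cartesian_product mult.commute)
  show "finite (rcosets (zsub m))" using bij_betw_finite[OF bij_pt[OF m]] by simp
qed

lemma finite_quotient_zsub: "0 < m \<Longrightarrow> finite_quotient (zsub m) G"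
  by (intro finite_quotient.intro finite_quotient_axioms.intro normal_zsub finite_rcosets_zsub)

text \<open>The exponents of elements of N form a subgroup of the integers, generated by its least
  positive element; there is a positive one because finitely many cosets force two powers of z into
  the same coset.\<close>

lemma zsub_subset: "N \<in> finite_index_normal G \<Longrightarrow> N \<subseteq> zsub k \<Longrightarrow> 0 < k \<Longrightarrow> \<exists>j>0. N = zsub (k * j)"
proof -
  assume N: "N \<in> finite_index_normal G" and sub: "N \<subseteq> zsub k" and k: "0 < k"
  have sN: "subgroup N G" using N by (auto simp: finite_index_normal_def normal_imp_subgroup)
  have fin: "finite (rcosets N)" using N by (simp add: finite_index_normal_def)
  define S where "S = {e::int. z [^] e \<in> N}"
  have add: "e + f \<in> S" if "e \<in> S" "f \<in> S" for e f using that subgroup.m_closed[OF sN] by (simp add: S_def zpow_add)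
  have neg: "- e \<in> S" if "e \<in> S" for e using that subgroup.m_inv_closed[OF sN] z by (simp add: S_def int_pow_neg)
  have mult: "e * f \<in> S" if "e \<in> S" for e f
  proof (cases f rule: int_cases2)
    case (nonneg j)
    have "e * int j \<in> S" for j by (induction j) (use that add subgroup.one_closed[OF sN] in \<open>auto simp: algebra_simps S_def\<close>)
    then show ?thesis using nonneg by simp
  next
    case (nonpos j)
    have "e * int j \<in> S" for j by (induction j) (use that add subgroup.one_closed[OF sN] in \<open>auto simp: algebra_simps S_def\<close>)
    then show ?thesis using nonpos neg by simp
  qed
  have "\<exists>e>0. e \<in> S"
  proof -
    have "(\<lambda>e::nat. N #> z [^] (int e)) ` UNIV \<subseteq> rcosets N" unfolding RCOSETS_def using zpow_closed by blast
    then have "finite ((\<lambda>e::nat. N #> z [^] (int e)) ` UNIV)" using fin finite_subset by blast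
    then have "\<not> inj (\<lambda>e::nat. N #> z [^] (int e))" using finite_imageD infinite_UNIV_nat by blast
    then obtain e f :: nat where ef: "e < f" "N #> z [^] (int e) = N #> z [^] (int f)"
      unfolding inj_def by (metis linorder_neqE_nat)
    have "z [^] (int f) \<in> N #> z [^] (int e)" using rcos_self[OF _ sN, of "z [^] int f"] ef(2) by simp
    then obtain h where h: "h \<in> N" "z [^] (int f) = h \<otimes> z [^] (int e)" by (auto simp: r_coset_def)
    have hc: "h \<in> carrier G" using h(1) subgroup.subset[OF sN] by blast
    have "z [^] (int f - int e) \<otimes> z [^] (int e) = h \<otimes> z [^] (int e)" using h(2) by (simp add: zpow_add[symmetric])
    then have "z [^] (int f - int e) = h" using hc by (simp add: r_cancel)
    then show ?thesis using h(1) ef(1) by (intro exI[of _ "int f - int e"]) (auto simp: S_def)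
  qed
  then obtain e0 where e0: "0 < e0" "e0 \<in> S" by blast
  define m where "m = (LEAST j. 0 < j \<and> int j \<in> S)"
  have "0 < nat e0 \<and> int (nat e0) \<in> S" using e0 by simp
  then have "0 < m \<and> int m \<in> S" unfolding m_def by (rule LeastI)
  then have m: "0 < m" "int m \<in> S" by blast+
  have least: "m \<le> j" if "0 < j" "int j \<in> S" for j
    unfolding m_def by (rule Least_le) (use that in blast)
  have dvd: "int m dvd e" if "e \<in> S" for e
  proof (rule ccontr)
    assume "\<not> int m dvd e"
    then have "e mod int m \<noteq> 0" by (simp only: dvd_eq_mod_eq_0 not_False_eq_True)
    moreover have "0 \<le> e mod int m" "e mod int m < int m" using m(1) by simp_all
    ultimately have r: "0 < e mod int m" "e mod int m < int m" by linarith+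
    have "e mod int m = e + - (int m * (e div int m))" using mult_div_mod_eq[of "int m" e] by linarith
    then have "e mod int m \<in> S" using add[OF that neg[OF mult[OF m(2), of "e div int m"]]] by (simp only:)
    then have "m \<le> nat (e mod int m)" using least[of "nat (e mod int m)"] r by simp
    then show False using r by linarith
  qed
  have "N = zsub m"
  proof
    show "N \<subseteq> zsub m"
    proof
      fix h assume h: "h \<in> N"
      then obtain e where "h = z [^] (int k * e)" using sub by (auto simp: zsub_eq)
      then show "h \<in> zsub m" using h dvd[of "int k * e"] by (simp add: zpow_mem_zsub S_def)
    qed
    show "zsub m \<subseteq> N" using mult[OF m(2)] by (auto simp: zsub_eq S_def)
  qed
  moreover have "k dvd m" unfolding int_dvd_int_iff[symmetric] using m(2) sub by (auto simp: S_def zpow_mem_zsub[symmetric])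
  then obtain j where "m = k * j" by (elim dvdE)
  ultimately show ?thesis using m(1) by auto
qed

text \<open>A nontrivial element of \<open>zsub m\<close> is a power of z with exponent at least m
  in absolute value, whereas the exponents of powers of z in S are bounded.\<close>

lemma zsub_trivial:
  assumes "finite S" shows "\<exists>m0. \<forall>m\<ge>m0. S \<inter> zsub m \<subseteq> {\<one>}"
proof -
  define E where "E = {e::int. z [^] e \<in> S}"
  have "finite E" unfolding E_def
    by (rule finite_vimageI[OF assms, of "\<lambda>e::int. z [^] e", unfolded vimage_def]) (auto simp: inj_def zpow_inj)
  then have b: "\<bar>e\<bar> \<le> Max (abs ` E)" if "e \<in> E" for e using that by simp
  define b where "b = Max (abs ` E)"
  have "S \<inter> zsub m \<subseteq> {\<one>}" if "m \<ge> nat (b + 1)" for m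
  proof
    fix g assume g: "g \<in> S \<inter> zsub m"
    then obtain k where k: "g = z [^] (int m * k)" by (auto simp: zsub_eq)
    then have kb: "\<bar>int m * k\<bar> \<le> b" using b g by (auto simp: E_def b_def)
    have "int m * k = 0"
    proof (rule ccontr)
      assume "int m * k \<noteq> 0"
      then have "\<bar>int m\<bar> \<le> \<bar>int m * k\<bar>" by (intro dvd_imp_le_int) auto
      then show False using kb that by linarith
    qed
    then have "g = z [^] (0::int)" using k by (simp only:)
    then show "g \<in> {\<one>}" by simp
  qed
  then show ?thesis by blast
qed

end

section \<open>Discrete Fourier transform\<close>

lemma sum_roots_unity_powi:
  assumes m: "0 < m"
  shows "(\<Sum>\<xi> | \<xi> ^ m = (1::complex). \<xi> powi d) = (if int m dvd d then of_nat m else 0)"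
proof -
  define w where "w = cis (2 * pi * of_int d / real m)"
  have "(\<Sum>\<xi> | \<xi> ^ m = (1::complex). \<xi> powi d) = (\<Sum>k<m. cis (2 * pi * real k / real m) powi d)"
    using sum.reindex_bij_betw[OF Complex.bij_betw_roots_unity[OF m], of "\<lambda>\<xi>. \<xi> powi d"] by simp
  also have "\<dots> = (\<Sum>k<m. w ^ k)"
  proof (rule sum.cong[OF refl])
    fix k
    have "cis (2 * pi * real k / real m) powi d = cis (of_int d * (2 * pi * real k / real m))" by (simp add: cis_power_int)
    also have "\<dots> = cis (real k * (2 * pi * of_int d / real m))" by (simp add: mult_ac)
    also have "\<dots> = w ^ k" unfolding w_def by (simp only: Complex.DeMoivre)
    finally show "cis (2 * pi * real k / real m) powi d = w ^ k" .
  qed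
  also have "\<dots> = (if int m dvd d then of_nat m else 0)"
  proof (cases "int m dvd d")
    case True
    then obtain j where "d = int m * j" by (auto simp: dvd_def)
    then have "w = cis (2 * pi * of_int j)" using m by (simp add: w_def mult.assoc)
    also have "\<dots> = 1" by (rule cis_multiple_2pi) simp
    finally have "w = 1" .
    then show ?thesis using True by simp
  next
    case False
    have w1: "w \<noteq> 1"
    proof
      assume "w = 1"
      then obtain j :: int where "2 * pi * of_int d / real m = of_int j * (2 * pi)"
        unfolding w_def cis_conv_exp exp_eq_1 by auto
      then have "real_of_int d = real m * of_int j" using m by (simp add: field_simps)
      then have "d = int m * j" by (metis of_int_eq_iff of_int_mult of_int_of_nat_eq)
      then show False using False by simp
    qed
    have "w ^ m = cis (real m * (2 * pi * of_int d / real m))" unfolding w_def by (rule Complex.DeMoivre)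
    also have "\<dots> = cis (2 * pi * of_int d)" using m by simp
    also have "\<dots> = 1" by (rule cis_multiple_2pi) simp
    finally show ?thesis using False w1 by (simp add: geometric_sum)
  qed
  finally show ?thesis .
qed

lemma parseval_roots_unity:
  fixes f :: "int \<Rightarrow> complex"
  assumes m: "0 < m"
  shows "(\<Sum>\<xi> | \<xi> ^ m = 1. (cmod (\<Sum>e\<in>{0..<int m}. f e * \<xi> powi e))\<^sup>2) = real m * (\<Sum>e\<in>{0..<int m}. (cmod (f e))\<^sup>2)"
proof -
  let ?I = "{0..<int m}"
  have "complex_of_real (\<Sum>\<xi> | \<xi> ^ m = 1. (cmod (\<Sum>e\<in>?I. f e * \<xi> powi e))\<^sup>2)
      = (\<Sum>\<xi> | \<xi> ^ m = 1. \<Sum>e\<in>?I. \<Sum>e'\<in>?I. f e * cnj (f e') * \<xi> powi (e - e'))"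
    unfolding of_real_sum
  proof (rule sum.cong[OF refl])
    fix \<xi> :: complex assume "\<xi> \<in> {\<xi>. \<xi> ^ m = 1}"
    then have \<xi>: "cmod \<xi> = 1" using norm_power[of \<xi> m] power_eq_imp_eq_base[of "cmod \<xi>" m 1] m by simp
    then have c: "cnj \<xi> = inverse \<xi>"
      using complex_norm_square[of \<xi>] by (metis inverse_unique mult.commute of_real_1 power_one)
    have "\<xi> \<noteq> 0" using \<xi> by auto
    then have p: "\<xi> powi e * cnj (\<xi> powi e') = \<xi> powi (e - e')" for e e'
      by (simp add: c power_int_diff power_int_inverse divide_inverse)
    have "complex_of_real ((cmod (\<Sum>e\<in>?I. f e * \<xi> powi e))\<^sup>2) = (\<Sum>e\<in>?I. f e * \<xi> powi e) * cnj (\<Sum>e\<in>?I. f e * \<xi> powi e)"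
      by (simp only: complex_norm_square)
    also have "\<dots> = (\<Sum>e\<in>?I. \<Sum>e'\<in>?I. f e * cnj (f e') * (\<xi> powi e * cnj (\<xi> powi e')))"
      unfolding cnj_sum sum_product complex_cnj_mult by (intro sum.cong refl) (simp only: mult_ac)
    finally show "complex_of_real ((cmod (\<Sum>e\<in>?I. f e * \<xi> powi e))\<^sup>2) = (\<Sum>e\<in>?I. \<Sum>e'\<in>?I. f e * cnj (f e') * \<xi> powi (e - e'))"
      by (simp only: p)
  qed
  also have "\<dots> = (\<Sum>e\<in>?I. \<Sum>\<xi> | \<xi> ^ m = 1. \<Sum>e'\<in>?I. f e * cnj (f e') * \<xi> powi (e - e'))" by (rule sum.swap)
  also have "\<dots> = (\<Sum>e\<in>?I. \<Sum>e'\<in>?I. \<Sum>\<xi> | \<xi> ^ m = 1. f e * cnj (f e') * \<xi> powi (e - e'))" by (intro sum.cong refl sum.swap)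
  also have "\<dots> = (\<Sum>e\<in>?I. \<Sum>e'\<in>?I. if e' = e then of_nat m * (f e * cnj (f e)) else 0)"
  proof (rule sum.cong[OF refl], rule sum.cong[OF refl])
    fix e e' assume "e \<in> ?I" "e' \<in> ?I"
    then have "\<bar>e - e'\<bar> < int m" by auto
    then have "int m dvd (e - e') \<longleftrightarrow> e' = e" using dvd_imp_le_int[of "e - e'" "int m"] by fastforce
    then show "(\<Sum>\<xi> | \<xi> ^ m = 1. f e * cnj (f e') * \<xi> powi (e - e')) = (if e' = e then of_nat m * (f e * cnj (f e)) else 0)"
      by (simp add: sum_distrib_left[symmetric] sum_roots_unity_powi[OF m])
  qed
  also have "\<dots> = of_nat m * (\<Sum>e\<in>?I. f e * cnj (f e))" by (simp add: sum_distrib_left)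
  also have "\<dots> = complex_of_real (real m * (\<Sum>e\<in>?I. (cmod (f e))\<^sup>2))" by (simp add: complex_norm_square del: of_real_power)
  finally show ?thesis by (simp only: of_real_eq_iff)
qed

section \<open>Matrices of Laurent polynomials on the unit circle\<close>

text \<open>The l-th coordinate of the row vector w times the matrix N(\<xi>).\<close>

definition laurent_row :: "laurent_poly mat \<Rightarrow> complex \<Rightarrow> (nat \<Rightarrow> complex) \<Rightarrow> nat \<Rightarrow> complex" where
  "laurent_row N \<xi> w l = (\<Sum>k<dim_row N. w k * laurent_eval (N $$ (k, l)) \<xi>)"

lemma laurent_row_mult:
  assumes "dim_col N = dim_row N'" "l < dim_col N'" "\<xi> \<noteq> 0"
  shows "laurent_row (N * N') \<xi> w l = laurent_row N' \<xi> (laurent_row N \<xi> w) l"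
proof -
  have "laurent_row (N * N') \<xi> w l = (\<Sum>k<dim_row N. \<Sum>j<dim_row N'. w k * (laurent_eval (N $$ (k, j)) \<xi> * laurent_eval (N' $$ (j, l)) \<xi>))"
    unfolding laurent_row_def using assms
    by (intro sum.cong) (auto simp: scalar_prod_def atLeast0LessThan laurent_eval_sum laurent_eval_mult sum_distrib_left)
  also have "\<dots> = (\<Sum>j<dim_row N'. \<Sum>k<dim_row N. w k * (laurent_eval (N $$ (k, j)) \<xi> * laurent_eval (N' $$ (j, l)) \<xi>))"
    by (rule sum.swap)
  also have "\<dots> = laurent_row N' \<xi> (laurent_row N \<xi> w) l"
    unfolding laurent_row_def sum_distrib_right by (intro sum.cong refl) (simp only: mult.assoc)
  finally show ?thesis .
qed

lemma laurent_row_one: "l < k \<Longrightarrow> laurent_row (1\<^sub>m k) \<xi> w l = w l"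
proof -
  assume l: "l < k"
  have "laurent_row (1\<^sub>m k) \<xi> w l = (\<Sum>j<k. if j = l then w j else 0)"
    unfolding laurent_row_def using l by (intro sum.cong) auto
  then show ?thesis using l by simp
qed

lemma laurent_row_cong: "(\<And>k. k < dim_row N \<Longrightarrow> w k = w' k) \<Longrightarrow> laurent_row N \<xi> w l = laurent_row N \<xi> w' l"
  by (simp add: laurent_row_def)

text \<open>Entries are bounded on the circle, so one K serves all \<xi>; this uniformity is what
  later makes the comparison constants independent of m.\<close>

lemma laurent_row_bounded:
  "\<exists>K\<ge>0. \<forall>\<xi> w. cmod \<xi> = 1 \<longrightarrow> (\<Sum>l<dim_col N. (cmod (laurent_row N \<xi> w l))\<^sup>2) \<le> K * (\<Sum>k<dim_row N. (cmod (w k))\<^sup>2)"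
proof -
  have "\<forall>k l. \<exists>b\<ge>0. \<forall>\<xi>. cmod \<xi> = 1 \<longrightarrow> cmod (laurent_eval (N $$ (k, l)) \<xi>) \<le> b"
    using laurent_eval_bounded by blast
  then obtain B where B: "\<And>k l. B k l \<ge> 0" "\<And>k l \<xi>. cmod \<xi> = 1 \<Longrightarrow> cmod (laurent_eval (N $$ (k, l)) \<xi>) \<le> B k l" by metis
  have "(\<Sum>l<dim_col N. (cmod (laurent_row N \<xi> w l))\<^sup>2) \<le> (\<Sum>l<dim_col N. \<Sum>k<dim_row N. (B k l)\<^sup>2) * (\<Sum>k<dim_row N. (cmod (w k))\<^sup>2)"
    if \<xi>: "cmod \<xi> = 1" for \<xi> w
    unfolding sum_distrib_right
  proof (rule sum_mono)
    fix l
    have "cmod (laurent_row N \<xi> w l) \<le> (\<Sum>k<dim_row N. B k l * cmod (w k))"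
      unfolding laurent_row_def
      by (rule order_trans[OF norm_sum sum_mono])
        (simp add: norm_mult mult.commute[of "cmod (w _)"] mult_right_mono B(2)[OF \<xi>])
    then have "(cmod (laurent_row N \<xi> w l))\<^sup>2 \<le> (\<Sum>k<dim_row N. B k l * cmod (w k))\<^sup>2" by (intro power_mono) auto
    also have "\<dots> \<le> (\<Sum>k<dim_row N. (B k l)\<^sup>2) * (\<Sum>k<dim_row N. (cmod (w k))\<^sup>2)" by (rule Cauchy_Schwarz_ineq_sum)
    finally show "(cmod (laurent_row N \<xi> w l))\<^sup>2 \<le> (\<Sum>n<dim_row N. (B n l)\<^sup>2 * (\<Sum>k<dim_row N. (cmod (w k))\<^sup>2))"
      by (simp add: sum_distrib_right)
  qed
  moreover have "0 \<le> (\<Sum>l<dim_col N. \<Sum>k<dim_row N. (B k l)\<^sup>2)" by (intro sum_nonneg) auto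
  ultimately show ?thesis by blast
qed

section \<open>Circulant block matrices\<close>

text \<open>M is block circulant with symbol B: an index a consists of a block number
  \<open>W a\<close> and a residue \<open>E a\<close> modulo m, and the entry at a, b sums the
  coefficients of the Laurent polynomial at \<open>W a\<close>, \<open>W b\<close> over exponents
  congruent to \<open>E b - E a\<close>. The order of the residues inside M is left open, because
  the enumeration of the quotient group is arbitrary.\<close>

locale circulant_blocks =
  fixes m R S :: nat and W :: "nat \<Rightarrow> nat" and E :: "nat \<Rightarrow> int" and B :: "laurent_poly mat" and M :: "complex mat"
  assumes m: "0 < m"
    and rows: "bij_betw (\<lambda>a. (W a, E a)) {..<R} ({..<dim_row B} \<times> {0..<int m})"
    and cols: "bij_betw (\<lambda>a. (W a, E a)) {..<S} ({..<dim_col B} \<times> {0..<int m})"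
    and entry: "\<And>a b. a < R \<Longrightarrow> b < S \<Longrightarrow> M $$ (a, b) =
      (\<Sum>e\<in>Poly_Mapping.keys (B $$ (W a, W b)). if int m dvd E a + e - E b then Poly_Mapping.lookup (B $$ (W a, W b)) e else 0)"
begin

text \<open>Fourier transform in the residue variable: for each m-th root of unity \<xi> a row
  vector indexed by block numbers.\<close>

definition hat :: "nat \<Rightarrow> (nat \<Rightarrow> complex) \<Rightarrow> complex \<Rightarrow> nat \<Rightarrow> complex" where
  "hat T x \<xi> k = (\<Sum>a<T. if W a = k then x a * \<xi> powi E a else 0)"

lemma sum_hat:
  assumes "W ` {..<T} \<subseteq> {..<T0}"
  shows "(\<Sum>k<T0. hat T x \<xi> k * f k) = (\<Sum>a<T. x a * \<xi> powi E a * f (W a))"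
proof -
  have "(\<Sum>k<T0. hat T x \<xi> k * f k) = (\<Sum>k<T0. \<Sum>a<T. if W a = k then x a * \<xi> powi E a * f k else 0)"
    unfolding hat_def sum_distrib_right by (intro sum.cong refl) simp
  also have "\<dots> = (\<Sum>a<T. \<Sum>k<T0. if W a = k then x a * \<xi> powi E a * f k else 0)" by (rule sum.swap)
  also have "\<dots> = (\<Sum>a<T. x a * \<xi> powi E a * f (W a))" using assms by (intro sum.cong refl) auto
  finally show ?thesis .
qed

lemma parseval_hat:
  assumes bij: "bij_betw (\<lambda>a. (W a, E a)) {..<T} ({..<T0} \<times> {0..<int m})"
  shows "(\<Sum>\<xi> | \<xi> ^ m = 1. \<Sum>k<T0. (cmod (hat T x \<xi> k))\<^sup>2) = real m * (\<Sum>a<T. (cmod (x a))\<^sup>2)"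
proof -
  define pos where "pos = inv_into {..<T} (\<lambda>a. (W a, E a))"
  have bp: "bij_betw pos ({..<T0} \<times> {0..<int m}) {..<T}" unfolding pos_def by (rule bij_betw_inv_into[OF bij])
  have WE: "W (pos (k, e)) = k" "E (pos (k, e)) = e" if "k < T0" "e \<in> {0..<int m}" for k e
    using bij_betw_inv_into_right[OF bij, of "(k, e)"] that unfolding pos_def by auto
  have re: "(\<Sum>a<T. f a) = (\<Sum>k<T0. \<Sum>e\<in>{0..<int m}. f (pos (k, e)))" for f :: "nat \<Rightarrow> 'z::comm_monoid_add"
    unfolding sum.reindex_bij_betw[OF bp, symmetric] by (simp add: sum.cartesian_product)
  have h: "hat T x \<xi> k = (\<Sum>e\<in>{0..<int m}. x (pos (k, e)) * \<xi> powi e)" if k: "k < T0" for \<xi> k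
  proof -
    have "hat T x \<xi> k = (\<Sum>k'<T0. \<Sum>e\<in>{0..<int m}. if k' = k then x (pos (k', e)) * \<xi> powi e else 0)"
      unfolding hat_def re by (intro sum.cong refl) (simp add: WE)
    also have "\<dots> = (\<Sum>k'<T0. if k' = k then \<Sum>e\<in>{0..<int m}. x (pos (k', e)) * \<xi> powi e else 0)"
      by (intro sum.cong refl) simp
    also have "\<dots> = (\<Sum>e\<in>{0..<int m}. x (pos (k, e)) * \<xi> powi e)" using k by simp
    finally show ?thesis .
  qed
  have "(\<Sum>\<xi> | \<xi> ^ m = 1. \<Sum>k<T0. (cmod (hat T x \<xi> k))\<^sup>2) = (\<Sum>k<T0. \<Sum>\<xi> | \<xi> ^ m = 1. (cmod (hat T x \<xi> k))\<^sup>2)"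
    by (rule sum.swap)
  also have "\<dots> = (\<Sum>k<T0. real m * (\<Sum>e\<in>{0..<int m}. (cmod (x (pos (k, e))))\<^sup>2))"
    by (intro sum.cong refl) (simp add: h parseval_roots_unity[OF m])
  also have "\<dots> = real m * (\<Sum>a<T. (cmod (x a))\<^sup>2)" unfolding re by (simp add: sum_distrib_left)
  finally show ?thesis .
qed

text \<open>The Fourier transform turns x M into multiplication by B(\<xi>). For fixed a and
  exponent e exactly one column b in block l has residue \<open>E a + e\<close>, and \<xi> only sees
  exponents modulo m.\<close>

lemma hat_mult:
  assumes l: "l < dim_col B" and \<xi>: "\<xi> ^ m = 1"
  shows "hat S (\<lambda>b. \<Sum>a<R. M $$ (a, b) * x a) \<xi> l = laurent_row B \<xi> (hat R x \<xi>) l"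
proof -
  have n1: "cmod \<xi> = 1" using \<xi> norm_power[of \<xi> m] power_eq_imp_eq_base[of "cmod \<xi>" m 1] m by simp
  then have \<xi>0: "\<xi> \<noteq> 0" by auto
  have per: "\<xi> powi e = \<xi> powi f" if d: "int m dvd e - f" for e f
  proof -
    obtain j where j: "e = f + int m * j" using d by (auto simp: dvd_def algebra_simps)
    have "\<xi> powi (int m * j) = 1" using \<xi> by (simp add: power_int_mult)
    then show ?thesis unfolding j using \<xi>0 by (simp add: power_int_add)
  qed
  have Wr: "W ` {..<R} \<subseteq> {..<dim_row B}" using bij_betw_imp_surj_on[OF rows] by auto
  have key: "(\<Sum>b<S. if W b = l then M $$ (a, b) * \<xi> powi E b else 0) = \<xi> powi E a * laurent_eval (B $$ (W a, l)) \<xi>"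
    if a: "a < R" for a
  proof -
    let ?p = "B $$ (W a, l)"
    have "(\<Sum>b<S. if W b = l then M $$ (a, b) * \<xi> powi E b else 0)
       = (\<Sum>b<S. \<Sum>e\<in>Poly_Mapping.keys ?p. if W b = l \<and> int m dvd E a + e - E b then Poly_Mapping.lookup ?p e * \<xi> powi E b else 0)"
      by (intro sum.cong refl) (auto simp: entry[OF a] sum_distrib_right intro!: sum.cong)
    also have "\<dots> = (\<Sum>e\<in>Poly_Mapping.keys ?p. \<Sum>b<S. if W b = l \<and> int m dvd E a + e - E b then Poly_Mapping.lookup ?p e * \<xi> powi E b else 0)"
      by (rule sum.swap)
    also have "\<dots> = (\<Sum>e\<in>Poly_Mapping.keys ?p. Poly_Mapping.lookup ?p e * \<xi> powi (E a + e))"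
    proof (rule sum.cong[OF refl])
      fix e
      have "(l, (E a + e) mod int m) \<in> {..<dim_col B} \<times> {0..<int m}" using l m by simp
      then obtain b0 where b0: "b0 < S" "W b0 = l" "E b0 = (E a + e) mod int m"
        unfolding bij_betw_imp_surj_on[OF cols, symmetric] by auto
      have dv: "int m dvd E a + e - E b0" unfolding b0(3) by (simp add: mod_eq_dvd_iff[symmetric])
      have uniq: "b = b0" if b: "b < S" "W b = l" "int m dvd E a + e - E b" for b
      proof -
        have "E b \<in> {0..<int m}" using bij_betw_apply[OF cols, of b] b(1) by auto
        moreover have "(E a + e) mod int m = E b mod int m" using b(3) by (simp add: mod_eq_dvd_iff)
        ultimately have "E b = E b0" by (simp add: b0(3))
        then show ?thesis using inj_onD[OF bij_betw_imp_inj_on[OF cols], of b b0] b b0 by simp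
      qed
      have "(\<Sum>b<S. if W b = l \<and> int m dvd E a + e - E b then Poly_Mapping.lookup ?p e * \<xi> powi E b else 0)
        = (\<Sum>b<S. if b = b0 then Poly_Mapping.lookup ?p e * \<xi> powi E b0 else 0)"
      proof (rule sum.cong[OF refl])
        fix b assume "b \<in> {..<S}"
        then have "(W b = l \<and> int m dvd E a + e - E b) \<longleftrightarrow> b = b0" using uniq b0(2) dv by blast
        then show "(if W b = l \<and> int m dvd E a + e - E b then Poly_Mapping.lookup ?p e * \<xi> powi E b else 0)
          = (if b = b0 then Poly_Mapping.lookup ?p e * \<xi> powi E b0 else 0)" by simp
      qed
      also have "\<dots> = Poly_Mapping.lookup ?p e * \<xi> powi (E a + e)" using b0(1) per[OF dv] by simp
      finally show "(\<Sum>b<S. if W b = l \<and> int m dvd E a + e - E b then Poly_Mapping.lookup ?p e * \<xi> powi E b else 0)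
        = Poly_Mapping.lookup ?p e * \<xi> powi (E a + e)" .
    qed
    also have "\<dots> = \<xi> powi E a * laurent_eval ?p \<xi>"
      unfolding laurent_eval_def sum_distrib_left using \<xi>0 by (intro sum.cong refl) (simp add: power_int_add mult_ac)
    finally show ?thesis .
  qed
  have "hat S (\<lambda>b. \<Sum>a<R. M $$ (a, b) * x a) \<xi> l = (\<Sum>b<S. \<Sum>a<R. x a * (if W b = l then M $$ (a, b) * \<xi> powi E b else 0))"
    unfolding hat_def by (intro sum.cong refl) (simp add: sum_distrib_left mult_ac)
  also have "\<dots> = (\<Sum>a<R. x a * (\<Sum>b<S. if W b = l then M $$ (a, b) * \<xi> powi E b else 0))"
    unfolding sum_distrib_left by (rule sum.swap)
  also have "\<dots> = (\<Sum>a<R. x a * \<xi> powi E a * laurent_eval (B $$ (W a, l)) \<xi>)"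
    by (intro sum.cong refl) (simp add: key)
  also have "\<dots> = laurent_row B \<xi> (hat R x \<xi>) l"
    unfolding laurent_row_def by (rule sum_hat[OF Wr, symmetric])
  finally show ?thesis .
qed

end

section \<open>Smith normal form and comparison of eigenvalue counts\<close>

locale smith_form =
  fixes B :: "laurent_poly mat" and ps :: "laurent_poly list"
  assumes inv: "invariant_factors B ps"
begin

sublocale divisor_chain ps "dim_row B"
  by standard (use inv in \<open>auto simp: invariant_factors_def\<close>)

definition P :: "laurent_poly mat" where
  "P = mat (dim_row B) (dim_col B) (\<lambda>(i, j). if i = j \<and> i < length ps then ps ! i else 0)"

lemma sum_laurent_row_P:
  "(\<Sum>l<dim_col B. (cmod (laurent_row P \<xi> y l))\<^sup>2) = (\<Sum>l<dim_row B. (val (l, \<xi>))\<^sup>2 * (cmod (y l))\<^sup>2)"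
proof -
  have len: "length ps \<le> dim_row B" "length ps \<le> dim_col B" using inv by (auto simp: invariant_factors_def)
  have row: "laurent_row P \<xi> y l = (if l < length ps then y l * laurent_eval (ps ! l) \<xi> else 0)" if l: "l < dim_col B" for l
  proof -
    have "laurent_row P \<xi> y l = (\<Sum>k<dim_row B. if k = l then (if l < length ps then y l * laurent_eval (ps ! l) \<xi> else 0) else 0)"
      unfolding laurent_row_def P_def using l by (intro sum.cong) auto
    then show ?thesis using len by simp
  qed
  have "(\<Sum>l<dim_col B. (cmod (laurent_row P \<xi> y l))\<^sup>2) = (\<Sum>l<dim_col B. (val (l, \<xi>))\<^sup>2 * (cmod (y l))\<^sup>2)"
    by (intro sum.cong refl) (simp add: row val_def norm_mult power_mult_distrib mult.commute)
  also have "\<dots> = (\<Sum>l<length ps. (val (l, \<xi>))\<^sup>2 * (cmod (y l))\<^sup>2)"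
    using len by (intro sum.mono_neutral_right) (auto simp: val_def)
  also have "\<dots> = (\<Sum>l<dim_row B. (val (l, \<xi>))\<^sup>2 * (cmod (y l))\<^sup>2)"
    using len by (intro sum.mono_neutral_left) (auto simp: val_def)
  finally show ?thesis .
qed

text \<open>N is the inverse of U. With P = U B V and y = w N one has w B V = y P. As U, V and their
  inverses are Laurent matrices, they are bounded on the circle, so w and y, as well as w B and y P,
  have comparable norms, with one K for all \<xi>.\<close>

lemma ex_base_change:
  "\<exists>N K. dim_row N = dim_row B \<and> dim_col N = dim_row B \<and> 0 < K \<and> (\<forall>\<xi> w. cmod \<xi> = 1 \<longrightarrow>
     (\<Sum>l<dim_row B. (cmod (laurent_row N \<xi> w l))\<^sup>2) \<le> K * (\<Sum>k<dim_row B. (cmod (w k))\<^sup>2) \<and>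
     (\<Sum>k<dim_row B. (cmod (w k))\<^sup>2) \<le> K * (\<Sum>l<dim_row B. (cmod (laurent_row N \<xi> w l))\<^sup>2) \<and>
     (\<Sum>l<dim_row B. (val (l, \<xi>))\<^sup>2 * (cmod (laurent_row N \<xi> w l))\<^sup>2) \<le> K * (\<Sum>l<dim_col B. (cmod (laurent_row B \<xi> w l))\<^sup>2) \<and>
     (\<Sum>l<dim_col B. (cmod (laurent_row B \<xi> w l))\<^sup>2) \<le> K * (\<Sum>l<dim_row B. (val (l, \<xi>))\<^sup>2 * (cmod (laurent_row N \<xi> w l))\<^sup>2))"
proof -
  let ?r = "dim_row B" and ?s = "dim_col B"
  obtain U V where U: "U \<in> carrier_mat ?r ?r" "invertible_mat U" and V: "V \<in> carrier_mat ?s ?s" "invertible_mat V"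
    and UBV: "U * B * V = P" using inv unfolding invariant_factors_def P_def by auto
  have ex: "\<exists>N'. N' \<in> carrier_mat k k \<and> N' * N = 1\<^sub>m k \<and> N * N' = 1\<^sub>m k"
    if N: "N \<in> carrier_mat k k" "invertible_mat N" for N :: "laurent_poly mat" and k
  proof -
    obtain N' where "inverts_mat N N'" "inverts_mat N' N" using N(2) unfolding invertible_mat_def by blast
    then have eq: "N * N' = 1\<^sub>m k" "N' * N = 1\<^sub>m (dim_row N')" using N(1) by (auto simp: inverts_mat_def)
    have "dim_col N' = k" using eq(1) by (metis index_mult_mat(3) index_one_mat(3))
    moreover have "dim_row N' = k" using eq(2) N(1) by (metis carrier_matD(2) index_mult_mat(3) index_one_mat(3))
    ultimately show ?thesis using eq by auto
  qed
  obtain U' where U': "U' \<in> carrier_mat ?r ?r" "U' * U = 1\<^sub>m ?r" using ex[OF U] by blast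
  obtain V' where V': "V' \<in> carrier_mat ?s ?s" "V * V' = 1\<^sub>m ?s" using ex[OF V] by blast
  have dims: "dim_row U = ?r" "dim_col U = ?r" "dim_row U' = ?r" "dim_col U' = ?r"
    "dim_row V = ?s" "dim_col V = ?s" "dim_row V' = ?s" "dim_col V' = ?s" using U V U' V' by auto
  obtain K1 where K1: "K1 \<ge> 0" "\<And>\<xi> w. cmod \<xi> = 1 \<Longrightarrow> (\<Sum>l<?r. (cmod (laurent_row U' \<xi> w l))\<^sup>2) \<le> K1 * (\<Sum>k<?r. (cmod (w k))\<^sup>2)"
    using laurent_row_bounded[of U'] unfolding dims by blast
  obtain K2 where K2: "K2 \<ge> 0" "\<And>\<xi> w. cmod \<xi> = 1 \<Longrightarrow> (\<Sum>l<?r. (cmod (laurent_row U \<xi> w l))\<^sup>2) \<le> K2 * (\<Sum>k<?r. (cmod (w k))\<^sup>2)"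
    using laurent_row_bounded[of U] unfolding dims by blast
  obtain K3 where K3: "K3 \<ge> 0" "\<And>\<xi> w. cmod \<xi> = 1 \<Longrightarrow> (\<Sum>l<?s. (cmod (laurent_row V \<xi> w l))\<^sup>2) \<le> K3 * (\<Sum>k<?s. (cmod (w k))\<^sup>2)"
    using laurent_row_bounded[of V] unfolding dims by blast
  obtain K4 where K4: "K4 \<ge> 0" "\<And>\<xi> w. cmod \<xi> = 1 \<Longrightarrow> (\<Sum>l<?s. (cmod (laurent_row V' \<xi> w l))\<^sup>2) \<le> K4 * (\<Sum>k<?s. (cmod (w k))\<^sup>2)"
    using laurent_row_bounded[of V'] unfolding dims by blast
  define K where "K = 1 + K1 + K2 + K3 + K4"
  have Kle: "0 < K" "K1 \<le> K" "K2 \<le> K" "K3 \<le> K" "K4 \<le> K" using K1(1) K2(1) K3(1) K4(1) by (auto simp: K_def)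
  have up: "k * a \<le> K * a" if "k \<le> K" "0 \<le> a" for k a using that by (intro mult_right_mono)
  have main: "(\<Sum>l<?r. (cmod (laurent_row U' \<xi> w l))\<^sup>2) \<le> K * (\<Sum>k<?r. (cmod (w k))\<^sup>2) \<and>
     (\<Sum>k<?r. (cmod (w k))\<^sup>2) \<le> K * (\<Sum>l<?r. (cmod (laurent_row U' \<xi> w l))\<^sup>2) \<and>
     (\<Sum>l<?r. (val (l, \<xi>))\<^sup>2 * (cmod (laurent_row U' \<xi> w l))\<^sup>2) \<le> K * (\<Sum>l<?s. (cmod (laurent_row B \<xi> w l))\<^sup>2) \<and>
     (\<Sum>l<?s. (cmod (laurent_row B \<xi> w l))\<^sup>2) \<le> K * (\<Sum>l<?r. (val (l, \<xi>))\<^sup>2 * (cmod (laurent_row U' \<xi> w l))\<^sup>2)"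
    if \<xi>: "cmod \<xi> = 1" for \<xi> w
  proof -
    have \<xi>0: "\<xi> \<noteq> 0" using \<xi> by auto
    define y where "y = laurent_row U' \<xi> w"
    have Uy: "laurent_row U \<xi> y k = w k" if k: "k < ?r" for k
      unfolding y_def using laurent_row_mult[of U' U k \<xi> w] k by (simp add: dims \<xi>0 U'(2) laurent_row_one)
    have row_B: "laurent_row B \<xi> (laurent_row U \<xi> y) l = laurent_row B \<xi> w l" for l
      by (rule laurent_row_cong) (simp add: Uy)
    have Py: "laurent_row P \<xi> y l = laurent_row V \<xi> (laurent_row B \<xi> w) l" if l: "l < ?s" for l
    proof -
      have "laurent_row P \<xi> y l = laurent_row V \<xi> (laurent_row (U * B) \<xi> y) l"
        unfolding UBV[symmetric] using l by (intro laurent_row_mult) (simp_all add: dims \<xi>0)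
      also have "\<dots> = laurent_row V \<xi> (laurent_row B \<xi> w) l"
        by (rule laurent_row_cong) (simp add: dims laurent_row_mult \<xi>0 row_B)
      finally show ?thesis .
    qed
    have Bw: "laurent_row B \<xi> w l = laurent_row V' \<xi> (laurent_row P \<xi> y) l" if l: "l < ?s" for l
    proof -
      have "laurent_row V' \<xi> (laurent_row P \<xi> y) l = laurent_row V' \<xi> (laurent_row V \<xi> (laurent_row B \<xi> w)) l"
        by (rule laurent_row_cong) (simp add: dims Py)
      also have "\<dots> = laurent_row (V * V') \<xi> (laurent_row B \<xi> w) l"
        using l by (intro laurent_row_mult[symmetric]) (simp_all add: dims \<xi>0)
      also have "\<dots> = laurent_row B \<xi> w l" using l by (simp add: V'(2) laurent_row_one)
      finally show ?thesis ..
    qed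
    have 1: "(\<Sum>l<?r. (cmod (y l))\<^sup>2) \<le> K * (\<Sum>k<?r. (cmod (w k))\<^sup>2)"
      unfolding y_def by (rule order_trans[OF K1(2)[OF \<xi>] up[OF Kle(2)]]) (simp add: sum_nonneg)
    have "(\<Sum>k<?r. (cmod (w k))\<^sup>2) = (\<Sum>k<?r. (cmod (laurent_row U \<xi> y k))\<^sup>2)" by (simp add: Uy)
    also have "\<dots> \<le> K * (\<Sum>l<?r. (cmod (y l))\<^sup>2)"
      by (rule order_trans[OF K2(2)[OF \<xi>] up[OF Kle(3)]]) (simp add: sum_nonneg)
    finally have 2: "(\<Sum>k<?r. (cmod (w k))\<^sup>2) \<le> K * (\<Sum>l<?r. (cmod (y l))\<^sup>2)" .
    have "(\<Sum>l<?s. (cmod (laurent_row P \<xi> y l))\<^sup>2) = (\<Sum>l<?s. (cmod (laurent_row V \<xi> (laurent_row B \<xi> w) l))\<^sup>2)"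
      by (simp add: Py)
    also have "\<dots> \<le> K * (\<Sum>l<?s. (cmod (laurent_row B \<xi> w l))\<^sup>2)"
      by (rule order_trans[OF K3(2)[OF \<xi>] up[OF Kle(4)]]) (simp add: sum_nonneg)
    finally have 3: "(\<Sum>l<?r. (val (l, \<xi>))\<^sup>2 * (cmod (y l))\<^sup>2) \<le> K * (\<Sum>l<?s. (cmod (laurent_row B \<xi> w l))\<^sup>2)"
      by (simp only: sum_laurent_row_P)
    have "(\<Sum>l<?s. (cmod (laurent_row B \<xi> w l))\<^sup>2) = (\<Sum>l<?s. (cmod (laurent_row V' \<xi> (laurent_row P \<xi> y) l))\<^sup>2)"
      by (intro sum.cong refl) (simp add: Bw[symmetric])
    also have "\<dots> \<le> K * (\<Sum>l<?s. (cmod (laurent_row P \<xi> y l))\<^sup>2)"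
      by (rule order_trans[OF K4(2)[OF \<xi>] up[OF Kle(5)]]) (simp add: sum_nonneg)
    finally have 4: "(\<Sum>l<?s. (cmod (laurent_row B \<xi> w l))\<^sup>2) \<le> K * (\<Sum>l<?r. (val (l, \<xi>))\<^sup>2 * (cmod (y l))\<^sup>2)"
      by (simp only: sum_laurent_row_P)
    show ?thesis using 1 2 3 4 by (simp add: y_def)
  qed
  show ?thesis
    by (rule exI[of _ U'], rule exI[of _ K], intro conjI allI impI dims Kle(1))
      (use main in blast)+
qed

text \<open>The functional \<psi> for a pair (l, \<xi>) is the l-th coordinate of the Fourier
  transform of x at \<xi> times the base change N(\<xi>). Up to the factor K these functionals
  diagonalize the form of M, with squared values in place of eigenvalues, and
  \<open>count_eigenvalues_le\<close> applies in both directions.\<close>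

theorem count_comparison:
  "\<exists>K\<ge>1. \<forall>m R S W E M \<phi> d t. circulant_blocks m R S W E B M \<longrightarrow>
    (\<forall>x. (\<Sum>a<R. (cmod (\<Sum>i<R. \<phi> a i * x i))\<^sup>2) = (\<Sum>i<R. (cmod (x i))\<^sup>2)) \<longrightarrow>
    (\<forall>x. (\<Sum>a<R. d a * (cmod (\<Sum>i<R. \<phi> a i * x i))\<^sup>2) = (\<Sum>b<S. (cmod (\<Sum>i<R. M $$ (i, b) * x i))\<^sup>2)) \<longrightarrow> 0 \<le> t \<longrightarrow>
    card {a \<in> {..<R}. d a \<le> t} \<le> card {b \<in> J m. (val b)\<^sup>2 \<le> K * t} \<and>
    card {b \<in> J m. (val b)\<^sup>2 \<le> t} \<le> card {a \<in> {..<R}. d a \<le> K * t}"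
proof -
  let ?r = "dim_row B" and ?s = "dim_col B"
  obtain N K where N: "dim_row N = ?r" "dim_col N = ?r" and K: "0 < K"
    and bounds: "\<And>\<xi> w. cmod \<xi> = 1 \<Longrightarrow> (\<Sum>l<?r. (cmod (laurent_row N \<xi> w l))\<^sup>2) \<le> K * (\<Sum>k<?r. (cmod (w k))\<^sup>2)"
      "\<And>\<xi> w. cmod \<xi> = 1 \<Longrightarrow> (\<Sum>k<?r. (cmod (w k))\<^sup>2) \<le> K * (\<Sum>l<?r. (cmod (laurent_row N \<xi> w l))\<^sup>2)"
      "\<And>\<xi> w. cmod \<xi> = 1 \<Longrightarrow> (\<Sum>l<?r. (val (l, \<xi>))\<^sup>2 * (cmod (laurent_row N \<xi> w l))\<^sup>2) \<le> K * (\<Sum>l<?s. (cmod (laurent_row B \<xi> w l))\<^sup>2)"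
      "\<And>\<xi> w. cmod \<xi> = 1 \<Longrightarrow> (\<Sum>l<?s. (cmod (laurent_row B \<xi> w l))\<^sup>2) \<le> K * (\<Sum>l<?r. (val (l, \<xi>))\<^sup>2 * (cmod (laurent_row N \<xi> w l))\<^sup>2)"
    using ex_base_change by blast
  have main: "card {a \<in> {..<R}. d a \<le> t} \<le> card {b \<in> J m. (val b)\<^sup>2 \<le> K * K * t} \<and>
    card {b \<in> J m. (val b)\<^sup>2 \<le> t} \<le> card {a \<in> {..<R}. d a \<le> K * K * t}"
    if circ: "circulant_blocks m R S W E B M"
      and orth: "\<And>x. (\<Sum>a<R. (cmod (\<Sum>i<R. \<phi> a i * x i))\<^sup>2) = (\<Sum>i<R. (cmod (x i))\<^sup>2)"
      and form: "\<And>x. (\<Sum>a<R. d a * (cmod (\<Sum>i<R. \<phi> a i * x i))\<^sup>2) = (\<Sum>b<S. (cmod (\<Sum>i<R. M $$ (i, b) * x i))\<^sup>2)"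
      and t: "0 \<le> t" for m R S W E M \<phi> d t
  proof -
    interpret circulant_blocks m R S W E B M by (rule circ)
    define \<psi> where "\<psi> = (\<lambda>b a. snd b powi E a * laurent_eval (N $$ (W a, fst b)) (snd b))"
    let ?\<psi> = "\<lambda>x b. cmod (\<Sum>i<R. \<psi> b i * x i)"
    have Wr: "W ` {..<R} \<subseteq> {..<?r}" using bij_betw_imp_surj_on[OF rows] by auto
    have \<psi>: "(\<Sum>i<R. \<psi> (l, \<xi>) i * x i) = laurent_row N \<xi> (hat R x \<xi>) l" for l \<xi> x
      unfolding laurent_row_def N sum_hat[OF Wr] \<psi>_def by (intro sum.cong refl) (simp add: mult_ac)
    have sum_J: "(\<Sum>b\<in>J m. f b) = (\<Sum>\<xi> | \<xi> ^ m = 1. \<Sum>l<?r. f (l, \<xi>))" for f :: "nat \<times> complex \<Rightarrow> real"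
      unfolding J_def by (subst sum.swap) (simp add: sum.cartesian_product)
    have norm1: "cmod \<xi> = 1" if "\<xi> \<in> {\<xi>. \<xi> ^ m = 1}" for \<xi> using norm_root[OF m] that by simp
    have R: "card (J m) = R" using bij_betw_same_card[OF rows] card_J[OF m] by (simp add: card_cartesian_product)
    have m0: "0 < real m" using m by simp
    let ?X = "\<lambda>x. \<Sum>i<R. (cmod (x i))\<^sup>2" and ?Y = "\<lambda>x. \<Sum>b<S. (cmod (\<Sum>i<R. M $$ (i, b) * x i))\<^sup>2"
    have pR: "real m * ?X x = (\<Sum>\<xi> | \<xi> ^ m = 1. \<Sum>k<?r. (cmod (hat R x \<xi> k))\<^sup>2)" for x
      by (rule parseval_hat[OF rows, symmetric])
    have pS: "real m * ?Y x = (\<Sum>\<xi> | \<xi> ^ m = 1. \<Sum>l<?s. (cmod (laurent_row B \<xi> (hat R x \<xi>) l))\<^sup>2)" for x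
      unfolding parseval_hat[OF cols, symmetric] by (intro sum.cong refl) (simp add: hat_mult)
    have A1: "(\<Sum>b\<in>J m. (?\<psi> x b)\<^sup>2) \<le> K * (real m * ?X x)" for x
      unfolding pR sum_J \<psi> by (subst sum_distrib_left) (rule sum_mono[OF bounds(1)[OF norm1]])
    have A2: "real m * ?X x \<le> K * (\<Sum>b\<in>J m. (?\<psi> x b)\<^sup>2)" for x
      unfolding pR sum_J \<psi> by (subst sum_distrib_left) (rule sum_mono[OF bounds(2)[OF norm1]])
    have A3: "(\<Sum>b\<in>J m. (val b)\<^sup>2 * (?\<psi> x b)\<^sup>2) \<le> K * (real m * ?Y x)" for x
      unfolding pS sum_J \<psi> by (subst sum_distrib_left) (rule sum_mono[OF bounds(3)[OF norm1]])
    have A4: "real m * ?Y x \<le> K * (\<Sum>b\<in>J m. (val b)\<^sup>2 * (?\<psi> x b)\<^sup>2)" for x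
      unfolding pS sum_J \<psi> by (subst sum_distrib_left) (rule sum_mono[OF bounds(4)[OF norm1]])
    have X0: "x i = 0" if "?X x \<le> 0" "i < R" for x i
    proof -
      have "?X x = 0" using that(1) sum_nonneg[of "{..<R}" "\<lambda>i. (cmod (x i))\<^sup>2"] by simp
      then show ?thesis using that(2) by (simp add: sum_nonneg_eq_0_iff)
    qed
    \<comment> \<open>Parseval puts a factor m into one hypothesis and 1 / m into the other; they
      cancel in the product of the two constants, so the result is uniform in m.\<close>
    have "card {a \<in> {..<R}. d a \<le> t} \<le> card {b \<in> J m. (val b)\<^sup>2 \<le> (K / real m) * (K * real m) * t}"
    proof (rule count_eigenvalues_le[where n = R])
      show "(\<Sum>a\<in>{..<R}. (cmod (\<Sum>i<R. \<phi> a i * x i))\<^sup>2) \<le> K / real m * (\<Sum>b\<in>J m. (?\<psi> x b)\<^sup>2)" for x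
        unfolding orth using A2[of x] m0 by (simp add: field_simps)
      show "x i = 0" if "\<And>b. b \<in> J m \<Longrightarrow> (\<Sum>i<R. \<psi> b i * x i) = 0" "i < R" for x i
      proof (rule X0[OF _ that(2)])
        have "real m * ?X x \<le> 0" using A2[of x] that(1) by simp
        then show "?X x \<le> 0" using m0 by (simp add: mult_le_0_iff)
      qed
      show "(\<Sum>b\<in>J m. (val b)\<^sup>2 * (?\<psi> x b)\<^sup>2) \<le> K * real m * (\<Sum>a\<in>{..<R}. d a * (cmod (\<Sum>i<R. \<phi> a i * x i))\<^sup>2)" for x
        unfolding form using A3[of x] by (simp add: mult_ac)
    qed (use finite_J[OF m] R K m0 t in auto)
    moreover have "card {b \<in> J m. (val b)\<^sup>2 \<le> t} \<le> card {a \<in> {..<R}. d a \<le> (K * real m) * (K / real m) * t}"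
    proof (rule count_eigenvalues_le[where n = R])
      show "(\<Sum>b\<in>J m. (?\<psi> x b)\<^sup>2) \<le> K * real m * (\<Sum>a\<in>{..<R}. (cmod (\<Sum>i<R. \<phi> a i * x i))\<^sup>2)" for x
        unfolding orth using A1[of x] by (simp add: mult_ac)
      show "x i = 0" if "\<And>a. a \<in> {..<R} \<Longrightarrow> (\<Sum>i<R. \<phi> a i * x i) = 0" "i < R" for x i
        by (rule X0[OF _ that(2)]) (use orth[of x] that(1) in simp)
      show "(\<Sum>a\<in>{..<R}. d a * (cmod (\<Sum>i<R. \<phi> a i * x i))\<^sup>2) \<le> K / real m * (\<Sum>b\<in>J m. (val b)\<^sup>2 * (?\<psi> x b)\<^sup>2)" for x
        unfolding form using A4[of x] m0 by (simp add: field_simps)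
    qed (use finite_J[OF m] R K m0 t in auto)
    moreover have "(K / real m) * (K * real m) = K * K" "(K * real m) * (K / real m) = K * K" using m0 by auto
    ultimately show ?thesis by (simp only:)
  qed
  have mono: "card {b \<in> J m. (val b)\<^sup>2 \<le> K * K * t} \<le> card {b \<in> J m. (val b)\<^sup>2 \<le> max 1 (K * K) * t}"
    "card {a \<in> {..<R}. d a \<le> K * K * t} \<le> card {a \<in> {..<R}. d a \<le> max 1 (K * K) * t}"
    if "0 \<le> t" "0 < m" for m R t and d :: "nat \<Rightarrow> real"
  proof -
    have le: "K * K * t \<le> max 1 (K * K) * t" using that(1) by (intro mult_right_mono) auto
    show "card {b \<in> J m. (val b)\<^sup>2 \<le> K * K * t} \<le> card {b \<in> J m. (val b)\<^sup>2 \<le> max 1 (K * K) * t}"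
      using le finite_J[OF that(2)] by (intro card_mono) auto
    show "card {a \<in> {..<R}. d a \<le> K * K * t} \<le> card {a \<in> {..<R}. d a \<le> max 1 (K * K) * t}"
      using le by (intro card_mono) auto
  qed
  show ?thesis
  proof (rule exI[of _ "max 1 (K * K)"], intro conjI allI impI)
    fix m R S W E M and \<phi> :: "nat \<Rightarrow> nat \<Rightarrow> complex" and d t
    assume c: "circulant_blocks m R S W E B M"
      and o: "\<forall>x. (\<Sum>a<R. (cmod (\<Sum>i<R. \<phi> a i * x i))\<^sup>2) = (\<Sum>i<R. (cmod (x i))\<^sup>2)"
      and f: "\<forall>x. (\<Sum>a<R. d a * (cmod (\<Sum>i<R. \<phi> a i * x i))\<^sup>2) = (\<Sum>b<S. (cmod (\<Sum>i<R. M $$ (i, b) * x i))\<^sup>2)"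
      and t: "0 \<le> (t::real)"
    note * = main[OF c o[rule_format] f[rule_format] t]
    have m: "0 < m" by (rule circulant_blocks.m[OF c])
    show "card {a \<in> {..<R}. d a \<le> t} \<le> card {b \<in> J m. (val b)\<^sup>2 \<le> max 1 (K * K) * t}"
      using * mono(1)[OF t m] by linarith
    show "card {b \<in> J m. (val b)\<^sup>2 \<le> t} \<le> card {a \<in> {..<R}. d a \<le> max 1 (K * K) * t}"
      using * mono(2)[OF t m, of R d] by linarith
  qed simp
qed

end

section \<open>Quotients by the subgroups of Z as block circulant matrices\<close>

context cyclic_restriction
begin

definition zcoord :: "nat \<Rightarrow> nat \<Rightarrow> int \<times> nat" where
  "zcoord m v = inv_into ({0..<int m} \<times> {..<n}) (pt m) (enum_list (G Mod zsub m) ! v)"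

text \<open>The row of \<open>res_mat\<close> to which a row of the regular matrix belongs: the
  block number is kept and the coset is replaced by its index in the transversal.\<close>

definition zrow :: "nat \<Rightarrow> nat \<Rightarrow> nat" where
  "zrow m a = (a div (n * m)) * n + snd (zcoord m (a mod (n * m)))"

definition zpos :: "nat \<Rightarrow> nat \<Rightarrow> int" where
  "zpos m a = fst (zcoord m (a mod (n * m)))"

lemma zcoord:
  assumes m: "0 < m" and v: "v < n * m"
  shows "fst (zcoord m v) \<in> {0..<int m}" "snd (zcoord m v) < n"
    "enum_list (G Mod zsub m) ! v = zsub m #> (z [^] fst (zcoord m v) \<otimes> gs ! snd (zcoord m v))"
proof -
  interpret fq: finite_quotient "zsub m" G by (rule finite_quotient_zsub[OF m])
  have "enum_list (G Mod zsub m) ! v \<in> rcosets (zsub m)"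
    using fq.qs_nth[of v] v card_rcosets_zsub[OF m] by (simp add: fq.carrier_Q)
  then have q: "enum_list (G Mod zsub m) ! v \<in> pt m ` ({0..<int m} \<times> {..<n})"
    by (simp add: bij_betw_imp_surj_on[OF bij_pt[OF m]])
  have "zcoord m v \<in> {0..<int m} \<times> {..<n}" unfolding zcoord_def by (rule inv_into_into[OF q])
  then show "fst (zcoord m v) \<in> {0..<int m}" "snd (zcoord m v) < n" by (simp_all only: mem_Times_iff lessThan_iff)
  have "pt m (zcoord m v) = enum_list (G Mod zsub m) ! v" unfolding zcoord_def by (rule f_inv_into_f[OF q])
  then show "enum_list (G Mod zsub m) ! v = zsub m #> (z [^] fst (zcoord m v) \<otimes> gs ! snd (zcoord m v))"
    by (simp add: pt_def case_prod_beta)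
qed

lemma zcoord_inj:
  assumes m: "0 < m" and "v < n * m" "w < n * m" "zcoord m v = zcoord m w"
  shows "v = w"
proof -
  interpret fq: finite_quotient "zsub m" G by (rule finite_quotient_zsub[OF m])
  have "enum_list (G Mod zsub m) ! v = enum_list (G Mod zsub m) ! w"
    using zcoord(3)[OF m] assms by simp
  then show ?thesis using fq.qs_eq_iff[of v w] assms card_rcosets_zsub[OF m] by simp
qed

lemma zrow:
  assumes m: "0 < m" and a: "a < T * (n * m)"
  shows "zrow m a < T * n" "zrow m a div n = a div (n * m)" "zrow m a mod n = snd (zcoord m (a mod (n * m)))"
    "a mod (n * m) < n * m" "a div (n * m) < T"
proof -
  have nm: "0 < n * m" using n_pos m by simp
  show v: "a mod (n * m) < n * m" using nm by simp
  show i: "a div (n * m) < T" using a by (rule less_mult_imp_div_less)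
  note u = zcoord(2)[OF m v]
  have aux: "(q * k + w) div k = q \<and> (q * k + w) mod k = w" if "w < k" for q k w :: nat using that by simp
  show "zrow m a div n = a div (n * m)" "zrow m a mod n = snd (zcoord m (a mod (n * m)))"
    unfolding zrow_def using aux[OF u] by blast+
  have "zrow m a < (a div (n * m) + 1) * n" using u by (simp add: zrow_def)
  also have "\<dots> \<le> T * n" using i by (intro mult_right_mono) auto
  finally show "zrow m a < T * n" .
qed

lemma bij_zrow:
  assumes m: "0 < m"
  shows "bij_betw (\<lambda>a. (zrow m a, zpos m a)) {..<T * (n * m)} ({..<T * n} \<times> {0..<int m})"
  unfolding bij_betw_def
proof
  show inj: "inj_on (\<lambda>a. (zrow m a, zpos m a)) {..<T * (n * m)}"
  proof (rule inj_onI)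
    fix a b assume ab: "a \<in> {..<T * (n * m)}" "b \<in> {..<T * (n * m)}" "(zrow m a, zpos m a) = (zrow m b, zpos m b)"
    then have a: "a < T * (n * m)" and b: "b < T * (n * m)" and eq: "zrow m a = zrow m b" "zpos m a = zpos m b" by auto
    note za = zrow[OF m a] and zb = zrow[OF m b]
    have "zcoord m (a mod (n * m)) = zcoord m (b mod (n * m))"
      using eq za(3) zb(3) by (auto simp: zpos_def prod_eq_iff)
    then have "a mod (n * m) = b mod (n * m)" using zcoord_inj[OF m za(4) zb(4)] by simp
    moreover have "a div (n * m) = b div (n * m)" using eq za(2) zb(2) by simp
    ultimately show "a = b" by (metis div_mult_mod_eq)
  qed
  show "(\<lambda>a. (zrow m a, zpos m a)) ` {..<T * (n * m)} = {..<T * n} \<times> {0..<int m}"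
  proof (rule card_subset_eq)
    show "(\<lambda>a. (zrow m a, zpos m a)) ` {..<T * (n * m)} \<subseteq> {..<T * n} \<times> {0..<int m}"
    proof (rule image_subsetI)
      fix a assume "a \<in> {..<T * (n * m)}"
      then have a: "a < T * (n * m)" by simp
      show "(zrow m a, zpos m a) \<in> {..<T * n} \<times> {0..<int m}"
        using zrow(1)[OF m a] zcoord(1)[OF m zrow(4)[OF m a]] unfolding zpos_def by blast
    qed
    show "card ((\<lambda>a. (zrow m a, zpos m a)) ` {..<T * (n * m)}) = card ({..<T * n} \<times> {0..<int m})"
      by (simp add: card_image[OF inj] card_cartesian_product)
  qed simp
qed

lemma lookup_restriction:
  assumes fin: "finite {g. f g \<noteq> 0}" and g: "g \<in> carrier G" "h \<in> carrier G"
  shows "Poly_Mapping.lookup (Abs_poly_mapping (\<lambda>e::int. f (g \<otimes> z [^] e \<otimes> h))) = (\<lambda>e. f (g \<otimes> z [^] e \<otimes> h) :: complex)"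
proof -
  have "inj (\<lambda>e::int. g \<otimes> z [^] e \<otimes> h)" using g by (auto simp: inj_def zpow_inj)
  then have "finite {e. f (g \<otimes> z [^] (e::int) \<otimes> h) \<noteq> 0}"
    using finite_vimageI[OF fin, of "\<lambda>e::int. g \<otimes> z [^] e \<otimes> h"] by (simp add: vimage_def)
  then show ?thesis by (rule lookup_Abs_poly_mapping)
qed

text \<open>Let row a and column b of the matrix have transversal indices u and v. A group element g
  contributes only if (gs ! u) g lies in Z (gs ! v), that is, g = inv (gs ! u) z ^ e (gs ! v) for
  some e, and these are the elements whose coefficients \<open>res_mat\<close> collects. The coset
  condition then becomes a congruence of exponents modulo m.\<close>

lemma circulant_zsub:
  assumes A: "gr_entries G r s A" and m: "0 < m"
  shows "circulant_blocks m (r * (n * m)) (s * (n * m)) (zrow m) (zpos m) (res_mat G z gs r s A)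
    (regular_mat (G Mod zsub m) r s (gr_mat_proj G (zsub m) A))"
proof
  interpret fq: finite_quotient "zsub m" G by (rule finite_quotient_zsub[OF m])
  note cc = card_rcosets_zsub[OF m]
  have dim: "dim_row (res_mat G z gs r s A) = r * n" "dim_col (res_mat G z gs r s A) = s * n"
    by (simp_all add: res_mat_def block_mat_def)
  show "0 < m" by (rule m)
  show "bij_betw (\<lambda>a. (zrow m a, zpos m a)) {..<r * (n * m)} ({..<dim_row (res_mat G z gs r s A)} \<times> {0..<int m})"
    "bij_betw (\<lambda>a. (zrow m a, zpos m a)) {..<s * (n * m)} ({..<dim_col (res_mat G z gs r s A)} \<times> {0..<int m})"
    unfolding dim by (rule bij_zrow[OF m])+
  fix a b assume a: "a < r * (n * m)" and b: "b < s * (n * m)"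
  define i j where ij: "i = a div (n * m)" "j = b div (n * m)"
  define u v where uv: "u = snd (zcoord m (a mod (n * m)))" "v = snd (zcoord m (b mod (n * m)))"
  have lt: "i < r" "j < s" "u < n" "v < n"
    using zrow(4,5)[OF m a] zrow(4,5)[OF m b] zcoord(2)[OF m] by (simp_all add: ij uv)
  define f where "f = A i j"
  have fin: "finite {g. f g \<noteq> 0}" and mem: "f g \<noteq> 0 \<Longrightarrow> g \<in> carrier G" for g
    using gr_entriesD(1)[OF A lt(1,2)] gr_entriesD(2)[OF A lt(1,2)] by (auto simp: f_def)
  have gu: "gs ! u \<in> carrier G" "gs ! v \<in> carrier G" using gs_closed lt by auto
  define h where "h = (\<lambda>e::int. inv (gs ! u) \<otimes> z [^] e \<otimes> gs ! v)"
  define p where "p = res_mat G z gs r s A $$ (zrow m a, zrow m b)"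
  have "p = Abs_poly_mapping (\<lambda>e. f (h e))"
    using zrow[OF m a] zrow[OF m b] by (simp add: p_def res_mat_def block_mat_def h_def f_def ij uv)
  then have look: "Poly_Mapping.lookup p = (\<lambda>e. f (h e))"
    using lookup_restriction[OF fin inv_closed[OF gu(1)] gu(2)] by (simp add: h_def)
  have keys: "Poly_Mapping.keys p = {e. f (h e) \<noteq> 0}" by (auto simp: in_keys_iff look)
  have inj: "inj_on h K" for K using gu by (auto simp: inj_on_def h_def zpow_inj)
  have gh: "gs ! u \<otimes> h e = z [^] e \<otimes> gs ! v" for e using gu by (simp add: h_def m_assoc[symmetric])
  let ?cond = "\<lambda>g. zsub m #> (z [^] zpos m a \<otimes> (gs ! u \<otimes> g)) = zsub m #> (z [^] zpos m b \<otimes> gs ! v)"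
  have qa: "enum_list (G Mod zsub m) ! (a mod (n * m)) = zsub m #> (z [^] zpos m a \<otimes> gs ! u)"
    "enum_list (G Mod zsub m) ! (b mod (n * m)) = zsub m #> (z [^] zpos m b \<otimes> gs ! v)"
    using zcoord(3)[OF m zrow(4)[OF m a]] zcoord(3)[OF m zrow(4)[OF m b]] by (simp_all add: zpos_def uv)
  have "regular_mat (G Mod zsub m) r s (gr_mat_proj G (zsub m) A) $$ (a, b)
    = (\<Sum>g | f g \<noteq> 0. if (zsub m #> (z [^] zpos m a \<otimes> gs ! u)) \<otimes>\<^bsub>G Mod zsub m\<^esub> (zsub m #> g) = zsub m #> (z [^] zpos m b \<otimes> gs ! v) then f g else 0)"
    using fq.qreg_index[OF A, of a b] a b unfolding cc fq.qreg_def qa ij[symmetric] f_def[symmetric] by simp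
  also have "\<dots> = (\<Sum>g | f g \<noteq> 0. if ?cond g then f g else 0)"
    by (rule sum.cong[OF refl]) (simp add: fq.coset_mult mem gu m_assoc)
  also have "\<dots> = (\<Sum>g\<in>h ` Poly_Mapping.keys p. if ?cond g then f g else 0)"
  proof (rule sum.mono_neutral_right[OF fin])
    show "h ` Poly_Mapping.keys p \<subseteq> {g. f g \<noteq> 0}" by (auto simp: keys)
    show "\<forall>g\<in>{g. f g \<noteq> 0} - h ` Poly_Mapping.keys p. (if ?cond g then f g else 0) = 0"
    proof
      fix g assume g: "g \<in> {g. f g \<noteq> 0} - h ` Poly_Mapping.keys p"
      then have gc: "g \<in> carrier G" and fg: "f g \<noteq> 0" using mem by auto
      \<comment> \<open>If (gs ! u) g lies in the class of gs ! w, the coset condition forces w = v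
        and so g = h e, contradicting the choice of g.\<close>
      obtain e w where ew: "w < n" "gs ! u \<otimes> g = z [^] (e::int) \<otimes> gs ! w"
        using ex_decomposition[OF m_closed[OF gu(1) gc]] by blast
      have "\<not> ?cond g"
      proof
        assume "?cond g"
        then have "zsub m #> (z [^] (zpos m a + e) \<otimes> gs ! w) = zsub m #> (z [^] zpos m b \<otimes> gs ! v)"
          using gs_closed[OF ew(1)] by (simp add: ew(2) zpow_add m_assoc)
        then have "w = v" using zsub_coset_eq_iff[OF ew(1) lt(4)] by blast
        then have "gs ! u \<otimes> g = gs ! u \<otimes> h e" by (simp add: ew(2) gh)
        moreover have "h e \<in> carrier G" using gu by (simp add: h_def)
        ultimately have "g = h e" using gc gu by simp
        then show False using g fg by (auto simp: keys)
      qed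
      then show "(if ?cond g then f g else 0) = 0" by simp
    qed
  qed
  also have "\<dots> = (\<Sum>e\<in>Poly_Mapping.keys p. if ?cond (h e) then f (h e) else 0)"
    unfolding sum.reindex[OF inj] by simp
  also have "\<dots> = (\<Sum>e\<in>Poly_Mapping.keys p. if int m dvd zpos m a + e - zpos m b then Poly_Mapping.lookup p e else 0)"
  proof (rule sum.cong[OF refl])
    fix e
    have "?cond (h e) \<longleftrightarrow> int m dvd zpos m a + e - zpos m b"
      using zsub_coset_eq_iff[OF lt(4,4), of m "zpos m a + e" "zpos m b"] gu by (simp add: gh zpow_add m_assoc)
    then show "(if ?cond (h e) then f (h e) else 0) = (if int m dvd zpos m a + e - zpos m b then Poly_Mapping.lookup p e else 0)"
      by (simp add: look)
  qed
  finally show "regular_mat (G Mod zsub m) r s (gr_mat_proj G (zsub m) A) $$ (a, b)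
    = (\<Sum>e\<in>Poly_Mapping.keys (res_mat G z gs r s A $$ (zrow m a, zrow m b)).
        if int m dvd zpos m a + e - zpos m b then Poly_Mapping.lookup (res_mat G z gs r s A $$ (zrow m a, zrow m b)) e else 0)"
    unfolding p_def .
qed

end

section \<open>Asymptotics of spectral distribution functions\<close>

text \<open>Errors C / m, which come from bounded numbers of eigenvalues, vanish in the
  limit.\<close>

lemma le_limit_of_eventually:
  fixes x L C :: real
  assumes "\<And>e. 0 < e \<Longrightarrow> \<forall>\<^sub>F m in sequentially. x \<le> L + C / real m + e"
  shows "x \<le> L"
proof (rule field_le_epsilon)
  fix e :: real assume e: "0 < e"
  have "(\<lambda>m. L + C * (1 / real m) + e) \<longlonglongrightarrow> L + C * 0 + e" by (intro tendsto_intros lim_1_over_n)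
  then have "(\<lambda>m. L + C / real m + e) \<longlonglongrightarrow> L + e" by simp
  then show "x \<le> L + e" by (rule tendsto_lowerbound) (use assms[OF e] in simp_all)
qed

text \<open>ln (F l) is p ln l up to a bounded error, and ln l tends to minus infinity. Dividing by
  the negative ln l exchanges the roles of the two bounds.\<close>

lemma tendsto_ln_quotient:
  fixes F :: "real \<Rightarrow> real"
  assumes c: "0 < c" and F: "\<forall>\<^sub>F l in at_right 0. c * l powr p \<le> F l \<and> F l \<le> C * l powr p"
  shows "((\<lambda>l. ln (F l) / ln l) \<longlongrightarrow> p) (at_right 0)"
proof -
  have ln: "filterlim (ln :: real \<Rightarrow> real) at_infinity (at_right 0)"
    by (rule filterlim_at_bot_imp_at_infinity[OF ln_at_0])
  have lim: "((\<lambda>l. p + K / ln l) \<longlongrightarrow> p) (at_right (0::real))" for K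
    using tendsto_add[OF tendsto_const tendsto_divide_0[OF tendsto_const ln], of p K] by simp
  have ev: "\<forall>\<^sub>F l in at_right (0::real). 0 < l \<and> l < 1"
    using eventually_at_right_real[of 0 1] by (auto elim: eventually_mono)
  show ?thesis
  proof (rule tendsto_sandwich[OF _ _ lim lim])
    show "\<forall>\<^sub>F l in at_right 0. p + ln C / ln l \<le> ln (F l) / ln l" using F ev
    proof eventually_elim
      case (elim l)
      have l: "0 < l powr p" "ln l < 0" using elim by auto
      have Fp: "0 < F l" using elim c l by (auto intro: less_le_trans[of 0 "c * l powr p"])
      then have "0 < C * l powr p" using elim by linarith
      then have C: "0 < C" using l by (simp add: zero_less_mult_iff)
      have "ln (F l) \<le> ln (C * l powr p)" using elim Fp by simp
      also have "\<dots> = ln C + p * ln l" using C elim by (simp add: ln_mult)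
      finally have "(ln C + p * ln l) / ln l \<le> ln (F l) / ln l" using l(2) by (intro divide_right_mono_neg) auto
      then show ?case using l(2) by (simp add: add_divide_distrib add.commute)
    qed
    show "\<forall>\<^sub>F l in at_right 0. ln (F l) / ln l \<le> p + ln c / ln l" using F ev
    proof eventually_elim
      case (elim l)
      have l: "0 < l powr p" "ln l < 0" using elim by auto
      have Fp: "0 < c * l powr p" using c l by simp
      have "ln c + p * ln l = ln (c * l powr p)" using c elim by (simp add: ln_mult)
      also have "\<dots> \<le> ln (F l)" using elim Fp by simp
      finally have "ln (F l) / ln l \<le> (ln c + p * ln l) / ln l" using l(2) by (intro divide_right_mono_neg) auto
      then show ?case using l(2) by (simp add: add_divide_distrib add.commute)
    qed
  qed
qed

text \<open>In the application q = [G:Z], R0 = r q, and the quotient by \<open>zsub m\<close> has q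
  m elements. The spectra d m are linked to \<Phi> by their moments and to the values of the
  invariant factors by counts, up to one factor Kc in the threshold.\<close>

locale spectral_comparison = moment_approximation \<Phi> Kt c0 "\<lambda>m. q * m" "\<lambda>m. R0 * m" d K' + divisor_chain ps R0
  for \<Phi> Kt c0 q R0 d K' ps +
  fixes Kc :: real
  assumes q: "0 < q" and Kc: "1 \<le> Kc"
    and comp1: "\<And>m t. 0 < m \<Longrightarrow> 0 \<le> t \<Longrightarrow> card {a. a < R0 * m \<and> d m a \<le> t} \<le> card {b \<in> J m. (val b)\<^sup>2 \<le> Kc * t}"
    and comp2: "\<And>m t. 0 < m \<Longrightarrow> 0 \<le> t \<Longrightarrow> card {b \<in> J m. (val b)\<^sup>2 \<le> t} \<le> card {a. a < R0 * m \<and> d m a \<le> Kc * t}"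
begin

abbreviation cnt :: "nat \<Rightarrow> real \<Rightarrow> nat" where "cnt m t \<equiv> card {a. a < R0 * m \<and> d m a \<le> t}"
abbreviation vcnt :: "nat \<Rightarrow> real \<Rightarrow> nat" where "vcnt m t \<equiv> card {b \<in> J m. (val b)\<^sup>2 \<le> t}"
abbreviation "k0 \<equiv> R0 - length ps"

lemma vcnt_split:
  assumes m: "0 < m" and t: "0 \<le> t"
  shows "vcnt m t = card {b \<in> J m. val b = 0} + card {b \<in> J m. 0 < val b \<and> val b \<le> sqrt t}"
proof -
  have iff: "(val b)\<^sup>2 \<le> t \<longleftrightarrow> val b \<le> sqrt t" for b
    using t val_nonneg[of b] by (metis real_sqrt_le_iff real_sqrt_unique)
  let ?A = "{b \<in> J m. val b = 0}" and ?B = "{b \<in> J m. 0 < val b \<and> val b \<le> sqrt t}"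
  have eq: "{b \<in> J m. (val b)\<^sup>2 \<le> t} = {b \<in> J m. val b = 0} \<union> {b \<in> J m. 0 < val b \<and> val b \<le> sqrt t}"
    unfolding iff using t val_nonneg by (auto simp: order_less_le)
  have fin: "finite ?A" "finite ?B" using finite_J[OF m] by simp_all
  have "?A \<inter> ?B = {}" by auto
  then show ?thesis unfolding eq by (rule card_Un_disjoint[OF fin])
qed

text \<open>The 2 in the threshold stems from the ramp function in \<open>count_sandwich\<close>, Kc
  from the Smith form. The additive constant C is divided by q m and disappears as m grows.\<close>

lemma Phi_le:
  assumes l: "0 < l" and b: "\<And>m. 0 < m \<Longrightarrow> real (vcnt m (2 * Kc * l)) \<le> L * real m + C"
  shows "\<Phi> l \<le> L / real q"
proof (rule le_limit_of_eventually[where C = "C / real q"])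
  fix e :: real assume e: "0 < e"
  show "\<forall>\<^sub>F m in sequentially. \<Phi> l \<le> L / real q + C / real q / real m + e"
    using count_sandwich(1)[OF l e] eventually_gt_at_top[of 0]
  proof eventually_elim
    case (elim m)
    have "real (cnt m (2 * l)) \<le> real (vcnt m (2 * Kc * l))"
      using comp1[OF elim(2), of "2 * l"] l by (simp add: mult_ac)
    also have "\<dots> \<le> L * real m + C" by (rule b[OF elim(2)])
    finally have "real (cnt m (2 * l)) / real (q * m) \<le> (L * real m + C) / real (q * m)" by (rule divide_right_mono) simp
    also have "\<dots> = L / real q + C / real q / real m" using elim(2) by (simp add: add_divide_distrib)
    finally show ?case using elim(1) by linarith
  qed
qed

lemma Phi_ge:
  assumes l: "0 < l" and b: "\<And>m. 0 < m \<Longrightarrow> L * real m - C \<le> real (vcnt m (l / (2 * Kc)))"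
  shows "L / real q \<le> \<Phi> l"
proof (rule le_limit_of_eventually[where C = "C / real q"])
  fix e :: real assume e: "0 < e"
  show "\<forall>\<^sub>F m in sequentially. L / real q \<le> \<Phi> l + C / real q / real m + e"
    using count_sandwich(2)[OF l e] eventually_gt_at_top[of 0]
  proof eventually_elim
    case (elim m)
    have "L * real m - C \<le> real (vcnt m (l / (2 * Kc)))" by (rule b[OF elim(2)])
    also have "\<dots> \<le> real (cnt m (l / 2))"
      using comp2[OF elim(2), of "l / (2 * Kc)"] l Kc by (simp add: field_simps)
    finally have "(L * real m - C) / real (q * m) \<le> real (cnt m (l / 2)) / real (q * m)" by (rule divide_right_mono) simp
    moreover have "(L * real m - C) / real (q * m) = L / real q - C / real q / real m"
      using elim(2) by (simp add: diff_divide_distrib)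
    ultimately show ?case using elim(1) by linarith
  qed
qed

text \<open>The counts give information for l > 0 only; right continuity of \<Phi> determines its
  value at 0.\<close>

lemma Phi_0:
  assumes "\<forall>\<^sub>F l in at_right 0. \<beta> \<le> \<Phi> l \<and> \<Phi> l \<le> f l" and "(f \<longlongrightarrow> \<beta>) (at_right 0)"
  shows "\<Phi> 0 = \<beta>"
proof -
  have "(\<Phi> \<longlongrightarrow> \<Phi> 0) (at_right 0)" using F_right_cont[of 0] by (simp add: continuous_within)
  moreover have "(\<Phi> \<longlongrightarrow> \<beta>) (at_right 0)"
    by (rule tendsto_sandwich[OF _ _ tendsto_const assms(2)]) (use assms(1) in \<open>auto elim: eventually_mono\<close>)
  ultimately show ?thesis using tendsto_unique[OF trivial_limit_at_right_real] by blast
qed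

lemma Phi_locally_constant:
  assumes "ps = [] \<or> circle_zeros (last ps) = {}"
  shows "\<exists>l>0. \<Phi> (l\<^sup>2) = \<Phi> 0"
proof -
  obtain t0 where t0: "0 < t0" "\<And>m. 0 < m \<Longrightarrow> {b \<in> J m. 0 < val b \<and> val b \<le> t0} = {}"
    "\<And>m. 0 < m \<Longrightarrow> card {b \<in> J m. val b = 0} = m * k0" using no_circle_zeros[OF assms] by blast
  have v: "vcnt m t = m * k0" if m: "0 < m" and t: "0 \<le> t" "t \<le> t0\<^sup>2" for m t
  proof -
    have "sqrt t \<le> t0" using t t0(1) by (simp add: real_le_lsqrt)
    then have e: "{b \<in> J m. 0 < val b \<and> val b \<le> sqrt t} = {}" using t0(2)[OF m] by fastforce
    show ?thesis unfolding vcnt_split[OF m t(1)] t0(3)[OF m] e card.empty by (rule add_0_right)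
  qed
  define l1 where "l1 = t0\<^sup>2 / (2 * Kc)"
  have l1: "0 < l1" using t0(1) Kc by (simp add: l1_def)
  have const: "\<Phi> l = real k0 / real q" if l: "0 < l" "l \<le> l1" for l
  proof (rule antisym)
    have le: "2 * Kc * l \<le> t0\<^sup>2" using l Kc by (simp add: l1_def field_simps)
    show "\<Phi> l \<le> real k0 / real q"
      by (rule Phi_le[OF l(1), where C = 0]) (use v[of _ "2 * Kc * l"] l le Kc in \<open>simp add: mult.commute\<close>)
    have "l / (2 * Kc) \<le> 2 * Kc * l"
    proof -
      have "l / (2 * Kc) \<le> l / 1" using l Kc by (intro divide_left_mono) auto
      also have "\<dots> \<le> 2 * Kc * l" using l Kc by simp
      finally show ?thesis .
    qed
    then have le': "l / (2 * Kc) \<le> t0\<^sup>2" using le by linarith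
    show "real k0 / real q \<le> \<Phi> l"
      by (rule Phi_ge[OF l(1), where C = 0]) (use v[of _ "l / (2 * Kc)"] l le' Kc in \<open>simp add: mult.commute\<close>)
  qed
  have "\<forall>\<^sub>F l in at_right 0. l \<in> {0<..<l1}" by (rule eventually_at_right_real[OF l1])
  then have "\<Phi> 0 = real k0 / real q"
    by (intro Phi_0[where f = "\<lambda>_. real k0 / real q"]) (auto elim!: eventually_mono simp: const)
  then show ?thesis using const[of "(sqrt l1)\<^sup>2"] l1 by (intro exI[of _ "sqrt l1"]) simp
qed

end

locale spectral_comparison_zeros = spectral_comparison \<Phi> Kt c0 q R0 d K' ps Kc + divisor_chain_zeros ps R0 P
  for \<Phi> Kt c0 q R0 d K' ps Kc P
begin

lemma val0: 
  assumes m: "0 < m"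
  shows "real k0 * real m \<le> real (card {b \<in> J m. val b = 0})"
    "real (card {b \<in> J m. val b = 0}) \<le> real k0 * real m + real (length ps * card Z)"
proof -
  have Z: "finite (circle_zeros (last ps))" using finite_Z by (simp add: circle_zeros_eq)
  show "real k0 * real m \<le> real (card {b \<in> J m. val b = 0})"
    using card_val_0(1)[OF m Z ne] unfolding of_nat_mult[symmetric] of_nat_le_iff by (simp add: mult.commute)
  show "real (card {b \<in> J m. val b = 0}) \<le> real k0 * real m + real (length ps * card Z)"
    using card_val_0(2)[OF m Z ne] unfolding of_nat_mult[symmetric] of_nat_add[symmetric] of_nat_le_iff circle_zeros_eq
    by (simp add: mult.commute)
qed

text \<open>The main term comes from zero rows, the rest from values with 0 < val \<le> sqrt t.
  Passing to squares halves the exponent 1 / \<mu>.\<close>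

lemma vcnt_upper: "\<exists>C>0. \<forall>m t. 0 < m \<longrightarrow> 0 \<le> t \<longrightarrow>
  real (vcnt m t) \<le> real k0 * real m + C * (real m * t powr (1 / (2 * real \<mu>)) + 1)"
proof -
  obtain C where C: "C > 0" "\<And>m t. 0 < m \<Longrightarrow> 0 \<le> t \<Longrightarrow>
    real (card {b \<in> J m. 0 < val b \<and> val b \<le> t}) \<le> C * (real m * t powr (1 / real \<mu>) + 1)" using count_upper by blast
  define C1 where "C1 = C + real (length ps * card Z)"
  have "real (vcnt m t) \<le> real k0 * real m + C1 * (real m * t powr (1 / (2 * real \<mu>)) + 1)" if m: "0 < m" and t: "0 \<le> t" for m t
  proof -
    have p: "sqrt t powr (1 / real \<mu>) = t powr (1 / (2 * real \<mu>))"
      using t by (simp add: powr_half_sqrt[symmetric] powr_powr)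
    have x: "0 \<le> real m * t powr (1 / (2 * real \<mu>))" by simp
    have "real (vcnt m t) \<le> real k0 * real m + real (length ps * card Z) + C * (real m * t powr (1 / (2 * real \<mu>)) + 1)"
      using vcnt_split[OF m t] val0(2)[OF m] C(2)[OF m, of "sqrt t"] t unfolding p by simp
    moreover have "real (length ps * card Z) * 1 \<le> real (length ps * card Z) * (real m * t powr (1 / (2 * real \<mu>)) + 1)"
      using x by (intro mult_left_mono) auto
    ultimately show ?thesis unfolding C1_def distrib_right by linarith
  qed
  moreover have "0 < C1" using C(1) by (simp add: C1_def add_pos_nonneg)
  ultimately show ?thesis by blast
qed

lemma vcnt_lower: "\<exists>c>0. \<exists>C t0. t0 > 0 \<and> (\<forall>m t. 0 < m \<longrightarrow> 0 \<le> t \<longrightarrow> t \<le> t0 \<longrightarrow>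
  real k0 * real m + c * (real m * t powr (1 / (2 * real \<mu>))) - C \<le> real (vcnt m t))"
proof -
  obtain c C t0 where c: "c > 0" "t0 > 0" "\<And>m t. 0 < m \<Longrightarrow> 0 \<le> t \<Longrightarrow> t \<le> t0 \<Longrightarrow>
    c * (real m * t powr (1 / real \<mu>)) - C \<le> real (card {b \<in> J m. 0 < val b \<and> val b \<le> t})" using count_lower by blast
  have "real k0 * real m + c * (real m * t powr (1 / (2 * real \<mu>))) - C \<le> real (vcnt m t)"
    if m: "0 < m" and t: "0 \<le> t" "t \<le> t0\<^sup>2" for m t
  proof -
    have p: "sqrt t powr (1 / real \<mu>) = t powr (1 / (2 * real \<mu>))"
      using t by (simp add: powr_half_sqrt[symmetric] powr_powr)
    have "sqrt t \<le> t0" using t c(2) by (simp add: real_le_lsqrt)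
    then show ?thesis
      using vcnt_split[OF m t(1)] val0(1)[OF m] c(3)[OF m, of "sqrt t"] t unfolding p by simp
  qed
  then show ?thesis using c(1,2) by (intro exI[of _ c] conjI exI[of _ C] exI[of _ "t0\<^sup>2"]) auto
qed

text \<open>The main terms k0 / q of both bounds coincide and equal \<Phi> 0 by right continuity;
  what remains on either side is of order l powr (1 / (2 \<mu>)).\<close>

lemma Phi_asymptotics:
  "\<exists>c C. 0 < c \<and> (\<forall>\<^sub>F l in at_right 0. c * l powr (1 / (2 * real \<mu>)) \<le> \<Phi> l - \<Phi> 0 \<and> \<Phi> l - \<Phi> 0 \<le> C * l powr (1 / (2 * real \<mu>)))"
proof -
  let ?p = "1 / (2 * real \<mu>)"
  obtain C where C: "C > 0" "\<And>m t. 0 < m \<Longrightarrow> 0 \<le> t \<Longrightarrow> real (vcnt m t) \<le> real k0 * real m + C * (real m * t powr ?p + 1)"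
    using vcnt_upper by blast
  obtain c C' t0 where c: "c > 0" "t0 > 0" "\<And>m t. 0 < m \<Longrightarrow> 0 \<le> t \<Longrightarrow> t \<le> t0 \<Longrightarrow>
    real k0 * real m + c * (real m * t powr ?p) - C' \<le> real (vcnt m t)" using vcnt_lower by blast
  define \<beta> c1 C1 where "\<beta> = real k0 / real q" and "c1 = c * (1 / (2 * Kc)) powr ?p / real q" and "C1 = C * (2 * Kc) powr ?p / real q"
  have up: "\<Phi> l \<le> \<beta> + C1 * l powr ?p" if l: "0 < l" for l
  proof -
    have "\<Phi> l \<le> (real k0 + C * (2 * Kc * l) powr ?p) / real q"
      by (rule Phi_le[OF l, where C = C]) (use C(2)[of _ "2 * Kc * l"] l Kc in \<open>simp add: algebra_simps\<close>)
    also have "\<dots> = \<beta> + C1 * l powr ?p" using l Kc by (simp add: \<beta>_def C1_def add_divide_distrib powr_mult)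
    finally show ?thesis .
  qed
  have lo: "\<beta> + c1 * l powr ?p \<le> \<Phi> l" if l: "0 < l" "l < t0" for l
  proof -
    have le: "l / (2 * Kc) \<le> t0"
    proof -
      have "l / (2 * Kc) \<le> l / 1" using l Kc by (intro divide_left_mono) auto
      then show ?thesis using l by simp
    qed
    have "\<beta> + c1 * l powr ?p = (real k0 + c * (1 / (2 * Kc) * l) powr ?p) / real q"
      using l Kc by (subst powr_mult) (simp_all add: \<beta>_def c1_def add_divide_distrib)
    also have "\<dots> \<le> \<Phi> l"
      by (rule Phi_ge[OF l(1), where C = C']) (use c(3)[of _ "l / (2 * Kc)"] l le Kc in \<open>simp add: algebra_simps\<close>)
    finally show ?thesis .
  qed
  have c1: "0 < c1" using c(1) Kc q by (simp add: c1_def)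
  have ev: "\<forall>\<^sub>F l in at_right 0. l \<in> {0<..<t0}" by (rule eventually_at_right_real[OF c(2)])
  have "((\<lambda>l. \<beta> + C1 * l powr ?p) \<longlongrightarrow> \<beta> + C1 * 0) (at_right 0)"
    using mu_pos by (intro tendsto_intros tendsto_zero_powrI[OF _ tendsto_const] tendsto_ident_at) (auto simp: eventually_at_filter)
  then have lim: "((\<lambda>l. \<beta> + C1 * l powr ?p) \<longlongrightarrow> \<beta>) (at_right 0)" by simp
  have "\<Phi> 0 = \<beta>"
  proof (rule Phi_0[OF _ lim])
    show "\<forall>\<^sub>F l in at_right 0. \<beta> \<le> \<Phi> l \<and> \<Phi> l \<le> \<beta> + C1 * l powr ?p" using ev
    proof eventually_elim
      case (elim l)
      have "0 \<le> c1 * l powr ?p" using c1 by simp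
      then show ?case using up[of l] lo[of l] elim by auto
    qed
  qed
  then show ?thesis using c1 up lo
    by (intro exI[of _ c1] exI[of _ C1] conjI) (use ev in \<open>auto elim!: eventually_mono\<close>, fastforce+)
qed

text \<open>The count at a threshold of order m powr (- 2 \<mu>) exceeds the number of zero
  eigenvalues, so a positive eigenvalue of at most that order exists. Counting up to the smallest
  one bounds its multiplicity. If it were below the gap of \<open>val_gap\<close>, the comparison
  would leave room for the zero eigenvalues only.\<close>

lemma smallest_positive:
  assumes B: "\<And>a. a \<in> circle_zeros (last ps) - {1} \<Longrightarrow> baker_constant a (-1) (Dt a)"
    and D: "\<And>a. a \<in> circle_zeros (last ps) - {1} \<Longrightarrow> Dt a \<le> D" and D1: "1 \<le> D"
  shows "\<exists>c C N m0. 0 < c \<and> 0 < C \<and> 0 < N \<and> (\<forall>m\<ge>m0. 0 < m \<longrightarrow> (\<exists>s>0. (\<exists>a<R0 * m. d m a = s) \<and>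
    (\<forall>a<R0 * m. 0 < d m a \<longrightarrow> s \<le> d m a) \<and> c * real m powr (- (2 * ((1 + D) * real \<mu>))) \<le> s \<and>
    s \<le> C * real m powr (- (2 * real \<mu>)) \<and> real (card {a. a < R0 * m \<and> d m a = s}) \<le> N))"
proof -
  let ?p = "1 / (2 * real \<mu>)"
  obtain Cu where Cu: "Cu > 0" "\<And>m t. 0 < m \<Longrightarrow> 0 \<le> t \<Longrightarrow> real (vcnt m t) \<le> real k0 * real m + Cu * (real m * t powr ?p + 1)"
    using vcnt_upper by blast
  obtain c C t0 where c: "c > 0" "t0 > 0" "\<And>m t. 0 < m \<Longrightarrow> 0 \<le> t \<Longrightarrow> t \<le> t0 \<Longrightarrow>
    real k0 * real m + c * (real m * t powr ?p) - C \<le> real (vcnt m t)" using vcnt_lower by blast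
  obtain g where g: "g > 0" "\<And>m b. b \<in> J m \<Longrightarrow> 0 < m \<Longrightarrow> 0 < val b \<Longrightarrow> g * real m powr (- ((1 + D) * real \<mu>)) \<le> val b"
    using val_gap[OF B D D1] by blast
  \<comment> \<open>With t = (C2 / m) powr (2 \<mu>) the lower bound for the count becomes at least
    k0 m + Cu + 1, one more than the upper bound k0 m + Cu for the number of zero
    eigenvalues.\<close>
  define C2 where "C2 = (\<bar>C\<bar> + Cu + 1) / c"
  have C2: "0 < C2" using c(1) Cu(1) by (simp add: C2_def add_nonneg_pos)
  define N where "N = Cu * ((Kc * Kc) powr ?p * C2 + 1)"
  have N: "0 < N" unfolding N_def using Cu(1) C2 by (intro mult_pos_pos add_nonneg_pos) auto
  define m0 where "m0 = nat \<lceil>C2 / t0 powr ?p\<rceil>"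
  have mu: "0 < real \<mu>" using mu_pos by simp
  have main: "\<exists>s>0. (\<exists>a<R0 * m. d m a = s) \<and>
    (\<forall>a<R0 * m. 0 < d m a \<longrightarrow> s \<le> d m a) \<and> g\<^sup>2 / Kc * real m powr (- (2 * ((1 + D) * real \<mu>))) \<le> s \<and>
    s \<le> Kc * C2 powr (2 * real \<mu>) * real m powr (- (2 * real \<mu>)) \<and> real (card {a. a < R0 * m \<and> d m a = s}) \<le> N"
    if mm0: "m0 \<le> m" and m: "0 < m" for m
  proof -
    define t where "t = (C2 / real m) powr (2 * real \<mu>)"
    have t: "0 < t" using C2 m by (simp add: t_def)
    have tp: "t powr ?p = C2 / real m" unfolding t_def using mu C2 m by (simp add: powr_powr)
    have "C2 / t0 powr ?p \<le> real m" using mm0 unfolding m0_def by linarith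
    then have "C2 / real m \<le> t0 powr ?p" using c(2) m by (simp add: field_simps)
    then have "t \<le> (t0 powr ?p) powr (2 * real \<mu>)" unfolding t_def using C2 m mu by (intro powr_mono2) auto
    also have "\<dots> = t0" using c(2) mu by (simp add: powr_powr)
    finally have tt0: "t \<le> t0" .
    have fin: "finite {a. a < R0 * m \<and> Q a}" for Q by simp
    have c0: "real (cnt m 0) \<le> real k0 * real m + Cu" "real k0 * real m \<le> real (cnt m 0)"
    proof -
      show "real (cnt m 0) \<le> real k0 * real m + Cu" using comp1[OF m, of 0] Cu(2)[OF m, of 0] by simp
      have "real k0 * real m \<le> real (vcnt m 0)" using val0(1)[OF m] vcnt_split[OF m, of 0] by simp
      then show "real k0 * real m \<le> real (cnt m 0)" using comp2[OF m, of 0] by simp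
    qed
    have "c * (real m * t powr ?p) = \<bar>C\<bar> + Cu + 1" unfolding tp C2_def using c(1) m by simp
    then have "real k0 * real m + Cu + 1 \<le> real (vcnt m t)" using c(3)[OF m _ tt0] t abs_ge_self[of C] by linarith
    also have "real (vcnt m t) \<le> real (cnt m (Kc * t))" using comp2[OF m, of t] t by simp
    finally have "cnt m 0 < cnt m (Kc * t)" using c0(1) by linarith
    then have "\<not> {a. a < R0 * m \<and> d m a \<le> Kc * t} \<subseteq> {a. a < R0 * m \<and> d m a \<le> 0}"
      using card_mono[OF fin] by (metis not_less)
    then obtain a0 where "a0 < R0 * m \<and> d m a0 \<le> Kc * t \<and> \<not> d m a0 \<le> 0" by blast
    then have a0: "a0 < R0 * m" "0 < d m a0" "d m a0 \<le> Kc * t" by simp_all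
    define S where "S = d m ` {a. a < R0 * m \<and> 0 < d m a}"
    have S: "finite S" "d m a0 \<in> S" using a0 by (auto simp: S_def)
    define s where "s = Min S"
    have "s \<in> S" unfolding s_def using S by (intro Min_in) auto
    then obtain a1 where a1: "a1 < R0 * m" "d m a1 = s" "0 < s" by (auto simp: S_def)
    have least: "s \<le> d m a" if "a < R0 * m" "0 < d m a" for a
      unfolding s_def using S(1) that by (intro Min_le) (auto simp: S_def)
    have sle: "s \<le> Kc * t" using least[OF a0(1,2)] a0(3) by linarith
    \<comment> \<open>The eigenvalues equal to s and the zero eigenvalues are disjoint parts of
      those that are at most s; since the zero ones number at least k0 m, this bounds the
      multiplicity of s.\<close>
    have mult: "card {a. a < R0 * m \<and> d m a = s} + cnt m 0 \<le> cnt m s"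
    proof -
      have "{a. a < R0 * m \<and> d m a = s} \<inter> {a. a < R0 * m \<and> d m a \<le> 0} = {}" using a1(3) by auto
      then have "card {a. a < R0 * m \<and> d m a = s} + cnt m 0 = card ({a. a < R0 * m \<and> d m a = s} \<union> {a. a < R0 * m \<and> d m a \<le> 0})"
        by (rule card_Un_disjoint[OF fin fin, symmetric])
      also have "\<dots> \<le> cnt m s" using a1(3) by (intro card_mono fin) auto
      finally show ?thesis .
    qed
    have one: "1 \<le> card {a. a < R0 * m \<and> d m a = s}"
      using a1 fin[of "\<lambda>a. d m a = s"] by (auto simp: Suc_le_eq card_gt_0_iff)
    have Ks: "0 \<le> Kc * s" using Kc a1(3) by simp
    have "real (card {a. a < R0 * m \<and> d m a = s}) \<le> N"
    proof -
      have "(Kc * s) powr ?p \<le> (Kc * Kc * t) powr ?p" using Kc Ks sle mu by (intro powr_mono2) auto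
      also have "\<dots> = (Kc * Kc) powr ?p * (C2 / real m)" using Kc t by (simp add: powr_mult tp)
      finally have "real m * (Kc * s) powr ?p \<le> real m * ((Kc * Kc) powr ?p * (C2 / real m))" by (intro mult_left_mono) auto
      also have "\<dots> = (Kc * Kc) powr ?p * C2" using m by simp
      finally have x: "Cu * (real m * (Kc * s) powr ?p + 1) \<le> N" unfolding N_def using Cu(1) by (intro mult_left_mono) auto
      have "real (cnt m s) \<le> real (vcnt m (Kc * s))" using comp1[OF m, of s] a1(3) by simp
      also have "\<dots> \<le> real k0 * real m + N" using Cu(2)[OF m Ks] x by linarith
      finally show ?thesis using mult c0(2) by linarith
    qed
    moreover have "g\<^sup>2 / Kc * real m powr (- (2 * ((1 + D) * real \<mu>))) \<le> s"
    proof (rule ccontr)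
      define gm where "gm = g * real m powr (- ((1 + D) * real \<mu>))"
      have gm: "0 < gm" using g(1) m by (simp add: gm_def)
      have gm2: "gm\<^sup>2 = g\<^sup>2 * real m powr (- (2 * ((1 + D) * real \<mu>)))"
        using m by (simp add: gm_def power_mult_distrib powr_power)
      assume "\<not> ?thesis"
      then have lt: "Kc * s < gm\<^sup>2" using Kc by (simp add: gm2 field_simps)
      have "{b \<in> J m. (val b)\<^sup>2 \<le> Kc * s} \<subseteq> {b \<in> J m. (val b)\<^sup>2 \<le> 0}"
      proof
        fix b assume b: "b \<in> {b \<in> J m. (val b)\<^sup>2 \<le> Kc * s}"
        have "val b = 0"
        proof (rule ccontr)
          assume "val b \<noteq> 0"
          then have "gm \<le> val b" unfolding gm_def using g(2)[of b m] b m val_nonneg[of b] by simp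
          then have "gm\<^sup>2 \<le> (val b)\<^sup>2" using gm by (intro power_mono) auto
          then show False using b lt by simp
        qed
        then show "b \<in> {b \<in> J m. (val b)\<^sup>2 \<le> 0}" using b by simp
      qed
      then have "vcnt m (Kc * s) \<le> vcnt m 0" using finite_J[OF m] by (intro card_mono) auto
      then have "cnt m s \<le> cnt m 0" using comp1[OF m, of s] comp2[OF m, of 0] a1(3) by simp
      then show False using mult one by simp
    qed
    moreover have "s \<le> Kc * C2 powr (2 * real \<mu>) * real m powr (- (2 * real \<mu>))"
    proof -
      have "t = C2 powr (2 * real \<mu>) * real m powr (- (2 * real \<mu>))"
        using C2 by (simp add: t_def powr_divide powr_minus_divide)
      then show ?thesis using sle by (simp add: mult.assoc)
    qed
    ultimately show ?thesis using a1 least by blast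
  qed
  have "0 < g\<^sup>2 / Kc" "0 < Kc * C2 powr (2 * real \<mu>)" using g(1) Kc C2 by auto
  then show ?thesis using N main by blast
qed

end

text \<open>Applied with b = 1 + D, s the smallest positive eigenvalue and k its multiplicity. For L
  = ln m the numerator is at most -(L + x) and minus the denominator at most b \<mu> L + y, with
  constants x and y. The denominator is negative for large m, so the quotient is at least (L + x) /
  (b \<mu> L + y), which tends to 1 / (b \<mu>).\<close>

lemma eventually_alpha_ge:
  assumes pos: "0 < c" "0 < C" "0 < N" "0 < q" "0 < \<mu>" "0 < b" and e: "0 < e"
  shows "\<forall>\<^sub>F m in sequentially. \<forall>s k. c * real m powr (- (2 * (b * \<mu>))) \<le> s \<longrightarrow> s \<le> C * real m powr (- (2 * \<mu>)) \<longrightarrow>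
    1 \<le> k \<longrightarrow> k \<le> N \<longrightarrow> 1 / (b * \<mu>) - e \<le> ln (k / (q * real m)) / ln (sqrt s)"
proof -
  define x y where "x = ln q - ln N" and "y = - (ln c) / 2"
  have lnm: "filterlim (\<lambda>m. ln (real m)) at_top sequentially"
    by (rule filterlim_compose[OF ln_at_top filterlim_real_sequentially])
  then have inf: "filterlim (\<lambda>m. ln (real m)) at_infinity sequentially" by (rule filterlim_at_top_imp_at_infinity)
  have "(\<lambda>m. (1 + x / ln (real m)) / (b * \<mu> + y / ln (real m))) \<longlonglongrightarrow> (1 + 0) / (b * \<mu> + 0)"
    using pos by (intro tendsto_intros tendsto_divide_0[OF tendsto_const inf]) auto
  then have "\<forall>\<^sub>F m in sequentially. 1 / (b * \<mu>) - e < (1 + x / ln (real m)) / (b * \<mu> + y / ln (real m))"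
    using e by (intro order_tendstoD(1)) auto
  \<comment> \<open>From here on L + x is positive and the upper bound for s is below 1, so that ln
    (sqrt s) is negative.\<close>
  moreover have "\<forall>\<^sub>F m in sequentially. 1 + \<bar>x\<bar> + \<bar>y\<bar> / (b * \<mu>) + \<bar>ln C\<bar> / (2 * \<mu>) \<le> ln (real m)"
    using lnm unfolding filterlim_at_top by blast
  ultimately show ?thesis using eventually_gt_at_top[of 0]
  proof eventually_elim
    case (elim m)
    show ?case
    proof (intro allI impI)
      fix s k
      assume st: "c * real m powr (- (2 * (b * \<mu>))) \<le> s" "s \<le> C * real m powr (- (2 * \<mu>))" "1 \<le> k" "k \<le> N"
      define L where "L = ln (real m)"
      have m: "0 < real m" using elim by simp
      have L: "0 < L" "\<bar>x\<bar> < L" "\<bar>y\<bar> / (b * \<mu>) < L" "\<bar>ln C\<bar> / (2 * \<mu>) < L"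
      proof -
        have "0 \<le> \<bar>x\<bar>" "0 \<le> \<bar>y\<bar> / (b * \<mu>)" "0 \<le> \<bar>ln C\<bar> / (2 * \<mu>)" using pos by simp_all
        then show "0 < L" "\<bar>x\<bar> < L" "\<bar>y\<bar> / (b * \<mu>) < L" "\<bar>ln C\<bar> / (2 * \<mu>) < L"
          using elim(2) unfolding L_def[symmetric] by linarith+
      qed
      have s: "0 < s" using st(1) pos(1) m by (auto intro: less_le_trans[of 0 "c * real m powr (- (2 * (b * \<mu>)))"])
      have "ln c - 2 * (b * \<mu>) * L = ln (c * real m powr (- (2 * (b * \<mu>))))" using pos m by (simp add: ln_mult L_def)
      also have "\<dots> \<le> ln s" using st(1) s pos m by simp
      finally have ls: "- (ln (sqrt s)) \<le> b * \<mu> * L + y" using s by (simp add: ln_sqrt y_def)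
      have "ln s \<le> ln (C * real m powr (- (2 * \<mu>)))" using st(2) s pos m by simp
      also have "\<dots> = ln C - 2 * \<mu> * L" using pos m by (simp add: ln_mult L_def)
      also have "\<dots> < 0" using L(4) pos by (simp add: field_simps)
      finally have neg: "ln (sqrt s) < 0" using s by (simp add: ln_sqrt)
      have "ln (k / (q * real m)) = ln k - ln q - L" using st elim pos m by (simp add: ln_div ln_mult L_def)
      moreover have "ln k \<le> ln N" using st pos by simp
      ultimately have num: "L + x \<le> - ln (k / (q * real m))" by (simp add: x_def)
      have Lx: "0 < L + x" using L(2) by linarith
      have "1 / (b * \<mu>) - e \<le> (1 + x / L) / (b * \<mu> + y / L)" using elim(1) by (simp add: L_def)
      also have "(1 + x / L) / (b * \<mu> + y / L) = ((L + x) / L) / ((b * \<mu> * L + y) / L)" using L(1) by (simp add: add_divide_distrib)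
      also have "\<dots> = (L + x) / (b * \<mu> * L + y)" using L(1) by simp
      also have "\<dots> \<le> (- ln (k / (q * real m))) / (- ln (sqrt s))"
        using num ls neg Lx by (intro frac_le) auto
      finally show "1 / (b * \<mu>) - e \<le> ln (k / (q * real m)) / ln (sqrt s)" by simp
    qed
  qed
qed

section \<open>Alpha numbers of virtually cyclic groups\<close>

text \<open>Supplies the uniform bound on the spectra, once values are compared with
  eigenvalues.\<close>

lemma (in divisor_chain) val_bounded: "\<exists>V. \<forall>m b. 0 < m \<longrightarrow> b \<in> J m \<longrightarrow> val b \<le> V"
proof -
  have "\<forall>l. \<exists>v\<ge>0. \<forall>\<xi>. cmod \<xi> = 1 \<longrightarrow> cmod (laurent_eval (ps ! l) \<xi>) \<le> v" using laurent_eval_bounded by blast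
  then obtain v where v: "\<And>l. 0 \<le> v l" "\<And>l \<xi>. cmod \<xi> = 1 \<Longrightarrow> cmod (laurent_eval (ps ! l) \<xi>) \<le> v l" by metis
  have "val b \<le> (\<Sum>l<length ps. v l)" if m: "0 < m" and b: "b \<in> J m" for m b
  proof (cases "fst b < length ps")
    case True
    have "cmod (snd b) = 1" using b norm_root[OF m, of "snd b"] by (auto simp: J_def)
    then have "val b \<le> v (fst b)" using v(2) True by (simp add: val_def)
    also have "\<dots> \<le> (\<Sum>l<length ps. v l)" using True v(1) by (intro member_le_sum) auto
    finally show ?thesis .
  next
    case False
    then show ?thesis using v(1) by (simp add: val_def sum_nonneg)
  qed
  then show ?thesis by blast
qed

lemma alpha_number_eq:
  fixes M :: "complex mat"
  assumes s: "0 < s" "a < R" "d a = s" and least: "\<forall>a<R. 0 < d a \<longrightarrow> s \<le> d a" and R: "dim_row M = R"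
    and ev: "\<And>e. eigenvalue (M * mat_adjoint M) e \<longleftrightarrow> (\<exists>a<R. e = of_real (d a))"
    and ker: "\<And>t. kernel_dim (M * mat_adjoint M - of_real t \<cdot>\<^sub>m 1\<^sub>m R) = card {a. a < R \<and> d a = t}"
  shows "sigma_plus M = sqrt s" "mult_plus M = card {a. a < R \<and> d a = s}"
proof -
  have sv: "\<sigma> \<in> singular_values M \<longleftrightarrow> 0 \<le> \<sigma> \<and> (\<exists>a<R. \<sigma>\<^sup>2 = d a)" for \<sigma>
    unfolding singular_values_def mem_Collect_eq ev of_real_eq_iff ..
  show sigma: "sigma_plus M = sqrt s" unfolding sigma_plus_def
  proof (rule Min_eqI)
    have "{\<sigma> \<in> singular_values M. 0 < \<sigma>} \<subseteq> (\<lambda>a. sqrt (d a)) ` {..<R}"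
    proof
      fix \<sigma> assume "\<sigma> \<in> {\<sigma> \<in> singular_values M. 0 < \<sigma>}"
      then obtain a where a: "a < R" "\<sigma>\<^sup>2 = d a" "0 \<le> \<sigma>" by (auto simp: sv)
      then have "\<sigma> = sqrt (d a)" by (metis real_sqrt_unique)
      then show "\<sigma> \<in> (\<lambda>a. sqrt (d a)) ` {..<R}" using a(1) by blast
    qed
    then show "finite {\<sigma> \<in> singular_values M. 0 < \<sigma>}" by (rule finite_subset) simp
    show "sqrt s \<le> \<sigma>" if "\<sigma> \<in> {\<sigma> \<in> singular_values M. 0 < \<sigma>}" for \<sigma>
    proof -
      have "0 < \<sigma>" "\<exists>a<R. \<sigma>\<^sup>2 = d a" using that by (simp_all add: sv)
      moreover from this obtain a where a: "a < R" "\<sigma>\<^sup>2 = d a" by blast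
      ultimately have "0 < d a" by (metis zero_less_power)
      then have "s \<le> \<sigma>\<^sup>2" unfolding a(2) by (rule least[rule_format, OF a(1)])
      then show ?thesis using \<open>0 < \<sigma>\<close> by (simp add: real_le_lsqrt s less_imp_le)
    qed
    show "sqrt s \<in> {\<sigma> \<in> singular_values M. 0 < \<sigma>}" using s by (auto simp: sv)
  qed
  show "mult_plus M = card {a. a < R \<and> d a = s}"
    unfolding mult_plus_def sigma R ker using s by simp
qed

section \<open>Spectra of the given matrix over the quotients\<close>

locale cyclic_matrix = cyclic_restriction G z gs
  for G :: "('g, 'm) monoid_scheme" (structure) and z :: 'g and gs :: "'g list" +
  fixes r s :: nat and A :: "'g gr_mat" and ps :: "laurent_poly list"
  assumes A: "gr_entries G r s A" and inv_factors: "invariant_factors (res_mat G z gs r s A) ps"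
begin

definition qmat :: "nat \<Rightarrow> complex mat" where
  "qmat m = regular_mat (G Mod zsub m) r s (gr_mat_proj G (zsub m) A)"

sublocale smith_form "res_mat G z gs r s A" ps by standard (rule inv_factors)

lemma dim_res: "dim_row (res_mat G z gs r s A) = r * n"
  by (simp add: res_mat_def block_mat_def)

text \<open>\<Phi> comes from the von Neumann trace, d m from the Gram matrix of
  \<open>qmat m\<close>, the counts from the Smith form of the restriction, and the moments agree
  because the traces do. Eigenvalues and kernel dimensions of the Gram matrices are exported as
  well, since alpha numbers have to refer to the same d.\<close>

lemma ex_comparison:
  "\<exists>\<Phi> Kt d K' Kc. spectral_comparison \<Phi> Kt (real r) n (r * n) d K' ps Kc \<and>
    (\<forall>l. spectral_distribution G r s A l = \<Phi> (l\<^sup>2)) \<and>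
    (\<forall>m>0. dim_row (qmat m) = r * n * m \<and>
      (\<forall>e. eigenvalue (qmat m * mat_adjoint (qmat m)) e \<longleftrightarrow> (\<exists>a<r * n * m. e = of_real (d m a))) \<and>
      (\<forall>t. kernel_dim (qmat m * mat_adjoint (qmat m) - of_real t \<cdot>\<^sub>m 1\<^sub>m (r * n * m)) = card {a. a < r * n * m \<and> d m a = t}))"
proof -
  define C where "C = gr_mult G s A (gr_adjoint G A)"
  have C: "gr_entries G r r C" unfolding C_def by (rule gr_entries_mult[OF A gr_entries_adjoint[OF A]])
  obtain \<Phi> Kt where \<Phi>: "distribution_function \<Phi> Kt (real r)" "\<And>l. spectral_distribution G r s A l = \<Phi> (l\<^sup>2)"
    "\<And>k. (LINT t|interval_measure \<Phi>. t ^ k) = Re (\<Sum>i<r. gr_pow G r C k i i \<one>)"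
    using spectral_distribution_moments[OF A] unfolding C_def by blast
  obtain Kc where Kc: "1 \<le> Kc" and comp: "\<And>m R S W E M \<phi> d t. circulant_blocks m R S W E (res_mat G z gs r s A) M \<Longrightarrow>
    (\<forall>x. (\<Sum>a<R. (cmod (\<Sum>i<R. \<phi> a i * x i))\<^sup>2) = (\<Sum>i<R. (cmod (x i))\<^sup>2)) \<Longrightarrow>
    (\<forall>x. (\<Sum>a<R. d a * (cmod (\<Sum>i<R. \<phi> a i * x i))\<^sup>2) = (\<Sum>b<S. (cmod (\<Sum>i<R. M $$ (i, b) * x i))\<^sup>2)) \<Longrightarrow> 0 \<le> t \<Longrightarrow>
    card {a \<in> {..<R}. d a \<le> t} \<le> card {b \<in> J m. (val b)\<^sup>2 \<le> Kc * t} \<and>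
    card {b \<in> J m. (val b)\<^sup>2 \<le> t} \<le> card {a \<in> {..<R}. d a \<le> Kc * t}"
    using count_comparison by (elim exE conjE) blast
  define Q where "Q = (\<lambda>m (d :: nat \<Rightarrow> real). (\<forall>a<r * (n * m). 0 \<le> d a) \<and>
    (\<forall>k. (\<Sum>i<r * (n * m). ((qmat m * mat_adjoint (qmat m)) ^\<^sub>m k) $$ (i, i)) = of_real (\<Sum>a<r * (n * m). d a ^ k)) \<and>
    (\<forall>e. eigenvalue (qmat m * mat_adjoint (qmat m)) e \<longleftrightarrow> (\<exists>a<r * (n * m). e = of_real (d a))) \<and>
    (\<forall>t. kernel_dim (qmat m * mat_adjoint (qmat m) - of_real t \<cdot>\<^sub>m 1\<^sub>m (r * (n * m))) = card {a. a < r * (n * m) \<and> d a = t}) \<and>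
    (\<forall>t\<ge>0. card {a. a < r * (n * m) \<and> d a \<le> t} \<le> card {b \<in> J m. (val b)\<^sup>2 \<le> Kc * t} \<and>
      card {b \<in> J m. (val b)\<^sup>2 \<le> t} \<le> card {a. a < r * (n * m) \<and> d a \<le> Kc * t}))"
  have carrier: "qmat m \<in> carrier_mat (r * (n * m)) (s * (n * m))" if m: "0 < m" for m
  proof -
    interpret fq: finite_quotient "zsub m" G by (rule finite_quotient_zsub[OF m])
    show ?thesis using fq.qreg_carrier[of r s A] unfolding fq.qreg_def qmat_def card_rcosets_zsub[OF m] .
  qed
  have exQ: "\<exists>d. Q m d" if m: "0 < m" for m
  proof -
    obtain \<phi> d where d: "\<forall>a<r * (n * m). 0 \<le> d a"
      "\<forall>x. (\<Sum>a<r * (n * m). (cmod (\<Sum>i<r * (n * m). \<phi> a i * x i))\<^sup>2) = (\<Sum>i<r * (n * m). (cmod (x i))\<^sup>2)"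
      "\<forall>x. (\<Sum>a<r * (n * m). d a * (cmod (\<Sum>i<r * (n * m). \<phi> a i * x i))\<^sup>2) = (\<Sum>b<s * (n * m). (cmod (\<Sum>i<r * (n * m). qmat m $$ (i, b) * x i))\<^sup>2)"
      "\<forall>k. (\<Sum>i<r * (n * m). ((qmat m * mat_adjoint (qmat m)) ^\<^sub>m k) $$ (i, i)) = of_real (\<Sum>a<r * (n * m). d a ^ k)"
      "\<forall>e. eigenvalue (qmat m * mat_adjoint (qmat m)) e \<longleftrightarrow> (\<exists>a<r * (n * m). e = of_real (d a))"
      "\<forall>t. kernel_dim (qmat m * mat_adjoint (qmat m) - of_real t \<cdot>\<^sub>m 1\<^sub>m (r * (n * m))) = card {a. a < r * (n * m) \<and> d a = t}"
      using gram_spectrum[OF carrier[OF m]] by (elim exE conjE) rule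
    have "\<forall>t\<ge>0. card {a. a < r * (n * m) \<and> d a \<le> t} \<le> card {b \<in> J m. (val b)\<^sup>2 \<le> Kc * t} \<and>
      card {b \<in> J m. (val b)\<^sup>2 \<le> t} \<le> card {a. a < r * (n * m) \<and> d a \<le> Kc * t}"
      using comp[OF circulant_zsub[OF A m, folded qmat_def] d(2,3)] by simp
    then show ?thesis unfolding Q_def using d by blast
  qed
  define d where "d = (\<lambda>m. SOME d. Q m d)"
  have Qd: "Q m (d m)" if "0 < m" for m unfolding d_def by (rule someI_ex[OF exQ[OF that]])
  have d: "\<And>a. a < r * (n * m) \<Longrightarrow> 0 \<le> d m a"
    "\<And>k. (\<Sum>i<r * (n * m). ((qmat m * mat_adjoint (qmat m)) ^\<^sub>m k) $$ (i, i)) = of_real (\<Sum>a<r * (n * m). d m a ^ k)"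
    "\<And>e. eigenvalue (qmat m * mat_adjoint (qmat m)) e \<longleftrightarrow> (\<exists>a<r * (n * m). e = of_real (d m a))"
    "\<And>t. kernel_dim (qmat m * mat_adjoint (qmat m) - of_real t \<cdot>\<^sub>m 1\<^sub>m (r * (n * m))) = card {a. a < r * (n * m) \<and> d m a = t}"
    "\<And>t. 0 \<le> t \<Longrightarrow> card {a. a < r * (n * m) \<and> d m a \<le> t} \<le> card {b \<in> J m. (val b)\<^sup>2 \<le> Kc * t}"
    "\<And>t. 0 \<le> t \<Longrightarrow> card {b \<in> J m. (val b)\<^sup>2 \<le> t} \<le> card {a. a < r * (n * m) \<and> d m a \<le> Kc * t}"
    if "0 < m" for m using Qd[OF that] unfolding Q_def by blast+
  obtain V where V: "\<And>m b. 0 < m \<Longrightarrow> b \<in> J m \<Longrightarrow> val b \<le> V" using val_bounded by blast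
  \<comment> \<open>A uniform bound on the spectra from counting: all r n m values have square at
    most V ^ 2, so the comparison leaves no eigenvalue above Kc V ^ 2.\<close>
  have le: "d m a \<le> Kc * V\<^sup>2" if m: "0 < m" and a: "a < r * (n * m)" for m a
  proof -
    have "(val b)\<^sup>2 \<le> V\<^sup>2" if "b \<in> J m" for b using V[OF m that] val_nonneg[of b] by (intro power_mono) auto
    then have "{b \<in> J m. (val b)\<^sup>2 \<le> V\<^sup>2} = J m" by blast
    then have "card {b \<in> J m. (val b)\<^sup>2 \<le> V\<^sup>2} = r * (n * m)" using card_J[OF m] by (simp add: dim_res mult.assoc)
    then have "card {..<r * (n * m)} \<le> card {a. a < r * (n * m) \<and> d m a \<le> Kc * V\<^sup>2}"
      using d(6)[OF m, of "V\<^sup>2"] by simp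
    moreover have "{a. a < r * (n * m) \<and> d m a \<le> Kc * V\<^sup>2} \<subseteq> {..<r * (n * m)}" by auto
    ultimately have "{a. a < r * (n * m) \<and> d m a \<le> Kc * V\<^sup>2} = {..<r * (n * m)}"
      using card_seteq[OF finite_lessThan] by blast
    then show ?thesis using a by blast
  qed
  have moment: "\<forall>\<^sub>F m in sequentially. (\<Sum>a<r * n * m. d m a ^ k) / real (n * m) = (LINT t|interval_measure \<Phi>. t ^ k)" for k
  proof -
    \<comment> \<open>The diagonal entries of C ^ k have finite support, which for large m meets
      \<open>zsub m\<close> at most in the identity.\<close>
    have fin: "finite (\<Union>i<r. {g. gr_pow G r C k i i g \<noteq> 0})"
      using gr_entriesD(1)[OF gr_entries_pow[OF C]] by auto
    obtain m0 where m0: "\<And>m. m0 \<le> m \<Longrightarrow> (\<Union>i<r. {g. gr_pow G r C k i i g \<noteq> 0}) \<inter> zsub m \<subseteq> {\<one>}"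
      using zsub_trivial[OF fin] by blast
    show ?thesis using eventually_ge_at_top[of m0] eventually_gt_at_top[of 0]
    proof eventually_elim
      case (elim m)
      interpret fq: finite_quotient "zsub m" G by (rule finite_quotient_zsub[OF elim(2)])
      have "complex_of_real (\<Sum>a<r * (n * m). d m a ^ k) = of_nat (n * m) * (\<Sum>i<r. gr_pow G r C k i i \<one>)"
        unfolding d(2)[OF elim(2), symmetric]
        unfolding C_def qmat_def fq.qreg_def[symmetric] card_rcosets_zsub[OF elim(2), symmetric]
      proof (rule fq.gram_trace[OF A])
        fix i g assume "i < r" "gr_pow G r (gr_mult G s A (gr_adjoint G A)) k i i g \<noteq> 0" "g \<in> zsub m"
        then have "g \<in> (\<Union>i<r. {g. gr_pow G r C k i i g \<noteq> 0}) \<inter> zsub m" by (auto simp: C_def)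
        then show "g = \<one>" using m0[OF elim(1)] by blast
      qed
      note tr = this
      have Re_mult_nat: "Re (of_nat N * x) = real N * Re x" for N x by simp
      have "Re (complex_of_real (\<Sum>a<r * (n * m). d m a ^ k)) = Re (of_nat (n * m) * (\<Sum>i<r. gr_pow G r C k i i \<one>))"
        by (simp only: tr)
      then have "(\<Sum>a<r * (n * m). d m a ^ k) = real (n * m) * Re (\<Sum>i<r. gr_pow G r C k i i \<one>)"
        unfolding Re_mult_nat Re_complex_of_real .
      moreover have "0 < real (n * m)" using n_pos elim(2) by simp
      moreover have "x / y = w" if "x = y * w" "0 < y" for x y w :: real using that by simp
      ultimately show ?case unfolding \<Phi>(3) mult.assoc by blast
    qed
  qed
  have "spectral_comparison \<Phi> Kt (real r) n (r * n) d (Kc * V\<^sup>2) ps Kc"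
  proof (intro spectral_comparison.intro moment_approximation.intro \<Phi>(1) moment_approximation_axioms.intro spectral_comparison_axioms.intro moment n_pos Kc)
    show "divisor_chain ps (r * n)" using divisor_chain_axioms unfolding dim_res .
    fix m a assume a: "a < r * n * m"
    then have "0 < m" by (cases m) auto
    then show "0 \<le> d m a" "d m a \<le> Kc * V\<^sup>2" using d(1) le a by (simp_all add: mult.assoc)
  next
    fix m :: nat and t :: real assume "0 < m" "0 \<le> t"
    then show "card {a. a < r * n * m \<and> d m a \<le> t} \<le> card {b \<in> divisor_chain.J (r * n) m. (divisor_chain.val ps b)\<^sup>2 \<le> Kc * t}"
      "card {b \<in> divisor_chain.J (r * n) m. (divisor_chain.val ps b)\<^sup>2 \<le> t} \<le> card {a. a < r * n * m \<and> d m a \<le> Kc * t}"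
      using d(5)[of m t] d(6)[of m t] unfolding dim_res mult.assoc by blast+
  qed
  moreover have "dim_row (qmat m) = r * n * m" if "0 < m" for m using carrier[OF that] by (simp add: mult.assoc)
  ultimately show ?thesis using \<Phi>(2) d(3,4) unfolding mult.assoc by (intro exI conjI) auto
qed

text \<open>Used in contrapositive form: a Novikov-Shubin number below \<open>NS_Infty_Plus\<close>
  provides a nonempty list of invariant factors and a zero on the circle.\<close>

lemma novikov_shubin_infinite:
  assumes "ps = [] \<or> circle_zeros (last ps) = {}"
  shows "novikov_shubin G r s A = NS_Infty_Plus"
proof -
  obtain \<Phi> Kt d K' Kc where comp: "spectral_comparison \<Phi> Kt (real r) n (r * n) d K' ps Kc"
    and F: "\<And>l. spectral_distribution G r s A l = \<Phi> (l\<^sup>2)" using ex_comparison by blast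
  have "\<exists>l>0. spectral_distribution G r s A l = spectral_distribution G r s A 0"
    using spectral_comparison.Phi_locally_constant[OF comp assms] by (simp add: F)
  then show ?thesis
    by (simp add: novikov_shubin_def upper_novikov_shubin_def lower_novikov_shubin_def Let_def)
qed

lemma alpha_lower_bound:
  assumes ne: "ps \<noteq> []" and zeros: "circle_zeros (last ps) \<noteq> {}"
    and B: "\<And>a. a \<in> circle_zeros (last ps) - {1} \<Longrightarrow> baker_constant a (-1) (Dt a)"
    and D: "D = Max (insert 1 (Dt ` (circle_zeros (last ps) - {1})))"
  shows "\<exists>\<mu>>0. 1 \<le> D \<and> novikov_shubin G r s A = NS (ereal (1 / \<mu>)) \<and>
    (\<forall>e>0. \<forall>\<^sub>F m in sequentially. 1 / ((1 + D) * \<mu>) - e \<le> alpha_number G r s A (zsub m))"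
proof -
  obtain \<Phi> Kt d K' Kc where H: "spectral_comparison \<Phi> Kt (real r) n (r * n) d K' ps Kc \<and>
    (\<forall>l. spectral_distribution G r s A l = \<Phi> (l\<^sup>2)) \<and>
    (\<forall>m>0. dim_row (qmat m) = r * n * m \<and>
      (\<forall>e. eigenvalue (qmat m * mat_adjoint (qmat m)) e \<longleftrightarrow> (\<exists>a<r * n * m. e = of_real (d m a))) \<and>
      (\<forall>t. kernel_dim (qmat m * mat_adjoint (qmat m) - of_real t \<cdot>\<^sub>m 1\<^sub>m (r * n * m)) = card {a. a < r * n * m \<and> d m a = t}))"
    using ex_comparison by (elim exE)
  note comp = H[THEN conjunct1] and F = H[THEN conjunct2, THEN conjunct1, rule_format]
    and spec = H[THEN conjunct2, THEN conjunct2, rule_format]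
  have "last ps \<noteq> 0" using nz ne by (metis last_in_set)
  then obtain Q where Q: "Q \<noteq> 0" "\<And>\<xi>. cmod \<xi> = 1 \<Longrightarrow> cmod (poly Q \<xi>) = cmod (laurent_eval (last ps) \<xi>)"
    using laurent_to_poly by blast
  interpret sc: spectral_comparison \<Phi> Kt "real r" n "r * n" d K' ps Kc by (rule comp)
  interpret sz: spectral_comparison_zeros \<Phi> Kt "real r" n "r * n" d K' ps Kc Q
    by unfold_locales (use ne zeros Q in auto)
  define \<mu> where "\<mu> = real (circle_order Q)"
  have \<mu>: "0 < \<mu>" using sz.mu_pos by (simp add: \<mu>_def)
  have finZ: "finite (circle_zeros (last ps))" using sz.finite_Z by (simp add: sz.circle_zeros_eq)
  have DD: "Dt a \<le> D" if "a \<in> circle_zeros (last ps) - {1}" for a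
    unfolding D using finZ that by (auto intro!: Max_ge)
  \<comment> \<open>The 1 inserted into the maximum guarantees this even if 1 is the only zero on
    the circle.\<close>
  have D1: "1 \<le> D" unfolding D using finZ by (auto intro!: Max_ge)
  let ?F = "\<lambda>l. \<Phi> (l\<^sup>2) - \<Phi> 0"
  obtain c C where cC: "0 < c" "\<forall>\<^sub>F l in at_right 0. c * l powr (1 / (2 * \<mu>)) \<le> \<Phi> l - \<Phi> 0 \<and> \<Phi> l - \<Phi> 0 \<le> C * l powr (1 / (2 * \<mu>))"
    using sz.Phi_asymptotics unfolding \<mu>_def by blast
  \<comment> \<open>\<Phi> refers to eigenvalues of Gram matrices, so F l = \<Phi> (l ^ 2);
    substituting l ^ 2 doubles the exponent 1 / (2 \<mu>).\<close>
  have sq: "filterlim (\<lambda>l::real. l\<^sup>2) (at_right 0) (at_right 0)"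
  proof (rule tendsto_imp_filterlim_at_right)
    have "((\<lambda>l::real. l\<^sup>2) \<longlongrightarrow> 0\<^sup>2) (at_right 0)" by (intro tendsto_intros)
    then show "((\<lambda>l::real. l\<^sup>2) \<longlongrightarrow> 0) (at_right 0)" by simp
    show "\<forall>\<^sub>F l in at_right 0. (0::real) < l\<^sup>2" by (auto simp: eventually_at_filter)
  qed
  have Fev: "\<forall>\<^sub>F l in at_right 0. c * l powr (1 / \<mu>) \<le> ?F l \<and> ?F l \<le> C * l powr (1 / \<mu>)"
    using eventually_compose_filterlim[OF cC(2) sq] eventually_at_right_less[of "0::real"]
  proof eventually_elim
    case (elim l)
    have "l powr 2 = l\<^sup>2" using elim(2) by simp
    then have "l\<^sup>2 powr (1 / (2 * \<mu>)) = (l powr 2) powr (1 / (2 * \<mu>))" by (simp only:)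
    also have "\<dots> = l powr (1 / \<mu>)" unfolding powr_powr using \<mu> by (simp add: field_simps)
    finally have "l\<^sup>2 powr (1 / (2 * \<mu>)) = l powr (1 / \<mu>)" .
    then show ?case using elim(1) by simp
  qed
  have lim: "((\<lambda>l. ln (?F l) / ln l) \<longlongrightarrow> 1 / \<mu>) (at_right 0)" by (rule tendsto_ln_quotient[OF cC(1) Fev])
  \<comment> \<open>If F took its value at 0 again at some l > 0, monotonicity would make it
    constant on the interval below l, against the lower bound c l powr (1 / \<mu>).\<close>
  have notconst: "\<not> (\<exists>l>0. spectral_distribution G r s A l = spectral_distribution G r s A 0)"
  proof
    assume "\<exists>l>0. spectral_distribution G r s A l = spectral_distribution G r s A 0"
    then obtain l where l: "0 < l" "\<Phi> (l\<^sup>2) = \<Phi> 0" by (auto simp: F)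
    have "\<forall>\<^sub>F x in at_right 0. x \<in> {0<..<l}" by (rule eventually_at_right_real[OF l(1)])
    with Fev have "\<forall>\<^sub>F x in at_right (0::real). False"
    proof eventually_elim
      case (elim x)
      have "0 < c * x powr (1 / \<mu>)" using cC(1) elim(2) by simp
      moreover have "\<Phi> (x\<^sup>2) \<le> \<Phi> (l\<^sup>2)" using elim(2) by (intro sc.F_mono power_mono) auto
      ultimately show ?case using elim(1) l(2) by linarith
    qed
    then show False by simp
  qed
  have eq: "(\<lambda>l. ereal (ln (spectral_distribution G r s A l - spectral_distribution G r s A 0) / ln l)) = (\<lambda>l. ereal (ln (?F l) / ln l))"
    by (simp add: F)
  have elim: "((\<lambda>l. ereal (ln (?F l) / ln l)) \<longlongrightarrow> ereal (1 / \<mu>)) (at_right 0)" using lim by simp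
  have "upper_novikov_shubin G r s A = NS (ereal (1 / \<mu>))" "lower_novikov_shubin G r s A = NS (ereal (1 / \<mu>))"
    using notconst lim_imp_Limsup[OF trivial_limit_at_right_real elim] lim_imp_Liminf[OF trivial_limit_at_right_real elim]
    unfolding upper_novikov_shubin_def lower_novikov_shubin_def Let_def eq by simp_all
  then have ns: "novikov_shubin G r s A = NS (ereal (1 / \<mu>))" by (simp add: novikov_shubin_def)
  obtain c C N m0 where pos: "0 < c" "0 < C" "0 < N" and small: "\<And>m. m0 \<le> m \<Longrightarrow> 0 < m \<Longrightarrow> \<exists>x>0. (\<exists>a<r * n * m. d m a = x) \<and>
    (\<forall>a<r * n * m. 0 < d m a \<longrightarrow> x \<le> d m a) \<and> c * real m powr (- (2 * ((1 + D) * \<mu>))) \<le> x \<and>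
    x \<le> C * real m powr (- (2 * \<mu>)) \<and> real (card {a. a < r * n * m \<and> d m a = x}) \<le> N"
    using sz.smallest_positive[OF B DD D1] unfolding \<mu>_def by blast
  have "\<forall>\<^sub>F m in sequentially. 1 / ((1 + D) * \<mu>) - e \<le> alpha_number G r s A (zsub m)" if e: "0 < e" for e
  proof -
    have pos': "0 < real n" "0 < 1 + D" using n_pos D1 by auto
    show ?thesis
      using eventually_alpha_ge[OF pos pos'(1) \<mu> pos'(2) e] eventually_ge_at_top[of m0] eventually_gt_at_top[of 0]
    proof eventually_elim
      case (elim m)
      obtain x a where x: "0 < x" "a < r * n * m" "d m a = x" "\<forall>a<r * n * m. 0 < d m a \<longrightarrow> x \<le> d m a"
        and bd: "c * real m powr (- (2 * ((1 + D) * \<mu>))) \<le> x" "x \<le> C * real m powr (- (2 * \<mu>))"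
          "real (card {a. a < r * n * m \<and> d m a = x}) \<le> N"
        using small[OF elim(2,3)] by blast
      note al = alpha_number_eq[where d = "d m" and M = "qmat m" and R = "r * n * m" and a = a, OF x(1-4) spec[OF elim(3), THEN conjunct1]
        spec[OF elim(3), THEN conjunct2, THEN conjunct1, rule_format] spec[OF elim(3), THEN conjunct2, THEN conjunct2, rule_format]]
      have "finite {a. a < r * n * m \<and> d m a = x}" by simp
      moreover have "a \<in> {a. a < r * n * m \<and> d m a = x}" using x(2,3) by simp
      ultimately have "0 < card {a. a < r * n * m \<and> d m a = x}" by (metis card_gt_0_iff empty_iff)
      then have one: "1 \<le> real (card {a. a < r * n * m \<and> d m a = x})" by simp
      have "alpha_number G r s A (zsub m) = ln (real (card {a. a < r * n * m \<and> d m a = x}) / (real n * real m)) / ln (sqrt x)"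
        unfolding alpha_number_def Let_def qmat_def[symmetric] al card_rcosets_zsub[OF elim(3)] by simp
      then show ?case using elim(1) bd one by simp
    qed
  qed
  then show ?thesis using \<mu> D1 ns by blast
qed

end

theorem corollary25:
  fixes G :: "('g, 'm) monoid_scheme" and r s :: nat and A :: "nat \<Rightarrow> nat \<Rightarrow> 'g \<Rightarrow> complex"
    and Z :: "'g set" and z :: 'g and gs :: "'g list"
    and ps :: "laurent_poly list" and Dt :: "complex \<Rightarrow> real" and D :: real
  assumes "group G" and "virtually_cyclic G"
    and "\<And>i j. i < r \<Longrightarrow> j < s \<Longrightarrow> A i j \<in> rat_group_ring G"
    and "novikov_shubin G r s A < NS_Infty_Plus"
    and "Z \<in> finite_index_normal G" and "infinite Z"
    and "z \<in> carrier G" and "Z = generate G {z}"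
    and "coset_transversal G Z gs"
    and "invariant_factors (res_mat G z gs r s A) ps"
    and "\<And>a. a \<in> circle_zeros (last ps) - {1} \<Longrightarrow> baker_constant a (-1) (Dt a)"
    and "D = Max (insert 1 (Dt ` (circle_zeros (last ps) - {1})))"
  shows "net_liminf (finite_index_normal G) (\<lambda>N. ereal (alpha_number G r s A N))
           \<ge> ns_ereal (novikov_shubin G r s A) / ereal (1 + D)"
proof -
  interpret group G by (rule assms(1))
  have "gr_entries G r s A" using assms(3) by (simp add: gr_entries_def rat_group_ring_def)
  then interpret cyclic_matrix G z gs r s A ps
    by (intro cyclic_matrix.intro cyclic_restriction.intro cyclic_restriction_axioms.intro cyclic_matrix_axioms.intro)
      (use assms in \<open>simp_all add: finite_index_normal_def\<close>)
  have "ps \<noteq> []" "circle_zeros (last ps) \<noteq> {}"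
    using novikov_shubin_infinite assms(4) by auto
  then obtain \<mu> where \<mu>: "0 < \<mu>" and D: "1 \<le> D" and ns: "novikov_shubin G r s A = NS (ereal (1 / \<mu>))"
    and alpha: "\<And>e. 0 < e \<Longrightarrow> \<forall>\<^sub>F m in sequentially. 1 / ((1 + D) * \<mu>) - e \<le> alpha_number G r s A (zsub m)"
    using alpha_lower_bound[OF _ _ assms(11,12)] by blast
  have eps: "ereal (1 / ((1 + D) * \<mu>)) \<le> net_liminf (finite_index_normal G) (\<lambda>N. ereal (alpha_number G r s A N)) + ereal e"
    if e: "0 < e" for e
  proof -
    obtain m0 where m0: "\<And>m. m0 \<le> m \<Longrightarrow> 1 / ((1 + D) * \<mu>) - e \<le> alpha_number G r s A (zsub m)"
      using alpha[OF e] by (auto simp: eventually_sequentially)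
    \<comment> \<open>A positive index above m0: every member of the tail of the net below
      \<open>zsub k\<close> is \<open>zsub (k * j)\<close> with j > 0, and k j \<ge> m0.\<close>
    define k where "k = Suc m0"
    have zk: "zsub k \<in> finite_index_normal G"
      using normal_zsub finite_rcosets_zsub[of k] by (simp add: finite_index_normal_def k_def)
    have "ereal (1 / ((1 + D) * \<mu>) - e) \<le> (INF M\<in>{M \<in> finite_index_normal G. M \<subseteq> zsub k}. ereal (alpha_number G r s A M))"
    proof (rule INF_greatest)
      fix M assume "M \<in> {M \<in> finite_index_normal G. M \<subseteq> zsub k}"
      then obtain j where j: "0 < j" "M = zsub (k * j)" using zsub_subset[of M k] by (auto simp: k_def)
      have "m0 \<le> k * j" using j(1) by (cases j) (auto simp: k_def)
      then show "ereal (1 / ((1 + D) * \<mu>) - e) \<le> ereal (alpha_number G r s A M)" using m0 by (simp add: j(2))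
    qed
    also have "\<dots> \<le> net_liminf (finite_index_normal G) (\<lambda>N. ereal (alpha_number G r s A N))"
      unfolding net_liminf_def by (rule SUP_upper[OF zk])
    finally have "ereal (1 / ((1 + D) * \<mu>) - e) + ereal e \<le> net_liminf (finite_index_normal G) (\<lambda>N. ereal (alpha_number G r s A N)) + ereal e"
      by (rule add_right_mono)
    then show ?thesis by simp
  qed
  have "ereal (1 / ((1 + D) * \<mu>)) \<le> net_liminf (finite_index_normal G) (\<lambda>N. ereal (alpha_number G r s A N))"
    by (rule ereal_le_epsilon2) (intro allI impI eps)
  moreover have "ns_ereal (novikov_shubin G r s A) / ereal (1 + D) = ereal (1 / ((1 + D) * \<mu>))"
    using D \<mu> by (simp add: ns mult.commute)
  ultimately show ?thesis by simp
qed

end
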